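(* Let $\Gamma$ be a finite simplicial graph with vertex set $\mathsf{V}$, let $\Delta=\Delta_\Gamma$ be its flag complex, and let $G_\Gamma$ be the associated right-angled Artin group. Suppose that, for every simplex $\sigma\in\Delta$ (including the empty simplex) and every $\mathsf{W}\subseteq\mathsf{V}$ with $\sigma\cap\mathsf{W}=\emptyset$, the complex $\mathrm{lk}_{\Delta_{\mathsf{W}}}(\sigma)$ has torsion-free integral homology. Then, for all $q\ge0$ and all fields $\Bbbk$, $$\Sigma^q(G_\Gamma,\mathbb{Z})=\Sigma^q(G_\Gamma,\Bbbk)=\Big(\bigcup_{i\le q}\mathcal{R}^i_1(G_\Gamma,\mathbb{R})\Big)^{c},$$ where $(\cdot)^c$ denotes the complement in $\mathrm{Hom}(G_\Gamma,\mathbb{R})=H^1(G_\Gamma,\mathbb{R})$.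
   Context: $G_\Gamma$ has a generator $v$ for each vertex $v$ of $\Gamma$, and a relation $vw=wv$ for each edge $\{v,w\}$. The flag complex $\Delta_\Gamma$ has as simplices the sets of pairwise adjacent vertices of $\Gamma$ (including $\emptyset$). For $\mathsf{W}\subseteq\mathsf{V}$, $\Delta_{\mathsf{W}}=\{\tau\in\Delta\mid\tau\subseteq\mathsf{W}\}$ is the induced subcomplex, and $\mathrm{lk}_{\Delta_{\mathsf{W}}}(\sigma)=\{\tau\in\Delta_{\mathsf{W}}\mid\tau\cup\sigma\in\Delta\}$; in particular $\mathrm{lk}_{\Delta_{\mathsf{W}}}(\emptyset)=\Delta_{\mathsf{W}}$. For a commutative ring $R$ with $1\ne0$ and a finitely generated group $G$, $\Sigma^q(G,R)$ is the set of non-zero homomorphisms $\chi\colon G\to\mathbb{R}$ such that the trivial module $R$ is of type $\mathrm{FP}_q$ over the monoid ring $RG_\chi$, where $G_\chi=\{g\in G\mid\chi(g)\ge0\}$. (A module over a ring is of type $\mathrm{FP}_q$ if it has a projective resolution $P_\bullet$ with $P_i$ finitely generated for $i\le q$.) With $A=H^*(G,\mathbb{R})$, $\mathcal{R}^i_1(G,\mathbb{R})=\{a\in A^1\mid H^i(A,\cdot a)\ne0\}$, where $(A,\cdot a)$ is the cochain complex with differential multiplication by $a$. *)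

theory Defs
  imports Complex_Main "HOL-Algebra.Coset" "HOL-Algebra.Module"
begin

section \<open>Graphs, flag complexes and links\<close>

definition finite_simple_graph :: "'v set \<Rightarrow> 'v set set \<Rightarrow> bool" where
  "finite_simple_graph V E \<longleftrightarrow>
     finite V \<and> (\<forall>e\<in>E. \<exists>v\<in>V. \<exists>w\<in>V. v \<noteq> w \<and> e = {v, w})"

text \<open>A simplicial complex is the set of its simplices, the empty simplex included.\<close>

definition flag_complex :: "'v set \<Rightarrow> 'v set set \<Rightarrow> 'v set set" where
  "flag_complex V E = {\<sigma>. \<sigma> \<subseteq> V \<and> (\<forall>v\<in>\<sigma>. \<forall>w\<in>\<sigma>. v \<noteq> w \<longrightarrow> {v, w} \<in> E)}"

definition induced_subcomplex :: "'v set set \<Rightarrow> 'v set \<Rightarrow> 'v set set" where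
  "induced_subcomplex \<Delta> W = {\<tau> \<in> \<Delta>. \<tau> \<subseteq> W}"

definition link :: "'v set set \<Rightarrow> 'v set \<Rightarrow> 'v set \<Rightarrow> 'v set set" where
  "link \<Delta> W \<sigma> = {\<tau> \<in> induced_subcomplex \<Delta> W. \<tau> \<union> \<sigma> \<in> \<Delta>}"


section \<open>Integral simplicial homology\<close>

text \<open>
  Oriented simplicial chains: an ordering \<open>[v\<^sub>0, \<dots>, v\<^sub>p]\<close> of a \<open>p\<close>-simplex represents an
  orientation of it, and a \<open>p\<close>-chain is a finitely supported integer function on such lists that
  changes sign whenever two neighbouring vertices are exchanged, hence under all odd permutations.
\<close>

definition simplicial_chains :: "'v set set \<Rightarrow> nat \<Rightarrow> ('v list \<Rightarrow> int) set" where
  "simplicial_chains K p =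
     {c. finite {xs. c xs \<noteq> 0} \<and>
         (\<forall>xs. c xs \<noteq> 0 \<longrightarrow> distinct xs \<and> length xs = Suc p \<and> set xs \<in> K) \<and>
         (\<forall>xs a b ys. c (xs @ a # b # ys) = - c (xs @ b # a # ys))}"

text \<open>
  The usual formula \<open>\<partial>[v\<^sub>0, \<dots>, v\<^sub>p] = (\<Sum>i\<le>p. (-1)^i [v\<^sub>0, \<dots>, omit v\<^sub>i, \<dots>, v\<^sub>p])\<close> in terms of
  coefficients: the oriented simplices having \<open>\<plusminus>ys\<close> in their boundary are those \<open>\<plusminus>[v, ys]\<close>,
  and \<open>ys\<close> occurs in \<open>\<partial>[v, ys]\<close> with sign \<open>+1\<close>.
\<close>

definition simplicial_boundary :: "('v list \<Rightarrow> int) \<Rightarrow> 'v list \<Rightarrow> int" where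
  "simplicial_boundary c = (\<lambda>ys. \<Sum>v\<in>{v. c (v # ys) \<noteq> 0}. c (v # ys))"

text \<open>The homology is unreduced, so all \<open>0\<close>-chains are cycles.\<close>

definition simplicial_cycles :: "'v set set \<Rightarrow> nat \<Rightarrow> ('v list \<Rightarrow> int) set" where
  "simplicial_cycles K p =
     {c \<in> simplicial_chains K p. p = 0 \<or> simplicial_boundary c = (\<lambda>_. 0)}"

definition simplicial_boundaries :: "'v set set \<Rightarrow> nat \<Rightarrow> ('v list \<Rightarrow> int) set" where
  "simplicial_boundaries K p = simplicial_boundary ` simplicial_chains K (Suc p)"

definition simplicial_cycle_group :: "'v set set \<Rightarrow> nat \<Rightarrow> ('v list \<Rightarrow> int) monoid" where
  "simplicial_cycle_group K p =
     \<lparr>carrier = simplicial_cycles K p, mult = \<lambda>c d xs. c xs + d xs, one = \<lambda>_. 0\<rparr>"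

definition simplicial_homology :: "'v set set \<Rightarrow> nat \<Rightarrow> ('v list \<Rightarrow> int) set monoid" where
  "simplicial_homology K p = simplicial_cycle_group K p Mod simplicial_boundaries K p"

definition torsion_free :: "('a, 'b) monoid_scheme \<Rightarrow> bool" where
  "torsion_free A \<longleftrightarrow>
     (\<forall>x\<in>carrier A. \<forall>n::nat. n > 0 \<and> x [^]\<^bsub>A\<^esub> n = \<one>\<^bsub>A\<^esub> \<longrightarrow> x = \<one>\<^bsub>A\<^esub>)"

definition torsion_free_homology :: "'v set set \<Rightarrow> bool" where
  "torsion_free_homology K \<longleftrightarrow> (\<forall>p. torsion_free (simplicial_homology K p))"


section \<open>Right-angled Artin groups\<close>

text \<open>
  A letter \<open>(v, True)\<close> stands for the generator \<open>v\<close> and \<open>(v, False)\<close> for its inverse. The group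
  is the quotient of the monoid of words by the congruence generated by free reduction and the
  relations \<open>v w = w v\<close> for the edges \<open>{v, w}\<close>.
\<close>

definition words :: "'v set \<Rightarrow> ('v \<times> bool) list set" where
  "words V = lists (V \<times> UNIV)"

inductive_set raag_rel ::
    "'v set \<Rightarrow> 'v set set \<Rightarrow> (('v \<times> bool) list \<times> ('v \<times> bool) list) set"
  for V :: "'v set" and E :: "'v set set" where
  refl: "x \<in> words V \<Longrightarrow> (x, x) \<in> raag_rel V E"
| sym: "(x, y) \<in> raag_rel V E \<Longrightarrow> (y, x) \<in> raag_rel V E"
| trans: "(x, y) \<in> raag_rel V E \<Longrightarrow> (y, z) \<in> raag_rel V E \<Longrightarrow> (x, z) \<in> raag_rel V E"
| cancel: "x \<in> words V \<Longrightarrow> y \<in> words V \<Longrightarrow> v \<in> V \<Longrightarrow>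
    (x @ [(v, b), (v, \<not> b)] @ y, x @ y) \<in> raag_rel V E"
| commute: "x \<in> words V \<Longrightarrow> y \<in> words V \<Longrightarrow> v \<in> V \<Longrightarrow> w \<in> V \<Longrightarrow> {v, w} \<in> E \<Longrightarrow>
    (x @ [(v, True), (w, True)] @ y, x @ [(w, True), (v, True)] @ y) \<in> raag_rel V E"

definition raag :: "'v set \<Rightarrow> 'v set set \<Rightarrow> ('v \<times> bool) list set monoid" where
  "raag V E =
     \<lparr>carrier = words V // raag_rel V E,
      mult = \<lambda>X Y. \<Union>x\<in>X. \<Union>y\<in>Y. raag_rel V E `` {x @ y},
      one = raag_rel V E `` {[]}\<rparr>"

text \<open>
  \<open>Hom(G, \<real>)\<close>. Homomorphisms take the value \<open>undefined\<close> outside the carrier, so that distinct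
  functions are distinct homomorphisms.
\<close>

definition real_homs :: "('g, 'b) monoid_scheme \<Rightarrow> ('g \<Rightarrow> real) set" where
  "real_homs G =
     hom G \<lparr>carrier = UNIV, mult = (+), one = 0\<rparr> \<inter> extensional (carrier G)"


section \<open>Modules over a possibly non-commutative ring\<close>

text \<open>
  The library locale \<open>module\<close> assumes a commutative ring, so left modules over an arbitrary ring
  are introduced here on the same record type. The fields \<open>mult\<close> and \<open>one\<close> of
  that record play no role.
\<close>

locale left_module = S?: ring S + M?: abelian_group M
  for S :: "('s, 'a) ring_scheme" (structure) and M :: "('s, 'm, 'b) module_scheme" (structure) +
  assumes smult_closed:
      "\<lbrakk>a \<in> carrier S; x \<in> carrier M\<rbrakk> \<Longrightarrow> a \<odot>\<^bsub>M\<^esub> x \<in> carrier M"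
    and smult_l_distr:
      "\<lbrakk>a \<in> carrier S; b \<in> carrier S; x \<in> carrier M\<rbrakk> \<Longrightarrow>
        (a \<oplus>\<^bsub>S\<^esub> b) \<odot>\<^bsub>M\<^esub> x = a \<odot>\<^bsub>M\<^esub> x \<oplus>\<^bsub>M\<^esub> b \<odot>\<^bsub>M\<^esub> x"
    and smult_r_distr:
      "\<lbrakk>a \<in> carrier S; x \<in> carrier M; y \<in> carrier M\<rbrakk> \<Longrightarrow>
        a \<odot>\<^bsub>M\<^esub> (x \<oplus>\<^bsub>M\<^esub> y) = a \<odot>\<^bsub>M\<^esub> x \<oplus>\<^bsub>M\<^esub> a \<odot>\<^bsub>M\<^esub> y"
    and smult_assoc:
      "\<lbrakk>a \<in> carrier S; b \<in> carrier S; x \<in> carrier M\<rbrakk> \<Longrightarrow>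
        (a \<otimes>\<^bsub>S\<^esub> b) \<odot>\<^bsub>M\<^esub> x = a \<odot>\<^bsub>M\<^esub> (b \<odot>\<^bsub>M\<^esub> x)"
    and smult_one: "x \<in> carrier M \<Longrightarrow> \<one>\<^bsub>S\<^esub> \<odot>\<^bsub>M\<^esub> x = x"

definition linear_maps ::
    "('s, 'a) ring_scheme \<Rightarrow> ('s, 'm, 'b) module_scheme \<Rightarrow> ('s, 'n, 'c) module_scheme \<Rightarrow>
     ('m \<Rightarrow> 'n) set" where
  "linear_maps S M N =
     {f \<in> carrier M \<rightarrow> carrier N.
        (\<forall>x\<in>carrier M. \<forall>y\<in>carrier M. f (x \<oplus>\<^bsub>M\<^esub> y) = f x \<oplus>\<^bsub>N\<^esub> f y) \<and>
        (\<forall>a\<in>carrier S. \<forall>x\<in>carrier M. f (a \<odot>\<^bsub>M\<^esub> x) = a \<odot>\<^bsub>N\<^esub> f x)}"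

definition fin_gen_module :: "('s, 'a) ring_scheme \<Rightarrow> ('s, 'm, 'b) module_scheme \<Rightarrow> bool" where
  "fin_gen_module S M \<longleftrightarrow>
     (\<exists>X. finite X \<and> X \<subseteq> carrier M \<and>
        (\<forall>m\<in>carrier M. \<exists>a \<in> X \<rightarrow> carrier S. m = (\<Oplus>\<^bsub>M\<^esub>x\<in>X. a x \<odot>\<^bsub>M\<^esub> x)))"

definition free_module :: "('s, 'a) ring_scheme \<Rightarrow> 'i set \<Rightarrow> ('s, 'i \<Rightarrow> 's) module" where
  "free_module S I =
     \<lparr>carrier = {f. (\<forall>i. f i \<in> carrier S) \<and> (\<forall>i. i \<notin> I \<longrightarrow> f i = \<zero>\<^bsub>S\<^esub>) \<and>
                    finite {i. f i \<noteq> \<zero>\<^bsub>S\<^esub>}},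
      mult = undefined, one = undefined,
      zero = \<lambda>_. \<zero>\<^bsub>S\<^esub>,
      add = \<lambda>f g i. f i \<oplus>\<^bsub>S\<^esub> g i,
      smult = \<lambda>a f i. a \<otimes>\<^bsub>S\<^esub> f i\<rparr>"

text \<open>
  Projective modules are the direct summands of free modules. A direct summand \<open>P\<close> of any free
  module is also one of the free module on the set \<open>carrier P\<close>, so it is no loss of
  generality to take the basis \<open>I\<close> in the element type of \<open>P\<close>.
\<close>

definition projective_module ::
    "('s, 'a) ring_scheme \<Rightarrow> ('s, 'm, 'b) module_scheme \<Rightarrow> bool" where
  "projective_module S P \<longleftrightarrow> left_module S P \<and>
     (\<exists>I::'m set. \<exists>\<iota> \<in> linear_maps S P (free_module S I).
        \<exists>\<rho> \<in> linear_maps S (free_module S I) P. \<forall>x\<in>carrier P. \<rho> (\<iota> x) = x)"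

text \<open>
  Type \<open>FP\<^sub>q\<close>: there is an exact sequence \<open>\<cdots> \<rightarrow> P 1 \<rightarrow> P 0 \<rightarrow> M \<rightarrow> 0\<close> with augmentation
  \<open>\<epsilon>\<close>, boundary maps \<open>d i : P (i + 1) \<rightarrow> P i\<close>, all \<open>P i\<close> projective, and \<open>P i\<close> finitely
  generated for \<open>i \<le> q\<close>. The modules \<open>P i\<close> have their elements in the type \<open>nat \<Rightarrow> 's\<close>. This is
  no restriction: given any such resolution, keep \<open>P 0, \<dots>, P q\<close> and continue with free
  covers of the successive kernels; all modules then have at most \<open>max \<bar>S\<bar> \<aleph>\<^sub>0\<close> elements, and hence
  isomorphic copies inside \<open>nat \<Rightarrow> 's\<close>.
\<close>

definition type_FP ::
    "nat \<Rightarrow> ('s, 'a) ring_scheme \<Rightarrow> ('s, 'm, 'b) module_scheme \<Rightarrow> bool" where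
  "type_FP q S M \<longleftrightarrow>
     (\<exists>(P :: nat \<Rightarrow> ('s, nat \<Rightarrow> 's) module) d \<epsilon>.
        (\<forall>i. projective_module S (P i)) \<and>
        (\<forall>i\<le>q. fin_gen_module S (P i)) \<and>
        \<epsilon> \<in> linear_maps S (P 0) M \<and>
        (\<forall>i. d i \<in> linear_maps S (P (Suc i)) (P i)) \<and>
        \<epsilon> ` carrier (P 0) = carrier M \<and>
        {x \<in> carrier (P 0). \<epsilon> x = \<zero>\<^bsub>M\<^esub>} = d 0 ` carrier (P (Suc 0)) \<and>
        (\<forall>i. {x \<in> carrier (P (Suc i)). d i x = \<zero>\<^bsub>P i\<^esub>} = d (Suc i) ` carrier (P (Suc (Suc i)))))"


section \<open>Monoid rings and the invariants \<open>\<Sigma>\<^sup>q\<close>\<close>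

text \<open>The monoid ring \<open>RM\<close>, where the coefficient ring \<open>R\<close> is the type \<open>'r\<close>.\<close>

definition monoid_ring :: "('g, 'b) monoid_scheme \<Rightarrow> ('g \<Rightarrow> 'r::comm_ring_1) ring" where
  "monoid_ring M =
     \<lparr>carrier = {f. finite {x. f x \<noteq> 0} \<and> {x. f x \<noteq> 0} \<subseteq> carrier M},
      mult = \<lambda>f h z. \<Sum>(x, y) \<in> {(x, y). f x \<noteq> 0 \<and> h y \<noteq> 0 \<and> x \<otimes>\<^bsub>M\<^esub> y = z}. f x * h y,
      one = \<lambda>z. if z = \<one>\<^bsub>M\<^esub> then 1 else 0,
      zero = \<lambda>_. 0,
      add = \<lambda>f h z. f z + h z\<rparr>"

text \<open>\<open>R\<close> with every element of the monoid acting as the identity.\<close>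

definition trivial_module :: "('g \<Rightarrow> 'r::comm_ring_1, 'r) module" where
  "trivial_module =
     \<lparr>carrier = UNIV, mult = undefined, one = undefined, zero = 0, add = (+),
      smult = \<lambda>f r. (\<Sum>x\<in>{x. f x \<noteq> 0}. f x) * r\<rparr>"

definition nonneg_submonoid :: "'g monoid \<Rightarrow> ('g \<Rightarrow> real) \<Rightarrow> 'g monoid" where
  "nonneg_submonoid G \<chi> = G\<lparr>carrier := {g \<in> carrier G. \<chi> g \<ge> 0}\<rparr>"

definition Sigma_inv :: "nat \<Rightarrow> 'g monoid \<Rightarrow> 'r::comm_ring_1 itself \<Rightarrow> ('g \<Rightarrow> real) set" where
  "Sigma_inv q G R =
     {\<chi> \<in> real_homs G. (\<exists>g\<in>carrier G. \<chi> g \<noteq> 0) \<and>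
        type_FP q (monoid_ring (nonneg_submonoid G \<chi>) :: ('g \<Rightarrow> 'r) ring)
          (trivial_module :: ('g \<Rightarrow> 'r, 'r) module)}"


section \<open>The cohomology ring \<open>H\<^sup>*(G, \<real>)\<close> and resonance varieties\<close>

text \<open>Inhomogeneous cochains of \<open>G\<close> with trivial real coefficients.\<close>

definition group_cochains :: "'g monoid \<Rightarrow> nat \<Rightarrow> ('g list \<Rightarrow> real) set" where
  "group_cochains G n =
     {f. \<forall>xs. f xs \<noteq> 0 \<longrightarrow> xs \<in> lists (carrier G) \<and> length xs = n}"

definition group_coboundary :: "'g monoid \<Rightarrow> nat \<Rightarrow> ('g list \<Rightarrow> real) \<Rightarrow> 'g list \<Rightarrow> real" where
  "group_coboundary G n f = (\<lambda>xs.
     if xs \<in> lists (carrier G) \<and> length xs = Suc n then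
       f (tl xs)
       + (\<Sum>i<n. (- 1) ^ Suc i * f (take i xs @ [xs ! i \<otimes>\<^bsub>G\<^esub> xs ! Suc i] @ drop (i + 2) xs))
       + (- 1) ^ Suc n * f (butlast xs)
     else 0)"

definition group_cocycles :: "'g monoid \<Rightarrow> nat \<Rightarrow> ('g list \<Rightarrow> real) set" where
  "group_cocycles G n = {f \<in> group_cochains G n. group_coboundary G n f = (\<lambda>_. 0)}"

definition group_coboundaries :: "'g monoid \<Rightarrow> nat \<Rightarrow> ('g list \<Rightarrow> real) set" where
  "group_coboundaries G n =
     (case n of 0 \<Rightarrow> {\<lambda>_. 0} | Suc m \<Rightarrow> group_coboundary G m ` group_cochains G m)"

definition cocycle_group :: "'g monoid \<Rightarrow> nat \<Rightarrow> ('g list \<Rightarrow> real) monoid" where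
  "cocycle_group G n =
     \<lparr>carrier = group_cocycles G n, mult = \<lambda>f h xs. f xs + h xs, one = \<lambda>_. 0\<rparr>"

definition group_cohomology :: "'g monoid \<Rightarrow> nat \<Rightarrow> ('g list \<Rightarrow> real) set monoid" where
  "group_cohomology G n = cocycle_group G n Mod group_coboundaries G n"

definition cohomology_class ::
    "'g monoid \<Rightarrow> nat \<Rightarrow> ('g list \<Rightarrow> real) \<Rightarrow> ('g list \<Rightarrow> real) set" where
  "cohomology_class G n f = group_coboundaries G n #>\<^bsub>cocycle_group G n\<^esub> f"

text \<open>
  For a \<open>p\<close>-cochain \<open>f\<close> and a \<open>q\<close>-cochain \<open>h\<close> this vanishes on lists of length
  other than \<open>p + q\<close>.
\<close>

definition cup_cochain ::
    "nat \<Rightarrow> ('g list \<Rightarrow> real) \<Rightarrow> ('g list \<Rightarrow> real) \<Rightarrow> 'g list \<Rightarrow> real" where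
  "cup_cochain p f h = (\<lambda>xs. f (take p xs) * h (drop p xs))"

text \<open>
  The product \<open>H\<^sup>p \<times> H\<^sup>q \<rightarrow> H\<^sup>p\<^sup>+\<^sup>q\<close>. All products of representatives lie in one class, and the union
  is that class.
\<close>

definition cup_product ::
    "'g monoid \<Rightarrow> nat \<Rightarrow> nat \<Rightarrow> ('g list \<Rightarrow> real) set \<Rightarrow> ('g list \<Rightarrow> real) set \<Rightarrow>
     ('g list \<Rightarrow> real) set" where
  "cup_product G p q X Y = (\<Union>f\<in>X. \<Union>h\<in>Y. cohomology_class G (p + q) (cup_cochain p f h))"

text \<open>The cohomology in degree \<open>i\<close> of the complex \<open>(A, \<cdot>a)\<close>, for \<open>A = H\<^sup>*(G, \<real>)\<close> and \<open>a \<in> A\<^sup>1\<close>.\<close>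

definition aomoto_cocycles ::
    "'g monoid \<Rightarrow> ('g list \<Rightarrow> real) set \<Rightarrow> nat \<Rightarrow> ('g list \<Rightarrow> real) set set" where
  "aomoto_cocycles G a i =
     {u \<in> carrier (group_cohomology G i).
        cup_product G 1 i a u = \<one>\<^bsub>group_cohomology G (Suc i)\<^esub>}"

definition aomoto_coboundaries ::
    "'g monoid \<Rightarrow> ('g list \<Rightarrow> real) set \<Rightarrow> nat \<Rightarrow> ('g list \<Rightarrow> real) set set" where
  "aomoto_coboundaries G a i =
     (case i of 0 \<Rightarrow> {\<one>\<^bsub>group_cohomology G 0\<^esub>}
      | Suc j \<Rightarrow> cup_product G 1 j a ` carrier (group_cohomology G j))"

definition aomoto_cohomology ::
    "'g monoid \<Rightarrow> ('g list \<Rightarrow> real) set \<Rightarrow> nat \<Rightarrow> ('g list \<Rightarrow> real) set set monoid" where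
  "aomoto_cohomology G a i =
     (group_cohomology G i)\<lparr>carrier := aomoto_cocycles G a i\<rparr> Mod aomoto_coboundaries G a i"

definition resonance_variety :: "'g monoid \<Rightarrow> nat \<Rightarrow> ('g list \<Rightarrow> real) set set" where
  "resonance_variety G i =
     {a \<in> carrier (group_cohomology G 1).
        carrier (aomoto_cohomology G a i) \<noteq> {\<one>\<^bsub>aomoto_cohomology G a i\<^esub>}}"

text \<open>The identification of \<open>Hom(G, \<real>)\<close> with \<open>H\<^sup>1(G, \<real>)\<close>.\<close>

definition hom_class :: "'g monoid \<Rightarrow> ('g \<Rightarrow> real) \<Rightarrow> ('g list \<Rightarrow> real) set" where
  "hom_class G \<chi> = cohomology_class G 1
     (\<lambda>xs. if xs \<in> lists (carrier G) \<and> length xs = 1 then \<chi> (hd xs) else 0)"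

end

theory Submission
  imports Defs "HOL-Library.Poly_Mapping" "HOL-Library.Countable_Set"
begin

text \<open>
  Orient the generators so that \<open>\<chi> \<ge> 0\<close> on all of them, and let \<open>W\<close> consist of the vertices on
  which \<open>\<chi> > 0\<close>. Consider the live complex: the augmented chains of \<open>\<Delta>\<close> with the part of the simplicial
  boundary that removes vertices of \<open>W\<close>. It is the direct sum of the augmented chain complexes of the links
  \<open>lk(\<sigma>)\<close> in \<open>\<Delta>\<^sub>W\<close> with \<open>\<sigma> \<inter> W = {}\<close>. Over each coefficient ring, the conditions of the theorem on \<open>\<chi>\<close>
  amount to its exactness in degrees \<open>\<le> q\<close>.

  \<^item> The cubes of the universal cover of the Salvetti complex form a free resolution over \<open>RG\<close>. If the live
    complex is exact up to degree \<open>q\<close>, a contraction of it gives an equivariant homotopy pushing cubes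
    to higher values of \<open>\<chi>\<close>. Hence the cubes with \<open>\<chi> \<ge> 0\<close> form a complex which is exact up to
    degree \<open>q\<close>, and \<open>R\<close> is of type \<open>FP\<close> over \<open>RG\<^sub>\<chi>\<close>.
  \<^item> Conversely, let \<open>R\<close> be of type \<open>FP\<close> over \<open>RG\<^sub>\<chi>\<close>. Translating the finitely many generators of a
    resolution gives a self map of the cube complex which raises \<open>\<chi>\<close> above \<open>0\<close> and is homotopic to the
    identity. Expanding \<open>1/(t\<^sup>c - 1)\<close> into a power series maps the cubes to the live complex, killing those with
    \<open>\<chi> > 0\<close>; so the homotopy bounds all cycles of the live complex.
  \<^item> Cocycles of \<open>G\<close> are determined up to coboundaries by their values on the tori spanned by the simplices,
    and the cup product with \<open>\<chi>\<close> is, up to rescaling, dual to the boundary of the live complex.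
  \<^item> By hypothesis the homology of the live complex is torsion-free. If it vanishes over a field in
    degrees \<open>\<le> q\<close> it therefore vanishes integrally, and then it does so over all rings.
\<close>

text \<open>The live complex appears because each condition sees the coefficients of faces only
  through \<chi>. Let a generator v act as t^\<chi>(v). The coefficient v - 1 of a pair of opposite
  faces becomes t^\<chi>(v) - 1: zero for a dead vertex, an invertible power series for a live one.
  Rescaling by these units leaves only signs. In cohomology the coefficient is \<chi>(v) itself,
  again zero or a unit. The obstacle is that t forgets everything but \<chi>: a live cycle lifts to
  a chain of cubes whose boundary is invisible to \<chi>, not to a cycle. This is enough because the
  homotopy is equivariant. Degrees count vertices, so degree 0 belongs to the empty simplex, and
  exactness there says that \<chi> is not zero. The modules of a resolution have to live in
  \<open>nat \<Rightarrow> 's\<close>, as free modules with bases of naturals do. So beyond degree q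
  the kernels are covered by countably many generators, even over an uncountable field; elimination
  over a principal ideal ring provides them.\<close>

hide_const (open) Poly_Mapping.range Poly_Mapping.degree Poly_Mapping.nth Poly_Mapping.map
abbreviation lookup where "lookup \<equiv> Poly_Mapping.lookup"
abbreviation keys where "keys \<equiv> Poly_Mapping.keys"

section \<open>Finitely supported chains\<close>

definition scale :: "'r::comm_ring_1 \<Rightarrow> ('c \<Rightarrow>\<^sub>0 'r) \<Rightarrow> ('c \<Rightarrow>\<^sub>0 'r)" where
  "scale r x = Poly_Mapping.map ((*) r) x"

text \<open>The value at a chain of the functional with the values \<open>f\<close> on the basis.
  Such a functional needs no finite support, so cochains remain plain functions throughout.\<close>

definition pair :: "('c \<Rightarrow> 'r::comm_ring_1) \<Rightarrow> ('c \<Rightarrow>\<^sub>0 'r) \<Rightarrow> 'r" where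
  "pair f x = (\<Sum>c\<in>keys x. lookup x c * f c)"

definition lin :: "('c \<Rightarrow> ('d \<Rightarrow>\<^sub>0 'r::comm_ring_1)) \<Rightarrow> ('c \<Rightarrow>\<^sub>0 'r) \<Rightarrow> ('d \<Rightarrow>\<^sub>0 'r)" where
  "lin \<phi> x = (\<Sum>c\<in>keys x. scale (lookup x c) (\<phi> c))"

lemma lookup_scale [simp]: "lookup (scale r x) c = r * lookup x c"
  by (simp add: scale_def Poly_Mapping.map.rep_eq when_def)

lemma pair_superset: "finite A \<Longrightarrow> keys x \<subseteq> A \<Longrightarrow> pair f x = (\<Sum>c\<in>A. lookup x c * f c)"
  unfolding pair_def by (rule sum.mono_neutral_left) (auto simp: in_keys_iff)

text \<open>A coefficient of \<open>lin\<close> is again the value of a functional. Identities for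
  \<open>lin\<close> are checked one coefficient at a time and so become identities for
  \<open>pair\<close>.\<close>

lemma lookup_lin: "lookup (lin \<phi> x) d = pair (\<lambda>c. lookup (\<phi> c) d) x"
  by (simp add: lin_def pair_def lookup_sum)

lemma pair_zero [simp]: "pair f 0 = 0" by (simp add: pair_def)

lemma pair_single [simp]: "pair f (Poly_Mapping.single c r) = r * f c"
  by (subst pair_superset[of "{c}"]) auto

lemma pair_add: "pair f (x + y) = pair f x + pair f y"
proof -
  let ?A = "keys x \<union> keys y"
  have *: "finite ?A" by simp
  show ?thesis
    by (subst (1 2 3) pair_superset[OF *])
      (use keys_add[of x y] in \<open>auto simp: lookup_add algebra_simps sum.distrib\<close>)
qed

lemma pair_scale: "pair f (scale r x) = r * pair f x"
  by (subst (1 2) pair_superset[of "keys x"])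
    (auto simp: in_keys_iff sum_distrib_left mult.assoc)

lemma pair_uminus: "pair f (- x) = - pair f x"
  using pair_add[of f x "-x"] by (simp add: eq_neg_iff_add_eq_0 add.commute)

lemma pair_diff: "pair f (x - y) = pair f x - pair f y"
  using pair_add[of f x "-y"] by (simp add: pair_uminus)

lemma pair_sum: "pair f (\<Sum>i\<in>I. x i) = (\<Sum>i\<in>I. pair f (x i))"
  by (induction I rule: infinite_finite_induct) (auto simp: pair_add)

lemma pair_cong: "(\<And>c. c \<in> keys x \<Longrightarrow> f c = g c) \<Longrightarrow> pair f x = pair g x"
  by (simp add: pair_def)

lemma pair_fun_add: "pair (\<lambda>c. f c + g c) x = pair f x + pair g x"
  by (simp add: pair_def sum.distrib algebra_simps)
lemma pair_fun_diff: "pair (\<lambda>c. f c - g c) x = pair f x - pair g x"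
  by (simp add: pair_def sum_subtractf algebra_simps)
lemma pair_fun_mult: "pair (\<lambda>c. r * f c) x = r * pair f x"
  by (simp add: pair_def sum_distrib_left algebra_simps)
lemma pair_fun_sum: "pair (\<lambda>c. \<Sum>i\<in>I. f i c) x = (\<Sum>i\<in>I. pair (f i) x)"
  by (induction I rule: infinite_finite_induct) (auto simp: pair_fun_add pair_def)
lemma pair_fun_zero [simp]: "pair (\<lambda>c. 0) x = 0" by (simp add: pair_def)

lemma pair_lin: "pair f (lin \<phi> x) = pair (\<lambda>c. pair f (\<phi> c)) x"
  by (simp add: lin_def pair_sum pair_scale pair_def[of "\<lambda>c. pair f (\<phi> c)"])

lemmas pm_eqI = poly_mapping_eqI

lemma scale_add: "scale r (x + y) = scale r x + scale r y"
  by (rule pm_eqI) (simp add: lookup_add algebra_simps)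
lemma scale_diff: "scale r (x - y) = scale r x - scale r y"
  by (rule pm_eqI) (simp add: lookup_minus algebra_simps)
lemma scale_sum: "scale r (\<Sum>i\<in>I. x i) = (\<Sum>i\<in>I. scale r (x i))"
  by (rule pm_eqI) (simp add: lookup_sum sum_distrib_left)
lemma scale_scale [simp]: "scale r (scale s x) = scale (r * s) x"
  by (rule pm_eqI) (simp add: mult.assoc)
lemma scale_one [simp]: "scale 1 x = x" by (rule pm_eqI) simp
lemma scale_zero [simp]: "scale r 0 = 0" "scale 0 x = 0" by (auto intro: pm_eqI)
lemma scale_minus_one: "scale (-1) x = - x" by (rule pm_eqI) simp
lemma scale_neg: "scale (-r) x = - scale r x" by (rule pm_eqI) simp
lemma scale_add_left: "scale (r + s) x = scale r x + scale s x"
  by (rule pm_eqI) (simp add: lookup_add algebra_simps)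
lemma scale_single [simp]: "scale r (Poly_Mapping.single c s) = Poly_Mapping.single c (r * s)"
  by (rule pm_eqI) (simp add: lookup_single when_def)
lemma keys_scale: "keys (scale r x) \<subseteq> keys x" by (auto simp: in_keys_iff)

lemma lin_zero [simp]: "lin \<phi> 0 = 0" by (simp add: lin_def)
lemma lin_single [simp]: "lin \<phi> (Poly_Mapping.single c r) = scale r (\<phi> c)"
  by (rule pm_eqI) (simp add: lookup_lin)
lemma lin_add: "lin \<phi> (x + y) = lin \<phi> x + lin \<phi> y"
  by (rule pm_eqI) (simp add: lookup_lin pair_add lookup_add)
lemma lin_uminus: "lin \<phi> (- x) = - lin \<phi> x"
  by (rule pm_eqI) (simp add: lookup_lin pair_uminus)
lemma lin_diff: "lin \<phi> (x - y) = lin \<phi> x - lin \<phi> y"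
  by (rule pm_eqI) (simp add: lookup_lin pair_diff lookup_minus)
lemma lin_sum: "lin \<phi> (\<Sum>i\<in>I. x i) = (\<Sum>i\<in>I. lin \<phi> (x i))"
  by (rule pm_eqI) (simp add: lookup_lin pair_sum lookup_sum)
lemma lin_scale: "lin \<phi> (scale r x) = scale r (lin \<phi> x)"
  by (rule pm_eqI) (simp add: lookup_lin pair_scale)
lemma lin_cong: "(\<And>c. c \<in> keys x \<Longrightarrow> \<phi> c = \<psi> c) \<Longrightarrow> lin \<phi> x = lin \<psi> x"
  by (simp add: lin_def)
lemma lin_fun_add: "lin (\<lambda>c. \<phi> c + \<psi> c) x = lin \<phi> x + lin \<psi> x"
  by (rule pm_eqI) (simp add: lookup_lin lookup_add pair_fun_add)
lemma lin_fun_diff: "lin (\<lambda>c. \<phi> c - \<psi> c) x = lin \<phi> x - lin \<psi> x"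
  by (rule pm_eqI) (simp add: lookup_lin lookup_minus pair_fun_diff)
lemma lin_fun_sum: "lin (\<lambda>c. \<Sum>i\<in>I. \<phi> i c) x = (\<Sum>i\<in>I. lin (\<phi> i) x)"
  by (rule pm_eqI) (simp add: lookup_lin lookup_sum pair_fun_sum)
lemma lin_fun_scale: "lin (\<lambda>c. scale r (\<phi> c)) x = scale r (lin \<phi> x)"
  by (rule pm_eqI) (simp add: lookup_lin pair_fun_mult)
lemma lin_fun_zero [simp]: "lin (\<lambda>c. 0) x = 0" by (rule pm_eqI) (simp add: lookup_lin)
lemma lin_lin: "lin \<psi> (lin \<phi> x) = lin (\<lambda>c. lin \<psi> (\<phi> c)) x"
  by (rule pm_eqI) (simp add: lookup_lin pair_lin)
lemma lin_id [simp]: "lin (\<lambda>c. Poly_Mapping.single c 1) x = x"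
  by (rule pm_eqI) (simp add: lookup_lin pair_def lookup_single when_def if_distrib[of "\<lambda>t. _ * t"] sum.delta
      in_keys_iff cong: if_cong)
lemma lin_id_on: "(\<And>c. c \<in> keys x \<Longrightarrow> \<phi> c = Poly_Mapping.single c 1) \<Longrightarrow> lin \<phi> x = x"
  using lin_cong[of x \<phi> "\<lambda>c. Poly_Mapping.single c 1"] by simp

lemma keys_lin: "keys (lin \<phi> x) \<subseteq> (\<Union>c\<in>keys x. keys (\<phi> c))"
proof
  fix d assume "d \<in> keys (lin \<phi> x)"
  then have "pair (\<lambda>c. lookup (\<phi> c) d) x \<noteq> 0" by (simp add: in_keys_iff lookup_lin)
  then obtain c where "c \<in> keys x" "lookup x c * lookup (\<phi> c) d \<noteq> 0"
    unfolding pair_def by (meson sum.neutral)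
  then have "c \<in> keys x" "d \<in> keys (\<phi> c)" by (auto simp: in_keys_iff)
  then show "d \<in> (\<Union>c\<in>keys x. keys (\<phi> c))" by blast
qed

lemma keys_diff': "keys (x - y) \<subseteq> keys x \<union> keys (y :: 'c \<Rightarrow>\<^sub>0 'r::ab_group_add)"
  by (auto simp: in_keys_iff lookup_minus)

lemma keys_sum': "keys (\<Sum>i\<in>I. x i) \<subseteq> (\<Union>i\<in>I. keys (x i :: 'c \<Rightarrow>\<^sub>0 'r::comm_monoid_add))"
proof
  fix d assume "d \<in> keys (\<Sum>i\<in>I. x i)"
  then have "(\<Sum>i\<in>I. lookup (x i) d) \<noteq> 0" by (simp add: in_keys_iff lookup_sum)
  then obtain i where "i \<in> I" "lookup (x i) d \<noteq> 0" by (meson sum.neutral)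
  then show "d \<in> (\<Union>i\<in>I. keys (x i))" by (auto simp: in_keys_iff)
qed

definition supported :: "'c set \<Rightarrow> ('c \<Rightarrow>\<^sub>0 'r::zero) set" where
  "supported A = {x. keys x \<subseteq> A}"

lemma supported_zero [simp]: "0 \<in> supported A" by (simp add: supported_def)
lemma supported_add: "x \<in> supported A \<Longrightarrow> y \<in> supported A \<Longrightarrow> x + y \<in> supported A"
  using keys_add[of x y] by (auto simp: supported_def)
lemma supported_diff: "x \<in> supported A \<Longrightarrow> y \<in> supported A \<Longrightarrow> (x - y :: 'c \<Rightarrow>\<^sub>0 'r::ab_group_add) \<in> supported A"
  using keys_diff'[of x y] by (auto simp: supported_def)
lemma supported_uminus: "x \<in> supported A \<Longrightarrow> (- x :: 'c \<Rightarrow>\<^sub>0 'r::ab_group_add) \<in> supported A"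
  by (auto simp: supported_def in_keys_iff)
lemma supported_scale: "x \<in> supported A \<Longrightarrow> scale r x \<in> supported A"
  using keys_scale[of r x] by (auto simp: supported_def)
lemma supported_single: "c \<in> A \<Longrightarrow> Poly_Mapping.single c r \<in> supported A"
  by (auto simp: supported_def)
lemma supported_sum: "(\<And>i. i \<in> I \<Longrightarrow> x i \<in> supported A) \<Longrightarrow> (\<Sum>i\<in>I. x i) \<in> supported A"
  using keys_sum'[of x I] by (simp add: supported_def) blast
lemma supported_lin: "x \<in> supported A \<Longrightarrow> (\<And>c. c \<in> A \<Longrightarrow> \<phi> c \<in> supported B) \<Longrightarrow> lin \<phi> x \<in> supported B"
  using keys_lin[of \<phi> x] by (fastforce simp: supported_def)
lemma supported_mono: "x \<in> supported A \<Longrightarrow> A \<subseteq> B \<Longrightarrow> x \<in> supported B"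
  by (auto simp: supported_def)
lemma supported_keys: "x \<in> supported A \<Longrightarrow> c \<in> keys x \<Longrightarrow> c \<in> A"
  by (auto simp: supported_def)
lemma lin_cong_on: "x \<in> supported A \<Longrightarrow> (\<And>c. c \<in> A \<Longrightarrow> \<phi> c = \<psi> c) \<Longrightarrow> lin \<phi> x = lin \<psi> x"
  by (rule lin_cong) (auto simp: supported_def)
lemma pair_cong_on: "x \<in> supported A \<Longrightarrow> (\<And>c. c \<in> A \<Longrightarrow> f c = g c) \<Longrightarrow> pair f x = pair g x"
  by (rule pair_cong) (auto simp: supported_def)

lemma chain_expand: "x = (\<Sum>c\<in>keys x. scale (lookup x c) (Poly_Mapping.single c (1::'r::comm_ring_1)))"
  using lin_id[of x] by (simp only: lin_def)

subsection \<open>Equivariant extension\<close>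

text \<open>A pair (g, b) stands for g b in the free module with basis elements b over the monoid
  ring. \<open>act\<close> multiplies by a monoid element, and \<open>ext\<close> is the module
  homomorphism with given values on the basis. In this form the ring itself does not enter before
  type FP is unfolded.\<close>

definition act :: "('g, 'z) monoid_scheme \<Rightarrow> 'g \<Rightarrow> ('g \<times> 'b \<Rightarrow>\<^sub>0 'r::comm_ring_1) \<Rightarrow> ('g \<times> 'b \<Rightarrow>\<^sub>0 'r)" where
  "act G h x = lin (\<lambda>(g, b). Poly_Mapping.single (h \<otimes>\<^bsub>G\<^esub> g, b) 1) x"

definition ext :: "('g, 'z) monoid_scheme \<Rightarrow> ('a \<Rightarrow> ('g \<times> 'b \<Rightarrow>\<^sub>0 'r::comm_ring_1)) \<Rightarrow>
    ('g \<times> 'a \<Rightarrow>\<^sub>0 'r) \<Rightarrow> ('g \<times> 'b \<Rightarrow>\<^sub>0 'r)" where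
  "ext G \<phi> x = lin (\<lambda>(g, a). act G g (\<phi> a)) x"

abbreviation chains :: "('g, 'z) monoid_scheme \<Rightarrow> 'b set \<Rightarrow> ('g \<times> 'b \<Rightarrow>\<^sub>0 'r::comm_ring_1) set" where
  "chains G B \<equiv> supported (carrier G \<times> B)"

lemma act_single [simp]: "act G h (Poly_Mapping.single (g, b) r) = Poly_Mapping.single (h \<otimes>\<^bsub>G\<^esub> g, b) r"
  by (simp add: act_def)
lemma act_zero [simp]: "act G h 0 = 0" by (simp add: act_def)
lemma act_add: "act G h (x + y) = act G h x + act G h y" by (simp add: act_def lin_add)
lemma act_diff: "act G h (x - y) = act G h x - act G h y" by (simp add: act_def lin_diff)
lemma act_sum: "act G h (\<Sum>i\<in>I. x i) = (\<Sum>i\<in>I. act G h (x i))" by (simp add: act_def lin_sum)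
lemma act_scale: "act G h (scale r x) = scale r (act G h x)" by (simp add: act_def lin_scale)

lemma ext_zero [simp]: "ext G \<phi> 0 = 0" by (simp add: ext_def)
lemma ext_add: "ext G \<phi> (x + y) = ext G \<phi> x + ext G \<phi> y" by (simp add: ext_def lin_add)
lemma ext_diff: "ext G \<phi> (x - y) = ext G \<phi> x - ext G \<phi> y" by (simp add: ext_def lin_diff)
lemma ext_uminus: "ext G \<phi> (- y) = - ext G \<phi> y" by (simp add: ext_def lin_uminus)
lemma ext_sum: "ext G \<phi> (\<Sum>i\<in>I. x i) = (\<Sum>i\<in>I. ext G \<phi> (x i))" by (simp add: ext_def lin_sum)
lemma ext_scale: "ext G \<phi> (scale r x) = scale r (ext G \<phi> x)" by (simp add: ext_def lin_scale)
lemma ext_single: "ext G \<phi> (Poly_Mapping.single (g, a) r) = scale r (act G g (\<phi> a))"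
  by (simp add: ext_def)

lemma ext_fun_zero [simp]: "ext G (\<lambda>a. 0) x = 0" by (simp add: ext_def split_def)

context monoid
begin

lemma act_closed: "h \<in> carrier G \<Longrightarrow> x \<in> chains G B \<Longrightarrow> act G h x \<in> chains G B"
  unfolding act_def by (rule supported_lin) (auto intro!: supported_single)

lemma act_one: "x \<in> chains G B \<Longrightarrow> act G \<one> x = x"
  unfolding act_def by (rule lin_id_on) (auto dest!: supported_keys)

lemma act_act: "h \<in> carrier G \<Longrightarrow> k \<in> carrier G \<Longrightarrow> x \<in> chains G B \<Longrightarrow>
    act G h (act G k x) = act G (h \<otimes> k) x"
  unfolding act_def lin_lin by (rule lin_cong_on[of x]) (auto simp: m_assoc)

lemma ext_closed: "x \<in> chains G A \<Longrightarrow> (\<And>a. a \<in> A \<Longrightarrow> \<phi> a \<in> chains G B) \<Longrightarrow> ext G \<phi> x \<in> chains G B"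
  unfolding ext_def by (rule supported_lin) (auto intro!: act_closed)

lemma ext_act:
  assumes "h \<in> carrier G" "x \<in> chains G A" "\<And>a. a \<in> A \<Longrightarrow> \<phi> a \<in> chains G B"
  shows "ext G \<phi> (act G h x) = act G h (ext G \<phi> x)"
proof -
  have "act G (h \<otimes> g) (\<phi> a) = act G h (act G g (\<phi> a))" if "g \<in> carrier G" "a \<in> A" for g a
    using act_act[OF assms(1) that(1) assms(3)[OF that(2)]] by simp
  then have "lin (\<lambda>(g, a). act G (h \<otimes> g) (\<phi> a)) x = lin (\<lambda>(g, a). act G h (act G g (\<phi> a))) x"
    by (intro lin_cong_on[OF assms(2)]) auto
  then show ?thesis
    by (simp add: ext_def act_def[of G h] lin_lin split_def)
qed

lemma ext_cong: "x \<in> chains G A \<Longrightarrow> (\<And>a. a \<in> A \<Longrightarrow> \<phi> a = \<psi> a) \<Longrightarrow> ext G \<phi> x = ext G \<psi> x"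
  unfolding ext_def by (rule lin_cong_on) auto

lemma ext_ext:
  assumes "x \<in> chains G A" "\<And>a. a \<in> A \<Longrightarrow> \<phi> a \<in> chains G B" "\<And>b. b \<in> B \<Longrightarrow> \<psi> b \<in> chains G C"
  shows "ext G \<psi> (ext G \<phi> x) = ext G (\<lambda>a. ext G \<psi> (\<phi> a)) x"
proof -
  have "ext G \<psi> (ext G \<phi> x) = lin (\<lambda>(g, a). ext G \<psi> (act G g (\<phi> a))) x"
    by (simp add: ext_def[of G \<psi>] ext_def[of G \<phi>] lin_lin split_def)
  also have "\<dots> = lin (\<lambda>(g, a). act G g (ext G \<psi> (\<phi> a))) x"
    by (rule lin_cong_on[OF assms(1)]) (auto intro!: ext_act assms)
  finally show ?thesis by (simp add: ext_def)
qed

lemma ext_fun_diff: "ext G (\<lambda>a. \<phi> a - \<psi> a) x = ext G \<phi> x - ext G \<psi> x"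
  by (simp add: ext_def act_diff split_def lin_fun_diff)

lemma ext_id: "x \<in> chains G B \<Longrightarrow> ext G (\<lambda>b. Poly_Mapping.single (\<one>, b) 1) x = x"
  unfolding ext_def by (rule lin_id_on) (auto dest!: supported_keys)

end

text \<open>The values on the basis are arbitrary: constantly 1 for cubes and bars, a general
  function for a projective resolution, and a cochain when cocycles are evaluated.\<close>

definition aug :: "('b \<Rightarrow> 'r::comm_ring_1) \<Rightarrow> ('g \<times> 'b \<Rightarrow>\<^sub>0 'r) \<Rightarrow> 'r" where
  "aug a x = pair (\<lambda>c. a (snd c)) x"

lemma aug_act [simp]: "aug a (act G h x) = aug a x"
  by (simp add: aug_def act_def pair_lin split_def)
lemma aug_zero [simp]: "aug a 0 = 0" by (simp add: aug_def)
lemma aug_add: "aug a (x + y) = aug a x + aug a y" by (simp add: aug_def pair_add)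
lemma aug_diff: "aug a (x - y) = aug a x - aug a y" by (simp add: aug_def pair_diff)
lemma aug_scale: "aug a (scale r x) = r * aug a x" by (simp add: aug_def pair_scale)
lemma aug_sum: "aug a (\<Sum>i\<in>I. x i) = (\<Sum>i\<in>I. aug a (x i))" by (simp add: aug_def pair_sum)
lemma aug_single [simp]: "aug a (Poly_Mapping.single c r) = r * a (snd c)" by (simp add: aug_def)
lemma aug_ext: "aug a (ext G \<phi> x) = aug (\<lambda>b. aug a (\<phi> b)) x"
proof -
  have "aug a (ext G \<phi> x) = pair (\<lambda>(g, b). aug a (act G g (\<phi> b))) x"
    by (simp add: aug_def ext_def pair_lin split_def)
  then show ?thesis by (simp add: aug_def[of "\<lambda>b. aug a (\<phi> b)"] split_def)
qed
lemma aug_cong: "x \<in> supported (A \<times> B) \<Longrightarrow> (\<And>b. b \<in> B \<Longrightarrow> a b = a' b) \<Longrightarrow> aug a x = aug a' x"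
  unfolding aug_def by (rule pair_cong_on) auto

subsection \<open>Comparison of complexes\<close>

text \<open>Terms of a projective resolution are only direct summands of free modules. Exact
  complexes are therefore built from submodules, and \<open>eqlin\<close> asks for linearity on the
  submodule.\<close>

definition submod :: "('g, 'z) monoid_scheme \<Rightarrow> ('g \<times> 'b \<Rightarrow>\<^sub>0 'r::comm_ring_1) set \<Rightarrow> bool" where
  "submod G Y \<longleftrightarrow> Y \<subseteq> chains G UNIV \<and> 0 \<in> Y \<and> (\<forall>x\<in>Y. \<forall>y\<in>Y. x + y \<in> Y) \<and> (\<forall>r. \<forall>x\<in>Y. scale r x \<in> Y) \<and>
     (\<forall>h\<in>carrier G. \<forall>x\<in>Y. act G h x \<in> Y)"

definition eqlin :: "('g, 'z) monoid_scheme \<Rightarrow> ('g \<times> 'b \<Rightarrow>\<^sub>0 'r::comm_ring_1) set \<Rightarrow>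
    (('g \<times> 'b \<Rightarrow>\<^sub>0 'r) \<Rightarrow> ('g \<times> 'c \<Rightarrow>\<^sub>0 'r)) \<Rightarrow> bool" where
  "eqlin G Y d \<longleftrightarrow> (\<forall>x\<in>Y. \<forall>y\<in>Y. d (x + y) = d x + d y) \<and> (\<forall>r. \<forall>x\<in>Y. d (scale r x) = scale r (d x)) \<and>
     (\<forall>h\<in>carrier G. \<forall>x\<in>Y. d (act G h x) = act G h (d x))"

lemma submod_sub: "submod G Y \<Longrightarrow> y \<in> Y \<Longrightarrow> y \<in> chains G UNIV" by (auto simp: submod_def)
lemma submod_add: "submod G Y \<Longrightarrow> x \<in> Y \<Longrightarrow> y \<in> Y \<Longrightarrow> x + y \<in> Y" by (simp add: submod_def)
lemma submod_scale: "submod G Y \<Longrightarrow> y \<in> Y \<Longrightarrow> scale r y \<in> Y" by (simp add: submod_def)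
lemma submod_act: "submod G Y \<Longrightarrow> h \<in> carrier G \<Longrightarrow> y \<in> Y \<Longrightarrow> act G h y \<in> Y" by (simp add: submod_def)
lemma eqlin_add: "eqlin G Y d \<Longrightarrow> x \<in> Y \<Longrightarrow> y \<in> Y \<Longrightarrow> d (x + y) = d x + d y" by (simp add: eqlin_def)
lemma eqlin_scale: "eqlin G Y d \<Longrightarrow> x \<in> Y \<Longrightarrow> d (scale r x) = scale r (d x)" by (simp add: eqlin_def)
lemma eqlin_act: "eqlin G Y d \<Longrightarrow> h \<in> carrier G \<Longrightarrow> x \<in> Y \<Longrightarrow> d (act G h x) = act G h (d x)"
  by (simp add: eqlin_def)
lemma submod_zero: "submod G Y \<Longrightarrow> 0 \<in> Y" by (simp add: submod_def)
lemma submod_diff: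
  assumes "submod G Y" "x \<in> Y" "y \<in> Y"
  shows "x - y \<in> Y"
proof -
  have "x + scale (-1) y \<in> Y" using assms by (intro submod_add submod_scale)
  then show ?thesis by (simp add: scale_minus_one)
qed
lemma eqlin_zero: assumes "submod G Y" "eqlin G Y d" shows "d 0 = 0"
  using eqlin_scale[OF assms(2) submod_zero[OF assms(1)], of 0] by simp
lemma eqlin_diff:
  assumes "submod G Y" "eqlin G Y d" "x \<in> Y" "y \<in> Y"
  shows "d (x - y) = d x - d y"
  using eqlin_add[OF assms(2,3) submod_scale[OF assms(1,4), of "-1"]] eqlin_scale[OF assms(2,4), of "-1"]
  by (simp add: scale_minus_one)

lemma submod_sum: "submod G Y \<Longrightarrow> (\<And>i. i \<in> I \<Longrightarrow> x i \<in> Y) \<Longrightarrow> (\<Sum>i\<in>I. x i) \<in> Y"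
  by (induction I rule: infinite_finite_induct) (auto simp: submod_def)
lemma eqlin_sum: "submod G Y \<Longrightarrow> eqlin G Y d \<Longrightarrow> (\<And>i. i \<in> I \<Longrightarrow> x i \<in> Y) \<Longrightarrow>
    d (\<Sum>i\<in>I. x i) = (\<Sum>i\<in>I. d (x i))"
proof (induction I rule: infinite_finite_induct)
  case (insert i I)
  then have "(\<Sum>i\<in>I. x i) \<in> Y" by (auto intro!: submod_sum)
  with insert show ?case by (auto simp: eqlin_def)
qed (auto simp: eqlin_zero)

context monoid
begin

lemma submod_chains: "submod G (chains G B)"
  unfolding submod_def
  by (auto intro!: supported_add supported_scale act_closed) (auto simp: supported_def)

lemma eqlin_ext_fun: "(\<And>b. b \<in> B \<Longrightarrow> \<phi> b \<in> chains G C) \<Longrightarrow> eqlin G (chains G B) (ext G \<phi>)"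
  unfolding eqlin_def by (auto simp: ext_add ext_scale intro!: ext_act)

lemma ext_in_submod:
  assumes "submod G Y" "x \<in> chains G A" "\<And>a. a \<in> A \<Longrightarrow> \<phi> a \<in> Y"
  shows "ext G \<phi> x \<in> Y"
  unfolding ext_def lin_def
  using assms by (intro submod_sum) (auto simp: submod_def dest!: supported_keys)

lemma eqlin_ext:
  assumes "submod G Y" "eqlin G Y d" "x \<in> chains G A" "\<And>a. a \<in> A \<Longrightarrow> \<phi> a \<in> Y"
  shows "d (ext G \<phi> x) = ext G (\<lambda>a. d (\<phi> a)) x"
proof -
  have *: "lookup x c = 0 \<or> (fst c \<in> carrier G \<and> \<phi> (snd c) \<in> Y)" for c
    using assms(3,4) supported_keys[of x "carrier G \<times> A" c] by (cases c) (auto simp: in_keys_iff)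
  have "d (ext G \<phi> x) = (\<Sum>c\<in>keys x. d (scale (lookup x c) (act G (fst c) (\<phi> (snd c)))))"
    unfolding ext_def lin_def split_def using *
    by (intro eqlin_sum[OF assms(1,2)] submod_scale[OF assms(1)] submod_act[OF assms(1)])
      (auto simp: in_keys_iff)
  also have "\<dots> = (\<Sum>c\<in>keys x. scale (lookup x c) (act G (fst c) (d (\<phi> (snd c)))))"
  proof (rule sum.cong)
    fix c assume "c \<in> keys x"
    then have "fst c \<in> carrier G" "\<phi> (snd c) \<in> Y" using *[of c] by (auto simp: in_keys_iff)
    then show "d (scale (lookup x c) (act G (fst c) (\<phi> (snd c)))) =
        scale (lookup x c) (act G (fst c) (d (\<phi> (snd c))))"
      by (simp add: eqlin_scale[OF assms(2)] eqlin_act[OF assms(2)] submod_act[OF assms(1)])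
  qed simp
  finally show ?thesis by (simp add: ext_def lin_def split_def)
qed

end

text \<open>The two sides of the comparison theorem are kept apart: the source is free and given by
  the boundaries of its basis elements, while the target, \<open>exact_complex\<close>, is exact
  with arbitrary submodules as terms.\<close>

locale free_complex = monoid G for G (structure) +
  fixes B :: "nat \<Rightarrow> 'b set" and D :: "nat \<Rightarrow> 'b \<Rightarrow> ('a \<times> 'b \<Rightarrow>\<^sub>0 'r::comm_ring_1)" and a :: "'b \<Rightarrow> 'r"
  assumes D_closed: "b \<in> B (Suc n) \<Longrightarrow> D n b \<in> chains G (B n)"
    and D_D: "b \<in> B (Suc (Suc n)) \<Longrightarrow> ext G (D n) (D (Suc n) b) = 0"
    and aug_D: "b \<in> B (Suc 0) \<Longrightarrow> aug a (D 0 b) = 0"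
begin

lemma ext_D_closed: "x \<in> chains G (B (Suc n)) \<Longrightarrow> ext G (D n) x \<in> chains G (B n)"
  by (rule ext_closed) (auto intro: D_closed)

lemma ext_D_D:
  assumes "x \<in> chains G (B (Suc (Suc n)))"
  shows "ext G (D n) (ext G (D (Suc n)) x) = 0"
proof -
  have "ext G (D n) (ext G (D (Suc n)) x) = ext G (\<lambda>b. ext G (D n) (D (Suc n) b)) x"
    by (rule ext_ext[OF assms D_closed D_closed])
  also have "\<dots> = ext G (\<lambda>b. 0) x" by (rule ext_cong[OF assms D_D])
  finally show ?thesis by (simp add: ext_fun_zero)
qed

end

locale exact_complex = monoid G for G (structure) +
  fixes Y :: "nat \<Rightarrow> ('a \<times> 'y \<Rightarrow>\<^sub>0 'r::comm_ring_1) set" and d e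
  assumes Y_submod: "submod G (Y n)"
    and d_eqlin: "eqlin G (Y (Suc n)) (d n)"
    and d_closed: "y \<in> Y (Suc n) \<Longrightarrow> d n y \<in> Y n"
    and aug_surj: "\<exists>y\<in>Y 0. aug e y = 1"
    and aug_d: "y \<in> Y (Suc 0) \<Longrightarrow> aug e (d 0 y) = 0"
    and d_d: "y \<in> Y (Suc (Suc n)) \<Longrightarrow> d n (d (Suc n) y) = 0"
    and exact0: "y \<in> Y 0 \<Longrightarrow> aug e y = 0 \<Longrightarrow> \<exists>z\<in>Y (Suc 0). d 0 z = y"
    and exactS: "y \<in> Y (Suc n) \<Longrightarrow> d n y = 0 \<Longrightarrow> \<exists>z\<in>Y (Suc (Suc n)). d (Suc n) z = y"

locale complex_pair = X: free_complex G B D a + Y: exact_complex G Y d e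
  for G :: "('g, 'z) monoid_scheme" and B :: "nat \<Rightarrow> 'b set" and D and a :: "'b \<Rightarrow> 'r::comm_ring_1" and
    Y :: "nat \<Rightarrow> ('g \<times> 'y \<Rightarrow>\<^sub>0 'r) set" and d e
begin

definition chain_map :: "(nat \<Rightarrow> 'b \<Rightarrow> ('g \<times> 'y \<Rightarrow>\<^sub>0 'r)) \<Rightarrow> bool" where
  "chain_map \<phi> \<longleftrightarrow> (\<forall>n. \<forall>b\<in>B n. \<phi> n b \<in> Y n) \<and> (\<forall>b\<in>B 0. aug e (\<phi> 0 b) = a b) \<and>
     (\<forall>n. \<forall>b\<in>B (Suc n). d n (\<phi> (Suc n) b) = ext G (\<phi> n) (D n b))"

lemma chain_map_closed: "chain_map \<phi> \<Longrightarrow> x \<in> chains G (B n) \<Longrightarrow> ext G (\<phi> n) x \<in> Y n"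
  by (rule X.ext_in_submod[OF Y.Y_submod]) (auto simp: chain_map_def)

lemma chain_map_d: "chain_map \<phi> \<Longrightarrow> x \<in> chains G (B (Suc n)) \<Longrightarrow>
    d n (ext G (\<phi> (Suc n)) x) = ext G (\<phi> n) (ext G (D n) x)"
  apply (subst X.eqlin_ext[OF Y.Y_submod Y.d_eqlin, of x "B (Suc n)"])
    apply assumption
   apply (simp add: chain_map_def)
  apply (subst X.ext_ext[of x "B (Suc n)" _ "B n" _ UNIV])
     apply assumption
    apply (simp add: X.D_closed)
   apply (rule submod_sub[OF Y.Y_submod[of n]], simp add: chain_map_def)
  apply (rule X.ext_cong, assumption)
  apply (simp add: chain_map_def)
  done

text \<open>Existence in the comparison theorem: by exactness, the image of the boundary of a basis
  element has a preimage, which is chosen as the value of the next map.\<close>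

theorem lift: "\<exists>\<phi>. chain_map \<phi>"
proof -
  \<comment> \<open>Each choice sees only the previous map. So \<open>P\<close> also records that
    the images of the boundaries of the next basis elements are cycles, which is what exactness
    turns into the next map.\<close>
  define P where "P n \<phi> \<longleftrightarrow> (\<forall>b\<in>B n. \<phi> b \<in> Y n) \<and>
      (\<forall>b\<in>B (Suc n). if n = 0 then aug e (ext G \<phi> (D n b)) = 0 else d (n - 1) (ext G \<phi> (D n b)) = 0) \<and>
      (n = 0 \<longrightarrow> (\<forall>b\<in>B 0. aug e (\<phi> b) = a b))" for n and \<phi> :: "'b \<Rightarrow> ('g \<times> 'y \<Rightarrow>\<^sub>0 'r)"
  define Q where "Q n \<phi> \<psi> \<longleftrightarrow> (\<forall>b\<in>B (Suc n). d n (\<psi> b) = ext G \<phi> (D n b))"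
    for n and \<phi> \<psi> :: "'b \<Rightarrow> ('g \<times> 'y \<Rightarrow>\<^sub>0 'r)"
  obtain y where y: "y \<in> Y 0" "aug e y = 1" using Y.aug_surj by auto
  have "\<exists>\<phi>. P 0 \<phi>"
  proof
    have *: "scale (a b) y \<in> Y 0" for b by (rule submod_scale[OF Y.Y_submod y(1)])
    have "aug e (ext G (\<lambda>b. scale (a b) y) (D 0 b)) = aug a (D 0 b)" for b
      by (simp add: aug_ext aug_scale y)
    then show "P 0 (\<lambda>b. scale (a b) y)"
      using * y by (auto simp: P_def aug_scale X.aug_D)
  qed
  moreover have "\<exists>\<psi>. P (Suc n) \<psi> \<and> Q n \<phi> \<psi>" if P: "P n \<phi>" for n \<phi>
  proof -
    have "\<exists>z\<in>Y (Suc n). d n z = ext G \<phi> (D n b)" if "b \<in> B (Suc n)" for b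
    proof -
      have "ext G \<phi> (D n b) \<in> Y n"
        using P that by (intro X.ext_in_submod[OF Y.Y_submod X.D_closed]) (auto simp: P_def)
      then show ?thesis
        using P that Y.exact0 Y.exactS by (cases n) (auto simp: P_def)
    qed
    then obtain \<psi> where \<psi>: "\<And>b. b \<in> B (Suc n) \<Longrightarrow> \<psi> b \<in> Y (Suc n) \<and> d n (\<psi> b) = ext G \<phi> (D n b)"
      by metis
    have "d n (ext G \<psi> (D (Suc n) b)) = 0" if b: "b \<in> B (Suc (Suc n))" for b
    proof -
      have "d n (ext G \<psi> (D (Suc n) b)) = ext G (\<lambda>b. d n (\<psi> b)) (D (Suc n) b)"
        by (rule X.eqlin_ext[OF Y.Y_submod Y.d_eqlin X.D_closed[OF b]]) (simp add: \<psi>)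
      also have "\<dots> = ext G (\<lambda>b. ext G \<phi> (D n b)) (D (Suc n) b)"
        by (rule X.ext_cong[OF X.D_closed[OF b]]) (simp add: \<psi>)
      also have "\<dots> = ext G \<phi> (ext G (D n) (D (Suc n) b))"
        by (rule X.ext_ext[OF X.D_closed[OF b], of _ "B n" _ UNIV, symmetric])
          (use P in \<open>auto simp: P_def intro: X.D_closed submod_sub[OF Y.Y_submod[of n]]\<close>)
      finally show ?thesis by (simp add: X.D_D b)
    qed
    then have "P (Suc n) \<psi> \<and> Q n \<phi> \<psi>" using \<psi> by (auto simp: P_def Q_def)
    then show ?thesis by blast
  qed
  ultimately obtain \<phi> where "\<And>n. P n (\<phi> n) \<and> Q n (\<phi> n) (\<phi> (Suc n))"
    using dependent_nat_choice[of P Q] by metis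
  then have "chain_map \<phi>" by (auto simp: P_def Q_def chain_map_def)
  then show ?thesis by blast
qed

definition homotopy where
  "homotopy \<phi> \<psi> H \<longleftrightarrow> (\<forall>n. \<forall>b\<in>B n. H n b \<in> Y (Suc n)) \<and> (\<forall>b\<in>B 0. d 0 (H 0 b) = \<phi> 0 b - \<psi> 0 b) \<and>
    (\<forall>n. \<forall>b\<in>B (Suc n). d (Suc n) (H (Suc n) b) = \<phi> (Suc n) b - \<psi> (Suc n) b - ext G (H n) (D n b))"

text \<open>Uniqueness in the comparison theorem, by the same kind of choice as in
  \<open>lift\<close>.\<close>

theorem homotopic:
  assumes \<phi>: "chain_map \<phi>" and \<psi>: "chain_map \<psi>"
  shows "\<exists>H. homotopy \<phi> \<psi> H"
proof -
  \<comment> \<open>The last clause makes the right side of \<open>Q\<close> a cycle in the next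
    degree.\<close>
  define P where "P n H \<longleftrightarrow> (\<forall>b\<in>B n. H b \<in> Y (Suc n)) \<and> (n = 0 \<longrightarrow> (\<forall>b\<in>B 0. d 0 (H b) = \<phi> 0 b - \<psi> 0 b)) \<and>
      (\<forall>b\<in>B (Suc n). d n (ext G H (D n b)) = d n (\<phi> (Suc n) b - \<psi> (Suc n) b))"
    for n and H :: "'b \<Rightarrow> ('g \<times> 'y \<Rightarrow>\<^sub>0 'r)"
  define Q where "Q n H K \<longleftrightarrow> (\<forall>b\<in>B (Suc n). d (Suc n) (K b) = \<phi> (Suc n) b - \<psi> (Suc n) b - ext G H (D n b))"
    for n and H K :: "'b \<Rightarrow> ('g \<times> 'y \<Rightarrow>\<^sub>0 'r)"
  have mem: "\<phi> n b \<in> Y n" "\<psi> n b \<in> Y n" if "b \<in> B n" for n b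
    using \<phi> \<psi> that by (auto simp: chain_map_def)
  have dif: "d n (\<phi> (Suc n) b - \<psi> (Suc n) b) = ext G (\<lambda>b. \<phi> n b - \<psi> n b) (D n b)" if "b \<in> B (Suc n)" for n b
    using \<phi> \<psi> mem[OF that] that eqlin_diff[OF Y.Y_submod Y.d_eqlin]
    by (simp add: chain_map_def X.ext_fun_diff)
  have ext_d: "d n (ext G H x) = ext G (\<lambda>b. d n (H b)) x"
    if "x \<in> chains G (B m)" "\<And>b. b \<in> B m \<Longrightarrow> H b \<in> Y (Suc n)" for m n H x
    by (rule X.eqlin_ext[OF Y.Y_submod Y.d_eqlin that])
  have "\<exists>H. P 0 H"
  proof -
    have "\<exists>z\<in>Y (Suc 0). d 0 z = \<phi> 0 b - \<psi> 0 b" if "b \<in> B 0" for b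
      using \<phi> \<psi> that mem by (intro Y.exact0 submod_diff[OF Y.Y_submod]) (auto simp: aug_diff chain_map_def)
    then obtain H where H: "\<And>b. b \<in> B 0 \<Longrightarrow> H b \<in> Y (Suc 0) \<and> d 0 (H b) = \<phi> 0 b - \<psi> 0 b" by metis
    have "d 0 (ext G H (D 0 b)) = d 0 (\<phi> (Suc 0) b - \<psi> (Suc 0) b)" if b: "b \<in> B (Suc 0)" for b
      using H by (auto simp: dif[OF b] ext_d[OF X.D_closed[OF b]] intro!: X.ext_cong[OF X.D_closed[OF b]])
    then have "P 0 H" using H by (auto simp: P_def)
    then show ?thesis by blast
  qed
  moreover have "\<exists>K. P (Suc n) K \<and> Q n H K" if P: "P n H" for n H
  proof -
    have mem': "\<phi> (Suc n) b - \<psi> (Suc n) b \<in> Y (Suc n)" "ext G H (D n b) \<in> Y (Suc n)"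
      if b: "b \<in> B (Suc n)" for b
      using P by (auto intro!: submod_diff[OF Y.Y_submod] mem b
          X.ext_in_submod[OF Y.Y_submod X.D_closed[OF b]] simp: P_def)
    have "\<exists>z\<in>Y (Suc (Suc n)). d (Suc n) z = \<phi> (Suc n) b - \<psi> (Suc n) b - ext G H (D n b)"
      if b: "b \<in> B (Suc n)" for b
      using P mem'[OF b] eqlin_diff[OF Y.Y_submod Y.d_eqlin mem'[OF b]] b
      by (intro Y.exactS submod_diff[OF Y.Y_submod mem'[OF b]]) (auto simp: P_def)
    then obtain K where K: "\<And>b. b \<in> B (Suc n) \<Longrightarrow> K b \<in> Y (Suc (Suc n)) \<and>
        d (Suc n) (K b) = \<phi> (Suc n) b - \<psi> (Suc n) b - ext G H (D n b)" by metis
    have "d (Suc n) (ext G K (D (Suc n) b)) = d (Suc n) (\<phi> (Suc (Suc n)) b - \<psi> (Suc (Suc n)) b)"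
      if b: "b \<in> B (Suc (Suc n))" for b
    proof -
      have "d (Suc n) (ext G K (D (Suc n) b)) = ext G (\<lambda>b. d (Suc n) (K b)) (D (Suc n) b)"
        using K by (intro ext_d[OF X.D_closed[OF b]]) auto
      also have "\<dots> = ext G (\<lambda>b. (\<phi> (Suc n) b - \<psi> (Suc n) b) - ext G H (D n b)) (D (Suc n) b)"
        by (rule X.ext_cong[OF X.D_closed[OF b]]) (simp add: K)
      also have "\<dots> = ext G (\<lambda>b. \<phi> (Suc n) b - \<psi> (Suc n) b) (D (Suc n) b) -
          ext G (\<lambda>b. ext G H (D n b)) (D (Suc n) b)" by (rule X.ext_fun_diff)
      also have "ext G (\<lambda>b. ext G H (D n b)) (D (Suc n) b) = ext G H (ext G (D n) (D (Suc n) b))"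
        by (rule X.ext_ext[OF X.D_closed[OF b], of _ "B n" _ UNIV, symmetric])
          (use P in \<open>auto simp: P_def intro: X.D_closed submod_sub[OF Y.Y_submod[of "Suc n"]]\<close>)
      finally show ?thesis by (simp add: dif[OF b] X.D_D b)
    qed
    then have "P (Suc n) K \<and> Q n H K" using K by (auto simp: P_def Q_def)
    then show ?thesis by blast
  qed
  ultimately obtain H where "\<And>n. P n (H n) \<and> Q n (H n) (H (Suc n))"
    using dependent_nat_choice[of P Q] by metis
  then have "homotopy \<phi> \<psi> H" unfolding homotopy_def by (auto simp: P_def Q_def)
  then show ?thesis by blast
qed

end

section \<open>Normal forms in right-angled Artin groups\<close>

definition linv :: "'v \<times> bool \<Rightarrow> 'v \<times> bool" where "linv a = (fst a, \<not> snd a)"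

lemma linv_linv [simp]: "linv (linv a) = a" by (simp add: linv_def)
lemma fst_linv [simp]: "fst (linv a) = fst a" by (simp add: linv_def)
lemma linv_neq [simp]: "linv a \<noteq> a" "a \<noteq> linv a" by (auto simp: linv_def prod_eq_iff)
lemma linv_eq_iff: "linv a = b \<longleftrightarrow> a = linv b" by (auto simp: linv_def)
lemma same_fst_letter: "fst a = fst b \<Longrightarrow> a = b \<or> a = linv b" by (cases a; cases b) (auto simp: linv_def)

definition indep :: "'v set set \<Rightarrow> 'v \<times> bool \<Rightarrow> 'v \<times> bool \<Rightarrow> bool" where
  "indep E a b \<longleftrightarrow> fst a \<noteq> fst b \<and> {fst a, fst b} \<in> E"

lemma indep_sym: "indep E a b \<Longrightarrow> indep E b a" by (auto simp: indep_def insert_commute)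
lemma indep_linv [simp]: "indep E (linv a) b = indep E a b" "indep E a (linv b) = indep E a b"
  by (auto simp: indep_def)
lemma indep_neq: "indep E a b \<Longrightarrow> a \<noteq> b" "indep E a b \<Longrightarrow> a \<noteq> linv b" "indep E a b \<Longrightarrow> linv a \<noteq> b"
  by (auto simp: indep_def)

text \<open>Normal forms are written backwards: the head of the list is the last letter of the word.
  \<^term>\<open>del E a w\<close> cancels the letter \<open>a\<close> against an inverse letter that can be moved to the head.\<close>

fun del :: "'v set set \<Rightarrow> 'v \<times> bool \<Rightarrow> ('v \<times> bool) list \<Rightarrow> ('v \<times> bool) list option" where
  "del E a [] = None"
| "del E a (x # xs) = (if x = linv a then Some xs
     else if indep E a x then map_option ((#) x) (del E a xs) else None)"

text \<open>Equality in the trace monoid, where adjacent independent letters may be exchanged.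
  Normal forms are unique only up to this relation.\<close>

inductive teq :: "'v set set \<Rightarrow> ('v \<times> bool) list \<Rightarrow> ('v \<times> bool) list \<Rightarrow> bool" for E where
  nil: "teq E [] []"
| cons: "teq E xs ys \<Longrightarrow> teq E (a # xs) (a # ys)"
| swap: "indep E a b \<Longrightarrow> teq E xs ys \<Longrightarrow> teq E (a # b # xs) (b # a # ys)"
| trans: "teq E xs ys \<Longrightarrow> teq E ys zs \<Longrightarrow> teq E xs zs"

lemma teq_refl [simp]: "teq E w w" by (induction w) (auto intro: teq.intros)
lemma teq_sym: "teq E w w' \<Longrightarrow> teq E w' w"
  by (induction rule: teq.induct) (auto intro: teq.intros indep_sym)
lemma teq_length: "teq E w w' \<Longrightarrow> length w = length w'" by (induction rule: teq.induct) auto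

lemma rel_option_teq_trans:
  "rel_option (teq E) x y \<Longrightarrow> rel_option (teq E) y z \<Longrightarrow> rel_option (teq E) x z"
  by (cases x; cases y; cases z) (auto intro: teq.trans)

text \<open>When two independent letters at the head are exchanged, at most one of them is inverse
  to \<open>a\<close>; then \<open>a\<close> is independent of the other, so the deletion commutes
  with the exchange.\<close>

lemma del_teq: "teq E w w' \<Longrightarrow> rel_option (teq E) (del E a w) (del E a w')"
proof (induction rule: teq.induct)
  case (cons xs ys b)
  then show ?case by (cases "del E a xs"; cases "del E a ys") (auto intro: teq.intros)
next
  case (swap b c xs ys)
  have "b = linv a \<Longrightarrow> indep E a c" "c = linv a \<Longrightarrow> indep E a b" "b \<noteq> c"
    using swap(1) by (auto dest: indep_sym indep_neq)
  then show ?case using swap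
    by (cases "del E a xs"; cases "del E a ys") (auto intro: teq.intros dest: indep_neq)
qed (auto intro: rel_option_teq_trans)

text \<open>Right multiplication by the letter \<open>a\<close>, as a transformation of normal
  forms.\<close>

definition ract :: "'v set set \<Rightarrow> 'v \<times> bool \<Rightarrow> ('v \<times> bool) list \<Rightarrow> ('v \<times> bool) list" where
  "ract E a w = (case del E a w of None \<Rightarrow> a # w | Some w' \<Rightarrow> w')"

lemma ract_teq: "teq E w w' \<Longrightarrow> teq E (ract E a w) (ract E a w')"
  using del_teq[of E w w' a] unfolding ract_def
  by (cases "del E a w"; cases "del E a w'") (auto intro: teq.intros)

fun red :: "'v set set \<Rightarrow> ('v \<times> bool) list \<Rightarrow> bool" where
  "red E [] \<longleftrightarrow> True"
| "red E (a # w) \<longleftrightarrow> red E w \<and> del E a w = None"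

lemma del_None_teq: "teq E w w' \<Longrightarrow> (del E a w = None) = (del E a w' = None)"
  using del_teq[of E w w' a] by (cases "del E a w"; cases "del E a w'") auto

lemma del_indep: "indep E a b \<Longrightarrow> del E a (b # w) = map_option ((#) b) (del E a w)"
  by (auto dest: indep_neq)

lemma red_teq: "teq E w w' \<Longrightarrow> red E w = red E w'"
proof (induction rule: teq.induct)
  case (cons xs ys a)
  then show ?case by (auto simp: del_None_teq)
next
  case (swap a b xs ys)
  then show ?case
    using indep_sym[OF swap(1)] del_None_teq[OF swap(2)] by (auto simp: del_indep simp del: del.simps)
qed auto

lemma del_Some_teq: "del E a w = Some w' \<Longrightarrow> teq E w (linv a # w')"
proof (induction w arbitrary: w')
  case (Cons x xs)
  show ?case
  proof (cases "x = linv a")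
    case False
    with Cons.prems obtain u where u: "indep E a x" "del E a xs = Some u" "w' = x # u"
      by (auto split: if_splits)
    have "teq E (x # xs) (x # linv a # u)" using Cons.IH u by (auto intro: teq.cons)
    moreover have "teq E (x # linv a # u) (linv a # x # u)" by (rule teq.swap) (use indep_sym[OF u(1)] in auto)
    ultimately show ?thesis using u by (auto intro: teq.trans)
  qed (use Cons in auto)
qed auto

lemma red_del: assumes "red E w" "del E a w = Some w'" shows "red E w'" "del E (linv a) w' = None"
  using red_teq[OF del_Some_teq[OF assms(2)]] assms(1) by auto

lemma red_ract: "red E w \<Longrightarrow> red E (ract E a w)"
  by (auto simp: ract_def red_del split: option.split)

text \<open>Reducedness matters when \<open>a\<close> cancels: \<open>linv a\<close> has to be added
  again afterwards, so it must not cancel against the remaining word.\<close>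

lemma ract_inverse: "red E w \<Longrightarrow> teq E (ract E (linv a) (ract E a w)) w"
proof (cases "del E a w")
  case (Some w')
  assume "red E w"
  then show ?thesis using red_del[OF _ Some] del_Some_teq[OF Some] Some by (auto simp: ract_def intro: teq_sym)
qed (auto simp: ract_def)

lemma del_ract_indep:
  assumes "indep E a b" shows "(del E b (ract E a w) = None) = (del E b w = None)"
proof (cases "del E a w")
  case None
  then show ?thesis using del_indep[OF indep_sym[OF assms]] by (simp add: ract_def del: del.simps)
next
  case (Some w')
  have "indep E b (linv a)" using indep_sym[OF assms] by simp
  then show ?thesis using Some del_None_teq[OF del_Some_teq[OF Some], of b] del_indep[of E b "linv a" w']
    by (simp add: ract_def del: del.simps)
qed

lemma ract_commute:
  assumes "indep E a b"
  shows "teq E (ract E a (ract E b w)) (ract E b (ract E a w))"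
proof -
  have ba: "indep E b a" using assms indep_sym by blast
  have N: "(del E b (ract E a w) = None) = (del E b w = None)" "(del E a (ract E b w) = None) = (del E a w = None)"
    using del_ract_indep assms ba by blast+
  show ?thesis
  proof (cases "del E a w"; cases "del E b w")
    assume "del E a w = None" "del E b w = None"
    then show ?thesis using N assms by (simp add: ract_def teq.swap del: del.simps)
  next
    fix w' assume "del E a w = None" "del E b w = Some w'"
    moreover from this have "del E a w' = None" using N by (simp add: ract_def)
    ultimately show ?thesis using N ba by (simp add: ract_def del_indep del: del.simps)
  next
    fix w' assume "del E a w = Some w'" "del E b w = None"
    moreover from this have "del E b w' = None" using N by (simp add: ract_def)
    ultimately show ?thesis using N assms by (simp add: ract_def del_indep del: del.simps)
  next
    \<comment> \<open>Both letters cancel. Shuffling \<open>w\<close> to \<open>linv b # w2\<close>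
      and deleting \<open>a\<close> behind the head shows that both orders of deletion leave the
      same word up to shuffling.\<close>
    fix w1 w2 assume *: "del E a w = Some w1" "del E b w = Some w2"
    then obtain u where u: "del E a w2 = Some u" using N by (auto simp: ract_def)
    have "teq E w (linv b # w2)" using *(2) by (rule del_Some_teq)
    then have "rel_option (teq E) (Some w1) (del E a (linv b # w2))" using del_teq * by metis
    moreover have "del E a (linv b # w2) = Some (linv b # u)"
      using del_indep[of E a "linv b" w2] assms u by (simp del: del.simps)
    ultimately have "teq E w1 (linv b # u)" by simp
    from del_teq[OF this, of b] obtain u' where "del E b w1 = Some u'" "teq E u' u"
      by (cases "del E b w1") auto
    then show ?thesis using * u by (auto simp: ract_def intro: teq_sym)
  qed
qed

text \<open>Whichever of the two inverse letters is met first has to be passed by the other letter,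
  so the two are independent. Geometrically, the edges that descend from a vertex span a
  cube.\<close>

lemma del_two:
  "del E a w = Some w1 \<Longrightarrow> del E b w = Some w2 \<Longrightarrow> a \<noteq> b \<Longrightarrow> indep E a b \<and> del E b w1 \<noteq> None"
proof (induction w arbitrary: w1 w2)
  case (Cons x xs)
  show ?case
  proof (cases "x = linv a \<or> x = linv b")
    case True
    with Cons.prems show ?thesis
      by (auto simp: linv_eq_iff split: if_splits dest: indep_sym indep_neq)
  next
    case False
    with Cons.prems Cons.IH show ?thesis by (fastforce split: if_splits)
  qed
qed auto

section \<open>Normal forms and the defining relations\<close>

definition nf :: "'v set set \<Rightarrow> ('v \<times> bool) list \<Rightarrow> ('v \<times> bool) list" where
  "nf E w = fold (ract E) w []"

lemma nf_Nil [simp]: "nf E [] = []" by (simp add: nf_def)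
lemma nf_snoc [simp]: "nf E (w @ [a]) = ract E a (nf E w)" by (simp add: nf_def)
lemma red_fold: "red E u \<Longrightarrow> red E (fold (ract E) w u)" by (induction w arbitrary: u) (auto simp: red_ract)
lemma red_nf: "red E (nf E w)" by (simp add: nf_def red_fold)
lemma fold_ract_teq: "teq E u u' \<Longrightarrow> teq E (fold (ract E) w u) (fold (ract E) w u')"
  by (induction w arbitrary: u u') (auto simp: ract_teq)
lemma nf_append: "nf E (x @ y) = fold (ract E) y (nf E x)" by (simp add: nf_def)

locale simple_graph =
  fixes V :: "'v set" and E :: "'v set set"
  assumes graph: "finite_simple_graph V E"
begin

lemma finite_V [simp]: "finite V" using graph by (simp add: finite_simple_graph_def)
lemma edge_neq: "{v, w} \<in> E \<Longrightarrow> v \<noteq> w" using graph by (fastforce simp: finite_simple_graph_def doubleton_eq_iff)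
lemma edge_V: "{v, w} \<in> E \<Longrightarrow> v \<in> V \<and> w \<in> V" using graph by (fastforce simp: finite_simple_graph_def doubleton_eq_iff)

abbreviation "Ga \<equiv> raag V E"
abbreviation "letters \<equiv> V \<times> (UNIV :: bool set)"
abbreviation "cls x \<equiv> raag_rel V E `` {x}"

text \<open>Van der Waerden's argument: the letters act on reduced words, and both sides of a
  defining relation act alike up to shuffling, so equivalent words carry the empty word to the same
  normal form.\<close>

lemma nf_rel: "(x, y) \<in> raag_rel V E \<Longrightarrow> teq E (nf E x) (nf E y)"
proof (induction rule: raag_rel.induct)
  case (cancel x y v b)
  have "teq E (ract E (linv (v, b)) (ract E (v, b) (nf E x))) (nf E x)" by (rule ract_inverse[OF red_nf])
  then show ?case by (simp add: nf_append linv_def fold_ract_teq)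
next
  case (commute x y v w)
  then have "indep E (w, True) (v, True)" using edge_neq by (auto simp: indep_def insert_commute)
  from ract_commute[OF this] show ?case by (simp add: nf_append fold_ract_teq)
qed (auto intro: teq_sym teq.trans)

lemma rel_words: "(x, y) \<in> raag_rel V E \<Longrightarrow> x \<in> words V \<and> y \<in> words V"
  by (induction rule: raag_rel.induct) (auto simp: words_def)

lemma equiv_rel: "equiv (words V) (raag_rel V E)"
  by (rule equivI) (auto simp: refl_on_def sym_def trans_def dest: rel_words intro: raag_rel.refl raag_rel.sym raag_rel.trans)

lemma words_append: "x @ y \<in> words V \<longleftrightarrow> x \<in> words V \<and> y \<in> words V" by (auto simp: words_def)

lemma rel_context: "(x, y) \<in> raag_rel V E \<Longrightarrow> u \<in> words V \<Longrightarrow> w \<in> words V \<Longrightarrow> (u @ x @ w, u @ y @ w) \<in> raag_rel V E"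
proof (induction rule: raag_rel.induct)
  case (refl x) then show ?case by (intro raag_rel.refl) (simp add: words_append)
next
  case (cancel x y v b)
  then show ?case using raag_rel.cancel[of "u @ x" V "y @ w" v b E] by (simp add: words_append)
next
  case (commute x y v v')
  then show ?case using raag_rel.commute[of "u @ x" V "y @ w" v v' E] by (simp add: words_append)
qed (auto intro: raag_rel.sym raag_rel.trans)

lemma rel_append: "(x, x') \<in> raag_rel V E \<Longrightarrow> (y, y') \<in> raag_rel V E \<Longrightarrow> (x @ y, x' @ y') \<in> raag_rel V E"
  using rel_context[of x x' "[]" y] rel_context[of y y' x' "[]"] rel_words[of x x'] rel_words[of y y']
  by (auto simp: words_def intro: raag_rel.trans)

lemma cls_eq: "x \<in> words V \<Longrightarrow> y \<in> words V \<Longrightarrow> cls x = cls y \<longleftrightarrow> (x, y) \<in> raag_rel V E"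
  using eq_equiv_class_iff[OF equiv_rel] by blast

lemma carrier_raag: "carrier Ga = cls ` words V" by (auto simp: raag_def quotient_def)
lemma one_raag: "\<one>\<^bsub>Ga\<^esub> = cls []" by (simp add: raag_def)

lemma mult_cls: assumes "x \<in> words V" "y \<in> words V" shows "cls x \<otimes>\<^bsub>Ga\<^esub> cls y = cls (x @ y)"
proof -
  have "cls (x' @ y') = cls (x @ y)" if "x' \<in> cls x" "y' \<in> cls y" for x' y'
    using that rel_append[of x x' y y'] equiv_class_eq[OF equiv_rel, of "x @ y" "x' @ y'"] by auto
  moreover have "x \<in> cls x" "y \<in> cls y" using assms by (auto intro: raag_rel.refl)
  ultimately have "(\<Union>x'\<in>cls x. \<Union>y'\<in>cls y. cls (x' @ y')) = cls (x @ y)" by (intro equalityI) blast+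
  then show ?thesis by (simp add: raag_def)
qed

lemma inv_word: "x \<in> words V \<Longrightarrow> (rev (map linv x) @ x, []) \<in> raag_rel V E \<and> rev (map linv x) \<in> words V"
proof (induction x rule: rev_induct)
  case Nil then show ?case by (auto intro: raag_rel.refl simp: words_def)
next
  case (snoc a x)
  obtain v b where a: "a = (v, b)" by force
  from snoc have x: "x \<in> words V" "v \<in> V" "(rev (map linv x) @ x, []) \<in> raag_rel V E" "rev (map linv x) \<in> words V"
    by (auto simp: words_append a words_def)
  have w: "[linv a] \<in> words V" "[a] \<in> words V" using x a by (auto simp: words_def linv_def)
  have "([linv a] @ (rev (map linv x) @ x) @ [a], [linv a] @ [] @ [a]) \<in> raag_rel V E"
    by (rule rel_context[OF x(3) w])
  then have 1: "(rev (map linv (x @ [a])) @ x @ [a], [linv a, a]) \<in> raag_rel V E" by simp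
  have "([] @ [(v, \<not> b), (v, \<not> \<not> b)] @ [], [] @ []) \<in> raag_rel V E"
    by (rule raag_rel.cancel) (use x in \<open>auto simp: words_def\<close>)
  then have "([linv a, a], []) \<in> raag_rel V E" by (simp add: linv_def a)
  with 1 have "(rev (map linv (x @ [a])) @ x @ [a], []) \<in> raag_rel V E" by (rule raag_rel.trans)
  moreover have "rev (map linv (x @ [a])) \<in> words V" using x(4) w by (simp add: words_def)
  ultimately show ?case by simp
qed

sublocale raag: group Ga
proof (rule groupI)
  fix x assume "x \<in> carrier Ga"
  then obtain u where u: "u \<in> words V" "x = cls u" by (auto simp: carrier_raag)
  show "\<exists>y\<in>carrier Ga. y \<otimes>\<^bsub>Ga\<^esub> x = \<one>\<^bsub>Ga\<^esub>"
  proof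
    have w: "rev (map linv u) \<in> words V" using inv_word u by blast
    show "cls (rev (map linv u)) \<in> carrier Ga" using w by (auto simp: carrier_raag)
    show "cls (rev (map linv u)) \<otimes>\<^bsub>Ga\<^esub> x = \<one>\<^bsub>Ga\<^esub>"
      using inv_word[OF u(1)] u w by (subst u(2), subst mult_cls)
        (auto simp: one_raag words_append cls_eq words_def[of V])
  qed
qed (auto simp: carrier_raag mult_cls one_raag words_append words_def[of V, symmetric],
    auto simp: words_def mult_cls intro!: imageI)

definition gl :: "'v \<times> bool \<Rightarrow> ('v \<times> bool) list set" where "gl a = cls [a]"

lemma gl_closed [simp]: "a \<in> letters \<Longrightarrow> gl a \<in> carrier Ga" by (auto simp: gl_def carrier_raag words_def)
lemma cls_snoc: "x \<in> words V \<Longrightarrow> a \<in> letters \<Longrightarrow> cls (x @ [a]) = cls x \<otimes>\<^bsub>Ga\<^esub> gl a"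
  by (auto simp: gl_def mult_cls words_def)
lemma linv_letters [simp]: "linv a \<in> letters \<longleftrightarrow> a \<in> letters" by (cases a) (auto simp: linv_def)

lemma gl_linv_r [simp]: "a \<in> letters \<Longrightarrow> gl a \<otimes>\<^bsub>Ga\<^esub> gl (linv a) = \<one>\<^bsub>Ga\<^esub>"
proof -
  assume a: "a \<in> letters"
  obtain v b where ab: "a = (v, b)" by force
  have "([] @ [(v, b), (v, \<not> b)] @ [], [] @ []) \<in> raag_rel V E"
    by (rule raag_rel.cancel) (use a ab in \<open>auto simp: words_def\<close>)
  then have "cls [a, linv a] = cls []"
    using cls_eq[of "[a, linv a]" "[]"] a by (auto simp: ab linv_def words_def)
  moreover have "gl a \<otimes>\<^bsub>Ga\<^esub> gl (linv a) = cls ([a] @ [linv a])"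
    unfolding gl_def by (rule mult_cls) (use a ab in \<open>auto simp: words_def linv_def\<close>)
  ultimately show ?thesis by (simp add: one_raag)
qed
lemma gl_linv_l [simp]: "a \<in> letters \<Longrightarrow> gl (linv a) \<otimes>\<^bsub>Ga\<^esub> gl a = \<one>\<^bsub>Ga\<^esub>"
  using gl_linv_r[of "linv a"] by simp
lemma gl_linv: "a \<in> letters \<Longrightarrow> gl (linv a) = inv\<^bsub>Ga\<^esub> (gl a)"
  by (metis gl_closed gl_linv_l linv_letters raag.inv_equality)

text \<open>The relations concern positive letters only. In a group, commuting passes to
  inverses.\<close>

lemma gl_commute:
  assumes "indep E a b" shows "gl a \<otimes>\<^bsub>Ga\<^esub> gl b = gl b \<otimes>\<^bsub>Ga\<^esub> gl a"
proof -
  have e: "{fst a, fst b} \<in> E" using assms by (simp add: indep_def)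
  have m: "a \<in> letters" "b \<in> letters" using edge_V[OF e] by (auto simp: mem_Times_iff)
  let ?p = "gl (fst a, True)" and ?q = "gl (fst b, True)"
  have pq: "?p \<in> carrier Ga" "?q \<in> carrier Ga" using m by auto
  have "([] @ [(fst a, True), (fst b, True)] @ [], [] @ [(fst b, True), (fst a, True)] @ []) \<in> raag_rel V E"
    by (rule raag_rel.commute) (use edge_V[OF e] e in \<open>auto simp: words_def\<close>)
  then have "cls [(fst a, True), (fst b, True)] = cls [(fst b, True), (fst a, True)]"
    using m by (subst cls_eq) (auto simp: words_def)
  then have c: "?p \<otimes>\<^bsub>Ga\<^esub> ?q = ?q \<otimes>\<^bsub>Ga\<^esub> ?p"
  proof -
    have "?p \<otimes>\<^bsub>Ga\<^esub> ?q = cls ([(fst a, True)] @ [(fst b, True)])"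
      unfolding gl_def by (rule mult_cls) (use m in \<open>auto simp: words_def\<close>)
    moreover have "?q \<otimes>\<^bsub>Ga\<^esub> ?p = cls ([(fst b, True)] @ [(fst a, True)])"
      unfolding gl_def by (rule mult_cls) (use m in \<open>auto simp: words_def\<close>)
    ultimately show ?thesis using \<open>cls [(fst a, True), (fst b, True)] = _\<close> by simp
  qed
  have inv_c: "inv\<^bsub>Ga\<^esub> x \<otimes>\<^bsub>Ga\<^esub> y = y \<otimes>\<^bsub>Ga\<^esub> inv\<^bsub>Ga\<^esub> x"
    if "x \<otimes>\<^bsub>Ga\<^esub> y = y \<otimes>\<^bsub>Ga\<^esub> x" "x \<in> carrier Ga" "y \<in> carrier Ga" for x y
    using that raag.inv_solve_left raag.inv_solve_right raag.m_assoc
    by (metis raag.inv_closed raag.m_closed)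
  have a: "gl a = ?p \<or> gl a = inv\<^bsub>Ga\<^esub> ?p" using gl_linv[of "(fst a, True)"] m by (cases a; cases "snd a") (auto simp: linv_def)
  have b: "gl b = ?q \<or> gl b = inv\<^bsub>Ga\<^esub> ?q" using gl_linv[of "(fst b, True)"] m by (cases b; cases "snd b") (auto simp: linv_def)
  from a have "gl a \<otimes>\<^bsub>Ga\<^esub> ?q = ?q \<otimes>\<^bsub>Ga\<^esub> gl a" using c inv_c pq by auto
  then show ?thesis using b inv_c[of ?q "gl a"] pq m by auto
qed

section \<open>Word length and descents\<close>

fun elt :: "('v \<times> bool) list \<Rightarrow> ('v \<times> bool) list set" where
  "elt [] = \<one>\<^bsub>Ga\<^esub>"
| "elt (a # w) = elt w \<otimes>\<^bsub>Ga\<^esub> gl a"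

lemma elt_closed [simp]: "set w \<subseteq> letters \<Longrightarrow> elt w \<in> carrier Ga" by (induction w) auto

lemma teq_set: "teq E w w' \<Longrightarrow> set w = set w'" by (induction rule: teq.induct) auto

lemma elt_teq: "teq E w w' \<Longrightarrow> set w \<subseteq> letters \<Longrightarrow> elt w = elt w'"
proof (induction rule: teq.induct)
  case (swap a b xs ys)
  then have "elt xs = elt ys" "a \<in> letters" "b \<in> letters" "elt ys \<in> carrier Ga"
    using teq_set[of xs ys] by auto
  then show ?case using gl_commute[OF swap(1)] by (simp add: raag.m_assoc)
next
  case (trans xs ys zs)
  then show ?case using teq_set[of xs ys] by simp
qed auto

lemma ract_letters: "set w \<subseteq> letters \<Longrightarrow> a \<in> letters \<Longrightarrow> set (ract E a w) \<subseteq> letters"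
proof (cases "del E a w")
  case (Some w')
  assume "set w \<subseteq> letters"
  then show ?thesis using teq_set[OF del_Some_teq[OF Some]] Some by (auto simp: ract_def)
qed (auto simp: ract_def)

lemma elt_ract: "set w \<subseteq> letters \<Longrightarrow> a \<in> letters \<Longrightarrow> elt (ract E a w) = elt w \<otimes>\<^bsub>Ga\<^esub> gl a"
proof (cases "del E a w")
  case (Some w')
  assume w: "set w \<subseteq> letters" and a: "a \<in> letters"
  have "set w' \<subseteq> letters" using teq_set[OF del_Some_teq[OF Some]] w by auto
  then show ?thesis using elt_teq[OF del_Some_teq[OF Some] w] Some a
    by (simp add: ract_def raag.m_assoc)
qed (auto simp: ract_def)

lemma cls_nf: "x \<in> words V \<Longrightarrow> set (nf E x) \<subseteq> letters \<and> elt (nf E x) = cls x"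
proof (induction x rule: rev_induct)
  case (snoc a x)
  then have x: "x \<in> words V" "a \<in> letters" by (auto simp: words_append words_def)
  with snoc show ?case using ract_letters[of "nf E x" a] by (simp add: elt_ract cls_snoc)
qed (simp add: one_raag)

text \<open>The chosen representative makes this arbitrary within a class of \<open>teq\<close>, but
  the length and the possible deletions do not depend on the choice.\<close>

definition nfg :: "('v \<times> bool) list set \<Rightarrow> ('v \<times> bool) list" where
  "nfg g = nf E (SOME x. x \<in> g)"
definition glen :: "('v \<times> bool) list set \<Rightarrow> nat" where "glen g = length (nfg g)"

lemma nfg_cls: assumes "x \<in> words V" shows "teq E (nfg (cls x)) (nf E x)"
proof -
  have "(SOME y. y \<in> cls x) \<in> cls x" by (rule someI[of _ x]) (use assms in \<open>auto intro: raag_rel.refl\<close>)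
  then show ?thesis unfolding nfg_def by (auto intro: nf_rel raag_rel.sym)
qed

lemma nfg_mult: assumes "g \<in> carrier Ga" "a \<in> letters"
  shows "teq E (nfg (g \<otimes>\<^bsub>Ga\<^esub> gl a)) (ract E a (nfg g))"
proof -
  obtain x where x: "x \<in> words V" "g = cls x" using assms by (auto simp: carrier_raag)
  have w: "x @ [a] \<in> words V" using x assms by (auto simp: words_append words_def)
  have "teq E (nfg (g \<otimes>\<^bsub>Ga\<^esub> gl a)) (nf E (x @ [a]))"
    using nfg_cls[OF w] assms(2) x by (simp del: nf_snoc flip: cls_snoc)
  moreover have "teq E (nf E (x @ [a])) (ract E a (nfg g))"
    using x by (simp add: ract_teq nfg_cls teq_sym)
  ultimately show ?thesis by (rule teq.trans)
qed

lemma elt_nfg: assumes "g \<in> carrier Ga" shows "set (nfg g) \<subseteq> letters" "elt (nfg g) = g"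
proof -
  obtain x where x: "x \<in> words V" "g = cls x" using assms by (auto simp: carrier_raag)
  show "set (nfg g) \<subseteq> letters" using teq_set[OF nfg_cls[OF x(1)]] cls_nf[OF x(1)] x by simp
  then show "elt (nfg g) = g" using elt_teq[OF nfg_cls[OF x(1)]] cls_nf[OF x(1)] x by simp
qed

text \<open>Right multiplication by \<open>a\<close> shortens \<open>g\<close>, see
  \<open>desc_iff\<close>. It is put in terms of deletions because their behaviour towards
  independent letters is known.\<close>

definition desc :: "('v \<times> bool) list set \<Rightarrow> 'v \<times> bool \<Rightarrow> bool" where
  "desc g a \<longleftrightarrow> del E a (nfg g) \<noteq> None"

lemma glen_desc:
  assumes "g \<in> carrier Ga" "a \<in> letters"
  shows "desc g a \<Longrightarrow> Suc (glen (g \<otimes>\<^bsub>Ga\<^esub> gl a)) = glen g"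
    and "\<not> desc g a \<Longrightarrow> glen (g \<otimes>\<^bsub>Ga\<^esub> gl a) = Suc (glen g)"
proof -
  have l: "glen (g \<otimes>\<^bsub>Ga\<^esub> gl a) = length (ract E a (nfg g))"
    using teq_length[OF nfg_mult[OF assms]] by (simp add: glen_def)
  show "desc g a \<Longrightarrow> Suc (glen (g \<otimes>\<^bsub>Ga\<^esub> gl a)) = glen g"
  proof -
    assume "desc g a"
    then obtain w' where w': "del E a (nfg g) = Some w'" by (auto simp: desc_def)
    then show ?thesis using l teq_length[OF del_Some_teq[OF w']] by (simp add: ract_def glen_def)
  qed
  show "\<not> desc g a \<Longrightarrow> glen (g \<otimes>\<^bsub>Ga\<^esub> gl a) = Suc (glen g)"
    using l by (auto simp: desc_def ract_def glen_def)
qed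

lemma desc_iff: "g \<in> carrier Ga \<Longrightarrow> a \<in> letters \<Longrightarrow> desc g a \<longleftrightarrow> glen (g \<otimes>\<^bsub>Ga\<^esub> gl a) < glen g"
  using glen_desc[of g a] by fastforce

lemma desc_linv: "g \<in> carrier Ga \<Longrightarrow> a \<in> letters \<Longrightarrow> desc (g \<otimes>\<^bsub>Ga\<^esub> gl a) (linv a) \<longleftrightarrow> \<not> desc g a"
  using glen_desc[of g a] desc_iff[of "g \<otimes>\<^bsub>Ga\<^esub> gl a" "linv a"]
  by (auto simp: raag.m_assoc)

lemma desc_mult_indep: "g \<in> carrier Ga \<Longrightarrow> indep E a b \<Longrightarrow> a \<in> letters \<Longrightarrow> desc (g \<otimes>\<^bsub>Ga\<^esub> gl a) b \<longleftrightarrow> desc g b"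
  unfolding desc_def using del_None_teq[OF nfg_mult] del_ract_indep by metis

lemma desc_two: "desc g a \<Longrightarrow> desc g b \<Longrightarrow> a \<noteq> b \<Longrightarrow> indep E a b"
  unfolding desc_def using del_two by (metis option.exhaust)

lemma glen_one: "glen \<one>\<^bsub>Ga\<^esub> = 0"
  using teq_length[OF nfg_cls[of "[]"]] by (simp add: glen_def one_raag words_def)

lemma glen_zero: "g \<in> carrier Ga \<Longrightarrow> glen g = 0 \<Longrightarrow> g = \<one>\<^bsub>Ga\<^esub>"
  using elt_nfg(2)[of g] by (simp add: glen_def)

lemma desc_exists: assumes "g \<in> carrier Ga" "g \<noteq> \<one>\<^bsub>Ga\<^esub>" shows "\<exists>a\<in>letters. desc g a"
proof (cases "nfg g")
  case Nil then show ?thesis using assms glen_zero by (simp add: glen_def)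
next
  case (Cons a w)
  then show ?thesis using elt_nfg(1)[OF assms(1)] by (intro bexI[of _ "linv a"]) (auto simp: desc_def)
qed

lemma raag_induct [consumes 1, case_names one mult]:
  assumes "g \<in> carrier Ga" "P \<one>\<^bsub>Ga\<^esub>" "\<And>g a. g \<in> carrier Ga \<Longrightarrow> a \<in> letters \<Longrightarrow> P g \<Longrightarrow> P (g \<otimes>\<^bsub>Ga\<^esub> gl a)"
  shows "P g"
proof -
  have "set w \<subseteq> letters \<Longrightarrow> P (elt w)" for w by (induction w) (auto intro: assms)
  then show ?thesis using elt_nfg[OF assms(1)] by metis
qed

text \<open>The relations hold in the abelian group of reals for any values on the generators. This
  will provide the cohomology classes dual to the generators.\<close>

lemma hom_exists:
  "\<exists>\<phi>. (\<forall>g\<in>carrier Ga. \<forall>h\<in>carrier Ga. \<phi> (g \<otimes>\<^bsub>Ga\<^esub> h) = \<phi> g + \<phi> h) \<and> (\<forall>v\<in>V. \<phi> (gl (v, True)) = (f v :: real))"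
proof -
  define s where "s x = sum_list (map (\<lambda>(v, b). if b then f v else - f v) x)" for x
  have s: "(x, y) \<in> raag_rel V E \<Longrightarrow> s x = s y" for x y
    by (induction rule: raag_rel.induct) (auto simp: s_def)
  define \<phi> where "\<phi> g = s (SOME x. x \<in> g)" for g
  have \<phi>: "\<phi> (cls x) = s x" if "x \<in> words V" for x
  proof -
    have "(SOME y. y \<in> cls x) \<in> cls x" by (rule someI[of _ x]) (use that in \<open>auto intro: raag_rel.refl\<close>)
    then show ?thesis unfolding \<phi>_def by (auto intro: s[symmetric])
  qed
  have "\<phi> (g \<otimes>\<^bsub>Ga\<^esub> h) = \<phi> g + \<phi> h" if gh: "g \<in> carrier Ga" "h \<in> carrier Ga" for g h
  proof -
    obtain x y where "x \<in> words V" "g = cls x" "y \<in> words V" "h = cls y" using gh by (auto simp: carrier_raag)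
    then show ?thesis by (simp add: mult_cls \<phi> words_append s_def)
  qed
  moreover have "\<phi> (gl (v, True)) = f v" if "v \<in> V" for v
    using that \<phi>[of "[(v, True)]"] by (simp add: gl_def words_def s_def)
  ultimately show ?thesis by blast
qed

end

section \<open>The Salvetti complex\<close>

text \<open>The usual sign for removing \<open>v\<close> from a simplex ordered by
  \<open>idx\<close>. The vertex \<open>v\<close> need not lie in \<open>\<tau>\<close>, which
  allows signs to be compared before and after insertion.\<close>

definition sg :: "('v \<Rightarrow> nat) \<Rightarrow> 'v \<Rightarrow> 'v set \<Rightarrow> 'r::comm_ring_1" where
  "sg idx v \<tau> = (- 1) ^ card {w\<in>\<tau>. idx w < idx v}"

lemma sg_sq [simp]: "sg idx v \<tau> * sg idx v \<tau> = 1"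
  by (simp add: sg_def flip: power_mult_distrib)

lemma sg_remove_less: "finite \<tau> \<Longrightarrow> w \<in> \<tau> \<Longrightarrow> idx w < idx v \<Longrightarrow> sg idx v (\<tau> - {w}) = (- sg idx v \<tau> :: 'r::comm_ring_1)"
proof -
  assume a: "finite \<tau>" "w \<in> \<tau>" "idx w < idx v"
  have "{u\<in>\<tau>. idx u < idx v} = insert w {u\<in>\<tau> - {w}. idx u < idx v}" using a by auto
  then show ?thesis using a by (simp add: sg_def)
qed

lemma sg_remove_ge: "\<not> idx w < idx v \<Longrightarrow> sg idx v (\<tau> - {w}) = (sg idx v \<tau> :: 'r::comm_ring_1)"
  unfolding sg_def by (rule arg_cong[where f = "\<lambda>A. (- 1) ^ card A"]) auto

lemma sg_insert_ge: "\<not> idx w < idx v \<Longrightarrow> sg idx v (insert w \<tau>) = (sg idx v \<tau> :: 'r::comm_ring_1)"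
  unfolding sg_def by (rule arg_cong[where f = "\<lambda>A. (- 1) ^ card A"]) auto

lemma sg_swap:
  assumes "finite \<tau>" "v \<in> \<tau>" "w \<in> \<tau>" "idx v \<noteq> idx w"
  shows "sg idx v \<tau> * sg idx w (\<tau> - {v}) = - (sg idx w \<tau> * sg idx v (\<tau> - {w}) :: 'r::comm_ring_1)"
proof (cases "idx v < idx w")
  case True
  then show ?thesis using assms sg_remove_less[of \<tau> v idx w, where 'r = 'r] sg_remove_ge[of idx w v \<tau>, where 'r = 'r] by simp
next
  case False
  then show ?thesis using assms sg_remove_less[of \<tau> w idx v, where 'r = 'r] sg_remove_ge[of idx v w \<tau>, where 'r = 'r] by simp
qed

text \<open>This is the cancellation behind a double boundary. The induction pairs each term with
  its mirror image; concluding from S = - S would not do, since 2 may be a zero divisor in the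
  coefficients.\<close>

lemma antisym_sum:
  fixes F :: "'v \<Rightarrow> 'v \<Rightarrow> 'a::ab_group_add"
  assumes "finite \<tau>" "\<And>v w. v \<in> \<tau> \<Longrightarrow> w \<in> \<tau> \<Longrightarrow> v \<noteq> w \<Longrightarrow> F v w = - F w v"
  shows "(\<Sum>v\<in>\<tau>. \<Sum>w\<in>\<tau> - {v}. F v w) = 0"
  using assms
proof (induction \<tau> rule: finite_induct)
  case (insert x \<tau>)
  have 1: "insert x \<tau> - {v} = insert x (\<tau> - {v})" if "v \<in> \<tau>" for v using insert.hyps that by auto
  have "(\<Sum>v\<in>insert x \<tau>. \<Sum>w\<in>insert x \<tau> - {v}. F v w) =
      (\<Sum>w\<in>\<tau>. F x w) + (\<Sum>v\<in>\<tau>. F v x + (\<Sum>w\<in>\<tau> - {v}. F v w))"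
  proof -
    have "(\<Sum>v\<in>\<tau>. \<Sum>w\<in>insert x \<tau> - {v}. F v w) = (\<Sum>v\<in>\<tau>. F v x + (\<Sum>w\<in>\<tau> - {v}. F v w))"
      by (rule sum.cong[OF HOL.refl]) (use insert.hyps in \<open>simp add: 1\<close>)
    moreover have "insert x \<tau> - {x} = \<tau>" using insert.hyps by auto
    ultimately show ?thesis using insert.hyps by simp
  qed
  also have "\<dots> = (\<Sum>w\<in>\<tau>. F x w + F w x) + (\<Sum>v\<in>\<tau>. \<Sum>w\<in>\<tau> - {v}. F v w)"
    by (simp add: sum.distrib algebra_simps)
  also have "(\<Sum>w\<in>\<tau>. F x w + F w x) = 0"
  proof (rule sum.neutral, rule ballI)
    fix w assume "w \<in> \<tau>"
    then have "x \<noteq> w" using insert.hyps by auto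
    then show "F x w + F w x = 0" using insert.prems[of x w] \<open>w \<in> \<tau>\<close> by simp
  qed
  finally have "(\<Sum>v\<in>insert x \<tau>. \<Sum>w\<in>insert x \<tau> - {v}. F v w) = (\<Sum>v\<in>\<tau>. \<Sum>w\<in>\<tau> - {v}. F v w)" by simp
  also have "\<dots> = 0" by (rule insert.IH) (rule insert.prems, auto)
  finally show ?case .
qed simp

text \<open>\<open>idx\<close> orders the vertices to fix signs. \<beta> chooses for each vertex the
  generator or its inverse as positive direction; later this choice makes \<chi>
  nonnegative.\<close>

locale raag_complex = simple_graph V E for V :: "'v set" and E +
  fixes idx :: "'v \<Rightarrow> nat" and \<beta> :: "'v \<Rightarrow> bool"
  assumes inj_idx: "inj_on idx V"
begin

abbreviation "\<Delta> \<equiv> flag_complex V E"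
text \<open>Counted by vertices, since a simplex with n vertices spans an n-cube; the empty simplex
  belongs to degree 0.\<close>

definition "simp n = {\<tau> \<in> \<Delta>. card \<tau> = n}"

lemma flag_V: "\<tau> \<in> \<Delta> \<Longrightarrow> \<tau> \<subseteq> V" by (auto simp: flag_complex_def)
lemma flag_mem_V: "\<tau> \<in> \<Delta> \<Longrightarrow> v \<in> \<tau> \<Longrightarrow> v \<in> V" by (auto simp: flag_complex_def)
lemma flag_subset: "\<tau> \<in> \<Delta> \<Longrightarrow> \<rho> \<subseteq> \<tau> \<Longrightarrow> \<rho> \<in> \<Delta>" by (fastforce simp: flag_complex_def)
lemma flag_finite: "\<tau> \<in> \<Delta> \<Longrightarrow> finite \<tau>" using flag_V finite_V finite_subset by metis
lemma flag_edge: "\<tau> \<in> \<Delta> \<Longrightarrow> v \<in> \<tau> \<Longrightarrow> w \<in> \<tau> \<Longrightarrow> v \<noteq> w \<Longrightarrow> {v, w} \<in> E" by (auto simp: flag_complex_def)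
lemma flag_empty [simp]: "{} \<in> \<Delta>" by (auto simp: flag_complex_def)
lemma finite_flag [simp]: "finite \<Delta>" by (rule finite_subset[of _ "Pow V"]) (auto simp: flag_complex_def)
lemma idx_neq: "v \<in> V \<Longrightarrow> w \<in> V \<Longrightarrow> v \<noteq> w \<Longrightarrow> idx v \<noteq> idx w" using inj_idx by (auto dest: inj_onD)

lemma sg_swap': "\<tau> \<in> \<Delta> \<Longrightarrow> v \<in> \<tau> \<Longrightarrow> w \<in> \<tau> \<Longrightarrow> v \<noteq> w \<Longrightarrow>
    sg idx v \<tau> * sg idx w (\<tau> - {v}) = - (sg idx w \<tau> * sg idx v (\<tau> - {w}) :: 'r::comm_ring_1)"
  using flag_V[of \<tau>] idx_neq[of v w] flag_finite by (intro sg_swap) auto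

definition "let1 v = (v, \<beta> v)"
definition "gam v = gl (let1 v)"

lemma let1_letters [simp]: "v \<in> V \<Longrightarrow> let1 v \<in> letters" by (simp add: let1_def)
lemma gam_closed [simp]: "v \<in> V \<Longrightarrow> gam v \<in> carrier Ga" by (simp add: gam_def)
lemma indep_let1: "\<tau> \<in> \<Delta> \<Longrightarrow> v \<in> \<tau> \<Longrightarrow> fst a \<in> \<tau> \<Longrightarrow> v \<noteq> fst a \<Longrightarrow> indep E (let1 v) a"
  using flag_edge by (auto simp: indep_def let1_def)
lemma gam_commute: "\<tau> \<in> \<Delta> \<Longrightarrow> v \<in> \<tau> \<Longrightarrow> w \<in> \<tau> \<Longrightarrow> gam v \<otimes>\<^bsub>Ga\<^esub> gam w = gam w \<otimes>\<^bsub>Ga\<^esub> gam v"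
  using gl_commute[OF indep_let1[of \<tau> v "let1 w"]] by (cases "v = w") (auto simp: gam_def let1_def)

text \<open>For the sake of the proof that finiteness implies exactness, the boundary is introduced for an
  arbitrary monoid containing commuting elements for adjacent vertices.\<close>

definition cbd :: "('g, 'z) monoid_scheme \<Rightarrow> ('v \<Rightarrow> 'g) \<Rightarrow> 'v set \<Rightarrow> ('g \<times> 'v set \<Rightarrow>\<^sub>0 'r::comm_ring_1)" where
  "cbd M \<gamma> \<tau> = (\<Sum>v\<in>\<tau>. scale (sg idx v \<tau>)
     (Poly_Mapping.single (\<gamma> v, \<tau> - {v}) 1 - Poly_Mapping.single (\<one>\<^bsub>M\<^esub>, \<tau> - {v}) 1))"

lemma card_remove: "\<tau> \<in> \<Delta> \<Longrightarrow> v \<in> \<tau> \<Longrightarrow> card \<tau> = Suc n \<Longrightarrow> card (\<tau> - {v}) = n"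
  using flag_finite by simp

lemma free_cbd:
  fixes M :: "('g, 'z) monoid_scheme"
  assumes M: "Group.monoid M" and \<gamma>: "\<And>v. v \<in> V \<Longrightarrow> \<gamma> v \<in> carrier M"
    and comm: "\<And>\<tau> v w. \<tau> \<in> \<Delta> \<Longrightarrow> v \<in> \<tau> \<Longrightarrow> w \<in> \<tau> \<Longrightarrow> \<gamma> v \<otimes>\<^bsub>M\<^esub> \<gamma> w = \<gamma> w \<otimes>\<^bsub>M\<^esub> \<gamma> v"
  shows "free_complex M simp (\<lambda>_. cbd M \<gamma>) (\<lambda>_. 1 :: 'r::comm_ring_1)"
proof -
  interpret M: Group.monoid M by fact
  show ?thesis
  proof
    fix n and \<tau>
    show "(cbd M \<gamma> \<tau> :: _ \<Rightarrow>\<^sub>0 'r) \<in> chains M (simp n)" if "\<tau> \<in> simp (Suc n)"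
      unfolding cbd_def using that flag_mem_V flag_subset card_remove \<gamma>
      by (intro supported_sum supported_scale supported_diff supported_single) (auto simp: simp_def)
    show "aug (\<lambda>_. 1) (cbd M \<gamma> \<tau>) = (0::'r)" by (simp add: cbd_def aug_sum aug_scale aug_diff)
    assume "\<tau> \<in> simp (Suc (Suc n))"
    then have \<tau>: "\<tau> \<in> \<Delta>" by (simp add: simp_def)
    let ?S = "\<lambda>g \<rho>. Poly_Mapping.single (g, \<rho>) (1::'r)"
    \<comment> \<open>Up to sign, the coefficient of the face without \<open>v\<close> and
      \<open>w\<close> is (\<gamma> v - 1)(\<gamma> w - 1), expanded. It is symmetric because
      \<gamma> v and \<gamma> w commute, while the sign is antisymmetric.\<close>
    define F where "F v w = scale (sg idx v \<tau> * sg idx w (\<tau> - {v})) (?S (\<gamma> v \<otimes>\<^bsub>M\<^esub> \<gamma> w) (\<tau> - {v} - {w})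
        - ?S (\<gamma> v) (\<tau> - {v} - {w}) - (?S (\<gamma> w) (\<tau> - {v} - {w}) - ?S \<one>\<^bsub>M\<^esub> (\<tau> - {v} - {w})))" for v w
    have "ext M (cbd M \<gamma>) (cbd M \<gamma> \<tau>) = (\<Sum>v\<in>\<tau>. \<Sum>w\<in>\<tau> - {v}. F v w)"
      unfolding cbd_def[of M \<gamma> \<tau>] ext_sum
    proof (rule sum.cong)
      fix v assume v: "v \<in> \<tau>"
      have V: "u \<in> \<tau> \<Longrightarrow> \<gamma> u \<in> carrier M" for u using flag_mem_V[OF \<tau>] \<gamma> by blast
      show "ext M (cbd M \<gamma>) (scale (sg idx v \<tau>) (?S (\<gamma> v) (\<tau> - {v}) - ?S \<one>\<^bsub>M\<^esub> (\<tau> - {v}))) = (\<Sum>w\<in>\<tau> - {v}. F v w)"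
        unfolding ext_scale ext_diff ext_single cbd_def act_sum F_def
        by (simp add: act_scale act_diff V v scale_diff scale_sum sum_subtractf flip: sum_subtractf)
    qed simp
    also have "\<dots> = 0"
    proof (rule antisym_sum[OF flag_finite[OF \<tau>]])
      fix v w assume vw: "v \<in> \<tau>" "w \<in> \<tau>" "v \<noteq> w"
      have *: "\<tau> - {v} - {w} = \<tau> - {w} - {v}" by auto
      show "F v w = - F w v"
        unfolding F_def sg_swap'[OF \<tau> vw] * comm[OF \<tau> vw(1,2)] scale_neg
        by (simp add: scale_diff algebra_simps)
    qed
    finally show "ext M (cbd M \<gamma>) (cbd M \<gamma> \<tau>) = (0 :: _ \<Rightarrow>\<^sub>0 'r)" .
  qed
qed

abbreviation bd :: "'v set \<Rightarrow> (('v \<times> bool) list set \<times> 'v set \<Rightarrow>\<^sub>0 'r::comm_ring_1)" where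
  "bd \<equiv> cbd Ga gam"

lemmas bd_def = cbd_def[of Ga gam]

lemma free_bd: "free_complex Ga simp (\<lambda>_. bd) (\<lambda>_. 1 :: 'r::comm_ring_1)"
  by (rule free_cbd[OF raag.monoid_axioms gam_closed gam_commute])

lemma bd_closed: "\<tau> \<in> simp (Suc n) \<Longrightarrow> bd \<tau> \<in> chains Ga (simp n)"
  by (rule free_complex.D_closed[OF free_bd])

lemma ext_bd_bd: "\<tau> \<in> \<Delta> \<Longrightarrow> ext Ga bd (bd \<tau>) = (0 :: _ \<Rightarrow>\<^sub>0 'r::comm_ring_1)"
proof (cases "card \<tau>")
  case 0
  then show "\<tau> \<in> \<Delta> \<Longrightarrow> ext Ga bd (bd \<tau>) = (0 :: _ \<Rightarrow>\<^sub>0 'r)" using flag_finite[of \<tau>] by (simp add: cbd_def)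
next
  case (Suc m)
  assume \<tau>: "\<tau> \<in> \<Delta>"
  show "ext Ga bd (bd \<tau>) = (0 :: _ \<Rightarrow>\<^sub>0 'r)"
  proof (cases m)
    case 0
    then obtain v where "\<tau> = {v}" using Suc by (metis One_nat_def card_1_singletonE)
    then show ?thesis by (simp add: cbd_def ext_scale ext_diff ext_single)
  next
    case (Suc k)
    then show ?thesis using free_complex.D_D[OF free_bd, of \<tau> k] \<tau> \<open>card \<tau> = Suc m\<close> by (simp add: simp_def)
  qed
qed

subsection \<open>Top vertices of cubes\<close>

text \<open>Off the carrier nothing is done, so that steps commute as functions on the whole type,
  as folding over a set requires. Thus \<open>gp g P\<close> is the vertex reached from
  \<open>g\<close> along the directions in \<open>P\<close>.\<close>

definition gstep :: "'v \<Rightarrow> ('v \<times> bool) list set \<Rightarrow> ('v \<times> bool) list set" where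
  "gstep v h = (if h \<in> carrier Ga then h \<otimes>\<^bsub>Ga\<^esub> gam v else h)"
definition "gp g P = Finite_Set.fold gstep g P"

lemma gstep_commute: "\<tau> \<in> \<Delta> \<Longrightarrow> comp_fun_commute_on \<tau> gstep"
proof
  fix v w assume "\<tau> \<in> \<Delta>" "v \<in> \<tau>" "w \<in> \<tau>"
  then show "gstep w \<circ> gstep v = gstep v \<circ> gstep w"
    using flag_mem_V gam_commute[of \<tau> v w] by (simp add: gstep_def fun_eq_iff raag.m_assoc)
qed

lemma gp_empty [simp]: "gp g {} = g" by (simp add: gp_def)

lemma gp_insert: "insert v P \<in> \<Delta> \<Longrightarrow> v \<notin> P \<Longrightarrow> gp g (insert v P) = gstep v (gp g P)"
  unfolding gp_def using comp_fun_commute_on.fold_insert[OF gstep_commute, of "insert v P" v P] flag_finite[of "insert v P"]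
  by simp
lemma gp_insert2: "insert v P \<in> \<Delta> \<Longrightarrow> v \<notin> P \<Longrightarrow> gp g (insert v P) = gp (gstep v g) P"
  unfolding gp_def using comp_fun_commute_on.fold_insert2[OF gstep_commute, of "insert v P" v P] flag_finite[of "insert v P"]
  by simp

lemma gp_closed: "P \<in> \<Delta> \<Longrightarrow> g \<in> carrier Ga \<Longrightarrow> gp g P \<in> carrier Ga"
proof (induction "card P" arbitrary: P g)
  case 0 then show ?case using flag_finite by auto
next
  case (Suc n)
  then obtain v Q where "P = insert v Q" "v \<notin> Q" by (metis card_Suc_eq)
  then show ?case using Suc flag_finite[of P] flag_subset[of P Q] flag_V[of P]
    by (auto simp: gp_insert gstep_def)
qed

lemma gp_snoc: "insert v P \<in> \<Delta> \<Longrightarrow> v \<notin> P \<Longrightarrow> g \<in> carrier Ga \<Longrightarrow> gp g (insert v P) = gp g P \<otimes>\<^bsub>Ga\<^esub> gam v"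
  using gp_closed[of P g] flag_subset[of "insert v P" P] by (auto simp: gp_insert gstep_def)
lemma gp_cons: "insert v P \<in> \<Delta> \<Longrightarrow> v \<notin> P \<Longrightarrow> g \<in> carrier Ga \<Longrightarrow> gp g (insert v P) = gp (g \<otimes>\<^bsub>Ga\<^esub> gam v) P"
  by (auto simp: gp_insert2 gstep_def)

lemma desc_gp: "insert (fst a) P \<in> \<Delta> \<Longrightarrow> fst a \<notin> P \<Longrightarrow> g \<in> carrier Ga \<Longrightarrow> desc (gp g P) a = desc g a"
proof (induction "card P" arbitrary: P g)
  case 0 then show ?case using flag_finite[of "insert (fst a) P"] by simp
next
  case (Suc n)
  then obtain v Q where Q: "P = insert v Q" "v \<notin> Q" by (metis card_Suc_eq)
  have s: "Q \<in> \<Delta>" "insert v Q \<in> \<Delta>" "insert (fst a) Q \<in> \<Delta>" "v \<in> V" "finite Q"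
    using Suc.prems Q flag_subset[of "insert (fst a) P"] flag_V[of "insert (fst a) P"]
      flag_finite[of "insert (fst a) P"] by auto
  have "indep E (let1 v) a" using Suc.prems Q by (intro indep_let1[OF Suc.prems(1)]) auto
  then have "desc (gp g P) a = desc (gp g Q) a"
    using s Q Suc.prems by (simp add: gp_snoc gam_def desc_mult_indep gp_closed)
  also have "\<dots> = desc g a" using Suc Q s by auto
  finally show ?case .
qed

text \<open>The cube at \<open>g\<close> has the vertices \<open>gp g P\<close> for \<open>P\<close>
  contained in \<tau>. Exactly the directions of \<open>posv\<close> lead to longer elements, so
  \<open>vtop\<close> is the longest vertex of the cube.\<close>

definition "posv g \<tau> = {v\<in>\<tau>. \<not> desc g (let1 v)}"
definition "vtop g \<tau> = gp g (posv g \<tau>)"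

lemma posv_flag: "\<tau> \<in> \<Delta> \<Longrightarrow> posv g \<tau> \<in> \<Delta>" using flag_subset by (auto simp: posv_def)
lemma top_closed: "\<tau> \<in> \<Delta> \<Longrightarrow> g \<in> carrier Ga \<Longrightarrow> vtop g \<tau> \<in> carrier Ga" by (simp add: vtop_def gp_closed posv_flag)

lemma desc_gam: "\<tau> \<in> \<Delta> \<Longrightarrow> v \<in> \<tau> \<Longrightarrow> w \<in> \<tau> \<Longrightarrow> v \<noteq> w \<Longrightarrow> g \<in> carrier Ga \<Longrightarrow>
    desc (g \<otimes>\<^bsub>Ga\<^esub> gam v) (let1 w) = desc g (let1 w)"
  unfolding gam_def using flag_V by (intro desc_mult_indep indep_let1) (auto simp: let1_def)

text \<open>The letter by which the cube at \<^term>\<open>g\<close> descends in direction \<^term>\<open>v\<close> from its top vertex.\<close>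

definition "dlet g v = (if desc g (let1 v) then let1 v else linv (let1 v))"

lemma posv_remove_neg: "\<tau> \<in> \<Delta> \<Longrightarrow> v \<in> \<tau> \<Longrightarrow> desc g (let1 v) \<Longrightarrow> posv g (\<tau> - {v}) = posv g \<tau>"
  by (auto simp: posv_def)
lemma posv_gam: "\<tau> \<in> \<Delta> \<Longrightarrow> v \<in> \<tau> \<Longrightarrow> g \<in> carrier Ga \<Longrightarrow> posv (g \<otimes>\<^bsub>Ga\<^esub> gam v) (\<tau> - {v}) = posv g \<tau> - {v}"
  using desc_gam by (auto simp: posv_def)

lemma desc_top: assumes "\<tau> \<in> \<Delta>" "g \<in> carrier Ga" "v \<in> \<tau>" shows "desc (vtop g \<tau>) (dlet g v)"
proof (cases "desc g (let1 v)")
  case True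
  then have "insert (fst (let1 v)) (posv g \<tau>) \<in> \<Delta>" "fst (let1 v) \<notin> posv g \<tau>"
    using assms flag_subset[of \<tau> "insert v (posv g \<tau>)"] by (auto simp: posv_def let1_def)
  then show ?thesis using True assms by (simp add: vtop_def dlet_def desc_gp)
next
  case False
  define Q where "Q = posv g \<tau> - {v}"
  have Q: "posv g \<tau> = insert v Q" "v \<notin> Q" using False assms by (auto simp: Q_def posv_def)
  have s: "insert v Q \<in> \<Delta>" "Q \<in> \<Delta>" using posv_flag[OF assms(1), of g] Q flag_subset[of "insert v Q" Q] by auto
  have V: "v \<in> V" using assms flag_V by auto
  have "vtop g \<tau> = gp g Q \<otimes>\<^bsub>Ga\<^esub> gl (let1 v)" using Q s assms by (simp add: vtop_def gp_snoc gam_def)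
  moreover have "desc (gp g Q) (let1 v) = desc g (let1 v)"
    using desc_gp[of "let1 v" Q g] s Q assms by (simp add: let1_def)
  ultimately show ?thesis using False desc_linv[of "gp g Q" "let1 v"] V s assms by (simp add: dlet_def gp_closed)
qed

text \<open>In direction \<^term>\<open>v\<close> exactly one of the two faces contains the top vertex.\<close>

definition "topface v c = (if desc (fst c) (let1 v) then fst c else fst c \<otimes>\<^bsub>Ga\<^esub> gam v, snd c - {v})"
definition "lowface v c = (if desc (fst c) (let1 v) then fst c \<otimes>\<^bsub>Ga\<^esub> gam v else fst c, snd c - {v})"
text \<open>The sign of the top face in gam v - 1; the low face has the opposite sign.\<close>

definition eta :: "'v \<Rightarrow> ('v \<times> bool) list set \<times> 'v set \<Rightarrow> 'r::comm_ring_1" where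
  "eta v c = (if desc (fst c) (let1 v) then - 1 else 1)"
abbreviation "topc c \<equiv> vtop (fst c) (snd c)"

lemma eta_sq [simp]: "eta v c * eta v c = 1" by (simp add: eta_def)

lemma top_topface:
  assumes "\<tau> \<in> \<Delta>" "g \<in> carrier Ga" "v \<in> \<tau>" shows "topc (topface v (g, \<tau>)) = vtop g \<tau>"
proof (cases "desc g (let1 v)")
  case True
  then show ?thesis using assms by (simp add: topface_def vtop_def posv_remove_neg)
next
  case False
  define Q where "Q = posv g \<tau> - {v}"
  have Q: "posv g \<tau> = insert v Q" "v \<notin> Q" using False assms by (auto simp: Q_def posv_def)
  then show ?thesis using False assms posv_flag[OF assms(1), of g] posv_gam[OF assms(1,3,2)]
    by (simp add: topface_def vtop_def gp_cons)
qed

text \<open>The longest vertex of this face is the neighbour of \<open>vtop g \<tau>\<close> down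
  the edge in direction \<open>v\<close>. So the boundary respects the filtration by top length, and
  \<open>bdtop\<close> is the boundary of the graded pieces.\<close>

lemma glen_lowface:
  assumes "\<tau> \<in> \<Delta>" "g \<in> carrier Ga" "v \<in> \<tau>" shows "Suc (glen (topc (lowface v (g, \<tau>)))) = glen (vtop g \<tau>)"
proof (cases "desc g (let1 v)")
  case True
  have V: "v \<in> V" using assms flag_V by auto
  have "insert v (posv g \<tau>) \<in> \<Delta>" "v \<notin> posv g \<tau>"
    using True assms flag_subset[of \<tau> "insert v (posv g \<tau>)"] by (auto simp: posv_def)
  moreover have "posv g \<tau> - {v} = posv g \<tau>" using True by (auto simp: posv_def)
  ultimately have "topc (lowface v (g, \<tau>)) = vtop g \<tau> \<otimes>\<^bsub>Ga\<^esub> gl (let1 v)"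
    using True assms posv_gam[OF assms(1,3,2)] gp_cons[of v "posv g \<tau>" g] gp_snoc[of v "posv g \<tau>" g]
    by (simp add: lowface_def vtop_def gam_def)
  moreover have "desc (vtop g \<tau>) (let1 v)" using desc_top[OF assms] True by (simp add: dlet_def)
  ultimately show ?thesis using glen_desc(1)[OF top_closed[OF assms(1,2)] let1_letters[OF V]] by simp
next
  case False
  define Q where "Q = posv g \<tau> - {v}"
  have Q: "posv g \<tau> = insert v Q" "v \<notin> Q" using False assms by (auto simp: Q_def posv_def)
  have s: "insert v Q \<in> \<Delta>" "Q \<in> \<Delta>" using posv_flag[OF assms(1), of g] Q flag_subset[of "insert v Q" Q] by auto
  have V: "v \<in> V" using assms flag_V by auto
  have "posv g (\<tau> - {v}) = Q" using Q by (auto simp: posv_def)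
  then have l: "topc (lowface v (g, \<tau>)) = gp g Q" using False by (simp add: lowface_def vtop_def)
  have "vtop g \<tau> = gp g Q \<otimes>\<^bsub>Ga\<^esub> gl (let1 v)" using Q s assms by (simp add: vtop_def gp_snoc gam_def)
  moreover have "\<not> desc (gp g Q) (let1 v)"
    using desc_gp[of "let1 v" Q g] s Q assms False by (simp add: let1_def)
  ultimately show ?thesis using l glen_desc(2)[OF gp_closed[OF s(2) assms(2)] let1_letters[OF V]] by simp
qed

abbreviation "cell \<equiv> (\<lambda>c. fst c \<in> carrier Ga \<and> snd c \<in> \<Delta>)"

lemma topface_cell: "cell c \<Longrightarrow> v \<in> snd c \<Longrightarrow> cell (topface v c)"
  using flag_mem_V flag_subset by (auto simp: topface_def)
lemma lowface_cell: "cell c \<Longrightarrow> v \<in> snd c \<Longrightarrow> cell (lowface v c)"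
  using flag_mem_V flag_subset by (auto simp: lowface_def)

definition bdtop :: "('v \<times> bool) list set \<times> 'v set \<Rightarrow> (('v \<times> bool) list set \<times> 'v set \<Rightarrow>\<^sub>0 'r::comm_ring_1)" where
  "bdtop c = (\<Sum>v\<in>snd c. Poly_Mapping.single (topface v c) (sg idx v (snd c) * eta v c))"
definition bdlow :: "('v \<times> bool) list set \<times> 'v set \<Rightarrow> (('v \<times> bool) list set \<times> 'v set \<Rightarrow>\<^sub>0 'r::comm_ring_1)" where
  "bdlow c = (\<Sum>v\<in>snd c. Poly_Mapping.single (lowface v c) (- (sg idx v (snd c) * eta v c)))"

lemma bd_split:
  assumes "cell c"
  shows "act Ga (fst c) (bd (snd c)) = bdtop c + (bdlow c :: _ \<Rightarrow>\<^sub>0 'r::comm_ring_1)"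
  unfolding bd_def bdtop_def bdlow_def sum.distrib[symmetric] act_sum
proof (rule sum.cong)
  fix v assume "v \<in> snd c"
  then have "gam v \<in> carrier Ga" using assms flag_mem_V by auto
  then show "act Ga (fst c) (scale (sg idx v (snd c)) (Poly_Mapping.single (gam v, snd c - {v}) 1 -
      Poly_Mapping.single (\<one>\<^bsub>Ga\<^esub>, snd c - {v}) 1)) =
      Poly_Mapping.single (topface v c) (sg idx v (snd c) * eta v c) +
      Poly_Mapping.single (lowface v c) (- (sg idx v (snd c) * eta v c :: 'r))"
    using assms by (simp add: act_scale act_diff scale_diff topface_def lowface_def eta_def single_uminus)
qed simp

subsection \<open>Exactness\<close>

text \<open>Above a top vertex other than the identity, all cubes can be enlarged in one fixed direction;
  this contracts the cubes with the same top vertex.\<close>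

definition "mlet t = (SOME a. a \<in> letters \<and> desc t a)"
text \<open>The base point stays if the descending letter is the chosen generator, and moves to the
  far end of the new edge otherwise. In both cases the old cube becomes the top face of the new one
  in the direction \<open>m\<close>.\<close>

definition "enlarge c = (let a = mlet (topc c); m = fst a in
   (if a = let1 m then fst c else fst c \<otimes>\<^bsub>Ga\<^esub> gl a, insert m (snd c)))"
definition cone :: "('v \<times> bool) list set \<times> 'v set \<Rightarrow> (('v \<times> bool) list set \<times> 'v set \<Rightarrow>\<^sub>0 'r::comm_ring_1)" where
  "cone c = (let m = fst (mlet (topc c)) in if m \<in> snd c then 0
     else Poly_Mapping.single (enlarge c) (sg idx m (insert m (snd c)) * eta m (enlarge c)))"

lemma mlet: assumes "t \<in> carrier Ga" "t \<noteq> \<one>\<^bsub>Ga\<^esub>" shows "mlet t \<in> letters" "desc t (mlet t)"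
proof -
  have "\<exists>a. a \<in> letters \<and> desc t a" using desc_exists[OF assms] by auto
  from someI_ex[OF this] show "mlet t \<in> letters" "desc t (mlet t)" by (auto simp: mlet_def)
qed

lemma let1_cases: "a = let1 (fst a) \<or> a = linv (let1 (fst a))"
  by (rule same_fst_letter) (simp add: let1_def)

context
  fixes g \<tau> a m
  assumes c: "g \<in> carrier Ga" "\<tau> \<in> \<Delta>" and t1: "vtop g \<tau> \<noteq> \<one>\<^bsub>Ga\<^esub>"
    and a: "a = mlet (vtop g \<tau>)" and m: "m = fst a"
begin

lemma a_letter: "a \<in> letters" "desc (vtop g \<tau>) a" "m \<in> V"
  using mlet[OF top_closed[OF c(2,1)] t1] a m by (auto simp: mem_Times_iff)

text \<open>Otherwise the top vertex would descend along both letters over the same vertex, and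
  \<open>desc_two\<close> would make them independent.\<close>

lemma mem_m: assumes "m \<in> \<tau>" shows "a = dlet g m"
proof (rule ccontr)
  assume "a \<noteq> dlet g m"
  then have "indep E a (dlet g m)" using desc_top[OF c(2,1) assms] a_letter desc_two by blast
  then show False by (auto simp: m indep_def dlet_def let1_def split: if_splits)
qed

text \<open>All letters by which the top vertex descends are pairwise independent, so their vertices
  are pairwise adjacent. Since \<Delta> is a flag complex, they form a simplex.\<close>

lemma insert_m: assumes "m \<notin> \<tau>" shows "insert m \<tau> \<in> \<Delta>"
proof -
  have "{m, v} \<in> E" if "v \<in> \<tau>" for v
  proof -
    have "a \<noteq> dlet g v" using that assms m by (auto simp: dlet_def let1_def)
    then have "indep E a (dlet g v)" using desc_top[OF c(2,1) that] a_letter desc_two by blast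
    then show ?thesis by (auto simp: indep_def m dlet_def let1_def split: if_splits)
  qed
  then show ?thesis using c(2) a_letter by (auto simp: flag_complex_def insert_commute)
qed

lemma desc_m: assumes "m \<notin> \<tau>" shows "desc g a"
  using desc_gp[of a "posv g \<tau>" g] insert_m[OF assms] c a_letter flag_subset[of "insert m \<tau>" "insert m (posv g \<tau>)"] assms
  by (auto simp: m vtop_def posv_def)

lemma enlarge_eq: "enlarge (g, \<tau>) = (if a = let1 m then g else g \<otimes>\<^bsub>Ga\<^esub> gl a, insert m \<tau>)"
  by (simp add: enlarge_def Let_def a m)

lemma enlarge_cell: "m \<notin> \<tau> \<Longrightarrow> cell (enlarge (g, \<tau>))"
  using insert_m c a_letter by (auto simp: enlarge_eq)

lemma enlarge_topface_m: "m \<notin> \<tau> \<Longrightarrow> topface m (enlarge (g, \<tau>)) = (g, \<tau>)"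
proof -
  assume mt: "m \<notin> \<tau>"
  show ?thesis
  proof (cases "a = let1 m")
    case True
    then show ?thesis using desc_m[OF mt] mt by (simp add: topface_def enlarge_eq)
  next
    case False
    then have l: "a = linv (let1 m)" using let1_cases[of a] m by auto
    then have "let1 m = linv a" by simp
    then have "\<not> desc (g \<otimes>\<^bsub>Ga\<^esub> gl a) (let1 m)" using desc_linv[OF c(1) a_letter(1)] desc_m[OF mt] by simp
    moreover have "g \<otimes>\<^bsub>Ga\<^esub> gl a \<otimes>\<^bsub>Ga\<^esub> gam m = g"
      using c a_letter l by (simp add: raag.m_assoc gam_def)
    ultimately show ?thesis using mt False by (simp add: topface_def enlarge_eq)
  qed
qed

lemma top_enlarge: "m \<notin> \<tau> \<Longrightarrow> topc (enlarge (g, \<tau>)) = vtop g \<tau>"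
  using top_topface[of "snd (enlarge (g, \<tau>))" "fst (enlarge (g, \<tau>))" m] enlarge_cell
  by (simp add: enlarge_topface_m) (simp add: enlarge_eq)

lemma desc_enlarge: "m \<notin> \<tau> \<Longrightarrow> v \<in> \<tau> \<Longrightarrow> desc (fst (enlarge (g, \<tau>))) (let1 v) = desc g (let1 v)"
proof -
  assume mt: "m \<notin> \<tau>" and v: "v \<in> \<tau>"
  have "indep E (let1 v) a" using mt v insert_m[OF mt] by (intro indep_let1[of "insert m \<tau>"]) (auto simp: m)
  then show ?thesis
    using desc_mult_indep[OF c(1) indep_sym, of "let1 v" a] a_letter by (simp add: enlarge_eq)
qed

lemma eta_enlarge: "m \<notin> \<tau> \<Longrightarrow> v \<in> \<tau> \<Longrightarrow> eta v (enlarge (g, \<tau>)) = eta v (g, \<tau>)"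
  by (simp add: eta_def desc_enlarge)

lemma topface_top: "v \<in> \<tau> \<Longrightarrow> topc (topface v (g, \<tau>)) = vtop g \<tau>" by (rule top_topface[OF c(2,1)])

lemma enlarge_topface: "m \<notin> \<tau> \<Longrightarrow> v \<in> \<tau> \<Longrightarrow> enlarge (topface v (g, \<tau>)) = topface v (enlarge (g, \<tau>))"
proof -
  assume mt: "m \<notin> \<tau>" and v: "v \<in> \<tau>"
  have "v \<noteq> m" using mt v by auto
  have "indep E (let1 v) a" using mt v insert_m[OF mt] by (intro indep_let1[of "insert m \<tau>"]) (auto simp: m)
  then have "gam v \<otimes>\<^bsub>Ga\<^esub> gl a = gl a \<otimes>\<^bsub>Ga\<^esub> gam v" unfolding gam_def by (rule gl_commute)
  moreover have "v \<in> V" using v c flag_V by auto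
  ultimately have *: "g \<otimes>\<^bsub>Ga\<^esub> gam v \<otimes>\<^bsub>Ga\<^esub> gl a = g \<otimes>\<^bsub>Ga\<^esub> gl a \<otimes>\<^bsub>Ga\<^esub> gam v"
    using c a_letter by (simp add: raag.m_assoc)
  have e: "enlarge (topface v (g, \<tau>)) = (if a = let1 m then fst (topface v (g, \<tau>)) else
      fst (topface v (g, \<tau>)) \<otimes>\<^bsub>Ga\<^esub> gl a, insert m (snd (topface v (g, \<tau>))))"
    unfolding enlarge_def topface_top[OF v] by (simp add: Let_def a m)
  show ?thesis
    unfolding e using * desc_enlarge[OF mt v] \<open>v \<noteq> m\<close>
    by (auto simp: topface_def enlarge_eq)
qed

lemma enlarge_topface': "m \<in> \<tau> \<Longrightarrow> enlarge (topface m (g, \<tau>)) = (g, \<tau>)"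
proof -
  assume mt: "m \<in> \<tau>"
  have e: "enlarge (topface m (g, \<tau>)) = (if a = let1 m then fst (topface m (g, \<tau>)) else
      fst (topface m (g, \<tau>)) \<otimes>\<^bsub>Ga\<^esub> gl a, insert m (snd (topface m (g, \<tau>))))"
    unfolding enlarge_def topface_top[OF mt] by (simp add: Let_def a m)
  show ?thesis
  proof (cases "desc g (let1 m)")
    case True
    then show ?thesis using mem_m[OF mt] mt unfolding e by (auto simp: topface_def dlet_def)
  next
    case False
    then have l: "a = linv (let1 m)" using mem_m[OF mt] by (simp add: dlet_def)
    have "let1 m \<in> letters" using a_letter(3) by simp
    then have "g \<otimes>\<^bsub>Ga\<^esub> gam m \<otimes>\<^bsub>Ga\<^esub> gl a = g" using c by (simp add: l raag.m_assoc gam_def)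
    then show ?thesis using False mt l unfolding e by (auto simp: topface_def)
  qed
qed

text \<open>If the direction \<open>m\<close> is present, the only face that is coned to something
  nonzero is the one without it, and its cone is the cube itself. If \<open>m\<close> is absent, the
  cube is the face of its cone in direction \<open>m\<close>, and the other faces cancel.\<close>

lemma cone_formula:
  "lin bdtop (cone (g, \<tau>)) + lin cone (bdtop (g, \<tau>)) = Poly_Mapping.single (g, \<tau>) (1::'r::comm_ring_1)"
proof (cases "m \<in> \<tau>")
  case True
  have "cone (topface v (g, \<tau>)) = (if v = m then Poly_Mapping.single (g, \<tau>) (sg idx m \<tau> * eta m (g, \<tau>)) else 0 :: _ \<Rightarrow>\<^sub>0 'r)"
    if "v \<in> \<tau>" for v
  proof (cases "v = m")
    case T: True
    then have "snd (topface v (g, \<tau>)) = \<tau> - {m}" by (simp add: topface_def)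
    then show ?thesis using True enlarge_topface' topface_top[OF that] T
      by (simp add: cone_def Let_def a[symmetric] m[symmetric] insert_absorb)
  next
    case False
    then show ?thesis using True topface_top[OF that]
      by (simp add: cone_def Let_def a[symmetric] m[symmetric]) (simp add: topface_def)
  qed
  then have "lin cone (bdtop (g, \<tau>)) = (\<Sum>v\<in>\<tau>. if v = m then Poly_Mapping.single (g, \<tau>) (1::'r) else 0)"
    unfolding bdtop_def lin_sum by (intro sum.cong) (auto simp: mult.assoc mult.left_commute simp flip: mult.assoc)
  moreover have "cone (g, \<tau>) = (0 :: _ \<Rightarrow>\<^sub>0 'r)" using True by (simp add: cone_def Let_def a[symmetric] m[symmetric])
  ultimately show ?thesis using True flag_finite[OF c(2)] by simp
next
  case False
  let ?c' = "enlarge (g, \<tau>)"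
  let ?k = "sg idx m (insert m \<tau>) * eta m ?c' :: 'r"
  have s: "snd ?c' = insert m \<tau>" by (simp add: enlarge_eq)
  have fin: "finite \<tau>" using c flag_finite by auto
  have 1: "cone (g, \<tau>) = Poly_Mapping.single ?c' ?k" using False by (simp add: cone_def Let_def a[symmetric] m[symmetric])
  have "lin bdtop (cone (g, \<tau>)) = scale ?k (Poly_Mapping.single (g, \<tau>) ?k) +
      scale ?k (\<Sum>v\<in>\<tau>. Poly_Mapping.single (topface v ?c') (sg idx v (insert m \<tau>) * eta v (g, \<tau>)))"
  proof -
    have "(\<Sum>v\<in>\<tau>. Poly_Mapping.single (topface v ?c') (sg idx v (insert m \<tau>) * eta v ?c')) =
        (\<Sum>v\<in>\<tau>. Poly_Mapping.single (topface v ?c') (sg idx v (insert m \<tau>) * eta v (g, \<tau>) :: 'r))"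
      by (rule sum.cong) (simp_all add: eta_enlarge[OF False])
    then show ?thesis
      unfolding 1 using False fin enlarge_topface_m[OF False]
      by (simp add: bdtop_def s scale_add)
  qed
  also have "scale ?k (Poly_Mapping.single (g, \<tau>) ?k) = Poly_Mapping.single (g, \<tau>) 1"
  proof -
    have "?k * ?k = (sg idx m (insert m \<tau>) * sg idx m (insert m \<tau>)) * (eta m ?c' * eta m ?c')"
      by (simp only: ac_simps)
    then show ?thesis by simp
  qed
  finally have 2: "lin bdtop (cone (g, \<tau>)) = Poly_Mapping.single (g, \<tau>) 1 +
    (\<Sum>v\<in>\<tau>. Poly_Mapping.single (topface v ?c') (?k * (sg idx v (insert m \<tau>) * eta v (g, \<tau>))))"
    by (simp add: scale_sum)
  have "cone (topface v (g, \<tau>)) = Poly_Mapping.single (topface v ?c') (sg idx m (insert m \<tau> - {v}) * eta m ?c' :: 'r)"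
    if v: "v \<in> \<tau>" for v
  proof -
    have vm: "v \<noteq> m" using v False by auto
    have ml: "mlet (topc (topface v (g, \<tau>))) = a" using topface_top[OF v] a by simp
    have sn: "snd (topface v (g, \<tau>)) = \<tau> - {v}" by (simp add: topface_def)
    have "cone (topface v (g, \<tau>)) = Poly_Mapping.single (enlarge (topface v (g, \<tau>)))
        (sg idx m (insert m (\<tau> - {v})) * eta m (enlarge (topface v (g, \<tau>))) :: 'r)"
      unfolding cone_def Let_def ml unfolding m[symmetric] sn using False by simp
    moreover have "insert m (\<tau> - {v}) = insert m \<tau> - {v}" using vm by auto
    moreover have "eta m (topface v ?c') = (eta m ?c' :: 'r)"
      using desc_gam[OF insert_m[OF False], of v m "fst ?c'"] v vm enlarge_cell[OF False]
      by (auto simp: eta_def topface_def)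
    ultimately show ?thesis by (simp add: enlarge_topface[OF False v])
  qed
  then have 3: "lin cone (bdtop (g, \<tau>)) = (\<Sum>v\<in>\<tau>. Poly_Mapping.single (topface v ?c')
      (sg idx v \<tau> * eta v (g, \<tau>) * (sg idx m (insert m \<tau> - {v}) * eta m ?c' :: 'r)))"
    unfolding bdtop_def lin_sum by (intro sum.cong) auto
  \<comment> \<open>Removing \<open>m\<close> and \<open>v\<close> in the opposite order reverses
    the sign, so the faces in the old directions cancel between the two sums.\<close>
  have "sg idx v \<tau> * eta v (g, \<tau>) * (sg idx m (insert m \<tau> - {v}) * eta m ?c') =
      - (?k * (sg idx v (insert m \<tau>) * eta v (g, \<tau>)) :: 'r)" if v: "v \<in> \<tau>" for v
  proof -
    have vm: "v \<noteq> m" using v False by auto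
    have "insert m \<tau> - {m} = \<tau>" using False by auto
    then have sw: "sg idx v (insert m \<tau>) * sg idx m (insert m \<tau> - {v}) = - (sg idx m (insert m \<tau>) * sg idx v \<tau> :: 'r)"
      using sg_swap'[OF insert_m[OF False], of v m, where ?'r = 'r] v vm by simp
    have "sg idx v \<tau> * sg idx m (insert m \<tau> - {v}) =
        sg idx v \<tau> * sg idx m (insert m \<tau> - {v}) * (sg idx v (insert m \<tau>) * sg idx v (insert m \<tau>) :: 'r)" by simp
    also have "\<dots> = sg idx v \<tau> * (sg idx v (insert m \<tau>) * sg idx m (insert m \<tau> - {v})) * sg idx v (insert m \<tau>)"
      by (simp only: ac_simps)
    also have "\<dots> = - ((sg idx v \<tau> * sg idx v \<tau>) * sg idx m (insert m \<tau>) * sg idx v (insert m \<tau>))"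
      unfolding sw by (simp only: mult_minus_left mult_minus_right ac_simps)
    also have "\<dots> = - (sg idx m (insert m \<tau>) * sg idx v (insert m \<tau>))" by simp
    finally have *: "sg idx v \<tau> * sg idx m (insert m \<tau> - {v}) = - (sg idx m (insert m \<tau>) * sg idx v (insert m \<tau>) :: 'r)" .
    have "sg idx v \<tau> * eta v (g, \<tau>) * (sg idx m (insert m \<tau> - {v}) * eta m ?c') =
      (sg idx v \<tau> * sg idx m (insert m \<tau> - {v})) * (eta v (g, \<tau>) * eta m ?c' :: 'r)" by (simp only: ac_simps)
    then show ?thesis unfolding * by (simp add: ac_simps)
  qed
  then show ?thesis unfolding 2 3 by (simp add: single_uminus sum_negf)
qed

end

section \<open>Exactness by induction on the length of top vertices\<close>

definition "level N = {c. cell c \<and> glen (topc c) = N}"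
definition "below N = {c. cell c \<and> glen (topc c) < N}"

lemma bdtop_level: "c \<in> level N \<Longrightarrow> bdtop c \<in> supported (level N)"
  unfolding bdtop_def using topface_cell top_topface[of "snd c" "fst c"]
  by (intro supported_sum supported_single) (auto simp: level_def)
lemma bdlow_level: "c \<in> level N \<Longrightarrow> bdlow c \<in> supported (below N)"
  unfolding bdlow_def
proof (intro supported_sum supported_single)
  fix v assume "c \<in> level N" "v \<in> snd c"
  then show "lowface v c \<in> below N"
    using lowface_cell[of c v] glen_lowface[of "snd c" "fst c" v] by (auto simp: level_def below_def)
qed
lemma cone_level: "c \<in> level (Suc N) \<Longrightarrow> cone c \<in> supported (level (Suc N))"
proof -
  assume c: "c \<in> level (Suc N)"
  then have 1: "fst c \<in> carrier Ga" "snd c \<in> \<Delta>" "vtop (fst c) (snd c) \<noteq> \<one>\<^bsub>Ga\<^esub>" by (auto simp: level_def glen_one)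
  show ?thesis unfolding cone_def Let_def
    using enlarge_cell[OF 1 HOL.refl HOL.refl] top_enlarge[OF 1 HOL.refl HOL.refl] c
    by (auto intro!: supported_single simp: level_def)
qed

definition "deg n = {c. cell c \<and> card (snd c) = n}"
lemma deg_eq: "deg n = carrier Ga \<times> simp n" by (auto simp: deg_def simp_def)

lemma cone_deg: "c \<in> level (Suc N) \<Longrightarrow> c \<in> deg n \<Longrightarrow> cone c \<in> supported (deg (Suc n))"
proof -
  assume c: "c \<in> level (Suc N)" "c \<in> deg n"
  then have 1: "fst c \<in> carrier Ga" "snd c \<in> \<Delta>" "vtop (fst c) (snd c) \<noteq> \<one>\<^bsub>Ga\<^esub>" by (auto simp: level_def glen_one)
  show ?thesis unfolding cone_def Let_def
    using enlarge_cell[OF 1 HOL.refl HOL.refl] enlarge_eq[OF 1 HOL.refl HOL.refl] c flag_finite[OF 1(2)]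
    by (auto intro!: supported_single simp: deg_def)
qed

abbreviation "BD \<equiv> ext Ga bd"

lemma BD_lin: "x \<in> supported (deg n) \<Longrightarrow> BD x = lin (\<lambda>c. bdtop c + bdlow c) x"
  unfolding ext_def by (rule lin_cong_on) (auto simp: deg_def bd_split[symmetric])

text \<open>The part of \<open>x\<close> of the highest top length is a cycle for
  \<open>bdtop\<close>, since all other terms of its boundary lie lower. Coning off this part
  removes it at the price of terms of smaller top length.\<close>

lemma reduce_step:
  fixes x :: "_ \<Rightarrow>\<^sub>0 'r::comm_ring_1"
  assumes x: "x \<in> supported (deg n)" "x \<in> supported (below (Suc (Suc N)))"
    and cyc: "n = 0 \<or> BD x = 0"
  shows "\<exists>y\<in>supported (deg (Suc n)). x - BD y \<in> supported (below (Suc N))"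
proof -
  let ?L = "level (Suc N)"
  define r :: "_ \<Rightarrow> _ \<Rightarrow>\<^sub>0 'r" where "r c = (if c \<in> ?L then Poly_Mapping.single c 1 else 0)" for c
  have xN: "lin r x \<in> supported ?L" "lin r x \<in> supported (deg n)"
    by (rule supported_lin[OF x(1)], simp add: r_def supported_single)+
  have rest: "x - lin r x \<in> supported (below (Suc N))"
  proof -
    have "lin (\<lambda>c. Poly_Mapping.single c 1 - r c) x \<in> supported (below (Suc N))"
      by (rule supported_lin[OF x(2)]) (auto simp: r_def below_def level_def intro!: supported_single)
    then show ?thesis by (simp add: lin_fun_diff)
  qed
  have r_id: "z \<in> supported ?L \<Longrightarrow> lin r z = z" for z
    using lin_cong_on[of z ?L r "\<lambda>c. Poly_Mapping.single c 1"] by (simp add: r_def)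
  have r_0: "z \<in> supported (below (Suc N)) \<Longrightarrow> lin r z = 0" for z
    using lin_cong_on[of z "below (Suc N)" r "\<lambda>c. 0"] by (simp add: r_def below_def level_def)
  have top0: "lin bdtop (lin r x) = 0"
  proof (cases "n = 0")
    case True
    have "lin bdtop (lin r x) = lin (\<lambda>_. 0) (lin r x)"
      by (rule lin_cong_on[OF xN(2)]) (use True flag_finite in \<open>auto simp: deg_def bdtop_def\<close>)
    then show ?thesis by simp
  next
    case False
    have bdc: "bdtop c + bdlow c \<in> supported (below (Suc N))" if "c \<in> below (Suc N)" for c
    proof -
      have c: "c \<in> level (glen (topc c))" "glen (topc c) < Suc N" using that by (auto simp: below_def level_def)
      show ?thesis using bdtop_level[OF c(1)] bdlow_level[OF c(1)] c(2)
        by (auto intro!: supported_add elim!: supported_mono simp: level_def below_def)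
    qed
    have "0 = lin r (BD x)" using cyc False by simp
    also have "BD x = lin (\<lambda>c. bdtop c + bdlow c) (x - lin r x) + lin (\<lambda>c. bdtop c + bdlow c) (lin r x)"
      by (simp add: BD_lin[OF x(1)] flip: lin_add)
    also have "lin r \<dots> = lin r (lin (\<lambda>c. bdtop c + bdlow c) (lin r x))"
      using r_0[OF supported_lin[OF rest bdc]] by (simp add: lin_add)
    also have "\<dots> = lin r (lin bdtop (lin r x)) + lin r (lin bdlow (lin r x))"
      by (simp add: lin_fun_add lin_add)
    also have "lin r (lin bdlow (lin r x)) = 0" by (rule r_0[OF supported_lin[OF xN(1) bdlow_level]])
    also have "lin r (lin bdtop (lin r x)) = lin bdtop (lin r x)"
      by (rule r_id[OF supported_lin[OF xN(1) bdtop_level]])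
    finally show ?thesis by simp
  qed
  define y where "y = lin cone (lin r x)"
  have y: "y \<in> supported ?L" unfolding y_def by (rule supported_lin[OF xN(1) cone_level])
  have y': "y \<in> supported (deg (Suc n))" unfolding y_def
  proof (rule supported_lin)
    show "lin r x \<in> supported (?L \<inter> deg n)" using xN by (auto simp: supported_def)
  qed (auto intro: cone_deg)
  have "lin bdtop y + lin cone (lin bdtop (lin r x)) = lin (\<lambda>c. lin bdtop (cone c) + lin cone (bdtop c)) (lin r x)"
    by (simp add: y_def lin_lin lin_fun_add)
  also have "\<dots> = lin (\<lambda>c. Poly_Mapping.single c 1) (lin r x)"
  proof (rule lin_cong_on[OF xN(1)])
    fix c assume c: "c \<in> ?L"
    then have 1: "fst c \<in> carrier Ga" "snd c \<in> \<Delta>" "vtop (fst c) (snd c) \<noteq> \<one>\<^bsub>Ga\<^esub>" by (auto simp: level_def glen_one)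
    show "lin bdtop (cone c) + lin cone (bdtop c) = Poly_Mapping.single c (1::'r)"
      using cone_formula[OF 1 HOL.refl HOL.refl] by simp
  qed
  finally have "lin bdtop y = lin r x" using top0 by simp
  then have "x - BD y = (x - lin r x) - lin bdlow y" by (simp add: BD_lin[OF y'] lin_fun_add)
  moreover have "lin bdlow y \<in> supported (below (Suc N))" by (rule supported_lin[OF y bdlow_level])
  ultimately have "x - BD y \<in> supported (below (Suc N))" using rest supported_diff by metis
  then show ?thesis using y' by blast
qed

text \<open>No edge descends from the identity, so the bottom of the filtration consists of a single
  vertex, where only the augmentation has to be known.\<close>

lemma glen_top_zero: "cell c \<Longrightarrow> glen (topc c) = 0 \<Longrightarrow> c = (\<one>\<^bsub>Ga\<^esub>, {})"
proof -
  assume c: "cell c" "glen (topc c) = 0"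
  have "snd c = {}"
  proof (rule ccontr)
    assume "snd c \<noteq> {}"
    then obtain v where v: "v \<in> snd c" by auto
    then have "desc (topc c) (dlet (fst c) v)" "dlet (fst c) v \<in> letters"
      using desc_top[of "snd c" "fst c" v] c flag_mem_V[of "snd c" v] by (auto simp: dlet_def)
    then show False using c glen_desc(1)[of "topc c"] top_closed by fastforce
  qed
  moreover have "topc c = \<one>\<^bsub>Ga\<^esub>" using c glen_zero top_closed by blast
  ultimately show ?thesis by (cases c) (auto simp: vtop_def posv_def)
qed

lemma BD_closed: "y \<in> chains Ga (simp (Suc n)) \<Longrightarrow> BD y \<in> chains Ga (simp n)"
  by (rule free_complex.ext_D_closed[OF free_bd])
lemma BD_BD: "y \<in> chains Ga (simp (Suc (Suc n))) \<Longrightarrow> BD (BD y) = 0"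
  by (rule free_complex.ext_D_D[OF free_bd])
lemma aug_BD: "y \<in> chains Ga (simp (Suc 0)) \<Longrightarrow> aug (\<lambda>_. 1) (BD y) = 0"
proof -
  assume y: "y \<in> chains Ga (simp (Suc 0))"
  have "aug (\<lambda>_. 1) (BD y) = aug (\<lambda>b. aug (\<lambda>_. 1) (bd b)) y" by (simp add: aug_ext)
  also have "\<dots> = aug (\<lambda>_. 0) y" by (rule aug_cong[OF y]) (rule free_complex.aug_D[OF free_bd])
  finally show ?thesis by (simp add: aug_def)
qed

lemma BD_exact:
  fixes x :: "_ \<Rightarrow>\<^sub>0 'r::comm_ring_1"
  assumes "x \<in> chains Ga (simp n)" "if n = 0 then aug (\<lambda>_. 1) x = 0 else BD x = 0"
  shows "\<exists>y\<in>chains Ga (simp (Suc n)). BD y = x"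
proof -
  have "\<exists>y\<in>supported (deg (Suc n)). BD y = x"
    if "x \<in> supported (deg n)" "if n = 0 then aug (\<lambda>_. 1) x = 0 else BD x = 0" "x \<in> supported (below (Suc N))"
    for N and x :: "_ \<Rightarrow>\<^sub>0 'r"
    using that
  proof (induction N arbitrary: x)
    case 0
    then have k: "keys x \<subseteq> {(\<one>\<^bsub>Ga\<^esub>, {})}" using glen_top_zero by (auto simp: supported_def below_def)
    have "x = 0"
    proof (cases "n = 0")
      case True
      then have "lookup x (\<one>\<^bsub>Ga\<^esub>, {}) = 0"
        using 0 pair_superset[OF _ k, of "\<lambda>_. 1"] by (simp add: aug_def)
      then show ?thesis using k by (intro pm_eqI) (auto simp: in_keys_iff)
    next
      case False
      then have "(\<one>\<^bsub>Ga\<^esub>, {}) \<notin> keys x" using 0(1) by (auto simp: supported_def deg_def)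
      then have "keys x = {}" using k by blast
      then show ?thesis by simp
    qed
    then show ?case by (intro bexI[of _ 0]) auto
  next
    case (Suc N)
    then obtain y where y: "y \<in> supported (deg (Suc n))" "x - BD y \<in> supported (below (Suc N))"
      using reduce_step[of x n N] by (auto split: if_splits)
    have "x - BD y \<in> supported (deg n)" using Suc.prems y BD_closed by (auto simp: deg_eq intro: supported_diff)
    moreover have "if n = 0 then aug (\<lambda>_. 1) (x - BD y) = 0 else BD (x - BD y) = 0"
      using Suc.prems y aug_BD BD_BD[of y "n - 1"] by (auto simp: deg_eq aug_diff ext_diff)
    ultimately obtain z where "z \<in> supported (deg (Suc n))" "BD z = x - BD y" using Suc.IH y by blast
    then show ?case using y by (intro bexI[of _ "z + y"]) (auto simp: ext_add supported_add)
  qed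
  moreover have "\<exists>N. x \<in> supported (below (Suc N))"
  proof
    have "glen (vtop g \<tau>) \<le> Max ((\<lambda>c. glen (topc c)) ` keys x)" if "(g, \<tau>) \<in> keys x" for g \<tau>
      using that by (intro Max_ge) force+
    then show "x \<in> supported (below (Suc (Max ((\<lambda>c. glen (topc c)) ` keys x))))"
      using assms(1) by (auto simp: supported_def below_def simp_def less_Suc_eq_le)
  qed
  ultimately show ?thesis using assms by (auto simp: deg_eq)
qed

lemma exact_bd: "exact_complex Ga (\<lambda>n. chains Ga (simp n)) (\<lambda>_. BD) (\<lambda>_. 1 :: 'r::comm_ring_1)"
proof
  show "submod Ga (chains Ga (simp n) :: (_ \<Rightarrow>\<^sub>0 'r) set)" for n by (rule raag.submod_chains)
  show "eqlin Ga (chains Ga (simp (Suc n)) :: (_ \<Rightarrow>\<^sub>0 'r) set) BD" for n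
    by (rule raag.eqlin_ext_fun) (rule bd_closed)
  show "\<exists>y\<in>chains Ga (simp 0). aug (\<lambda>_. 1) y = (1::'r)"
    by (rule bexI[of _ "Poly_Mapping.single (\<one>\<^bsub>Ga\<^esub>, {}) 1"]) (auto intro!: supported_single simp: simp_def)
  fix y :: "_ \<Rightarrow>\<^sub>0 'r"
  show "\<exists>z\<in>chains Ga (simp (Suc 0)). BD z = y" if "y \<in> chains Ga (simp 0)" "aug (\<lambda>_. 1) y = 0"
    using BD_exact[OF that(1)] that by simp
  show "\<exists>z\<in>chains Ga (simp (Suc (Suc n))). BD z = y" if "y \<in> chains Ga (simp (Suc n))" "BD y = 0" for n
    using BD_exact[OF that(1)] that by simp
qed (use BD_closed BD_BD aug_BD in auto)

end

section \<open>The live complex and a contraction that raises the character\<close>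

lemma lin_fun_uminus: "lin (\<lambda>c. - \<phi> c) x = - lin \<phi> x"
  using lin_fun_scale[of "-1" \<phi> x] by (simp add: scale_minus_one)

context raag_complex
begin

text \<open>The boundary of the live complex. It preserves \<^term>\<open>\<tau> - W\<close>; the summand with \<open>\<tau> - W = \<sigma>\<close> is the
  augmented chain complex of the link of \<open>\<sigma>\<close> in \<open>W\<close>.\<close>

definition lbd :: "'v set \<Rightarrow> 'v set \<Rightarrow> ('v set \<Rightarrow>\<^sub>0 'r::comm_ring_1)" where
  "lbd W \<tau> = (\<Sum>v\<in>\<tau> \<inter> W. Poly_Mapping.single (\<tau> - {v}) (sg idx v \<tau>))"

text \<open>Degree 0 is spanned by the empty simplex, which is always a cycle. It is a boundary
  exactly if some vertex is live.\<close>

definition lexact :: "'v set \<Rightarrow> nat \<Rightarrow> 'r::comm_ring_1 itself \<Rightarrow> bool" where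
  "lexact W q R \<longleftrightarrow> (\<forall>n\<le>q. \<forall>x :: 'v set \<Rightarrow>\<^sub>0 'r. x \<in> supported (simp n) \<longrightarrow> lin (lbd W) x = 0 \<longrightarrow>
     (\<exists>y\<in>supported (simp (Suc n)). lin (lbd W) y = x))"

lemma lbd_closed: "\<tau> \<in> simp (Suc n) \<Longrightarrow> lbd W \<tau> \<in> supported (simp n)"
  unfolding lbd_def using flag_subset card_remove
  by (intro supported_sum supported_single) (auto simp: simp_def)

lemma lbd_zero: "\<tau> \<in> simp 0 \<Longrightarrow> lbd W \<tau> = 0"
  using flag_finite by (auto simp: lbd_def simp_def)

lemma lbd_lbd: assumes \<tau>: "\<tau> \<in> \<Delta>" shows "lin (lbd W) (lbd W \<tau>) = (0 :: _ \<Rightarrow>\<^sub>0 'r::comm_ring_1)"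
proof -
  define F :: "'v \<Rightarrow> 'v \<Rightarrow> ('v set \<Rightarrow>\<^sub>0 'r)" where
    "F v w = Poly_Mapping.single (\<tau> - {v} - {w}) (sg idx v \<tau> * sg idx w (\<tau> - {v}))" for v w
  have "lin (lbd W) (lbd W \<tau>) = (\<Sum>v\<in>\<tau> \<inter> W. \<Sum>w\<in>\<tau> \<inter> W - {v}. F v w)"
    unfolding lbd_def[of W \<tau>] lin_sum
    by (rule sum.cong) (auto simp: lbd_def scale_sum F_def Int_Diff Diff_Int_distrib2 intro!: sum.cong)
  also have "\<dots> = 0"
  proof (rule antisym_sum)
    show "finite (\<tau> \<inter> W)" using flag_finite[OF \<tau>] by simp
    fix v w assume vw: "v \<in> \<tau> \<inter> W" "w \<in> \<tau> \<inter> W" "v \<noteq> w"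
    have *: "\<tau> - {v} - {w} = \<tau> - {w} - {v}" by auto
    show "F v w = - F w v" using vw unfolding F_def * by (subst sg_swap'[OF \<tau>]) (auto simp: single_uminus)
  qed
  finally show ?thesis .
qed

definition "part W D = {\<tau> \<in> \<Delta>. \<tau> - W = D}"

text \<open>Besides contracting, \<open>s\<close> keeps the dead part \<open>\<tau> - W\<close>.
  Otherwise pushing could gain dead directions without raising \<chi>.\<close>

definition contraction :: "'v set \<Rightarrow> nat \<Rightarrow> ('v set \<Rightarrow> ('v set \<Rightarrow>\<^sub>0 'r::comm_ring_1)) \<Rightarrow> bool" where
  "contraction W q s \<longleftrightarrow> (\<forall>\<tau>\<in>\<Delta>. card \<tau> \<le> q \<longrightarrow> s \<tau> \<in> supported (simp (Suc (card \<tau>)) \<inter> part W (\<tau> - W)) \<and>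
     lin (lbd W) (s \<tau>) + lin s (lbd W \<tau>) = Poly_Mapping.single \<tau> 1)"

lemma contraction_lin:
  assumes "contraction W q s" "x \<in> supported (simp n)" "n \<le> q"
  shows "lin (lbd W) (lin s x) + lin s (lin (lbd W) x) = x"
proof -
  have "lin (\<lambda>\<tau>. lin (lbd W) (s \<tau>) + lin s (lbd W \<tau>)) x = lin (\<lambda>\<tau>. Poly_Mapping.single \<tau> 1) x"
    using assms by (intro lin_cong_on[OF assms(2)]) (auto simp: contraction_def simp_def)
  then show ?thesis by (simp add: lin_lin lin_fun_add)
qed

lemma contraction_closed: "contraction W q s \<Longrightarrow> x \<in> supported (simp n) \<Longrightarrow> n \<le> q \<Longrightarrow> lin s x \<in> supported (simp (Suc n))"
  by (rule supported_lin) (auto simp: contraction_def simp_def supported_def)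

lemma contraction_lexact:
  assumes "contraction W q (s :: _ \<Rightarrow> (_ \<Rightarrow>\<^sub>0 'r::comm_ring_1))" shows "lexact W q TYPE('r)"
  unfolding lexact_def
proof (intro allI impI)
  fix n and x :: "'v set \<Rightarrow>\<^sub>0 'r" assume n: "n \<le> q" and x: "x \<in> supported (simp n)" and z: "lin (lbd W) x = 0"
  show "\<exists>y\<in>supported (simp (Suc n)). lin (lbd W) y = x"
    using contraction_lin[OF assms x n] contraction_closed[OF assms x n] z by (intro bexI[of _ "lin s x"]) auto
qed

lemma part_lbd: "lbd W \<tau> \<in> supported {\<rho>. \<rho> - W = \<tau> - W}"
  unfolding lbd_def by (intro supported_sum supported_single) auto

definition proj :: "'v set \<Rightarrow> 'v set \<Rightarrow> 'v set \<Rightarrow> ('v set \<Rightarrow>\<^sub>0 'r::comm_ring_1)" where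
  "proj W D \<tau> = (if \<tau> - W = D then Poly_Mapping.single \<tau> 1 else 0)"

lemma proj_lbd: "lin (proj W D) (lbd W \<tau>) = (if \<tau> - W = D then lbd W \<tau> else 0)"
proof (cases "\<tau> - W = D")
  case True
  then show ?thesis using lin_cong_on[OF part_lbd[of W \<tau>], of "proj W D" "\<lambda>\<tau>. Poly_Mapping.single \<tau> 1"]
    by (simp add: proj_def)
next
  case False
  then show ?thesis using lin_cong_on[OF part_lbd[of W \<tau>], of "proj W D" "\<lambda>\<tau>. 0"]
    by (simp add: proj_def)
qed

text \<open>Induction on the degree: \<tau> minus \<open>s\<close> of its live boundary is a cycle
  by the identity one degree lower, and \<open>s \<tau>\<close> is chosen as a filling of
  it.\<close>

lemma lexact_contraction:
  assumes L: "lexact W q TYPE('r::comm_ring_1)"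
  shows "\<exists>s :: _ \<Rightarrow> (_ \<Rightarrow>\<^sub>0 'r). contraction W q s"
proof -
  define P where "P s \<tau> \<longleftrightarrow> s \<tau> \<in> supported (simp (Suc (card \<tau>)) \<inter> part W (\<tau> - W)) \<and>
     lin (lbd W) (s \<tau>) + lin s (lbd W \<tau>) = Poly_Mapping.single \<tau> 1"
    for s :: "_ \<Rightarrow> (_ \<Rightarrow>\<^sub>0 'r)" and \<tau>
  have "\<exists>s. \<forall>\<tau>\<in>\<Delta>. card \<tau> < n \<longrightarrow> P s \<tau>" if "n \<le> Suc q" for n
    using that
  proof (induction n)
    case (Suc n)
    then obtain s where s: "\<And>\<tau>. \<tau> \<in> \<Delta> \<Longrightarrow> card \<tau> < n \<Longrightarrow> P s \<tau>" by auto
    have "\<exists>y\<in>supported (simp (Suc n) \<inter> part W (\<tau> - W)).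
        lin (lbd W) y = Poly_Mapping.single \<tau> 1 - lin s (lbd W \<tau>)" if \<tau>: "\<tau> \<in> simp n" for \<tau>
    proof -
      let ?z = "Poly_Mapping.single \<tau> 1 - lin s (lbd W \<tau>) :: _ \<Rightarrow>\<^sub>0 'r"
      have face: "\<rho> \<in> \<Delta> \<and> P s \<rho> \<and> card \<rho> = n - 1 \<and> Suc (n - 1) = n \<and> \<rho> - W = \<tau> - W" if r: "\<rho> \<in> keys (lbd W \<tau> :: _ \<Rightarrow>\<^sub>0 'r)" for \<rho>
      proof -
        obtain m where m: "n = Suc m" using r \<tau> lbd_zero[of \<tau> W, where 'a = 'r] by (cases n) auto
        have "\<rho> \<in> simp m" using r lbd_closed[of \<tau> m W, where 'a = 'r] \<tau> m by (auto dest: supported_keys)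
        moreover have "\<rho> - W = \<tau> - W" using r part_lbd[of W \<tau>, where 'a = 'r] supported_keys by fastforce
        ultimately show ?thesis using m s by (auto simp: simp_def)
      qed
      have lbd_s: "(lbd W \<tau> :: _ \<Rightarrow>\<^sub>0 'r) \<in> supported {\<rho>. \<rho> \<in> keys (lbd W \<tau> :: _ \<Rightarrow>\<^sub>0 'r)}" by (simp add: supported_def)
      have z: "?z \<in> supported (simp n \<inter> part W (\<tau> - W))"
      proof (rule supported_diff)
        show "Poly_Mapping.single \<tau> 1 \<in> supported (simp n \<inter> part W (\<tau> - W))"
          using \<tau> by (auto intro!: supported_single simp: part_def simp_def)
        show "lin s (lbd W \<tau>) \<in> supported (simp n \<inter> part W (\<tau> - W))"
        proof (rule supported_lin[OF lbd_s])
          fix \<rho> assume "\<rho> \<in> {\<rho>. \<rho> \<in> keys (lbd W \<tau> :: _ \<Rightarrow>\<^sub>0 'r)}"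
          then have f: "\<rho> \<in> \<Delta> \<and> P s \<rho> \<and> card \<rho> = n - 1 \<and> Suc (n - 1) = n \<and> \<rho> - W = \<tau> - W" using face by blast
          then have "s \<rho> \<in> supported (simp (Suc (card \<rho>)) \<inter> part W (\<rho> - W))" unfolding P_def by blast
          then show "s \<rho> \<in> supported (simp n \<inter> part W (\<tau> - W))" using f by (simp add: supported_def)
        qed
      qed
      have "lin (lbd W) (lin s (lbd W \<tau>)) + lin s (lin (lbd W) (lbd W \<tau>)) =
          lin (\<lambda>\<rho>. Poly_Mapping.single \<rho> 1) (lbd W \<tau>)"
        unfolding lin_lin lin_fun_add[symmetric]
        by (rule lin_cong_on[OF lbd_s]) (use face in \<open>auto simp: P_def\<close>)
      then have "lin (lbd W) ?z = 0" using \<tau> by (simp add: lbd_lbd simp_def lin_diff)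
      then obtain y where y: "y \<in> supported (simp (Suc n))" "lin (lbd W) y = ?z"
        using L supported_mono[OF z, of "simp n"] Suc.prems unfolding lexact_def by auto
      \<comment> \<open>A filling may have components with other dead parts. The projection to the
        summand of \<tau> removes them and commutes with the live boundary.\<close>
      let ?p = "proj W (\<tau> - W) :: _ \<Rightarrow> (_ \<Rightarrow>\<^sub>0 'r)"
      have "lin (lbd W) (lin ?p y) = lin ?p (lin (lbd W) y)"
        unfolding lin_lin by (rule lin_cong) (auto simp: proj_lbd proj_def)
      also have "\<dots> = ?z" unfolding y(2)
        using lin_cong_on[OF z, of ?p "\<lambda>\<tau>. Poly_Mapping.single \<tau> 1"] by (simp add: proj_def part_def)
      finally have "lin (lbd W) (lin ?p y) = ?z" .
      moreover have "lin ?p y \<in> supported (simp (Suc n) \<inter> part W (\<tau> - W))"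
        by (rule supported_lin[OF y(1)]) (auto simp: proj_def part_def simp_def intro!: supported_single)
      ultimately show ?thesis by blast
    qed
    then obtain t where t: "\<And>\<tau>. \<tau> \<in> simp n \<Longrightarrow> t \<tau> \<in> supported (simp (Suc n) \<inter> part W (\<tau> - W)) \<and>
        lin (lbd W) (t \<tau>) = Poly_Mapping.single \<tau> 1 - lin s (lbd W \<tau>)" by metis
    define s' where "s' \<tau> = (if card \<tau> < n then s \<tau> else t \<tau>)" for \<tau>
    have "P s' \<tau>" if \<tau>: "\<tau> \<in> \<Delta>" "card \<tau> < Suc n" for \<tau>
    proof -
      have "lin s' (lbd W \<tau>) = lin s (lbd W \<tau>)"
      proof (cases "card \<tau>")
        case 0
        then show ?thesis using \<tau> by (simp add: lbd_zero simp_def)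
      next
        case (Suc m)
        then show ?thesis using \<tau>
          by (intro lin_cong_on[OF lbd_closed[of \<tau> m]]) (auto simp: simp_def s'_def)
      qed
      moreover have "P s' \<tau> = P s \<tau>" if "card \<tau> < n" using that calculation by (simp add: P_def s'_def)
      moreover have "P s' \<tau>" if n: "n = card \<tau>"
        using calculation(1) t[of \<tau>] \<tau> n by (simp add: P_def s'_def simp_def)
      ultimately show ?thesis using \<tau> s[of \<tau>] by linarith
    qed
    then show ?case by blast
  qed simp
  from this[of "Suc q"] show ?thesis unfolding contraction_def P_def by (auto simp: less_Suc_eq_le)
qed

end

section \<open>Pushing cubes to higher values of the character\<close>

locale raag_character = raag_complex V E idx \<beta> for V :: "'v set" and E idx \<beta> +
  fixes \<chi> :: "('v \<times> bool) list set \<Rightarrow> real"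
  assumes \<chi>_mult: "g \<in> carrier (raag V E) \<Longrightarrow> h \<in> carrier (raag V E) \<Longrightarrow> \<chi> (g \<otimes>\<^bsub>raag V E\<^esub> h) = \<chi> g + \<chi> h"
    and \<chi>_gam: "v \<in> V \<Longrightarrow> 0 \<le> \<chi> (gam v)"
begin

definition "W = {v\<in>V. 0 < \<chi> (gam v)}"

lemma \<chi>_one [simp]: "\<chi> \<one>\<^bsub>Ga\<^esub> = 0" using \<chi>_mult[of "\<one>\<^bsub>Ga\<^esub>" "\<one>\<^bsub>Ga\<^esub>"] by simp
lemma \<chi>_dead: "v \<in> V \<Longrightarrow> v \<notin> W \<Longrightarrow> \<chi> (gam v) = 0" using \<chi>_gam[of v] by (auto simp: W_def)

text \<open>A positive lower bound for \<chi> on the live generators. The entry 1 covers the case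
  that no vertex is live.\<close>

definition "\<delta> = Min (insert 1 ((\<lambda>v. \<chi> (gam v)) ` W))"

lemma finite_W [simp]: "finite W" by (simp add: W_def)
lemma \<delta>_pos: "0 < \<delta>" by (auto simp: \<delta>_def W_def)
lemma \<delta>_le: "v \<in> W \<Longrightarrow> \<delta> \<le> \<chi> (gam v)" by (simp add: \<delta>_def)

text \<open>The lexicographic order by \<chi> and then by few dead directions, as one real number:
  raising \<chi> by \<delta> counts card V + 1, which outweighs any change of at most card V in the
  number of dead directions.\<close>

definition pot :: "('v \<times> bool) list set \<times> 'v set \<Rightarrow> real" where
  "pot c = \<chi> (fst c) / \<delta> * (real (card V) + 1) - real (card (snd c - W))"

text \<open>The cells that, seen from the cube \<tau> at the identity, have a \<open>pot\<close>
  larger by at least 1 and no smaller \<chi>.\<close>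

definition higher :: "'v set \<Rightarrow> (('v \<times> bool) list set \<times> 'v set) set" where
  "higher \<tau> = {(g, \<rho>). g \<in> carrier Ga \<and> \<rho> \<in> simp (card \<tau>) \<and> 0 \<le> \<chi> g \<and> (\<delta> \<le> \<chi> g \<or> card (\<rho> - W) < card (\<tau> - W))}"

abbreviation "inc \<equiv> lin (\<lambda>\<tau>. Poly_Mapping.single (\<one>\<^bsub>Ga\<^esub>, \<tau>) 1)"

text \<open>The boundary without the faces at the identity in live directions. Those form the live
  boundary with a minus sign; every term kept here raises \<chi> or loses a dead direction.\<close>

definition rbd :: "'v set \<Rightarrow> (('v \<times> bool) list set \<times> 'v set \<Rightarrow>\<^sub>0 'r::comm_ring_1)" where
  "rbd \<tau> = (\<Sum>v\<in>\<tau>. scale (sg idx v \<tau>) (Poly_Mapping.single (gam v, \<tau> - {v}) 1 -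
     (if v \<in> W then 0 else Poly_Mapping.single (\<one>\<^bsub>Ga\<^esub>, \<tau> - {v}) 1)))"

lemma bd_rbd: assumes "\<tau> \<in> \<Delta>" shows "bd \<tau> = rbd \<tau> - inc (lbd W \<tau>)"
proof -
  have "inc (lbd W \<tau>) = (\<Sum>v\<in>\<tau> \<inter> W. Poly_Mapping.single (\<one>\<^bsub>Ga\<^esub>, \<tau> - {v}) (sg idx v \<tau> :: 'a))"
    by (simp add: lbd_def lin_sum)
  also have "\<dots> = (\<Sum>v\<in>\<tau>. if v \<in> W then Poly_Mapping.single (\<one>\<^bsub>Ga\<^esub>, \<tau> - {v}) (sg idx v \<tau>) else 0)"
    using flag_finite[OF assms] by (simp add: sum.If_cases Int_def)
  finally show ?thesis
    unfolding bd_def rbd_def by (auto simp: scale_diff simp flip: sum_subtractf intro!: sum.cong)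
qed

lemma inc_supported: "x \<in> supported A \<Longrightarrow> inc x \<in> supported ({\<one>\<^bsub>Ga\<^esub>} \<times> A)"
  by (rule supported_lin) (auto intro: supported_single)

context
  fixes s :: "'v set \<Rightarrow> ('v set \<Rightarrow>\<^sub>0 'r::comm_ring_1)" and q
  assumes s: "contraction W q s"
begin

text \<open>The contraction of the live complex as a homotopy on cubes, negative because the live
  boundary enters \<open>bd\<close> with a minus sign. The map \<open>push\<close> is the identity
  changed along this homotopy.\<close>

definition "hmt \<tau> = - inc (s \<tau>)"
definition "push \<tau> = Poly_Mapping.single (\<one>\<^bsub>Ga\<^esub>, \<tau>) 1 - ext Ga bd (hmt \<tau>) - ext Ga hmt (bd \<tau>)"

lemma s_closed: "\<tau> \<in> simp n \<Longrightarrow> n \<le> q \<Longrightarrow> s \<tau> \<in> supported (simp (Suc n) \<inter> part W (\<tau> - W))"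
  using s by (auto simp: contraction_def simp_def)

lemma hmt_closed: "\<tau> \<in> simp n \<Longrightarrow> n \<le> q \<Longrightarrow> hmt \<tau> \<in> supported ({\<one>\<^bsub>Ga\<^esub>} \<times> (simp (Suc n) \<inter> part W (\<tau> - W)))"
  unfolding hmt_def by (intro supported_uminus inc_supported s_closed)

lemma ext_inc: "ext Ga \<phi> (inc x) = lin (\<lambda>\<tau>. act Ga \<one>\<^bsub>Ga\<^esub> (\<phi> \<tau>)) x"
  by (simp add: ext_def lin_lin)

text \<open>The live parts of the two homotopy terms add up to the identity by the contraction
  property, so only the terms with \<open>rbd\<close> survive.\<close>

lemma push_eq:
  assumes \<tau>: "\<tau> \<in> simp n" "n \<le> q"
  shows "push \<tau> = lin rbd (s \<tau>) - ext Ga hmt (rbd \<tau>)"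
proof -
  have sc: "s \<tau> \<in> supported (simp (Suc n))" using s_closed[OF \<tau>] by (auto simp: supported_def)
  have one: "act Ga \<one>\<^bsub>Ga\<^esub> (bd \<rho>) = bd \<rho>" if "\<rho> \<in> simp (Suc n)" for \<rho>
    by (rule raag.act_one[OF bd_closed[OF that]])
  have 1: "ext Ga bd (hmt \<tau>) = inc (lin (lbd W) (s \<tau>)) - lin rbd (s \<tau>)"
  proof -
    have "ext Ga bd (hmt \<tau>) = - lin (\<lambda>\<rho>. bd \<rho>) (s \<tau>)"
      unfolding hmt_def ext_uminus ext_inc by (rule arg_cong[where f = uminus], rule lin_cong_on[OF sc one])
    also have "lin (\<lambda>\<rho>. bd \<rho>) (s \<tau>) = lin (\<lambda>\<rho>. rbd \<rho> - inc (lbd W \<rho>)) (s \<tau>)"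
      by (rule lin_cong_on[OF sc]) (simp add: bd_rbd simp_def)
    also have "\<dots> = lin rbd (s \<tau>) - inc (lin (lbd W) (s \<tau>))" by (simp add: lin_fun_diff lin_lin)
    finally show ?thesis by simp
  qed
  have 2: "ext Ga hmt (inc (lbd W \<tau>)) = - inc (lin s (lbd W \<tau>))"
  proof -
    have "act Ga \<one>\<^bsub>Ga\<^esub> (hmt \<rho>) = hmt \<rho>" if r: "\<rho> \<in> keys (lbd W \<tau> :: _ \<Rightarrow>\<^sub>0 'r)" for \<rho>
    proof -
      obtain m where m: "n = Suc m" using r \<tau> lbd_zero[of \<tau> W, where 'a = 'r] by (cases n) auto
      have "\<rho> \<in> simp m" using r lbd_closed[of \<tau> m W, where 'a = 'r] \<tau> m by (auto dest: supported_keys)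
      then have "hmt \<rho> \<in> chains Ga UNIV" using hmt_closed[of \<rho> m] \<tau> m by (auto elim!: supported_mono)
      then show ?thesis by (rule raag.act_one)
    qed
    then have "ext Ga hmt (inc (lbd W \<tau>)) = lin hmt (lbd W \<tau>)"
      unfolding ext_inc by (intro lin_cong) auto
    also have "\<dots> = - inc (lin s (lbd W \<tau>))" by (simp add: hmt_def[abs_def] lin_fun_uminus lin_lin)
    finally show ?thesis .
  qed
  have "lin (lbd W) (s \<tau>) + lin s (lbd W \<tau>) = Poly_Mapping.single \<tau> 1"
    using s \<tau> by (auto simp: contraction_def simp_def)
  then have "inc (lin (lbd W) (s \<tau>)) + inc (lin s (lbd W \<tau>)) = Poly_Mapping.single (\<one>\<^bsub>Ga\<^esub>, \<tau>) (1::'r)"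
    by (simp flip: lin_add)
  moreover have "ext Ga hmt (bd \<tau>) = ext Ga hmt (rbd \<tau>) + inc (lin s (lbd W \<tau>))"
    using \<tau> 2 by (simp add: bd_rbd simp_def ext_diff)
  ultimately show ?thesis unfolding push_def 1 by (simp add: algebra_simps)
qed

lemma push_higher: assumes \<tau>: "\<tau> \<in> simp n" "n \<le> q" shows "push \<tau> \<in> supported (higher \<tau>)"
proof -
  have cardW: "card ((\<rho> - {v}) - W) < card (\<rho> - W)" if "v \<in> \<rho>" "v \<notin> W" "\<rho> \<in> \<Delta>" for v \<rho>
    using that flag_finite by (intro psubset_card_mono) auto
  have \<Delta>: "\<tau> \<in> \<Delta>" "card \<tau> = n" using \<tau> by (auto simp: simp_def)
  have "lin rbd (s \<tau>) \<in> supported (higher \<tau>)"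
  proof (rule supported_lin[OF s_closed[OF \<tau>]])
    fix \<rho> assume "\<rho> \<in> simp (Suc n) \<inter> part W (\<tau> - W)"
    then have r: "\<rho> \<in> \<Delta>" "card \<rho> = Suc n" "\<rho> - W = \<tau> - W" by (auto simp: simp_def part_def)
    have "(gam v, \<rho> - {v}) \<in> higher \<tau>" if "v \<in> \<rho>" for v
      using that r \<Delta> flag_mem_V[OF r(1) that] flag_subset[OF r(1)] card_remove[OF r(1) that r(2)] cardW[of v \<rho>] \<chi>_gam \<delta>_le[of v]
      by (auto simp: higher_def simp_def)
    moreover have "(\<one>\<^bsub>Ga\<^esub>, \<rho> - {v}) \<in> higher \<tau>" if "v \<in> \<rho>" "v \<notin> W" for v
      using that r \<Delta> flag_subset[OF r(1)] card_remove[OF r(1) that(1) r(2)] cardW[of v \<rho>]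
      by (auto simp: higher_def simp_def)
    ultimately show "(rbd \<rho> :: _ \<Rightarrow>\<^sub>0 'r) \<in> supported (higher \<tau>)"
      unfolding rbd_def by (intro supported_sum supported_scale supported_diff) (auto intro: supported_single)
  qed
  moreover have "ext Ga hmt (rbd \<tau>) \<in> supported (higher \<tau>)"
    unfolding rbd_def ext_sum ext_scale
  proof (intro supported_sum supported_scale)
    fix v assume v: "v \<in> \<tau>"
    then obtain m where m: "n = Suc m" using \<Delta> flag_finite by (cases n) auto
    have f: "\<tau> - {v} \<in> simp m" using \<Delta> v flag_subset[OF \<Delta>(1)] card_remove[OF \<Delta>(1) v] m by (auto simp: simp_def)
    have A: "act Ga g (hmt (\<tau> - {v})) \<in> supported (higher \<tau>)"
      if g: "g \<in> carrier Ga" "0 \<le> \<chi> g" "v \<in> W \<Longrightarrow> \<delta> \<le> \<chi> g" for g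
      unfolding act_def
    proof (rule supported_lin[OF hmt_closed[OF f]])
      show "m \<le> q" using m \<tau> by simp
      fix c assume "c \<in> {\<one>\<^bsub>Ga\<^esub>} \<times> (simp (Suc m) \<inter> part W (\<tau> - {v} - W))"
      then obtain \<rho> where c: "c = (\<one>\<^bsub>Ga\<^esub>, \<rho>)" "\<rho> \<in> simp (Suc m)" "\<rho> - W = \<tau> - {v} - W"
        by (auto simp: part_def)
      have "\<delta> \<le> \<chi> g \<or> card (\<rho> - W) < card (\<tau> - W)"
        using g(3) cardW[OF v _ \<Delta>(1)] c(3) by (cases "v \<in> W") auto
      then have "(g, \<rho>) \<in> higher \<tau>" using g(1,2) c(2) m \<Delta>(2) by (simp add: higher_def)
      then show "(case c of (ga, b) \<Rightarrow> Poly_Mapping.single (g \<otimes>\<^bsub>Ga\<^esub> ga, b) 1) \<in> supported (higher \<tau>)"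
        using g(1) by (simp add: c(1) supported_single)
    qed
    show "ext Ga hmt (Poly_Mapping.single (gam v, \<tau> - {v}) 1 -
        (if v \<in> W then 0 else Poly_Mapping.single (\<one>\<^bsub>Ga\<^esub>, \<tau> - {v}) 1)) \<in> supported (higher \<tau>)"
      using A[of "gam v"] A[of "\<one>\<^bsub>Ga\<^esub>"] flag_mem_V[OF \<Delta>(1) v] \<chi>_gam \<delta>_le[of v]
      by (auto simp: ext_diff ext_single intro!: supported_diff)
  qed
  ultimately show ?thesis unfolding push_eq[OF \<tau>] by (rule supported_diff)
qed

lemma ext_push: assumes x: "x \<in> chains Ga (simp n)" "n \<le> q"
  shows "ext Ga push x = x - BD (ext Ga hmt x) - (if n = 0 then 0 else ext Ga hmt (BD x))"
proof -
  have hc: "hmt \<tau> \<in> chains Ga (simp (Suc m))" if "\<tau> \<in> simp m" "m \<le> q" for \<tau> m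
    using hmt_closed[OF that] by (rule supported_mono) auto
  have "ext Ga push x = x - ext Ga (\<lambda>\<tau>. BD (hmt \<tau>)) x - ext Ga (\<lambda>\<tau>. ext Ga hmt (bd \<tau>)) x"
    unfolding push_def[abs_def] raag.ext_fun_diff raag.ext_id[OF x(1)] ..
  moreover have "ext Ga (\<lambda>\<tau>. BD (hmt \<tau>)) x = BD (ext Ga hmt x)"
    by (rule raag.ext_ext[symmetric, OF x(1) hc[OF _ x(2)] bd_closed])
  moreover have "ext Ga (\<lambda>\<tau>. ext Ga hmt (bd \<tau>)) x = (if n = 0 then 0 else ext Ga hmt (BD x))"
  proof (cases n)
    case 0
    have "ext Ga (\<lambda>\<tau>. ext Ga hmt (bd \<tau>)) x = ext Ga (\<lambda>\<tau>. 0) x"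
      using 0 flag_finite by (intro raag.ext_cong[OF x(1)]) (auto simp: simp_def bd_def)
    then show ?thesis using 0 by simp
  next
    case (Suc m)
    have "ext Ga (\<lambda>\<tau>. ext Ga hmt (bd \<tau>)) x = ext Ga hmt (BD x)"
      using x Suc by (intro raag.ext_ext[symmetric, of x "simp n" _ "simp m" _ "simp (Suc m)"]) (auto intro: bd_closed hc)
    then show ?thesis using Suc by simp
  qed
  ultimately show ?thesis by simp
qed

abbreviation "Mon \<equiv> nonneg_submonoid Ga \<chi>"

text \<open>Fill the cycle anywhere in the cube complex and push the filling up. Each push raises
  \<open>pot\<close> by at least 1 and never lowers \<chi>, and a nonnegative \<open>pot\<close>
  forces a nonnegative \<chi>, so finitely many pushes suffice. The filling has degree j + 1, whence
  j < q.\<close>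

lemma exact_nonneg:
  assumes x: "x \<in> chains Mon (simp j)" "j < q" "if j = 0 then aug (\<lambda>_. 1) x = 0 else BD x = 0"
  shows "\<exists>y\<in>chains Mon (simp (Suc j)). BD y = (x :: _ \<Rightarrow>\<^sub>0 'r)"
proof -
  have car: "carrier Mon = {g\<in>carrier Ga. 0 \<le> \<chi> g}" by (simp add: nonneg_submonoid_def)
  have xG: "x \<in> chains Ga (simp j)" using x(1) by (rule supported_mono) (auto simp: car)
  obtain y0 where y0: "y0 \<in> chains Ga (simp (Suc j))" "BD y0 = x" using BD_exact[OF xG x(3)] by auto
  define K where "K = Max (insert 0 ((\<lambda>c. - pot c) ` keys y0))"
  have K: "- K \<le> pot c" if "c \<in> keys y0" for c
  proof -
    have "- pot c \<le> K" unfolding K_def using that by (intro Max_ge) auto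
    then show ?thesis by simp
  qed
  have hx: "ext Ga hmt x \<in> chains Mon (simp (Suc j))"
    unfolding ext_def
  proof (rule supported_lin[OF x(1)], clarsimp)
    fix g \<tau> assume g: "g \<in> carrier Mon" "\<tau> \<in> simp j"
    show "act Ga g (hmt \<tau>) \<in> chains Mon (simp (Suc j))"
      unfolding act_def
      by (rule supported_lin[OF hmt_closed[OF g(2)]])
        (use g x(2) in \<open>auto simp: car intro!: supported_single\<close>)
  qed
  have "\<exists>y\<in>chains Ga (simp (Suc j)). BD y = x \<and> (\<forall>c\<in>keys y. 0 \<le> \<chi> (fst c) \<or> real N - K \<le> pot c)" for N
  proof (induction N)
    case 0
    then show ?case using y0 K by (intro bexI[of _ y0]) auto
  next
    case (Suc N)
    then obtain y where y: "y \<in> chains Ga (simp (Suc j))" "BD y = x"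
      and yk: "\<And>c. c \<in> keys y \<Longrightarrow> 0 \<le> \<chi> (fst c) \<or> real N - K \<le> pot c" by blast
    \<comment> \<open>With h for \<open>hmt\<close>, the push of y is y - \<partial>h y - h x.
      Adding h x, which already lies at nonnegative level, restores the boundary
      \<open>x\<close>.\<close>
    let ?z = "ext Ga push y + ext Ga hmt x"
    have zG: "ext Ga hmt x \<in> chains Ga (simp (Suc j))" using hx by (rule supported_mono) (auto simp: car)
    let ?A = "{c. 0 \<le> \<chi> (fst c) \<or> real (Suc N) - K \<le> pot c} \<inter> carrier Ga \<times> simp (Suc j)"
    have "ext Ga push y \<in> supported ?A"
      unfolding ext_def
    proof (rule supported_lin[of y "keys y"], simp add: supported_def, clarify)
      fix g \<tau> assume c: "(g, \<tau>) \<in> keys y"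
      then have g: "g \<in> carrier Ga" "\<tau> \<in> simp (Suc j)" using supported_keys[OF y(1) c] by auto
      show "act Ga g (push \<tau>) \<in> supported ?A"
        unfolding act_def
      proof (rule supported_lin[OF push_higher[OF g(2)]])
        show "Suc j \<le> q" using x(2) by simp
        fix d assume d: "d \<in> higher \<tau>"
        obtain h \<rho> where hr: "d = (h, \<rho>)" by force
        have h: "h \<in> carrier Ga" "\<rho> \<in> simp (card \<tau>)" "0 \<le> \<chi> h" "\<delta> \<le> \<chi> h \<or> card (\<rho> - W) < card (\<tau> - W)"
          using d by (auto simp: hr higher_def)
        have \<chi>gh: "\<chi> (g \<otimes>\<^bsub>Ga\<^esub> h) = \<chi> g + \<chi> h" using g h \<chi>_mult by simp
        have "pot (g, \<tau>) + 1 \<le> pot (g \<otimes>\<^bsub>Ga\<^esub> h, \<rho>)"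
        proof -
          have le: "real (card (\<rho> - W)) \<le> real (card V)" "0 \<le> real (card (\<tau> - W))"
            using h(2) flag_V by (auto simp: simp_def intro!: card_mono)
          define X where "X = \<chi> h / \<delta> * (real (card V) + 1)"
          have e: "pot (g \<otimes>\<^bsub>Ga\<^esub> h, \<rho>) - pot (g, \<tau>) = X + real (card (\<tau> - W)) - real (card (\<rho> - W))"
            by (simp add: X_def pot_def \<chi>gh algebra_simps add_divide_distrib)
          have nn: "0 \<le> X" using h(3) \<delta>_pos by (simp add: X_def)
          show ?thesis
          proof (cases "\<delta> \<le> \<chi> h")
            case True
            then have "1 \<le> \<chi> h / \<delta>" using \<delta>_pos by simp
            then have "1 * (real (card V) + 1) \<le> X" unfolding X_def by (intro mult_right_mono) auto
            then have "real (card V) + 1 \<le> X" by simp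
            then show ?thesis using e le by (linarith | smt (verit))
          next
            case False
            then have "card (\<rho> - W) < card (\<tau> - W)" using h by simp
            then show ?thesis using e nn by linarith
          qed
        qed
        then have "(g \<otimes>\<^bsub>Ga\<^esub> h, \<rho>) \<in> ?A" using g h yk[OF c] \<chi>gh by (auto simp: simp_def)
        then show "(case d of (ga, b) \<Rightarrow> Poly_Mapping.single (g \<otimes>\<^bsub>Ga\<^esub> ga, b) 1) \<in> supported ?A"
          by (simp add: hr supported_single)
      qed
    qed
    moreover have "ext Ga hmt x \<in> supported ?A" using hx by (rule supported_mono) (auto simp: car)
    ultimately have z: "?z \<in> supported ?A" by (rule supported_add)
    have "ext Ga push y = y - BD (ext Ga hmt y) - ext Ga hmt x"
      using ext_push[OF y(1)] x(2) y(2) by simp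
    then have "?z = y - BD (ext Ga hmt y)" by simp
    moreover have "ext Ga hmt y \<in> chains Ga (simp (Suc (Suc j)))"
      using x(2) by (intro raag.ext_closed[OF y(1)] supported_mono[OF hmt_closed]) auto
    ultimately have "BD ?z = x" using y by (simp add: ext_diff BD_BD)
    then show ?case using z by (intro bexI[of _ ?z]) (auto simp: supported_def)
  qed
  \<comment> \<open>After at least K pushes the lower bound N - K for \<open>pot\<close> is
    nonnegative.\<close>
  from this[of "nat \<lceil>K\<rceil>"] obtain y where y: "y \<in> chains Ga (simp (Suc j))" "BD y = x"
    and yk: "\<And>c. c \<in> keys y \<Longrightarrow> 0 \<le> \<chi> (fst c) \<or> real (nat \<lceil>K\<rceil>) - K \<le> pot c" by blast
  have "0 \<le> \<chi> (fst c)" if "c \<in> keys y" for c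
  proof (rule ccontr)
    assume n: "\<not> 0 \<le> \<chi> (fst c)"
    have "K \<le> real (nat \<lceil>K\<rceil>)" by linarith
    then have "0 \<le> pot c" using yk[OF that] n by linarith
    moreover have "\<chi> (fst c) / \<delta> * (real (card V) + 1) < 0"
      using n \<delta>_pos by (intro mult_neg_pos divide_neg_pos) auto
    ultimately show False by (simp add: pot_def)
  qed
  then have "y \<in> chains Mon (simp (Suc j))" using y(1) by (fastforce simp: supported_def car)
  then show ?thesis using y(2) by blast
qed

end

end

section \<open>Monoid rings and free modules\<close>

definition pm :: "('c \<Rightarrow> 'r::zero) \<Rightarrow> ('c \<Rightarrow>\<^sub>0 'r)" where "pm f = Abs_poly_mapping f"

lemma lookup_pm: "finite {x. f x \<noteq> 0} \<Longrightarrow> lookup (pm f) = f" by (simp add: pm_def)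
lemma pm_lookup [simp]: "pm (lookup x) = x" by (simp add: pm_def)
lemma keys_pm: "finite {x. f x \<noteq> 0} \<Longrightarrow> keys (pm f) = {x. f x \<noteq> 0}"
  by (auto simp: in_keys_iff lookup_pm)

definition shift :: "('g, 'z) monoid_scheme \<Rightarrow> 'g \<Rightarrow> ('g \<Rightarrow>\<^sub>0 'r::comm_ring_1) \<Rightarrow> ('g \<Rightarrow>\<^sub>0 'r)" where
  "shift M m a = lin (\<lambda>y. Poly_Mapping.single (m \<otimes>\<^bsub>M\<^esub> y) 1) a"
definition conv :: "('g, 'z) monoid_scheme \<Rightarrow> ('g \<Rightarrow>\<^sub>0 'r::comm_ring_1) \<Rightarrow> ('g \<Rightarrow>\<^sub>0 'r) \<Rightarrow> ('g \<Rightarrow>\<^sub>0 'r)" where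
  "conv M a b = lin (\<lambda>x. shift M x b) a"

lemma carrier_monoid_ring: "f \<in> carrier (monoid_ring M) \<longleftrightarrow> (\<exists>a \<in> supported (carrier M). f = lookup a)"
proof
  assume "f \<in> carrier (monoid_ring M)"
  then have f: "finite {x. f x \<noteq> 0}" "{x. f x \<noteq> 0} \<subseteq> carrier M" by (auto simp: monoid_ring_def)
  show "\<exists>a \<in> supported (carrier M). f = lookup a"
    using f(2) lookup_pm[OF f(1)] keys_pm[OF f(1)] by (intro bexI[of _ "pm f"]) (auto simp: supported_def)
qed (auto simp: monoid_ring_def supported_def in_keys_iff)

lemma lookup_carrier [simp]: "lookup a \<in> carrier (monoid_ring M) \<longleftrightarrow> a \<in> supported (carrier M)"
  by (auto simp: monoid_ring_def supported_def in_keys_iff)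

lemma monoid_ring_zero: "\<zero>\<^bsub>monoid_ring M\<^esub> = lookup 0" by (simp add: monoid_ring_def fun_eq_iff)
lemma monoid_ring_one: "\<one>\<^bsub>monoid_ring M\<^esub> = lookup (Poly_Mapping.single \<one>\<^bsub>M\<^esub> 1)"
  by (auto simp: monoid_ring_def fun_eq_iff lookup_single when_def)
lemma monoid_ring_add: "lookup a \<oplus>\<^bsub>monoid_ring M\<^esub> lookup b = lookup (a + b)"
  by (simp add: monoid_ring_def fun_eq_iff lookup_add)
lemma monoid_ring_mult: "lookup a \<otimes>\<^bsub>monoid_ring M\<^esub> lookup b = lookup (conv M a (b :: 'g \<Rightarrow>\<^sub>0 'r::comm_ring_1))"
proof
  fix z
  have "lookup (conv M a b) z =
      (\<Sum>x\<in>keys a. lookup a x * (\<Sum>y\<in>keys b. lookup b y * (if x \<otimes>\<^bsub>M\<^esub> y = z then 1 else 0)))"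
    by (simp add: conv_def shift_def lookup_lin pair_def lookup_single when_def)
  also have "\<dots> = (\<Sum>x\<in>keys a. \<Sum>y\<in>keys b. if x \<otimes>\<^bsub>M\<^esub> y = z then lookup a x * lookup b y else 0)"
    by (auto simp: sum_distrib_left intro!: sum.cong)
  also have "\<dots> = (\<Sum>(x, y)\<in>keys a \<times> keys b. if x \<otimes>\<^bsub>M\<^esub> y = z then lookup a x * lookup b y else 0)"
    by (simp add: sum.cartesian_product)
  also have "\<dots> = (\<Sum>(x, y)\<in>{(x, y). lookup a x \<noteq> 0 \<and> lookup b y \<noteq> 0 \<and> x \<otimes>\<^bsub>M\<^esub> y = z}. lookup a x * lookup b y)"
    by (rule sum.mono_neutral_cong_right) (auto simp: in_keys_iff split: if_splits)
  finally show "(lookup a \<otimes>\<^bsub>monoid_ring M\<^esub> lookup b) z = lookup (conv M a b) z"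
    by (simp add: monoid_ring_def)
qed

lemmas monoid_ring_simps = monoid_ring_zero monoid_ring_one monoid_ring_add monoid_ring_mult

context monoid
begin

lemma shift_closed: "m \<in> carrier G \<Longrightarrow> a \<in> supported (carrier G) \<Longrightarrow> shift G m a \<in> supported (carrier G)"
  unfolding shift_def by (rule supported_lin) (auto intro: supported_single)
lemma conv_closed: "a \<in> supported (carrier G) \<Longrightarrow> b \<in> supported (carrier G) \<Longrightarrow> conv G a b \<in> supported (carrier G)"
  unfolding conv_def by (rule supported_lin) (auto intro: shift_closed)

lemma shift_shift: "x \<in> carrier G \<Longrightarrow> y \<in> carrier G \<Longrightarrow> c \<in> supported (carrier G) \<Longrightarrow>
    shift G x (shift G y c) = shift G (x \<otimes> y) c"
  unfolding shift_def lin_lin by (rule lin_cong_on[of c]) (auto simp: m_assoc)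

lemma shift_conv:
  assumes "x \<in> carrier G" "b \<in> supported (carrier G)" "c \<in> supported (carrier G)"
  shows "lin (\<lambda>z. shift G z c) (shift G x b) = shift G x (conv G b c)"
proof -
  have "lin (\<lambda>z. shift G z c) (shift G x b) = lin (\<lambda>y. shift G (x \<otimes> y) c) b"
    by (simp add: shift_def[of G x b] lin_lin)
  also have "\<dots> = lin (\<lambda>y. shift G x (shift G y c)) b"
    using assms by (intro lin_cong_on[of b]) (auto simp: shift_shift)
  also have "\<dots> = shift G x (conv G b c)" by (simp add: conv_def shift_def[of G x] lin_lin)
  finally show ?thesis .
qed

lemma conv_assoc:
  assumes "a \<in> supported (carrier G)" "b \<in> supported (carrier G)" "c \<in> supported (carrier G)"
  shows "conv G (conv G a b) c = conv G a (conv G b c)"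
proof -
  have "conv G (conv G a b) c = lin (\<lambda>x. lin (\<lambda>z. shift G z c) (shift G x b)) a"
    by (simp add: conv_def[of G _ c] conv_def[of G a b] lin_lin)
  also have "\<dots> = lin (\<lambda>x. shift G x (conv G b c)) a"
    using assms by (intro lin_cong_on[of a]) (auto simp: shift_conv)
  finally show ?thesis by (simp add: conv_def)
qed

lemma ring_monoid_ring: "ring (monoid_ring G :: ('a \<Rightarrow> 'r::comm_ring_1) ring)"
proof (rule ringI)
  let ?S = "monoid_ring G :: ('a \<Rightarrow> 'r) ring"
  note [simp] = monoid_ring_simps
  show "abelian_group ?S"
  proof (rule abelian_groupI)
    fix x assume "x \<in> carrier ?S"
    then obtain a where "a \<in> supported (carrier G)" "x = lookup a" by (auto simp: carrier_monoid_ring)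
    then show "\<exists>y\<in>carrier ?S. y \<oplus>\<^bsub>?S\<^esub> x = \<zero>\<^bsub>?S\<^esub>"
      by (intro bexI[of _ "lookup (- a)"]) (auto simp del: lookup_uminus simp: supported_uminus)
  qed (auto simp: carrier_monoid_ring supported_add ac_simps)
  show "Group.monoid ?S"
  proof (rule monoidI)
    fix x assume "x \<in> carrier ?S"
    then obtain a where a: "a \<in> supported (carrier G)" "x = lookup a" by (auto simp: carrier_monoid_ring)
    have "shift G \<one> a = a" unfolding shift_def
      using lin_cong_on[OF a(1), of _ "\<lambda>y. Poly_Mapping.single y 1"] by auto
    then show "\<one>\<^bsub>?S\<^esub> \<otimes>\<^bsub>?S\<^esub> x = x" by (simp add: a(2) conv_def)
    have "conv G a (Poly_Mapping.single \<one> 1) = lin (\<lambda>x. Poly_Mapping.single x 1) a"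
      unfolding conv_def shift_def by (rule lin_cong_on[OF a(1)]) auto
    then show "x \<otimes>\<^bsub>?S\<^esub> \<one>\<^bsub>?S\<^esub> = x" by (simp add: a(2))
  next
    show "\<one>\<^bsub>?S\<^esub> \<in> carrier ?S" by (simp add: supported_single)
  qed (auto simp: carrier_monoid_ring conv_closed conv_assoc)
qed (auto simp: carrier_monoid_ring monoid_ring_simps conv_def shift_def lin_add lin_fun_add)

end

subsection \<open>Free modules\<close>

lemma free_module_simps:
  "carrier (free_module S I) = {f. (\<forall>i. f i \<in> carrier S) \<and> (\<forall>i. i \<notin> I \<longrightarrow> f i = \<zero>\<^bsub>S\<^esub>) \<and> finite {i. f i \<noteq> \<zero>\<^bsub>S\<^esub>}}"
  "\<zero>\<^bsub>free_module S I\<^esub> = (\<lambda>_. \<zero>\<^bsub>S\<^esub>)" "f \<oplus>\<^bsub>free_module S I\<^esub> g = (\<lambda>i. f i \<oplus>\<^bsub>S\<^esub> g i)"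
  "a \<odot>\<^bsub>free_module S I\<^esub> f = (\<lambda>i. a \<otimes>\<^bsub>S\<^esub> f i)"
  by (simp_all add: free_module_def)

lemma left_module_free:
  fixes S :: "('s, 'z) ring_scheme" and I :: "'i set"
  assumes "ring S" shows "left_module S (free_module S I)"
proof -
  interpret S: ring S by fact
  have fin_add: "finite {i. f i \<oplus>\<^bsub>S\<^esub> g i \<noteq> \<zero>\<^bsub>S\<^esub>}" if "finite {i. f i \<noteq> \<zero>\<^bsub>S\<^esub>}" "finite {i. g i \<noteq> \<zero>\<^bsub>S\<^esub>}" for f g :: "'i \<Rightarrow> 's"
    by (rule finite_subset[OF _ finite_UnI[OF that]]) auto
  have fin_mult: "finite {i. a \<otimes>\<^bsub>S\<^esub> f i \<noteq> \<zero>\<^bsub>S\<^esub>}" if "finite {i. f i \<noteq> \<zero>\<^bsub>S\<^esub>}" "a \<in> carrier S" for a and f :: "'i \<Rightarrow> 's"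
    by (rule finite_subset[OF _ that(1)]) (use that in auto)
  have "abelian_group (free_module S I)"
  proof (rule abelian_groupI)
    fix x assume x: "x \<in> carrier (free_module S I)"
    have "finite {i. \<ominus>\<^bsub>S\<^esub> x i \<noteq> \<zero>\<^bsub>S\<^esub>}"
      by (rule finite_subset[of _ "{i. x i \<noteq> \<zero>\<^bsub>S\<^esub>}"]) (use x in \<open>auto simp: free_module_simps\<close>)
    then show "\<exists>y\<in>carrier (free_module S I). y \<oplus>\<^bsub>free_module S I\<^esub> x = \<zero>\<^bsub>free_module S I\<^esub>"
      using x by (intro bexI[of _ "\<lambda>i. \<ominus>\<^bsub>S\<^esub> x i"]) (auto simp: free_module_simps S.l_neg)
  qed (auto simp: free_module_simps fin_add S.a_assoc, simp_all add: S.a_ac)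
  then show ?thesis
    by (intro left_module.intro assms left_module_axioms.intro)
      (auto simp: free_module_simps fin_mult S.l_distr S.r_distr S.m_assoc)
qed

text \<open>Elements of the free module over a monoid ring are chains.\<close>

definition toch :: "('i \<Rightarrow> 'g \<Rightarrow> 'r::comm_ring_1) \<Rightarrow> ('g \<times> 'i \<Rightarrow>\<^sub>0 'r)" where
  "toch f = pm (\<lambda>(g, i). f i g)"
definition frch :: "('g \<times> 'i \<Rightarrow>\<^sub>0 'r::comm_ring_1) \<Rightarrow> 'i \<Rightarrow> 'g \<Rightarrow> 'r" where
  "frch x = (\<lambda>i g. lookup x (g, i))"
definition sact :: "('g, 'z) monoid_scheme \<Rightarrow> ('g \<Rightarrow>\<^sub>0 'r::comm_ring_1) \<Rightarrow> ('g \<times> 'i \<Rightarrow>\<^sub>0 'r) \<Rightarrow> ('g \<times> 'i \<Rightarrow>\<^sub>0 'r)" where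
  "sact M a x = lin (\<lambda>m. act M m x) a"

lemma toch_frch [simp]: "toch (frch x) = x"
  by (simp add: toch_def frch_def case_prod_eta)

lemma frch_carrier: "x \<in> chains M I \<Longrightarrow> frch x \<in> carrier (free_module (monoid_ring M) I)"
proof -
  assume x: "x \<in> chains M I"
  have f: "finite {g. lookup x (g, i) \<noteq> 0}" for i
    by (rule finite_subset[of _ "fst ` keys x"]) (force simp: in_keys_iff)+
  have "finite {i. (\<lambda>g. lookup x (g, i)) \<noteq> (\<lambda>_. 0)}"
    by (rule finite_subset[of _ "snd ` keys x"]) (force simp: in_keys_iff fun_eq_iff)+
  moreover have "lookup x (g, i) \<noteq> 0 \<Longrightarrow> g \<in> carrier M \<and> i \<in> I" for g i
    using supported_keys[OF x, of "(g, i)"] by (auto simp: in_keys_iff)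
  ultimately show ?thesis using f by (fastforce simp: free_module_simps frch_def monoid_ring_def)
qed

lemma frch_toch:
  assumes "f \<in> carrier (free_module (monoid_ring M) I)"
  shows "frch (toch f) = f" "toch f \<in> chains M I"
proof -
  have f: "finite {g. f i g \<noteq> 0}" "f i g \<noteq> 0 \<Longrightarrow> g \<in> carrier M \<and> i \<in> I" for i g
    using assms by (auto simp: free_module_simps monoid_ring_def)
  have "finite {i. f i \<noteq> (\<lambda>_. 0)}" using assms by (auto simp: free_module_simps monoid_ring_def)
  then have "finite (\<Union>i\<in>{i. f i \<noteq> (\<lambda>_. 0)}. (\<lambda>g. (g, i)) ` {g. f i g \<noteq> 0})" using f by auto
  then have fin: "finite {c. (case c of (g, i) \<Rightarrow> f i g) \<noteq> 0}"
    by (rule rev_finite_subset) (auto simp: fun_eq_iff)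
  show "frch (toch f) = f" by (simp add: frch_def toch_def lookup_pm[OF fin])
  show "toch f \<in> chains M I" using f by (auto simp: supported_def toch_def keys_pm[OF fin])
qed

lemma frch_add: "frch x \<oplus>\<^bsub>free_module (monoid_ring M) I\<^esub> frch y = frch (x + y)"
  by (simp add: free_module_simps frch_def monoid_ring_def lookup_add)
lemma frch_zero: "\<zero>\<^bsub>free_module (monoid_ring M) I\<^esub> = frch 0"
  by (simp add: free_module_simps frch_def monoid_ring_def)

lemma frch_smult: "lookup a \<odot>\<^bsub>free_module (monoid_ring M) I\<^esub> frch x = frch (sact M a x)"
proof
  fix i
  define xi where "xi = lin (\<lambda>(g, j). if j = i then Poly_Mapping.single g 1 else 0) x"
  have xi: "frch x i = lookup xi"
  proof
    fix g
    have "lookup xi g = pair (\<lambda>c. if c = (g, i) then 1 else 0) x"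
      by (auto simp: xi_def lookup_lin lookup_single when_def split_def intro!: pair_cong)
    also have "\<dots> = lookup x (g, i)" by (simp add: pair_def if_distrib[of "\<lambda>t. _ * t"] in_keys_iff cong: if_cong)
    finally show "frch x i g = lookup xi g" by (simp add: frch_def)
  qed
  have "lookup (conv M a xi) g = lookup (sact M a x) (g, i)" for g
  proof -
    have "lookup (shift M m xi) g = lookup (act M m x) (g, i)" for m
      by (auto simp: shift_def xi_def act_def lin_lin lookup_lin lookup_single when_def split_def intro!: pair_cong)
    then show ?thesis by (simp add: conv_def sact_def lookup_lin)
  qed
  then show "(lookup a \<odot>\<^bsub>free_module (monoid_ring M) I\<^esub> frch x) i = frch (sact M a x) i"
    by (simp add: free_module_simps(4) xi monoid_ring_mult) (simp add: frch_def fun_eq_iff)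
qed

lemma sact_single [simp]: "sact M (Poly_Mapping.single m r) x = scale r (act M m x)" by (simp add: sact_def)

context monoid begin

lemma sact_in_submod: "submod G Y \<Longrightarrow> a \<in> supported (carrier G) \<Longrightarrow> x \<in> Y \<Longrightarrow> sact G a x \<in> Y"
  unfolding sact_def lin_def
  by (intro submod_sum submod_scale submod_act) (auto dest: supported_keys)

lemma eqlin_sact: assumes "submod G Y" "eqlin G Y d" "a \<in> supported (carrier G)" "x \<in> Y"
  shows "d (sact G a x) = sact G a (d x)"
proof -
  have *: "m \<in> keys a \<Longrightarrow> m \<in> carrier G" for m using assms(3) by (auto dest: supported_keys)
  have "d (sact G a x) = (\<Sum>m\<in>keys a. d (scale (lookup a m) (act G m x)))"
    unfolding sact_def lin_def using * by (intro eqlin_sum[OF assms(1,2)] submod_scale[OF assms(1)] submod_act[OF assms(1)] assms(4))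
  also have "\<dots> = (\<Sum>m\<in>keys a. scale (lookup a m) (act G m (d x)))"
    using * by (intro sum.cong) (auto simp: eqlin_scale[OF assms(2)] eqlin_act[OF assms(2)] submod_act[OF assms(1)] assms(4))
  finally show ?thesis by (simp add: sact_def lin_def)
qed

lemma linear_maps_frch:
  assumes d: "\<And>x. x \<in> chains G I \<Longrightarrow> d x \<in> chains G J" and lin: "eqlin G (chains G I) d"
  shows "(\<lambda>f. frch (d (toch f))) \<in> linear_maps (monoid_ring G) (free_module (monoid_ring G) I) (free_module (monoid_ring G) J)"
proof -
  let ?F = "free_module (monoid_ring G)"
  have 1: "(\<lambda>f. frch (d (toch f))) \<in> carrier (?F I) \<rightarrow> carrier (?F J)"
    by (auto intro!: frch_carrier d frch_toch)
  have 2: "frch (d (toch (f \<oplus>\<^bsub>?F I\<^esub> h))) = frch (d (toch f)) \<oplus>\<^bsub>?F J\<^esub> frch (d (toch h))"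
    if fh: "f \<in> carrier (?F I)" "h \<in> carrier (?F I)" for f h
  proof -
    have "f \<oplus>\<^bsub>?F I\<^esub> h = frch (toch f + toch h)" using fh frch_toch(1) by (metis frch_add)
    then show ?thesis using frch_toch(2)[OF fh(1)] frch_toch(2)[OF fh(2)] by (simp add: frch_add eqlin_add[OF lin])
  qed
  have 3: "frch (d (toch (a \<odot>\<^bsub>?F I\<^esub> f))) = a \<odot>\<^bsub>?F J\<^esub> frch (d (toch f))"
    if a: "a \<in> carrier (monoid_ring G)" and f: "f \<in> carrier (?F I)" for a f
  proof -
    obtain b where b: "b \<in> supported (carrier G)" "a = lookup b" using a by (auto simp: carrier_monoid_ring)
    have "a \<odot>\<^bsub>?F I\<^esub> f = frch (sact G b (toch f))" using frch_toch(1)[OF f] b by (metis frch_smult)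
    then show ?thesis
      using eqlin_sact[OF submod_chains lin b(1) frch_toch(2)[OF f]] b by (simp add: frch_smult)
  qed
  show ?thesis using 1 2 3 by (auto simp: linear_maps_def)
qed

text \<open>Projectivity asks for a free module whose basis lies in the element type of the module
  itself. So the index n is replaced by the unit vector \<open>h n\<close>; these are distinct
  because 1 and 0 differ.\<close>

lemma projective_free: "projective_module (monoid_ring G :: ('a \<Rightarrow> 'r::comm_ring_1) ring) (free_module (monoid_ring G) (B :: nat set))"
proof -
  let ?S = "monoid_ring G :: ('a \<Rightarrow> 'r) ring"
  let ?F = "free_module ?S B"
  define h :: "nat \<Rightarrow> nat \<Rightarrow> ('a \<Rightarrow> 'r)" where "h n = (\<lambda>m. if m = n then \<one>\<^bsub>?S\<^esub> else \<zero>\<^bsub>?S\<^esub>)" for n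
  have ne: "\<one>\<^bsub>?S\<^esub> \<noteq> \<zero>\<^bsub>?S\<^esub>" by (auto simp: monoid_ring_def fun_eq_iff)
  have h: "h m = h n \<longleftrightarrow> m = n" for m n using ne by (auto simp: h_def fun_eq_iff)
  let ?F' = "free_module ?S (h ` B)"
  define \<iota> where "\<iota> f = (\<lambda>j. if j \<in> h ` B then f (THE n. h n = j) else \<zero>\<^bsub>?S\<^esub>)" for f :: "nat \<Rightarrow> ('a \<Rightarrow> 'r)"
  define \<rho> where "\<rho> f = (\<lambda>n. if n \<in> B then f (h n) else \<zero>\<^bsub>?S\<^esub>)" for f :: "(nat \<Rightarrow> ('a \<Rightarrow> 'r)) \<Rightarrow> ('a \<Rightarrow> 'r)"
  have the: "(THE n. h n = h m) = m" for m by (simp add: h)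
  interpret S: ring ?S by (rule ring_monoid_ring)
  have "\<iota> f \<in> carrier ?F'" if f: "f \<in> carrier ?F" for f
  proof -
    have "finite (h ` {i. f i \<noteq> \<zero>\<^bsub>?S\<^esub>})" using f by (auto simp: free_module_simps)
    then have "finite {j. \<iota> f j \<noteq> \<zero>\<^bsub>?S\<^esub>}" by (rule rev_finite_subset) (auto simp: \<iota>_def the split: if_splits)
    then show ?thesis using f by (auto simp: free_module_simps \<iota>_def)
  qed
  then have 1: "\<iota> \<in> linear_maps ?S ?F ?F'"
    by (auto simp: linear_maps_def free_module_simps(3,4)) (auto simp: \<iota>_def fun_eq_iff)
  have "\<rho> f \<in> carrier ?F" if f: "f \<in> carrier ?F'" for f
  proof -
    have "finite (h -` {i. f i \<noteq> \<zero>\<^bsub>?S\<^esub>})" using f h by (intro finite_vimageI) (auto simp: free_module_simps inj_on_def)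
    then have "finite {j. \<rho> f j \<noteq> \<zero>\<^bsub>?S\<^esub>}" by (rule rev_finite_subset) (auto simp: \<rho>_def)
    then show ?thesis using f by (auto simp: free_module_simps \<rho>_def)
  qed
  then have 2: "\<rho> \<in> linear_maps ?S ?F' ?F"
    by (auto simp: linear_maps_def free_module_simps(3,4)) (auto simp: \<rho>_def fun_eq_iff)
  have "\<rho> (\<iota> f) = f" if "f \<in> carrier ?F" for f
  proof
    fix n
    have "n \<notin> B \<Longrightarrow> f n = \<zero>\<^bsub>?S\<^esub>" using that by (simp add: free_module_simps)
    then show "\<rho> (\<iota> f) n = f n" by (cases "n \<in> B") (simp_all add: \<rho>_def \<iota>_def the)
  qed
  then show ?thesis unfolding projective_module_def
    by (intro conjI left_module_free[OF ring_monoid_ring] exI[of _ "h ` B"] bexI[OF _ 1] bexI[OF _ 2] ballI)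
qed

lemma fin_gen_free: fixes B :: "'i set" assumes "finite B" shows "fin_gen_module (monoid_ring G :: ('a \<Rightarrow> 'r::comm_ring_1) ring) (free_module (monoid_ring G) B)"
proof -
  let ?S = "monoid_ring G :: ('a \<Rightarrow> 'r) ring"
  let ?F = "free_module ?S B"
  interpret S: ring ?S by (rule ring_monoid_ring)
  interpret F: left_module ?S ?F by (rule left_module_free[OF ring_monoid_ring])
  define e where "e n = (\<lambda>m. if m = n then \<one>\<^bsub>?S\<^esub> else \<zero>\<^bsub>?S\<^esub>)" for n :: 'i
  have ne: "\<one>\<^bsub>?S\<^esub> \<noteq> \<zero>\<^bsub>?S\<^esub>" by (auto simp: monoid_ring_def fun_eq_iff)
  have e_inj: "inj_on e B" using ne by (auto simp: e_def fun_eq_iff inj_on_def)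
  have e_car: "e n \<in> carrier ?F" if "n \<in> B" for n
    using that by (auto simp: free_module_simps e_def)
  have gen: "\<exists>a\<in>e ` B \<rightarrow> carrier ?S. f = (\<Oplus>\<^bsub>?F\<^esub>x\<in>e ` B. a x \<odot>\<^bsub>?F\<^esub> x)" if f: "f \<in> carrier ?F" for f
  proof
    let ?a = "\<lambda>x. f (inv_into B e x)"
    show a: "?a \<in> e ` B \<rightarrow> carrier ?S" using f by (auto simp: free_module_simps)
    have "A \<subseteq> B \<Longrightarrow> (\<Oplus>\<^bsub>?F\<^esub>x\<in>e ` A. ?a x \<odot>\<^bsub>?F\<^esub> x) = (\<lambda>i. if i \<in> A then f i else \<zero>\<^bsub>?S\<^esub>)" if "finite A" for A
      using that
    proof (induction A rule: finite_induct)
      case empty then show ?case by (simp add: free_module_simps)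
    next
      case (insert n A)
      have t: "?a (e n) \<odot>\<^bsub>?F\<^esub> e n = (\<lambda>i. if i = n then f n else \<zero>\<^bsub>?S\<^esub>)"
      proof
        fix i
        have "inv_into B e (e n) = n" using insert.prems e_inj by simp
        moreover have "f n \<in> carrier ?S" using f by (simp add: free_module_simps)
        ultimately show "(?a (e n) \<odot>\<^bsub>?F\<^esub> e n) i = (if i = n then f n else \<zero>\<^bsub>?S\<^esub>)"
          by (simp add: free_module_simps(4)) (simp add: e_def)
      qed
      have "?a x \<odot>\<^bsub>?F\<^esub> x \<in> carrier ?F" if "x \<in> e ` insert n A" for x
      proof (rule F.smult_closed)
        show "x \<in> carrier ?F" using that insert.prems e_car by auto
        show "?a x \<in> carrier ?S" using f by (simp add: free_module_simps)
      qed
      moreover have "e n \<notin> e ` A" using insert e_inj by (auto simp: inj_on_def)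
      ultimately have "(\<Oplus>\<^bsub>?F\<^esub>x\<in>e ` insert n A. ?a x \<odot>\<^bsub>?F\<^esub> x) =
          ?a (e n) \<odot>\<^bsub>?F\<^esub> e n \<oplus>\<^bsub>?F\<^esub> (\<Oplus>\<^bsub>?F\<^esub>x\<in>e ` A. ?a x \<odot>\<^bsub>?F\<^esub> x)"
        using insert.hyps by (simp add: F.M.finsum_insert Pi_def)
      also have "\<dots> = (\<lambda>i. if i \<in> insert n A then f i else \<zero>\<^bsub>?S\<^esub>)"
      proof -
        have IH: "(\<Oplus>\<^bsub>?F\<^esub>x\<in>e ` A. ?a x \<odot>\<^bsub>?F\<^esub> x) = (\<lambda>i. if i \<in> A then f i else \<zero>\<^bsub>?S\<^esub>)"
          using insert.IH insert.prems by simp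
        have fc: "f i \<in> carrier ?S" for i using f by (simp add: free_module_simps)
        show ?thesis unfolding t IH free_module_simps(3) by (rule ext) (use insert.hyps fc in auto)
      qed
      finally show ?case .
    qed
    from this[OF assms] have "(\<Oplus>\<^bsub>?F\<^esub>x\<in>e ` B. ?a x \<odot>\<^bsub>?F\<^esub> x) = (\<lambda>i. if i \<in> B then f i else \<zero>\<^bsub>?S\<^esub>)" by simp
    also have "\<dots> = f" by (rule ext) (use f in \<open>auto simp: free_module_simps\<close>)
    finally show "f = (\<Oplus>\<^bsub>?F\<^esub>x\<in>e ` B. ?a x \<odot>\<^bsub>?F\<^esub> x)" by simp
  qed
  have sub: "e ` B \<subseteq> carrier ?F" using e_car by blast
  show ?thesis unfolding fin_gen_module_def
    by (intro exI[of _ "e ` B"] conjI ballI finite_imageI[OF assms] sub gen)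
qed

text \<open>Bases consisting of naturals give the modules the element type
  \<open>nat \<Rightarrow> 's\<close> that \<open>type_FP\<close> prescribes.\<close>

lemma type_FP_if_free_resolution:
  fixes B :: "nat \<Rightarrow> nat set" and a :: "nat \<Rightarrow> 'r::comm_ring_1"
  assumes X: "exact_complex G (\<lambda>n. chains G (B n)) d a" and fin: "\<And>n. n \<le> q \<Longrightarrow> finite (B n)"
  shows "type_FP q (monoid_ring G :: ('a \<Rightarrow> 'r) ring) (trivial_module :: ('a \<Rightarrow> 'r, 'r) module)"
proof -
  interpret X: exact_complex G "\<lambda>n. chains G (B n)" d a by fact
  let ?S = "monoid_ring G :: ('a \<Rightarrow> 'r) ring"
  let ?T = "trivial_module :: ('a \<Rightarrow> 'r, 'r) module"
  let ?P = "\<lambda>n. free_module ?S (B n)"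
  let ?d = "\<lambda>n f. frch (d n (toch f))"
  let ?e = "\<lambda>f. aug a (toch f)"
  have car: "carrier (?P n) = frch ` (chains G (B n) :: (_ \<Rightarrow>\<^sub>0 'r) set)" for n
  proof (intro equalityI subsetI)
    fix f assume f: "f \<in> carrier (?P n)"
    show "f \<in> frch ` (chains G (B n) :: (_ \<Rightarrow>\<^sub>0 'r) set)"
      using imageI[OF frch_toch(2)[OF f], of frch] unfolding frch_toch(1)[OF f] .
  next
    fix f assume "f \<in> frch ` (chains G (B n) :: (_ \<Rightarrow>\<^sub>0 'r) set)"
    then show "f \<in> carrier (?P n)" using frch_carrier by blast
  qed
  have eps: "?e \<in> linear_maps ?S (?P 0) ?T"
  proof -
    have "aug a (sact G b x) = (\<Sum>g\<in>{g. lookup b g \<noteq> 0}. lookup b g) * aug a x" for b x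
      by (simp add: sact_def lin_def aug_sum aug_scale sum_distrib_right in_keys_iff[abs_def] keys.rep_eq)
    then show ?thesis
      by (auto simp: linear_maps_def car carrier_monoid_ring frch_add frch_smult trivial_module_def aug_add)
  qed
  have d: "?d n \<in> linear_maps ?S (?P (Suc n)) (?P n)" for n
    by (rule linear_maps_frch) (use X.d_closed X.d_eqlin in auto)
  have e_surj: "?e ` carrier (?P 0) = carrier ?T"
  proof -
    obtain y where y: "y \<in> chains G (B 0)" "aug a y = 1" using X.aug_surj by auto
    have "r \<in> ?e ` carrier (?P 0)" for r
      using y by (auto simp: car image_iff aug_scale supported_scale intro!: bexI[of _ "scale r y"])
    then show ?thesis by (auto simp: trivial_module_def)
  qed
  have inj: "frch x = frch y \<longleftrightarrow> x = y" for x y :: "'a \<times> nat \<Rightarrow>\<^sub>0 'r" using toch_frch by metis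
  have ex0: "{x \<in> carrier (?P 0). ?e x = \<zero>\<^bsub>?T\<^esub>} = ?d 0 ` carrier (?P (Suc 0))"
  proof -
    have "{x \<in> chains G (B 0). aug a x = 0} = d 0 ` chains G (B (Suc 0))"
      using X.exact0 X.d_closed X.aug_d by (auto simp: image_iff)
    then have "frch ` {x \<in> chains G (B 0). aug a x = 0} = frch ` d 0 ` chains G (B (Suc 0))" by simp
    then show ?thesis by (auto simp: car image_image trivial_module_def image_iff inj X.aug_d)
  qed
  have exS: "{x \<in> carrier (?P (Suc i)). ?d i x = \<zero>\<^bsub>?P i\<^esub>} = ?d (Suc i) ` carrier (?P (Suc (Suc i)))" for i
  proof -
    have "{x \<in> chains G (B (Suc i)). d i x = 0} = d (Suc i) ` chains G (B (Suc (Suc i)))"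
      using X.exactS X.d_closed X.d_d by (auto simp: image_iff)
    then have "frch ` {x \<in> chains G (B (Suc i)). d i x = 0} = frch ` d (Suc i) ` chains G (B (Suc (Suc i)))" by simp
    then show ?thesis by (auto simp: car image_image frch_zero image_iff inj X.d_d)
  qed
  show ?thesis unfolding type_FP_def
    by (intro exI[of _ ?P] exI[of _ ?d] exI[of _ ?e] conjI allI impI projective_free
      fin_gen_free[OF fin] eps d e_surj ex0 exS)
qed

end

section \<open>From the live complex to finiteness properties\<close>

text \<open>Common to the integers and to fields, and what elimination needs: the leading
  coefficients occurring in a submodule are the multiples of a single one.\<close>

definition principal_ideals :: "'r::comm_ring_1 itself \<Rightarrow> bool" where
  "principal_ideals R \<longleftrightarrow> (\<forall>I :: 'r set. 0 \<in> I \<longrightarrow> (\<forall>x\<in>I. \<forall>y\<in>I. x + y \<in> I) \<longrightarrow> (\<forall>r. \<forall>x\<in>I. r * x \<in> I) \<longrightarrow>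
     (\<exists>d\<in>I. \<forall>x\<in>I. \<exists>r. x = r * d))"

lemma principal_ideals_field: "principal_ideals TYPE('k::field)"
  unfolding principal_ideals_def
proof (intro allI impI)
  fix I :: "'k set" assume I: "0 \<in> I"
  show "\<exists>d\<in>I. \<forall>x\<in>I. \<exists>r. x = r * d"
  proof (cases "I = {0}")
    case False
    then obtain d where d: "d \<in> I" "d \<noteq> 0" using I by blast
    have "x = (x / d) * d" for x using d(2) by simp
    then show ?thesis using d(1) by blast
  qed auto
qed

lemma principal_ideals_int: "principal_ideals TYPE(int)"
  unfolding principal_ideals_def
proof (intro allI impI)
  fix I :: "int set" assume I: "0 \<in> I" "\<forall>x\<in>I. \<forall>y\<in>I. x + y \<in> I" "\<forall>r. \<forall>x\<in>I. r * x \<in> I"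
  show "\<exists>d\<in>I. \<forall>x\<in>I. \<exists>r. x = r * d"
  proof (cases "I = {0}")
    case False
    then obtain a where a: "a \<in> I" "a \<noteq> 0" using I(1) by blast
    then have "\<bar>a\<bar> \<in> I" using I(3)[rule_format, of a "sgn a"] by (simp add: abs_sgn mult.commute)
    then have ex: "nat \<bar>a\<bar> > 0 \<and> int (nat \<bar>a\<bar>) \<in> I" using a(2) by simp
    define d where "d = (LEAST m. m > 0 \<and> int m \<in> I)"
    have d: "d > 0" "int d \<in> I" using LeastI[of "\<lambda>m. m > 0 \<and> int m \<in> I", OF ex] by (auto simp: d_def)
    have "x = (x div int d) * int d" if x: "x \<in> I" for x
    proof -
      have "x mod int d = x + (- (x div int d)) * int d" by (simp add: minus_div_mult_eq_mod[symmetric])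
      then have "x mod int d \<in> I" using I(2)[rule_format, OF x I(3)[rule_format, OF d(2), of "- (x div int d)"]] by simp
      moreover have m: "0 \<le> x mod int d" "x mod int d < int d" using d(1) by simp_all
      ultimately have "nat (x mod int d) > 0 \<Longrightarrow> d \<le> nat (x mod int d)" unfolding d_def by (intro Least_le) simp
      then have "x mod int d = 0" using m by linarith
      then show ?thesis by (simp add: minus_mod_eq_div_mult[symmetric])
    qed
    then show ?thesis using d(2) by blast
  qed auto
qed

text \<open>Gaussian elimination along an enumeration of the basis: for each position n choose an
  element of \<open>N\<close> supported up to n whose coefficient at n generates the ideal of all
  such coefficients. Subtracting multiples of the chosen elements shortens any element of
  \<open>N\<close> down to 0. No countability of the ring enters.\<close>

lemma countably_generated:
  fixes N :: "('c \<Rightarrow>\<^sub>0 'r::comm_ring_1) set"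
  assumes R: "principal_ideals TYPE('r)" and C: "countable C" and N: "N \<subseteq> supported C"
    and N0: "0 \<in> N" and N_add: "\<And>x y. x \<in> N \<Longrightarrow> y \<in> N \<Longrightarrow> x + y \<in> N" and N_scale: "\<And>r x. x \<in> N \<Longrightarrow> scale r x \<in> N"
  shows "\<exists>z :: nat \<Rightarrow> _. range z \<subseteq> N \<and> (\<forall>x\<in>N. \<exists>r. x = lin z r)"
proof -
  define enc where "enc = to_nat_on C"
  have enc: "c \<in> C \<Longrightarrow> c' \<in> C \<Longrightarrow> enc c = enc c' \<Longrightarrow> c = c'" for c c'
    using inj_on_to_nat_on[OF C] by (auto simp: enc_def dest: inj_onD)
  define lead where "lead n = pair (\<lambda>c. if enc c = n then 1 else (0::'r))" for n
  define F where "F n = {x\<in>N. \<forall>c\<in>keys x. enc c < Suc n}" for n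
  have F0: "0 \<in> F n" for n using N0 by (simp add: F_def)
  have F_add: "x + y \<in> F n" if "x \<in> F n" "y \<in> F n" for x y n
    using that N_add keys_add[of x y] by (auto simp: F_def)
  have F_scale: "scale r x \<in> F n" if "x \<in> F n" for r x n
    using that N_scale keys_scale[of r x] by (auto simp: F_def)
  have "\<exists>z\<in>F n. \<forall>x\<in>F n. \<exists>r. lead n x = r * lead n z" for n
  proof -
    let ?I = "lead n ` F n"
    have "0 \<in> ?I" using F0[of n] by (force simp: lead_def)
    moreover have "\<forall>x\<in>?I. \<forall>y\<in>?I. x + y \<in> ?I"
      using F_add by (force simp: lead_def simp flip: pair_add)
    moreover have "\<forall>r. \<forall>x\<in>?I. r * x \<in> ?I"
      using F_scale by (force simp: lead_def simp flip: pair_scale)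
    ultimately have "\<exists>d\<in>?I. \<forall>x\<in>?I. \<exists>r. x = r * d" using R unfolding principal_ideals_def by blast
    then show ?thesis by auto
  qed
  then obtain z where z: "\<And>n. z n \<in> F n" "\<And>n x. x \<in> F n \<Longrightarrow> \<exists>r. lead n x = r * lead n (z n)" by metis
  have span: "x \<in> N \<Longrightarrow> (\<forall>c\<in>keys x. enc c < n) \<Longrightarrow> \<exists>r. x = lin z r" for n x
  proof (induction n arbitrary: x)
    case 0
    then have "x = 0" by (metis keys_eq_empty not_less0 ex_in_conv)
    then show ?case by (intro exI[of _ 0]) simp
  next
    case (Suc n)
    then have x: "x \<in> F n" by (simp add: F_def)
    then obtain r where r: "lead n x = r * lead n (z n)" using z by blast
    define x' where "x' = x + scale (- r) (z n)"
    have x': "x' \<in> F n" unfolding x'_def by (intro F_add F_scale x z)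
    have lead0: "lead n x' = 0" by (simp add: x'_def lead_def pair_add pair_scale) (use r in \<open>simp add: lead_def\<close>)
    have "enc c < n" if c: "c \<in> keys x'" for c
    proof (rule ccontr)
      assume "\<not> enc c < n"
      then have e: "enc c = n" using x' c by (auto simp: F_def)
      have C': "c' \<in> keys x' \<Longrightarrow> c' \<in> C" for c' using x' N by (auto simp: F_def supported_def)
      have "lead n x' = (\<Sum>c'\<in>keys x'. if c' = c then lookup x' c' else 0)"
        unfolding lead_def pair_def using e enc C' c by (intro sum.cong) auto
      then have "lookup x' c = 0" using lead0 c by simp
      then show False using c by (simp add: in_keys_iff)
    qed
    then obtain r' where "x' = lin z r'" using Suc.IH[of x'] x' by (auto simp: F_def)
    then have "x = lin z (r' + Poly_Mapping.single n r)"
      by (simp add: lin_add x'_def scale_neg algebra_simps)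
    then show ?case by blast
  qed
  have "\<exists>r. x = lin z r" if "x \<in> N" for x
  proof (rule span[OF that, of "Suc (Max (insert 0 (enc ` keys x)))"], rule ballI)
    fix c assume "c \<in> keys x"
    then have "enc c \<le> Max (insert 0 (enc ` keys x))" by (intro Max_ge) auto
    then show "enc c < Suc (Max (insert 0 (enc ` keys x)))" by simp
  qed
  moreover have "range z \<subseteq> N" using z(1) by (auto simp: F_def)
  ultimately show ?thesis by blast
qed

context monoid begin

text \<open>As the monoid is countable, the free module has countable rank already over the
  coefficients, and generators over the coefficients also generate over the monoid ring.\<close>

lemma submod_generated:
  fixes Z :: "('a \<times> nat \<Rightarrow>\<^sub>0 'r::comm_ring_1) set"
  assumes R: "principal_ideals TYPE('r)" and C: "countable (carrier G)" and Z: "submod G Z"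
  shows "\<exists>D :: nat \<Rightarrow> _. range D \<subseteq> Z \<and> (\<forall>x\<in>Z. \<exists>y\<in>chains G UNIV. ext G D y = x)"
proof -
  have "countable (carrier G \<times> (UNIV :: nat set))" using C by auto
  moreover have "Z \<subseteq> chains G UNIV" using submod_sub[OF Z] by blast
  ultimately obtain D :: "nat \<Rightarrow> _" where D: "range D \<subseteq> Z" "\<And>x. x \<in> Z \<Longrightarrow> \<exists>r. x = lin D r"
    using countably_generated[OF R _ _ submod_zero[OF Z] submod_add[OF Z] submod_scale[OF Z]] by metis
  have "\<exists>y\<in>chains G UNIV. ext G D y = x" if x: "x \<in> Z" for x
  proof -
    obtain r where r: "x = lin D r" using D(2) x by blast
    have "ext G D (lin (\<lambda>j. Poly_Mapping.single (\<one>, j) 1) r) = lin (\<lambda>j. act G \<one> (D j)) r"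
      by (simp add: ext_def lin_lin)
    also have "\<dots> = lin D r"
      using D(1) submod_sub[OF Z] by (intro lin_cong act_one[of _ UNIV]) auto
    finally show ?thesis using r
      by (intro bexI[of _ "lin (\<lambda>j. Poly_Mapping.single (\<one>, j) 1) r"])
        (auto intro!: supported_lin[of r UNIV] supported_single simp: supported_def[of UNIV])
  qed
  then show ?thesis using D(1) by blast
qed

end

lemma act_nonneg [simp]: "act (nonneg_submonoid G \<chi>) = act G"
  by (simp add: fun_eq_iff act_def nonneg_submonoid_def)
lemma ext_nonneg [simp]: "ext (nonneg_submonoid G \<chi>) = ext G"
  by (simp add: fun_eq_iff ext_def)

context simple_graph begin

lemma countable_carrier: "countable (carrier Ga)"
  unfolding carrier_raag words_def by (intro countable_image countable_lists countable_finite) simp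

end

context raag_character begin

lemma monoid_nonneg: "Group.monoid (nonneg_submonoid Ga \<chi>)"
  by (rule monoidI) (auto simp: nonneg_submonoid_def \<chi>_mult raag.m_assoc)

text \<open>Up to degree q the resolution consists of the cubes with nonnegative \<chi>, free on
  finitely many simplices. Its homology vanishes below degree q by \<open>exact_nonneg\<close>; from
  there on free modules of countable rank cover the kernels.\<close>

theorem type_FP_if_lexact:
  assumes L: "lexact W q TYPE('r::comm_ring_1)" and R: "principal_ideals TYPE('r)"
  shows "type_FP q (monoid_ring (nonneg_submonoid Ga \<chi>) :: (_ \<Rightarrow> 'r) ring) (trivial_module :: (_ \<Rightarrow> 'r, 'r) module)"
proof -
  let ?M = "nonneg_submonoid Ga \<chi>"
  interpret M: Group.monoid ?M by (rule monoid_nonneg)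
  have carM: "carrier ?M = {g\<in>carrier Ga. 0 \<le> \<chi> g}" by (simp add: nonneg_submonoid_def)
  have oneM: "\<one>\<^bsub>?M\<^esub> = \<one>\<^bsub>Ga\<^esub>" by (simp add: nonneg_submonoid_def)
  have cM: "countable (carrier ?M)" using countable_subset[OF _ countable_carrier] by (auto simp: carM)
  obtain s :: "_ \<Rightarrow> (_ \<Rightarrow>\<^sub>0 'r)" where s: "contraction W q s" using lexact_contraction[OF L] by blast
  define enc where "enc = to_nat_on \<Delta>"
  define dec where "dec = inv_into \<Delta> enc"
  have dec: "dec (enc \<tau>) = \<tau>" if "\<tau> \<in> \<Delta>" for \<tau>
    using that inj_on_to_nat_on[OF countable_finite[OF finite_flag]] by (simp add: dec_def enc_def)
  \<comment> \<open>The resolution is to have bases of naturals: \<open>rx\<close> renames simplices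
    by their codes, and \<open>ry\<close> renames them back.\<close>
  define rx :: "(('v \<times> bool) list set \<times> 'v set \<Rightarrow>\<^sub>0 'r) \<Rightarrow> (('v \<times> bool) list set \<times> nat \<Rightarrow>\<^sub>0 'r)" where "rx = lin (\<lambda>(g, \<tau>). Poly_Mapping.single (g, enc \<tau>) 1)"
  define ry :: "(('v \<times> bool) list set \<times> nat \<Rightarrow>\<^sub>0 'r) \<Rightarrow> (('v \<times> bool) list set \<times> 'v set \<Rightarrow>\<^sub>0 'r)" where "ry = lin (\<lambda>(g, j). Poly_Mapping.single (g, dec j) 1)"
  \<comment> \<open>Finite up to degree q, as finite generation demands; above, one generator for
    each natural number.\<close>
  define B where "B n = (if n \<le> q then enc ` simp n else UNIV)" for n
  have rx_closed: "rx x \<in> chains ?M (enc ` A)" if "x \<in> chains ?M A" for x A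
    unfolding rx_def by (rule supported_lin[OF that]) (auto intro: supported_single)
  have ry_closed: "ry x \<in> chains ?M (simp n)" if "x \<in> chains ?M (enc ` simp n)" for x n
    unfolding ry_def by (rule supported_lin[OF that]) (auto intro!: supported_single simp: dec simp_def)
  have rx_ry: "rx (ry x) = x" if "x \<in> chains ?M (enc ` simp n)" for x n
    unfolding rx_def ry_def lin_lin
    by (rule HOL.trans[OF lin_cong_on[OF that, of _ "\<lambda>c. Poly_Mapping.single c 1"]]) (auto simp: dec simp_def)
  have ry_rx: "ry (rx x) = x" if "x \<in> chains ?M (simp n)" for x n
    unfolding rx_def ry_def lin_lin
    by (rule HOL.trans[OF lin_cong_on[OF that, of _ "\<lambda>c. Poly_Mapping.single c 1"]]) (auto simp: dec simp_def)
  have rx_aug: "aug (\<lambda>_. 1) (rx x) = aug (\<lambda>_. 1) x" for x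
    by (simp add: rx_def aug_def pair_lin split_def)
  define Dfix where "Dfix j = rx (bd (dec j))" for j
  have rx_act: "rx (act Ga g x) = act Ga g (rx x)" for g x
    by (simp add: rx_def act_def lin_lin split_def)
  have ext_rx: "ext Ga Dfix (rx x) = rx (ext Ga bd x)" if "x \<in> chains ?M (simp n)" for x n
  proof -
    have "ext Ga Dfix (rx x) = lin (\<lambda>(g, \<tau>). act Ga g (Dfix (enc \<tau>))) x"
      by (simp add: ext_def rx_def lin_lin split_def)
    also have "\<dots> = lin (\<lambda>(g, \<tau>). rx (act Ga g (bd \<tau>))) x"
      by (rule lin_cong_on[OF that]) (auto simp: Dfix_def dec simp_def rx_act)
    also have "\<dots> = rx (ext Ga bd x)" by (simp add: ext_def rx_def lin_lin split_def)
    finally show ?thesis .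
  qed
  have bdM: "bd \<tau> \<in> chains ?M (simp n)" if "\<tau> \<in> simp (Suc n)" for \<tau> n
    unfolding bd_def using that flag_mem_V flag_subset card_remove \<chi>_gam
    by (intro supported_sum supported_scale supported_diff supported_single) (auto simp: simp_def carM)
  define Z where "Z n D = {x \<in> chains ?M (B n). if n = 0 then aug (\<lambda>_. 1) x = 0 else ext Ga D x = 0}"
    for n and D :: "nat \<Rightarrow> (('v \<times> bool) list set \<times> nat \<Rightarrow>\<^sub>0 'r)"
  define gen where "gen n D D' \<longleftrightarrow> (\<forall>b\<in>B (Suc n). D' b \<in> Z n D) \<and> (\<forall>x\<in>Z n D. \<exists>y\<in>chains ?M (B (Suc n)). ext Ga D' y = x)"
    for n and D D' :: "nat \<Rightarrow> (('v \<times> bool) list set \<times> nat \<Rightarrow>\<^sub>0 'r)"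
  have gen_fix: "gen n Dfix Dfix" if n: "n < q" for n
  proof -
    have "Dfix b \<in> Z n Dfix" if b: "b \<in> B (Suc n)" for b
    proof -
      obtain \<tau> where \<tau>: "\<tau> \<in> simp (Suc n)" "b = enc \<tau>" using b n by (auto simp: B_def)
      have D: "Dfix b = rx (bd \<tau>)" using \<tau> dec by (simp add: Dfix_def simp_def)
      have "n \<noteq> 0 \<Longrightarrow> ext Ga bd (bd \<tau>) = (0 :: _ \<Rightarrow>\<^sub>0 'r)" using \<tau> by (intro ext_bd_bd) (simp add: simp_def)
      moreover have "n = 0 \<Longrightarrow> aug (\<lambda>_. 1) (bd \<tau>) = (0::'r)"
        using free_complex.aug_D[OF free_bd, of \<tau>] \<tau> by simp
      ultimately show ?thesis unfolding D Z_def using rx_closed[OF bdM[OF \<tau>(1)]] n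
        by (auto simp: B_def ext_rx[OF bdM[OF \<tau>(1)]] rx_aug) (simp_all add: rx_def)
    qed
    moreover have "\<exists>y\<in>chains ?M (B (Suc n)). ext Ga Dfix y = x" if x: "x \<in> Z n Dfix" for x
    proof -
      have xc: "x \<in> chains ?M (enc ` simp n)" using x n by (simp add: Z_def B_def)
      have "ry x \<in> chains ?M (simp n)" by (rule ry_closed[OF xc])
      moreover have "if n = 0 then aug (\<lambda>_. 1) (ry x) = 0 else BD (ry x) = 0"
      proof (cases "n = 0")
        case True
        then show ?thesis using x rx_aug[of "ry x"] rx_ry[OF xc] by (simp add: Z_def)
      next
        case False
        then obtain m where m: "n = Suc m" by (cases n) auto
        have ryx: "ry x \<in> chains Ga (simp (Suc m))"
          using ry_closed[OF xc] unfolding m by (rule supported_mono) (auto simp: carM)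
        have "BD (ry x) \<in> chains ?M (simp m)"
          unfolding ext_nonneg[of Ga \<chi>, symmetric]
          by (rule M.ext_closed[OF ry_closed[OF xc, unfolded m] bdM])
        then have "BD (ry x) = ry (rx (BD (ry x)))" by (simp add: ry_rx)
        also have "rx (BD (ry x)) = 0"
          using x False by (simp add: ext_rx[OF ry_closed[OF xc], symmetric] rx_ry[OF xc] Z_def)
        finally show ?thesis using False by (simp add: ry_def)
      qed
      ultimately obtain y where y: "y \<in> chains ?M (simp (Suc n))" "BD y = ry x"
        using exact_nonneg[OF s _ n] by blast
      then have "ext Ga Dfix (rx y) = x" using ext_rx[OF y(1)] rx_ry[OF xc] by simp
      then show ?thesis using rx_closed[OF y(1)] n by (intro bexI[of _ "rx y"]) (auto simp: B_def)
    qed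
    ultimately show ?thesis by (auto simp: gen_def)
  qed
  have submod_Z: "submod ?M (Z n D)"
    if "n = 0 \<or> (\<forall>b\<in>B n. D b \<in> chains ?M UNIV)" for n D
  proof -
    have "ext Ga D (act Ga h x) = act Ga h (ext Ga D x)"
      if "n \<noteq> 0" "h \<in> carrier ?M" "x \<in> chains ?M (B n)" for h x
      using M.ext_act[OF that(2,3), of D UNIV] \<open>n = 0 \<or> _\<close> that(1) by simp
    then show ?thesis
      unfolding submod_def Z_def
      using M.submod_chains[of "B n"]
      by (auto simp: aug_add aug_scale ext_add ext_scale submod_def elim!: supported_mono)
  qed
  have gen_new: "\<exists>D'. gen n D D'" if "n = 0 \<or> (\<forall>b\<in>B n. D b \<in> chains ?M UNIV)" "q \<le> n" for n D
  proof -
    have B: "B (Suc n) = UNIV" using that(2) by (simp add: B_def)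
    from M.submod_generated[OF R cM submod_Z[OF that(1)]] show ?thesis
      unfolding gen_def B ext_nonneg by blast
  qed
  \<comment> \<open>\<open>gen\<close> relates consecutive boundary maps, so the first one needs a
    clause of its own. It can be written \<open>gen 0 D D\<close> because \<open>Z 0\<close> ignores
    its second argument.\<close>
  define P where "P n D \<longleftrightarrow> (n < q \<longrightarrow> D = Dfix) \<and> (\<forall>b\<in>B (Suc n). D b \<in> chains ?M (B n)) \<and> (n = 0 \<longrightarrow> gen 0 D D)"
    for n and D :: "nat \<Rightarrow> (('v \<times> bool) list set \<times> nat \<Rightarrow>\<^sub>0 'r)"
  have genZ: "gen n D D' \<Longrightarrow> b \<in> B (Suc n) \<Longrightarrow> D' b \<in> chains ?M (B n)" for n D D' b
    by (auto simp: gen_def Z_def)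
  have "\<exists>D. P 0 D"
  proof (cases "0 < q")
    case True
    then show ?thesis using gen_fix[OF True] genZ[OF gen_fix[OF True]] by (auto simp: P_def)
  next
    case False
    then obtain D' where "gen 0 undefined D'" using gen_new[of 0] by auto
    moreover from this have "gen 0 D' D'" by (simp add: gen_def Z_def)
    ultimately show ?thesis using False genZ[of 0 D' D'] by (intro exI[of _ D']) (auto simp: P_def)
  qed
  moreover have "\<exists>D'. P (Suc n) D' \<and> gen (Suc n) D D'" if P: "P n D" for n D
  proof (cases "Suc n < q")
    case True
    then have "D = Dfix" using P by (simp add: P_def)
    then show ?thesis using gen_fix[OF True] genZ[OF gen_fix[OF True]] True by (auto simp: P_def)
  next
    case False
    have "\<forall>b\<in>B (Suc n). D b \<in> chains ?M UNIV" using P by (auto simp: P_def elim!: supported_mono)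
    then obtain D' where "gen (Suc n) D D'" using gen_new[of "Suc n" D] False by auto
    then show ?thesis using False genZ[of "Suc n" D D'] by (intro exI[of _ D']) (auto simp: P_def)
  qed
  ultimately obtain D where D: "\<And>n. P n (D n) \<and> gen (Suc n) (D n) (D (Suc n))"
    using dependent_nat_choice[of P "\<lambda>n. gen (Suc n)"] by metis
  have Dc: "b \<in> B (Suc n) \<Longrightarrow> D n b \<in> chains ?M (B n)" for n b using D[of n] by (auto simp: P_def)
  have DU: "b \<in> B (Suc n) \<Longrightarrow> D n b \<in> chains ?M UNIV" for n b using Dc[of b n] by (rule supported_mono) auto
  have g0: "gen 0 (D 0) (D 0)" using D[of 0] by (simp add: P_def)
  have in_Z0: "ext Ga (D 0) y \<in> Z 0 (D 0)" if "y \<in> chains ?M (B (Suc 0))" for y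
    unfolding ext_nonneg[of Ga \<chi>, symmetric]
    by (rule M.ext_in_submod[OF submod_Z that]) (use g0 in \<open>auto simp: gen_def\<close>)
  have in_ZS: "ext Ga (D (Suc n)) y \<in> Z (Suc n) (D n)" if "y \<in> chains ?M (B (Suc (Suc n)))" for y n
    unfolding ext_nonneg[of Ga \<chi>, symmetric]
    by (rule M.ext_in_submod[OF submod_Z that])
      (use D[of n] DU in \<open>auto simp: gen_def\<close>)
  have "exact_complex ?M (\<lambda>n. chains ?M (B n)) (\<lambda>n. ext Ga (D n)) (\<lambda>_. 1 :: 'r)"
  proof
    show "submod ?M (chains ?M (B n) :: (_ \<Rightarrow>\<^sub>0 'r) set)" for n by (rule M.submod_chains)
    show "eqlin ?M (chains ?M (B (Suc n)) :: (_ \<Rightarrow>\<^sub>0 'r) set) (ext Ga (D n))" for n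
      using M.eqlin_ext_fun[of "B (Suc n)" "D n" "B n"] Dc by simp
    show "\<exists>y\<in>chains ?M (B 0). aug (\<lambda>_. 1) y = (1::'r)"
      by (rule bexI[of _ "Poly_Mapping.single (\<one>\<^bsub>Ga\<^esub>, enc {}) 1"])
        (auto intro!: supported_single simp: B_def simp_def carM)
    fix y :: "_ \<Rightarrow>\<^sub>0 'r"
    show "ext Ga (D n) y \<in> chains ?M (B n)" if "y \<in> chains ?M (B (Suc n))" for n
      using M.ext_closed[OF that, of "D n" "B n"] Dc by simp
    show "aug (\<lambda>_. 1) (ext Ga (D 0) y) = 0" if "y \<in> chains ?M (B (Suc 0))"
      using in_Z0[OF that] by (simp add: Z_def)
    show "ext Ga (D n) (ext Ga (D (Suc n)) y) = 0" if "y \<in> chains ?M (B (Suc (Suc n)))" for n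
      using in_ZS[OF that] by (simp add: Z_def)
    show "\<exists>z\<in>chains ?M (B (Suc 0)). ext Ga (D 0) z = y" if "y \<in> chains ?M (B 0)" "aug (\<lambda>_. 1) y = 0"
      using g0 that by (auto simp: gen_def Z_def)
    show "\<exists>z\<in>chains ?M (B (Suc (Suc n))). ext Ga (D (Suc n)) z = y"
      if "y \<in> chains ?M (B (Suc n))" "ext Ga (D n) y = 0" for n
      using D[of n] that by (auto simp: gen_def Z_def)
  qed
  then show ?thesis
    by (rule M.type_FP_if_free_resolution) (auto simp: B_def simp_def)
qed

end

section \<open>Unpacking projective resolutions over a monoid ring\<close>

lemma linear_maps_closed: "f \<in> linear_maps S M N \<Longrightarrow> x \<in> carrier M \<Longrightarrow> f x \<in> carrier N"
  by (auto simp: linear_maps_def)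
lemma linear_maps_add: "f \<in> linear_maps S M N \<Longrightarrow> x \<in> carrier M \<Longrightarrow> y \<in> carrier M \<Longrightarrow>
    f (x \<oplus>\<^bsub>M\<^esub> y) = f x \<oplus>\<^bsub>N\<^esub> f y"
  by (simp add: linear_maps_def)
lemma linear_maps_smult: "f \<in> linear_maps S M N \<Longrightarrow> a \<in> carrier S \<Longrightarrow> x \<in> carrier M \<Longrightarrow>
    f (a \<odot>\<^bsub>M\<^esub> x) = a \<odot>\<^bsub>N\<^esub> f x"
  by (simp add: linear_maps_def)

lemma linear_maps_comp:
  "f \<in> linear_maps S M N \<Longrightarrow> g \<in> linear_maps S N L \<Longrightarrow> (\<lambda>x. g (f x)) \<in> linear_maps S M L"
  by (simp add: linear_maps_def Pi_def)

lemma linear_maps_zero: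
  assumes "left_module S M" "left_module S N" "f \<in> linear_maps S M N"
  shows "f \<zero>\<^bsub>M\<^esub> = \<zero>\<^bsub>N\<^esub>"
proof -
  interpret M: left_module S M by fact
  interpret N: abelian_group N using assms(2) by (simp add: left_module_def)
  have z: "f \<zero>\<^bsub>M\<^esub> \<in> carrier N" using assms(3) by (auto simp: linear_maps_def)
  have "f (\<zero>\<^bsub>M\<^esub> \<oplus>\<^bsub>M\<^esub> \<zero>\<^bsub>M\<^esub>) = f \<zero>\<^bsub>M\<^esub> \<oplus>\<^bsub>N\<^esub> f \<zero>\<^bsub>M\<^esub>"
    using assms(3) M.M.zero_closed unfolding linear_maps_def by blast
  then have "f \<zero>\<^bsub>M\<^esub> \<oplus>\<^bsub>N\<^esub> f \<zero>\<^bsub>M\<^esub> = f \<zero>\<^bsub>M\<^esub> \<oplus>\<^bsub>N\<^esub> \<zero>\<^bsub>N\<^esub>" using z by simp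
  then have "\<ominus>\<^bsub>N\<^esub> f \<zero>\<^bsub>M\<^esub> \<oplus>\<^bsub>N\<^esub> (f \<zero>\<^bsub>M\<^esub> \<oplus>\<^bsub>N\<^esub> f \<zero>\<^bsub>M\<^esub>) = \<ominus>\<^bsub>N\<^esub> f \<zero>\<^bsub>M\<^esub> \<oplus>\<^bsub>N\<^esub> (f \<zero>\<^bsub>M\<^esub> \<oplus>\<^bsub>N\<^esub> \<zero>\<^bsub>N\<^esub>)" by simp
  then show ?thesis using N.r_neg1[OF z z] N.r_neg1[OF z N.zero_closed] by simp
qed

context monoid begin

lemma act_sact: "h \<in> carrier G \<Longrightarrow> act G h x = sact G (Poly_Mapping.single h 1) x" by simp
lemma scale_sact: "x \<in> chains G I \<Longrightarrow> scale r x = sact G (Poly_Mapping.single \<one> r) x" by (simp add: act_one)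

lemma eqlin_linear_maps:
  fixes \<phi> :: "('i \<Rightarrow> 'a \<Rightarrow> 'r::comm_ring_1) \<Rightarrow> ('j \<Rightarrow> 'a \<Rightarrow> 'r)"
  assumes \<phi>: "\<phi> \<in> linear_maps (monoid_ring G) (free_module (monoid_ring G) I) (free_module (monoid_ring G) J)"
  shows "eqlin G (chains G I) (\<lambda>x. toch (\<phi> (frch x)))" and "x \<in> chains G I \<Longrightarrow> toch (\<phi> (frch x)) \<in> chains G J"
    and "x \<in> chains G I \<Longrightarrow> frch (toch (\<phi> (frch x))) = \<phi> (frch x)"
proof -
  let ?F = "free_module (monoid_ring G) I" and ?K = "free_module (monoid_ring G) J"
  have car: "\<phi> (frch x) \<in> carrier ?K" if "x \<in> chains G I" for x
    using \<phi> frch_carrier[OF that] by (auto simp: linear_maps_def)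
  show 1: "toch (\<phi> (frch x)) \<in> chains G J" "frch (toch (\<phi> (frch x))) = \<phi> (frch x)" if "x \<in> chains G I" for x
    using frch_toch[OF car[OF that]] by auto
  have add: "toch (\<phi> (frch (x + y))) = toch (\<phi> (frch x)) + toch (\<phi> (frch y))" if "x \<in> chains G I" "y \<in> chains G I" for x y
  proof -
    have "\<phi> (frch (x + y)) = \<phi> (frch x) \<oplus>\<^bsub>?K\<^esub> \<phi> (frch y)"
      unfolding frch_add[where M = G and I = I, symmetric]
      by (rule linear_maps_add[OF \<phi> frch_carrier[OF that(1)] frch_carrier[OF that(2)]])
    also have "\<dots> = frch (toch (\<phi> (frch x)) + toch (\<phi> (frch y)))"
      unfolding frch_add[where M = G and I = J, symmetric] 1(2)[OF that(1)] 1(2)[OF that(2)] ..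
    finally show ?thesis by simp
  qed
  have sact: "toch (\<phi> (frch (sact G a x))) = sact G a (toch (\<phi> (frch x)))" if "a \<in> supported (carrier G)" "x \<in> chains G I" for a x
  proof -
    have a: "lookup a \<in> carrier (monoid_ring G)" using that by simp
    have "\<phi> (frch (sact G a x)) = lookup a \<odot>\<^bsub>?K\<^esub> \<phi> (frch x)"
      unfolding frch_smult[where M = G and I = I, symmetric]
      by (rule linear_maps_smult[OF \<phi> a frch_carrier[OF that(2)]])
    also have "\<dots> = frch (sact G a (toch (\<phi> (frch x))))"
      unfolding frch_smult[where M = G and I = J, symmetric] 1(2)[OF that(2)] ..
    finally show ?thesis by simp
  qed
  show "eqlin G (chains G I) (\<lambda>x. toch (\<phi> (frch x)))"
    unfolding eqlin_def
  proof (intro conjI ballI allI)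
    fix x :: "'a \<times> 'i \<Rightarrow>\<^sub>0 'r" and r assume x: "x \<in> chains G I"
    show "toch (\<phi> (frch (scale r x))) = scale r (toch (\<phi> (frch x)))"
      unfolding scale_sact[OF x] scale_sact[OF 1(1)[OF x]]
      by (rule sact[OF _ x]) (simp add: supported_single)
  next
    fix h and x :: "'a \<times> 'i \<Rightarrow>\<^sub>0 'r" assume h: "h \<in> carrier G" and x: "x \<in> chains G I"
    show "toch (\<phi> (frch (act G h x))) = act G h (toch (\<phi> (frch x)))"
      unfolding act_sact[OF h] by (rule sact[OF _ x]) (simp add: supported_single h)
  qed (rule add)
qed

text \<open>Each projective module is identified with the image \<open>Y\<close> of the idempotent
  \<iota>\<rho> on a free module, and the boundary and augmentation are extended to all of the free
  module through \<rho>. The extension gives a free complex, as source of a comparison; exactness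
  holds on \<open>Y\<close>, as target. Finite generation is phrased through submodules containing
  the generators, so that no coefficients have to be carried.\<close>

theorem type_FP_unpack:
  fixes q
  assumes FP: "type_FP q (monoid_ring G :: ('a \<Rightarrow> 'r::comm_ring_1) ring) (trivial_module :: ('a \<Rightarrow> 'r, 'r) module)"
  shows "\<exists>(I :: nat \<Rightarrow> (nat \<Rightarrow> 'a \<Rightarrow> 'r) set) Y d (e :: _ \<Rightarrow> 'r). exact_complex G Y d e \<and> (\<forall>n. Y n \<subseteq> chains G (I n)) \<and>
    (\<forall>n. eqlin G (chains G (I (Suc n))) (d n)) \<and> (\<forall>n. \<forall>x\<in>chains G (I (Suc n)). d n x \<in> Y n) \<and>
    (\<forall>n. \<forall>x\<in>chains G (I (Suc (Suc n))). d n (d (Suc n) x) = 0) \<and>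
    (\<forall>x\<in>chains G (I (Suc 0)). aug e (d 0 x) = 0) \<and>
    (\<forall>n\<le>q. \<exists>X. finite X \<and> X \<subseteq> Y n \<and> (\<forall>Z. submod G Z \<longrightarrow> X \<subseteq> Z \<longrightarrow> Y n \<subseteq> Z))"
proof -
  let ?S = "monoid_ring G :: ('a \<Rightarrow> 'r) ring"
  let ?T = "trivial_module :: ('a \<Rightarrow> 'r, 'r) module"
  let ?F = "free_module ?S :: (nat \<Rightarrow> 'a \<Rightarrow> 'r) set \<Rightarrow> _"
  obtain P :: "nat \<Rightarrow> ('a \<Rightarrow> 'r, nat \<Rightarrow> 'a \<Rightarrow> 'r) module" and \<delta> \<epsilon> where
    R: "\<forall>i. projective_module ?S (P i)" "\<forall>i\<le>q. fin_gen_module ?S (P i)" "\<epsilon> \<in> linear_maps ?S (P 0) ?T"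
      "\<forall>i. \<delta> i \<in> linear_maps ?S (P (Suc i)) (P i)" "\<epsilon> ` carrier (P 0) = carrier ?T"
      "{x \<in> carrier (P 0). \<epsilon> x = \<zero>\<^bsub>?T\<^esub>} = \<delta> 0 ` carrier (P (Suc 0))"
      "\<forall>i. {x \<in> carrier (P (Suc i)). \<delta> i x = \<zero>\<^bsub>P i\<^esub>} = \<delta> (Suc i) ` carrier (P (Suc (Suc i)))"
    using FP unfolding type_FP_def by (elim exE conjE) (rule that)
  note proj = R(1)[rule_format] and fg = R(2)[rule_format] and \<epsilon> = R(3) and \<delta> = R(4)[rule_format]
    and \<epsilon>_surj = R(5) and ex0 = R(6) and exS = R(7)[rule_format]
  have lm: "left_module ?S (P i)" for i using proj by (simp add: projective_module_def)
  have "\<exists>J \<iota> \<rho>. \<iota> \<in> linear_maps ?S (P i) (?F J) \<and> \<rho> \<in> linear_maps ?S (?F J) (P i) \<and> (\<forall>x\<in>carrier (P i). \<rho> (\<iota> x) = x)" for i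
  proof -
    obtain J where "\<exists>\<iota>\<in>linear_maps ?S (P i) (?F J). \<exists>\<rho>\<in>linear_maps ?S (?F J) (P i). \<forall>x\<in>carrier (P i). \<rho> (\<iota> x) = x"
      using proj[of i] unfolding projective_module_def by (elim conjE exE) (rule that)
    then show ?thesis by (elim bexE) (rule exI, rule exI, rule exI, intro conjI)
  qed
  from choice[OF allI[OF this]] obtain I where "\<forall>i. \<exists>\<iota> \<rho>. \<iota> \<in> linear_maps ?S (P i) (?F (I i)) \<and>
      \<rho> \<in> linear_maps ?S (?F (I i)) (P i) \<and> (\<forall>x\<in>carrier (P i). \<rho> (\<iota> x) = x)" by (rule exE)
  from choice[OF this] obtain \<iota> where "\<forall>i. \<exists>\<rho>. \<iota> i \<in> linear_maps ?S (P i) (?F (I i)) \<and>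
      \<rho> \<in> linear_maps ?S (?F (I i)) (P i) \<and> (\<forall>x\<in>carrier (P i). \<rho> (\<iota> i x) = x)" by (rule exE)
  from choice[OF this] obtain \<rho> where R': "\<forall>i. \<iota> i \<in> linear_maps ?S (P i) (?F (I i)) \<and>
      \<rho> i \<in> linear_maps ?S (?F (I i)) (P i) \<and> (\<forall>x\<in>carrier (P i). \<rho> i (\<iota> i x) = x)" by (rule exE)
  have \<iota>: "\<iota> i \<in> linear_maps ?S (P i) (?F (I i))" and \<rho>: "\<rho> i \<in> linear_maps ?S (?F (I i)) (P i)"
    and \<rho>\<iota>: "x \<in> carrier (P i) \<Longrightarrow> \<rho> i (\<iota> i x) = x" for i x using R'[rule_format, of i] by auto
  have \<iota>c: "\<iota> i x \<in> carrier (?F (I i))" if "x \<in> carrier (P i)" for i x by (rule linear_maps_closed[OF \<iota> that])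
  have \<rho>c: "\<rho> i f \<in> carrier (P i)" if "f \<in> carrier (?F (I i))" for i f by (rule linear_maps_closed[OF \<rho> that])
  have \<delta>c: "\<delta> i x \<in> carrier (P i)" if "x \<in> carrier (P (Suc i))" for i x by (rule linear_maps_closed[OF \<delta> that])
  have \<rho>f: "\<rho> i (frch x) \<in> carrier (P i)" if "x \<in> chains G (I i)" for i x by (rule \<rho>c[OF frch_carrier[OF that]])
  define up where "up i p = toch (\<iota> i p)" for i p
  define dn where "dn i x = \<rho> i (frch x)" for i x
  define E where "E i x = up i (dn i x)" for i x
  define d where "d i x = up i (\<delta> i (dn (Suc i) x))" for i x
  define Y where "Y i = up i ` carrier (P i)" for i
  have up_c: "up i p \<in> chains G (I i)" and dn_up: "dn i (up i p) = p" if "p \<in> carrier (P i)" for i p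
    using frch_toch[OF \<iota>c[OF that]] \<rho>\<iota>[OF that] by (auto simp: up_def dn_def)
  have dn_c: "dn i x \<in> carrier (P i)" if "x \<in> chains G (I i)" for i x by (simp add: dn_def \<rho>f that)
  have E_lin: "eqlin G (chains G (I i)) (E i)" for i
    using eqlin_linear_maps(1)[OF linear_maps_comp[OF \<rho> \<iota>]] by (simp add: E_def[abs_def] up_def dn_def)
  have d_lin: "eqlin G (chains G (I (Suc i))) (d i)" for i
    using eqlin_linear_maps(1)[OF linear_maps_comp[OF linear_maps_comp[OF \<rho> \<delta>] \<iota>]]
    by (simp add: d_def[abs_def] up_def dn_def)
  \<comment> \<open>\<open>Y i\<close> is the image of the idempotent \<open>E i\<close>, hence its
    fixed set, and the fixed point equation passes through all module operations.\<close>
  have Y_iff: "y \<in> Y i \<longleftrightarrow> y \<in> chains G (I i) \<and> E i y = y" for y i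
    using up_c dn_up dn_c by (auto simp: Y_def E_def) (metis imageI)
  have Y_sub: "submod G (Y i)" for i
    unfolding submod_def
  proof (intro conjI ballI allI)
    have zero: "E i 0 = 0" by (rule eqlin_zero[OF submod_chains E_lin])
    show "0 \<in> Y i" by (simp add: Y_iff zero)
  qed (auto simp: Y_iff eqlin_add[OF E_lin] eqlin_scale[OF E_lin] eqlin_act[OF E_lin] act_closed
      intro: supported_add supported_scale elim!: supported_mono)
  have d_Y: "d i x \<in> Y i" if "x \<in> chains G (I (Suc i))" for i x
    using dn_c[OF that] \<delta>c by (auto simp: d_def Y_def)
  have lmF: "left_module ?S (?F J)" for J by (rule left_module_free[OF ring_monoid_ring])
  have up_zero: "up i \<zero>\<^bsub>P i\<^esub> = 0" for i
    using linear_maps_zero[OF lm lmF \<iota>[of i]] by (simp add: up_def frch_zero)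
  have \<delta>\<delta>: "\<delta> i (\<delta> (Suc i) p) = \<zero>\<^bsub>P i\<^esub>" if "p \<in> carrier (P (Suc (Suc i)))" for i p
    using exS[of i] that by blast
  have dd: "d i (d (Suc i) x) = 0" if "x \<in> chains G (I (Suc (Suc i)))" for i x
    using dn_c[OF that] \<delta>c by (simp add: d_def dn_up \<delta>\<delta> up_zero)
  define \<psi> where "\<psi> x = \<epsilon> (dn 0 x)" for x
  have tm: "left_module ?S ?T \<Longrightarrow> True" by simp
  have \<psi>_add: "\<psi> (x + y) = \<psi> x + \<psi> y" if "x \<in> chains G (I 0)" "y \<in> chains G (I 0)" for x y
  proof -
    have "dn 0 (x + y) = dn 0 x \<oplus>\<^bsub>P 0\<^esub> dn 0 y"
      unfolding dn_def frch_add[where M = G and I = "I 0", symmetric]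
      by (rule linear_maps_add[OF \<rho> frch_carrier[OF that(1)] frch_carrier[OF that(2)]])
    then show ?thesis using linear_maps_add[OF \<epsilon> dn_c[OF that(1)] dn_c[OF that(2)]]
      by (simp add: \<psi>_def trivial_module_def)
  qed
  have \<psi>_sact: "\<psi> (scale r (act G h x)) = r * \<psi> x" if "x \<in> chains G (I 0)" "h \<in> carrier G" for x h r
  proof -
    let ?a = "lookup (Poly_Mapping.single h r) :: 'a \<Rightarrow> 'r"
    have a: "?a \<in> carrier ?S" using that by (simp add: supported_single)
    have "dn 0 (sact G (Poly_Mapping.single h r) x) = ?a \<odot>\<^bsub>P 0\<^esub> dn 0 x"
      unfolding dn_def frch_smult[where M = G and I = "I 0", symmetric]
      by (rule linear_maps_smult[OF \<rho> a frch_carrier[OF that(1)]])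
    then have "\<psi> (scale r (act G h x)) = ?a \<odot>\<^bsub>?T\<^esub> \<psi> x"
      using linear_maps_smult[OF \<epsilon> a dn_c[OF that(1)]] by (simp add: \<psi>_def)
    also have "\<dots> = (\<Sum>g\<in>{g. ?a g \<noteq> 0}. ?a g) * \<psi> x" by (simp add: trivial_module_def)
    also have "(\<Sum>g\<in>{g. ?a g \<noteq> 0}. ?a g) = r"
      by (cases "r = 0") (auto simp: lookup_single when_def)
    finally show ?thesis .
  qed
  \<comment> \<open>Through \<rho> the augmentation becomes a functional on a free module, so it is
    given by its values on the basis, as \<open>aug\<close> expects.\<close>
  define e where "e i = (if i \<in> I 0 then \<psi> (Poly_Mapping.single (\<one>, i) 1) else 0)" for i
  have single_c: "Poly_Mapping.single (\<one>, i) 1 \<in> chains G (I 0)" if "i \<in> I 0" for i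
    using that by (simp add: supported_single)
  have \<psi>_e: "\<psi> x = aug e x" if x: "x \<in> chains G (I 0)" for x
  proof -
    have *: "finite A \<Longrightarrow> A \<subseteq> carrier G \<times> I 0 \<Longrightarrow> \<psi> (\<Sum>c\<in>A. scale (lookup x c) (Poly_Mapping.single c 1)) = (\<Sum>c\<in>A. lookup x c * e (snd c))" for A
    proof (induction A rule: finite_induct)
      case empty
      then show ?case using \<psi>_add[of 0 0] by simp
    next
      case (insert c A)
      obtain g i where c: "c = (g, i)" by force
      have gi: "g \<in> carrier G" "i \<in> I 0" using insert.prems by (auto simp: c)
      have "scale (lookup x c) (Poly_Mapping.single c 1) = scale (lookup x c) (act G g (Poly_Mapping.single (\<one>, i) 1))"
        using gi by (simp add: c)
      then have t: "\<psi> (scale (lookup x c) (Poly_Mapping.single c 1)) = lookup x c * e i"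
        using \<psi>_sact[OF single_c[OF gi(2)] gi(1), of "lookup x c"] gi by (simp add: e_def)
      have s1: "(\<Sum>c\<in>A. scale (lookup x c) (Poly_Mapping.single c 1)) \<in> chains G (I 0)"
        using insert.prems by (intro supported_sum supported_scale supported_single) auto
      have s2: "scale (lookup x c) (Poly_Mapping.single c 1) \<in> chains G (I 0)"
        using insert.prems by (intro supported_scale supported_single) auto
      have IH: "\<psi> (\<Sum>c\<in>A. scale (lookup x c) (Poly_Mapping.single c 1)) = (\<Sum>c\<in>A. lookup x c * e (snd c))"
        using insert by blast
      have "snd c = i" by (simp add: c)
      then show ?case unfolding sum.insert[OF insert.hyps] \<psi>_add[OF s2 s1] t IH by simp
    qed
    have "\<psi> x = \<psi> (\<Sum>c\<in>keys x. scale (lookup x c) (Poly_Mapping.single c 1))" by (simp only: chain_expand[symmetric])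
    also have "\<dots> = aug e x" using x by (subst *) (auto simp: supported_def aug_def pair_def)
    finally show ?thesis .
  qed
  have "exact_complex G Y d e"
  proof
    show "submod G (Y n)" for n by (rule Y_sub)
    show "eqlin G (Y (Suc n)) (d n)" for n
      using d_lin[of n] by (auto simp: eqlin_def Y_iff)
    show "\<exists>y\<in>Y 0. aug e y = 1"
    proof -
      have "1 \<in> carrier ?T" by (simp add: trivial_module_def)
      then obtain p where p: "p \<in> carrier (P 0)" "\<epsilon> p = 1" using \<epsilon>_surj by (metis imageE)
      then have "\<psi> (up 0 p) = 1" by (simp add: \<psi>_def dn_up)
      then show ?thesis using \<psi>_e[OF up_c[OF p(1)]] p by (auto simp: Y_def)
    qed
    fix y
    show "d n y \<in> Y n" if "y \<in> Y (Suc n)" for n using d_Y that by (simp add: Y_iff)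
    show "d n (d (Suc n) y) = 0" if "y \<in> Y (Suc (Suc n))" for n using dd that by (simp add: Y_iff)
    show "aug e (d 0 y) = 0" if "y \<in> Y (Suc 0)"
    proof -
      have y: "y \<in> chains G (I (Suc 0))" using that by (simp add: Y_iff)
      have "aug e (d 0 y) = \<psi> (d 0 y)" using \<psi>_e d_Y[OF y] by (simp add: Y_iff)
      also have "\<dots> = \<epsilon> (\<delta> 0 (dn (Suc 0) y))" using \<delta>c[OF dn_c[OF y]] by (simp add: \<psi>_def d_def dn_up)
      also have "\<dots> = 0" using ex0 dn_c[OF y] by (auto simp: trivial_module_def)
      finally show ?thesis .
    qed
    show "\<exists>z\<in>Y (Suc 0). d 0 z = y" if y: "y \<in> Y 0" "aug e y = 0"
    proof -
      obtain p where p: "p \<in> carrier (P 0)" "y = up 0 p" using y(1) by (auto simp: Y_def)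
      have "\<epsilon> p = \<zero>\<^bsub>?T\<^esub>" using y p \<psi>_e[OF up_c[OF p(1)]] by (simp add: \<psi>_def dn_up trivial_module_def)
      then have "p \<in> \<delta> 0 ` carrier (P (Suc 0))" using p ex0 by blast
      then obtain p' where "p' \<in> carrier (P (Suc 0))" "p = \<delta> 0 p'" by blast
      then show ?thesis using p by (intro bexI[of _ "up (Suc 0) p'"]) (auto simp: d_def dn_up Y_def)
    qed
    show "\<exists>z\<in>Y (Suc (Suc n)). d (Suc n) z = y" if y: "y \<in> Y (Suc n)" "d n y = 0" for n
    proof -
      obtain p where p: "p \<in> carrier (P (Suc n))" "y = up (Suc n) p" using y(1) by (auto simp: Y_def)
      have "up n (\<delta> n p) = up n \<zero>\<^bsub>P n\<^esub>" using y p by (simp add: d_def dn_up up_zero)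
      then have "dn n (up n (\<delta> n p)) = dn n (up n \<zero>\<^bsub>P n\<^esub>)" by simp
      moreover have "\<zero>\<^bsub>P n\<^esub> \<in> carrier (P n)"
        using lm[of n] by (simp add: left_module_def abelian_group_def abelian_monoid.zero_closed)
      ultimately have "\<delta> n p = \<zero>\<^bsub>P n\<^esub>" using \<delta>c[OF p(1)] by (simp add: dn_up)
      then have "p \<in> \<delta> (Suc n) ` carrier (P (Suc (Suc n)))" using p exS by blast
      then obtain p' where "p' \<in> carrier (P (Suc (Suc n)))" "p = \<delta> (Suc n) p'" by blast
      then show ?thesis using p by (intro bexI[of _ "up (Suc (Suc n)) p'"]) (auto simp: d_def dn_up Y_def)
    qed
  qed
  moreover have "\<exists>X. finite X \<and> X \<subseteq> Y n \<and> (\<forall>Z. submod G Z \<longrightarrow> X \<subseteq> Z \<longrightarrow> Y n \<subseteq> Z)" if n: "n \<le> q" for n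
  proof -
    interpret Pn: left_module ?S "P n" by (rule lm)
    obtain X where X: "finite X" "X \<subseteq> carrier (P n)"
      and gen: "\<And>m. m \<in> carrier (P n) \<Longrightarrow> \<exists>a \<in> X \<rightarrow> carrier ?S. m = (\<Oplus>\<^bsub>P n\<^esub>x\<in>X. a x \<odot>\<^bsub>P n\<^esub> x)"
      using fg[OF n] unfolding fin_gen_module_def by blast
    have "Y n \<subseteq> Z" if Z: "submod G Z" "up n ` X \<subseteq> Z" for Z
    proof
      fix y assume "y \<in> Y n"
      then obtain m where m: "m \<in> carrier (P n)" "y = up n m" by (auto simp: Y_def)
      obtain a where a: "a \<in> X \<rightarrow> carrier ?S" "m = (\<Oplus>\<^bsub>P n\<^esub>x\<in>X. a x \<odot>\<^bsub>P n\<^esub> x)" using gen[OF m(1)] by blast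
      have up_add: "up n (p \<oplus>\<^bsub>P n\<^esub> p') = up n p + up n p'" if "p \<in> carrier (P n)" "p' \<in> carrier (P n)" for p p'
      proof -
        have "\<iota> n (p \<oplus>\<^bsub>P n\<^esub> p') = frch (up n p) \<oplus>\<^bsub>?F (I n)\<^esub> frch (up n p')"
          using linear_maps_add[OF \<iota> that] frch_toch(1)[OF \<iota>c[OF that(1)]] frch_toch(1)[OF \<iota>c[OF that(2)]]
          by (simp add: up_def)
        then show ?thesis by (simp add: up_def frch_add)
      qed
      have up_smult: "up n (s \<odot>\<^bsub>P n\<^esub> p) \<in> Z" if sc: "s \<in> carrier ?S" and "p \<in> carrier (P n)" "up n p \<in> Z" for s p
      proof -
        obtain b where b: "b \<in> supported (carrier G)" "s = lookup b" using sc by (auto simp: carrier_monoid_ring)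
        have "\<iota> n (s \<odot>\<^bsub>P n\<^esub> p) = s \<odot>\<^bsub>?F (I n)\<^esub> frch (up n p)"
          using linear_maps_smult[OF \<iota> that(1,2)] frch_toch(1)[OF \<iota>c[OF that(2)]] by (simp add: up_def)
        then have "up n (s \<odot>\<^bsub>P n\<^esub> p) = sact G b (up n p)" using b by (simp add: up_def frch_smult)
        then show ?thesis using sact_in_submod[OF Z(1) b(1) that(3)] by simp
      qed
      have "finite A \<Longrightarrow> A \<subseteq> X \<Longrightarrow> (\<Oplus>\<^bsub>P n\<^esub>x\<in>A. a x \<odot>\<^bsub>P n\<^esub> x) \<in> carrier (P n) \<and> up n (\<Oplus>\<^bsub>P n\<^esub>x\<in>A. a x \<odot>\<^bsub>P n\<^esub> x) \<in> Z" for A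
      proof (induction A rule: finite_induct)
        case empty
        then show ?case using submod_zero[OF Z(1)] by (simp add: up_zero)
      next
        case (insert x A)
        have c: "a z \<odot>\<^bsub>P n\<^esub> z \<in> carrier (P n)" if "z \<in> insert x A" for z
          using that insert.prems X(2) a(1) by (intro Pn.smult_closed) auto
        have "(\<Oplus>\<^bsub>P n\<^esub>z\<in>insert x A. a z \<odot>\<^bsub>P n\<^esub> z) = a x \<odot>\<^bsub>P n\<^esub> x \<oplus>\<^bsub>P n\<^esub> (\<Oplus>\<^bsub>P n\<^esub>z\<in>A. a z \<odot>\<^bsub>P n\<^esub> z)"
          using insert.hyps c by (intro Pn.M.finsum_insert) auto
        moreover have "up n (a x \<odot>\<^bsub>P n\<^esub> x) \<in> Z" using insert.prems X(2) a(1) Z(2) by (intro up_smult) auto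
        moreover have "(\<Oplus>\<^bsub>P n\<^esub>z\<in>A. a z \<odot>\<^bsub>P n\<^esub> z) \<in> carrier (P n) \<and> up n (\<Oplus>\<^bsub>P n\<^esub>z\<in>A. a z \<odot>\<^bsub>P n\<^esub> z) \<in> Z"
          using insert by blast
        ultimately show ?case using c[of x] by (simp add: up_add submod_add[OF Z(1)])
      qed
      from this[OF X(1)] show "y \<in> Z" using m a by simp
    qed
    then show ?thesis using X by (intro exI[of _ "up n ` X"]) (auto simp: Y_def)
  qed
  moreover have "aug e (d 0 x) = 0" if x: "x \<in> chains G (I (Suc 0))" for x
  proof -
    have "aug e (d 0 x) = \<psi> (d 0 x)" using \<psi>_e d_Y[OF x] by (simp add: Y_iff)
    also have "\<dots> = \<epsilon> (\<delta> 0 (dn (Suc 0) x))" using \<delta>c[OF dn_c[OF x]] by (simp add: \<psi>_def d_def dn_up)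
    also have "\<dots> = 0" using ex0 dn_c[OF x] by (auto simp: trivial_module_def)
    finally show ?thesis .
  qed
  moreover have "Y n \<subseteq> chains G (I n)" for n by (auto simp: Y_iff)
  ultimately show ?thesis using d_lin d_Y dd
    by - (rule exI[of _ I], rule exI[of _ Y], rule exI[of _ d], rule exI[of _ e],
      intro conjI allI ballI impI; (assumption | blast))
qed

end

section \<open>From finiteness properties to the live complex\<close>

context raag_character
begin

text \<open>\<^term>\<open>npart U a\<close> is the coefficient of \<open>t\<^sup>-\<^sup>a\<close> in the expansion of the product of the series
  \<open>(t\<^sup>\<chi>\<^sup>v - 1)\<^sup>-\<^sup>1\<close> over \<open>v \<in> U\<close>.\<close>

definition "nsols U b = {n :: 'v \<Rightarrow> nat. (\<forall>v. v \<notin> U \<longrightarrow> n v = 0) \<and> (\<Sum>v\<in>U. real (n v) * \<chi> (gam v)) = b}"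
definition npart :: "'v set \<Rightarrow> real \<Rightarrow> 'r::comm_ring_1" where
  "npart U a = (- 1) ^ card U * of_nat (card (nsols U (- a)))"

lemma W_pos: "v \<in> W \<Longrightarrow> 0 < \<chi> (gam v)" by (simp add: W_def)
lemma W_V: "v \<in> W \<Longrightarrow> v \<in> V" by (simp add: W_def)

lemma nsols_neg: assumes "U \<subseteq> W" "b < 0" shows "nsols U b = {}"
proof -
  have "0 \<le> (\<Sum>v\<in>U. real (n v) * \<chi> (gam v))" for n :: "'v \<Rightarrow> nat"
    using assms W_pos by (intro sum_nonneg mult_nonneg_nonneg) (auto intro: less_imp_le)
  then show ?thesis using assms(2) by (auto simp: nsols_def) (metis not_le)
qed

lemma finite_nsols: assumes U: "U \<subseteq> W" shows "finite (nsols U b)"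
proof -
  have fU: "finite U" by (rule finite_subset[OF U finite_W])
  let ?K = "nat \<lceil>b / \<delta>\<rceil>"
  have "n v \<le> ?K" if n: "n \<in> nsols U b" and v: "v \<in> U" for n v
  proof -
    have "real (n v) * \<delta> \<le> real (n v) * \<chi> (gam v)" using U v \<delta>_le by (intro mult_left_mono) auto
    also have "\<dots> \<le> (\<Sum>v\<in>U. real (n v) * \<chi> (gam v))"
    proof (rule member_le_sum[OF v _ fU])
      fix u assume "u \<in> U - {v}"
      then have "0 < \<chi> (gam u)" using U W_pos by blast
      then show "0 \<le> real (n u) * \<chi> (gam u)" by simp
    qed
    also have "\<dots> = b" using n by (simp add: nsols_def)
    finally have "real (n v) \<le> b / \<delta>" using \<delta>_pos by (simp add: pos_le_divide_eq)
    then show ?thesis by linarith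
  qed
  then have "nsols U b \<subseteq> {n. \<forall>v. (v \<in> U \<longrightarrow> n v \<in> {..?K}) \<and> (v \<notin> U \<longrightarrow> n v = 0)}"
    by (auto simp: nsols_def)
  then show ?thesis by (rule finite_subset) (rule finite_set_of_finite_funs[OF fU finite_atMost])
qed

text \<open>Solutions either do not use \<open>v\<close> or become solutions for a smaller sum when
  one copy of \<open>v\<close> is removed. In terms of series, this is multiplication by 1 -
  t^\<chi>(v).\<close>

lemma card_nsols:
  assumes U: "U \<subseteq> W" and v: "v \<in> U"
  shows "card (nsols U b) = card (nsols (U - {v}) b) + card (nsols U (b - \<chi> (gam v)))"
proof -
  have fU: "finite U" by (rule finite_subset[OF U finite_W])
  let ?A = "{n\<in>nsols U b. n v = 0}" and ?B = "{n\<in>nsols U b. n v \<noteq> 0}"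
  have A: "?A = nsols (U - {v}) b"
    unfolding nsols_def by (auto simp: sum.remove[OF fU v])
  have upd: "(\<Sum>u\<in>U. real ((n(v := k)) u) * \<chi> (gam u)) = real k * \<chi> (gam v) + (\<Sum>u\<in>U - {v}. real (n u) * \<chi> (gam u))"
    for n :: "'v \<Rightarrow> nat" and k
    by (subst sum.remove[OF fU v]) (auto intro!: sum.cong)
  have B: "?B = (\<lambda>n. n(v := Suc (n v))) ` nsols U (b - \<chi> (gam v))" (is "_ = ?f ` _")
  proof (intro equalityI subsetI)
    fix n assume n: "n \<in> ?B"
    have "n(v := n v - 1) \<in> nsols U (b - \<chi> (gam v))"
    proof -
      have "(\<Sum>u\<in>U. real ((n(v := n v - 1)) u) * \<chi> (gam u)) = real (n v - 1) * \<chi> (gam v) + (\<Sum>u\<in>U - {v}. real (n u) * \<chi> (gam u))"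
        by (rule upd)
      also have "\<dots> = (\<Sum>u\<in>U. real (n u) * \<chi> (gam u)) - \<chi> (gam v)"
        using n by (simp add: sum.remove[OF fU v] of_nat_diff algebra_simps)
      finally show ?thesis using n v by (auto simp: nsols_def)
    qed
    moreover have "n = ?f (n(v := n v - 1))" using n by auto
    ultimately show "n \<in> ?f ` nsols U (b - \<chi> (gam v))" by blast
  next
    fix n assume "n \<in> ?f ` nsols U (b - \<chi> (gam v))"
    then obtain m where m: "m \<in> nsols U (b - \<chi> (gam v))" "n = ?f m" by auto
    have "(\<Sum>u\<in>U. real (n u) * \<chi> (gam u)) = (\<Sum>u\<in>U. real (m u) * \<chi> (gam u)) + \<chi> (gam v)"
      unfolding m(2) upd by (simp add: sum.remove[OF fU v] algebra_simps)
    then show "n \<in> ?B" using m v by (auto simp: nsols_def)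
  qed
  have "inj_on ?f (nsols U (b - \<chi> (gam v)))"
  proof (rule inj_onI)
    fix n m :: "'v \<Rightarrow> nat" assume e: "?f n = ?f m"
    show "n = m"
    proof
      fix u show "n u = m u" using fun_cong[OF e, of u] by (cases "u = v") auto
    qed
  qed
  then have "card ?B = card (nsols U (b - \<chi> (gam v)))" unfolding B by (rule card_image)
  moreover have "card (nsols U b) = card ?A + card ?B"
    using finite_nsols[OF U] by (subst card_Un_disjoint[symmetric]) (auto intro!: arg_cong[where f = card])
  ultimately show ?thesis unfolding A by simp
qed

text \<open>Multiplication by t^\<chi>(v) - 1 cancels the factor of \<open>v\<close>.\<close>

lemma npart_diff:
  assumes U: "U \<subseteq> W" and v: "v \<in> U"
  shows "npart U (a + \<chi> (gam v)) - npart U a = (npart (U - {v}) a :: 'r::comm_ring_1)"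
proof -
  have c: "card U = Suc (card (U - {v}))" by (rule card_Suc_Diff1[OF finite_subset[OF U finite_W] v, symmetric])
  have "card (nsols U (- a)) = card (nsols (U - {v}) (- a)) + card (nsols U (- (a + \<chi> (gam v))))"
    using card_nsols[OF U v, of "- a"] by simp
  then show ?thesis by (simp add: npart_def c algebra_simps)
qed

lemma npart_pos: "U \<subseteq> W \<Longrightarrow> 0 < a \<Longrightarrow> npart U a = 0"
  by (simp add: npart_def nsols_neg)
lemma npart_empty: "npart {} 0 = 1"
proof -
  have "nsols {} 0 = {\<lambda>_. 0}" by (auto simp: nsols_def)
  then show ?thesis by (simp add: npart_def)
qed

text \<open>The value at 0 of the iterated difference of \<open>F\<close> with the steps \<chi> (gam
  u) for u in \<open>T\<close>. Equivalently, F evaluated on the expanded product of t^\<chi>(u) - 1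
  over u in \<open>T\<close>.\<close>

definition altsum :: "'v set \<Rightarrow> (real \<Rightarrow> 'r::comm_ring_1) \<Rightarrow> 'r" where
  "altsum T F = (\<Sum>U\<in>Pow T. (- 1) ^ card (T - U) * F (\<Sum>u\<in>U. \<chi> (gam u)))"

lemma altsum_insert:
  assumes T: "finite T" "v \<notin> T"
  shows "altsum (insert v T) F = altsum T (\<lambda>a. F (a + \<chi> (gam v)) - F a)"
proof -
  have inj: "inj_on (insert v) (Pow T)" using T by (auto simp: inj_on_def)
  have disj: "Pow T \<inter> insert v ` Pow T = {}" using T by auto
  have 1: "(\<Sum>U\<in>Pow T. (- 1) ^ card (insert v T - U) * F (\<Sum>u\<in>U. \<chi> (gam u))) =
      - (\<Sum>U\<in>Pow T. (- 1) ^ card (T - U) * F (\<Sum>u\<in>U. \<chi> (gam u)))"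
    unfolding sum_negf[symmetric]
  proof (rule sum.cong)
    fix U assume "U \<in> Pow T"
    then have "insert v T - U = insert v (T - U)" "v \<notin> T - U" using T by auto
    then show "(- 1) ^ card (insert v T - U) * F (\<Sum>u\<in>U. \<chi> (gam u)) = - ((- 1) ^ card (T - U) * F (\<Sum>u\<in>U. \<chi> (gam u)))"
      using T by simp
  qed simp
  have 2: "(\<Sum>U\<in>insert v ` Pow T. (- 1) ^ card (insert v T - U) * F (\<Sum>u\<in>U. \<chi> (gam u))) =
      (\<Sum>U\<in>Pow T. (- 1) ^ card (T - U) * F ((\<Sum>u\<in>U. \<chi> (gam u)) + \<chi> (gam v)))"
    unfolding sum.reindex[OF inj] o_def
  proof (rule sum.cong)
    fix U assume U: "U \<in> Pow T"
    then have "insert v T - insert v U = T - U" "v \<notin> U" "finite U" using T finite_subset by auto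
    then show "(- 1) ^ card (insert v T - insert v U) * F (\<Sum>u\<in>insert v U. \<chi> (gam u)) =
        (- 1) ^ card (T - U) * F ((\<Sum>u\<in>U. \<chi> (gam u)) + \<chi> (gam v))" by (simp add: add.commute)
  qed simp
  show ?thesis
    unfolding altsum_def Pow_insert using T disj
    by (subst sum.union_disjoint) (auto simp: 1 2 right_diff_distrib sum_subtractf)
qed

text \<open>By \<open>npart_diff\<close>, each difference cancels one factor of the series.\<close>

lemma altsum_npart:
  assumes "finite T" "T \<union> T' \<subseteq> W" "T \<inter> T' = {}"
  shows "altsum T (npart (T \<union> T')) = npart T' 0"
  using assms
proof (induction T rule: finite_induct)
  case empty then show ?case by (simp add: altsum_def)
next
  case (insert v T)
  have e: "(\<lambda>a. npart (insert v T \<union> T') (a + \<chi> (gam v)) - npart (insert v T \<union> T') a) = npart (T \<union> T')"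
  proof
    fix a
    have "insert v T \<union> T' - {v} = T \<union> T'" using insert by auto
    then show "npart (insert v T \<union> T') (a + \<chi> (gam v)) - npart (insert v T \<union> T') a = npart (T \<union> T') a"
      using npart_diff[of "insert v T \<union> T'" v a] insert by simp
  qed
  show ?case unfolding altsum_insert[OF insert.hyps] e using insert by simp
qed

text \<open>A chain map onto the live complex which vanishes on cells of positive level.\<close>

definition tht :: "('v \<times> bool) list set \<times> 'v set \<Rightarrow> ('v set \<Rightarrow>\<^sub>0 'r::comm_ring_1)" where
  "tht c = Poly_Mapping.single (snd c) (npart (W - snd c) (\<chi> (fst c)))"

text \<open>\<open>tht\<close> takes the constant term of t^\<chi>(g) times the series of
  \<open>W - \<tau>\<close>. In a live direction the two faces combine to t^\<chi>(v) - 1, which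
  cancels the additional factor in the series of \<open>W - (\<tau> - {v})\<close>. In a dead
  direction both faces lie at the same level and cancel.\<close>

lemma tht_bd:
  assumes "g \<in> carrier Ga" "\<tau> \<in> \<Delta>"
  shows "lin tht (act Ga g (bd \<tau>)) = lin (lbd W) (tht (g, \<tau>) :: _ \<Rightarrow>\<^sub>0 'r::comm_ring_1)"
proof -
  have "lin tht (act Ga g (bd \<tau>)) = (\<Sum>v\<in>\<tau>. if v \<in> W
      then Poly_Mapping.single (\<tau> - {v}) (sg idx v \<tau> * npart (W - \<tau>) (\<chi> g)) else (0 :: _ \<Rightarrow>\<^sub>0 'r))"
    unfolding cbd_def act_sum lin_sum
  proof (rule sum.cong)
    fix v assume v: "v \<in> \<tau>"
    have V: "v \<in> V" using assms v flag_mem_V by blast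
    have "lin tht (act Ga g (scale (sg idx v \<tau>) (Poly_Mapping.single (gam v, \<tau> - {v}) 1 - Poly_Mapping.single (\<one>\<^bsub>Ga\<^esub>, \<tau> - {v}) 1)))
      = Poly_Mapping.single (\<tau> - {v}) (sg idx v \<tau> * (npart (W - (\<tau> - {v})) (\<chi> g + \<chi> (gam v)) - npart (W - (\<tau> - {v})) (\<chi> g)) :: 'r)"
      using V assms
      by (simp add: act_scale act_diff lin_scale lin_diff tht_def \<chi>_mult scale_diff right_diff_distrib single_diff)
    also have "\<dots> = (if v \<in> W then Poly_Mapping.single (\<tau> - {v}) (sg idx v \<tau> * npart (W - \<tau>) (\<chi> g)) else 0)"
    proof (cases "v \<in> W")
      case True
      have "W - (\<tau> - {v}) - {v} = W - \<tau>" using v by auto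
      then have "npart (W - (\<tau> - {v})) (\<chi> g + \<chi> (gam v)) - npart (W - (\<tau> - {v})) (\<chi> g) = (npart (W - \<tau>) (\<chi> g) :: 'r)"
        using npart_diff[of "W - (\<tau> - {v})" v "\<chi> g", where 'r = 'r] True by simp
      then show ?thesis using True by simp
    qed (use \<chi>_dead[OF V] in simp)
    finally show "lin tht (act Ga g (scale (sg idx v \<tau>) (Poly_Mapping.single (gam v, \<tau> - {v}) 1 - Poly_Mapping.single (\<one>\<^bsub>Ga\<^esub>, \<tau> - {v}) 1)))
      = (if v \<in> W then Poly_Mapping.single (\<tau> - {v}) (sg idx v \<tau> * npart (W - \<tau>) (\<chi> g)) else (0 :: _ \<Rightarrow>\<^sub>0 'r))" .
  qed simp
  also have "\<dots> = (\<Sum>v\<in>\<tau> \<inter> W. Poly_Mapping.single (\<tau> - {v}) (sg idx v \<tau> * npart (W - \<tau>) (\<chi> g)))"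
    using flag_finite[OF assms(2)] by (simp add: sum.If_cases Int_def)
  also have "\<dots> = lin (lbd W) (tht (g, \<tau>))"
    by (simp add: tht_def lbd_def scale_sum mult.commute)
  finally show ?thesis .
qed

lemma tht_BD: assumes "x \<in> chains Ga (simp n)"
  shows "lin tht (BD x) = lin (lbd W) (lin tht x :: _ \<Rightarrow>\<^sub>0 'r::comm_ring_1)"
proof -
  have "lin tht (BD x) = lin (\<lambda>(g, \<tau>). lin tht (act Ga g (bd \<tau>))) x"
    by (simp add: ext_def lin_lin split_def)
  also have "\<dots> = lin (\<lambda>c. lin (lbd W) (tht c)) x"
    by (rule lin_cong_on[OF assms]) (auto simp: tht_bd simp_def)
  finally show ?thesis by (simp add: lin_lin)
qed

text \<open>Chains that are invisible after passing to the image of the character.\<close>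

definition flatkernel :: "(('v \<times> bool) list set \<times> 'v set \<Rightarrow>\<^sub>0 'r::comm_ring_1) set" where
  "flatkernel = {x. \<forall>F. pair (\<lambda>(g, \<tau>). F (\<chi> g) \<tau>) x = 0}"

text \<open>The coefficients of \<open>tht\<close> on a translate by g depend on g only through
  \<chi> g. So \<open>tht\<close> after an equivariant map is a functional of the levels and
  simplices of the chain, and all these vanish on \<open>flatkernel\<close>.\<close>

lemma tht_flatkernel:
  assumes x: "x \<in> flatkernel" "x \<in> chains Ga A" and H: "\<And>\<tau>. \<tau> \<in> A \<Longrightarrow> H \<tau> \<in> chains Ga UNIV"
  shows "lin tht (ext Ga H x) = (0 :: _ \<Rightarrow>\<^sub>0 'r::comm_ring_1)"
proof (rule pm_eqI)
  fix \<rho>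
  define F where "F a \<tau> = pair (\<lambda>(h, \<tau>'). if \<tau>' = \<rho> then npart (W - \<rho>) (a + \<chi> h) else 0) (H \<tau>)" for a \<tau>
  have "lookup (lin tht (ext Ga H x)) \<rho> = pair (\<lambda>(g, \<tau>). lookup (lin tht (act Ga g (H \<tau>))) \<rho>) x"
    by (simp add: ext_def lin_lin lookup_lin split_def)
  also have "\<dots> = pair (\<lambda>(g, \<tau>). F (\<chi> g) \<tau>) x"
  proof (rule pair_cong_on[OF x(2)], clarify)
    fix g \<tau> assume g: "g \<in> carrier Ga" "\<tau> \<in> A"
    have "lookup (lin tht (act Ga g (H \<tau>))) \<rho> =
        pair (\<lambda>(h, \<tau>'). lookup (tht (g \<otimes>\<^bsub>Ga\<^esub> h, \<tau>')) \<rho>) (H \<tau>)"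
      by (simp add: act_def lin_lin lookup_lin split_def)
    also have "\<dots> = F (\<chi> g) \<tau>"
      unfolding F_def
      by (rule pair_cong_on[OF H[OF g(2)]]) (use g in \<open>auto simp: tht_def lookup_single when_def \<chi>_mult\<close>)
    finally show "lookup (lin tht (act Ga g (H \<tau>))) \<rho> = F (\<chi> g) \<tau>" .
  qed
  also have "\<dots> = 0" using x(1) by (simp add: flatkernel_def)
  finally show "lookup (lin tht (ext Ga H x)) \<rho> = lookup 0 \<rho>" by simp
qed

section \<open>Lifting live cycles to chains of cubes\<close>

lemma exists_level: assumes "finite U" "U \<subseteq> V" shows "\<exists>g\<in>carrier Ga. \<chi> g = (\<Sum>u\<in>U. \<chi> (gam u))"
  using assms
proof (induction U rule: finite_induct)
  case (insert u U)
  then obtain g where "g \<in> carrier Ga" "\<chi> g = (\<Sum>u\<in>U. \<chi> (gam u))" by auto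
  then show ?case using insert by (intro bexI[of _ "g \<otimes>\<^bsub>Ga\<^esub> gam u"]) (auto simp: \<chi>_mult)
qed (use raag.one_closed in force)

text \<open>A simplex \<tau> lifts to its multiple by the product of t^\<chi>(u) - 1 over u in
  \<open>W - \<tau>\<close>, inverse to the series in \<open>tht\<close>. These vertices need not
  commute, so a monomial is represented by any element \<open>gU U\<close> of its level. As far as
  \<chi> can see, the boundary of the lift is the lift of the live boundary, hence invisible for a
  live cycle.\<close>

lemma cycle_lift:
  fixes z :: "'v set \<Rightarrow>\<^sub>0 'r::comm_ring_1"
  assumes z: "z \<in> supported (simp n)" "lin (lbd W) z = 0"
  shows "\<exists>x\<in>supported ({g\<in>carrier Ga. 0 \<le> \<chi> g} \<times> simp n). lin tht x = z \<and> BD x \<in> flatkernel"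
proof -
  have "\<exists>g. U \<subseteq> W \<longrightarrow> g \<in> carrier Ga \<and> \<chi> g = (\<Sum>u\<in>U. \<chi> (gam u))" for U
  proof (cases "U \<subseteq> W")
    case True
    then have "U \<subseteq> V" using W_V by blast
    from exists_level[OF finite_subset[OF True finite_W] this] show ?thesis by blast
  qed simp
  from choice[OF allI[OF this]] obtain gU
    where "\<forall>U. U \<subseteq> W \<longrightarrow> gU U \<in> carrier Ga \<and> \<chi> (gU U) = (\<Sum>u\<in>U. \<chi> (gam u))" by (rule exE)
  note gU = this[rule_format]
  define X :: "'v set \<Rightarrow> (_ \<Rightarrow>\<^sub>0 'r)" where
    "X \<tau> = (\<Sum>U\<in>Pow (W - \<tau>). Poly_Mapping.single (gU U, \<tau>) ((- 1) ^ card (W - \<tau> - U)))" for \<tau>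
  have X_pair: "pair f (X \<tau>) = altsum (W - \<tau>) (\<lambda>a. F a)"
    if "\<And>U. U \<subseteq> W \<Longrightarrow> f (gU U, \<tau>) = F (\<Sum>u\<in>U. \<chi> (gam u))" for f and F :: "real \<Rightarrow> 'r" and \<tau>
    unfolding X_def altsum_def pair_sum
  proof (rule sum.cong)
    fix U assume "U \<in> Pow (W - \<tau>)"
    then have "U \<subseteq> W" by auto
    then show "pair f (Poly_Mapping.single (gU U, \<tau>) ((- 1) ^ card (W - \<tau> - U))) =
        (- 1) ^ card (W - \<tau> - U) * F (\<Sum>u\<in>U. \<chi> (gam u))" by (simp add: that)
  qed simp
  have Xc: "X \<tau> \<in> supported ({g\<in>carrier Ga. 0 \<le> \<chi> g} \<times> {\<tau>})" for \<tau>
    unfolding X_def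
  proof (intro supported_sum supported_single)
    fix U assume "U \<in> Pow (W - \<tau>)"
    then have U: "U \<subseteq> W" by auto
    have "0 \<le> (\<Sum>u\<in>U. \<chi> (gam u))"
    proof (rule sum_nonneg)
      fix u assume "u \<in> U"
      then show "0 \<le> \<chi> (gam u)" using U W_V \<chi>_gam by blast
    qed
    then show "(gU U, \<tau>) \<in> {g\<in>carrier Ga. 0 \<le> \<chi> g} \<times> {\<tau>}" using gU[OF U] by simp
  qed
  have tht_X: "lin tht (X \<tau>) = Poly_Mapping.single \<tau> (1::'r)" for \<tau>
  proof (rule pm_eqI)
    fix \<rho>
    have "lookup (lin tht (X \<tau>)) \<rho> = altsum (W - \<tau>) (\<lambda>a. if \<rho> = \<tau> then npart (W - \<tau>) a else (0::'r))"
      unfolding lookup_lin by (rule X_pair) (use gU in \<open>auto simp: tht_def lookup_single when_def\<close>)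
    also have "\<dots> = (if \<rho> = \<tau> then 1 else 0)"
      using altsum_npart[of "W - \<tau>" "{}", where 'a = 'r] by (simp add: npart_empty) (simp add: altsum_def)
    finally show "lookup (lin tht (X \<tau>)) \<rho> = lookup (Poly_Mapping.single \<tau> 1) \<rho>"
      by (auto simp: lookup_single when_def)
  qed
  let ?x = "lin X z"
  have xc: "?x \<in> supported ({g\<in>carrier Ga. 0 \<le> \<chi> g} \<times> simp n)"
    by (rule supported_lin[OF z(1)]) (rule supported_mono[OF Xc], auto)
  have "lin tht ?x = z" by (simp add: lin_lin tht_X)
  moreover have "pair (\<lambda>(g, \<tau>). F (\<chi> g) \<tau>) (BD ?x) = 0" for F :: "real \<Rightarrow> 'v set \<Rightarrow> 'r"
  proof -
    \<comment> \<open>The value of \<open>F\<close> on the lift of \<rho>. The next equation thus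
      says that the boundary of a lift and the lift of the live boundary agree under
      \<open>F\<close>.\<close>
    define Q where "Q \<rho> = altsum (W - \<rho>) (\<lambda>a. F a \<rho>)" for \<rho>
    have "pair (\<lambda>(g, \<tau>). F (\<chi> g) \<tau>) (BD (X \<tau>)) = pair Q (lbd W \<tau>)" if \<tau>: "\<tau> \<in> \<Delta>" for \<tau>
    proof -
      define f where "f c = pair (\<lambda>(g, \<tau>). F (\<chi> g) \<tau>) (act Ga (fst c) (bd (snd c)))" for c
      have "pair (\<lambda>(g, \<tau>). F (\<chi> g) \<tau>) (BD (X \<tau>)) = pair f (X \<tau>)"
        by (simp add: ext_def pair_lin f_def[abs_def] split_def)
      also have "\<dots> = altsum (W - \<tau>) (\<lambda>a. \<Sum>v\<in>\<tau>. sg idx v \<tau> * (F (a + \<chi> (gam v)) (\<tau> - {v}) - F a (\<tau> - {v})))"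
      proof (rule X_pair)
        fix U assume U: "U \<subseteq> W"
        have V: "v \<in> \<tau> \<Longrightarrow> gam v \<in> carrier Ga" for v using \<tau> flag_mem_V by auto
        have "f (gU U, \<tau>) = (\<Sum>v\<in>\<tau>. sg idx v \<tau> * (F (\<chi> (gU U \<otimes>\<^bsub>Ga\<^esub> gam v)) (\<tau> - {v}) - F (\<chi> (gU U \<otimes>\<^bsub>Ga\<^esub> \<one>\<^bsub>Ga\<^esub>)) (\<tau> - {v})))"
          by (simp add: f_def cbd_def act_sum pair_sum act_scale pair_scale act_diff pair_diff)
        also have "\<dots> = (\<Sum>v\<in>\<tau>. sg idx v \<tau> * (F ((\<Sum>u\<in>U. \<chi> (gam u)) + \<chi> (gam v)) (\<tau> - {v}) - F (\<Sum>u\<in>U. \<chi> (gam u)) (\<tau> - {v})))"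
          using gU[OF U] V by (intro sum.cong) (auto simp: \<chi>_mult)
        finally show "f (gU U, \<tau>) = (\<Sum>v\<in>\<tau>. sg idx v \<tau> * (F ((\<Sum>u\<in>U. \<chi> (gam u)) + \<chi> (gam v)) (\<tau> - {v}) - F (\<Sum>u\<in>U. \<chi> (gam u)) (\<tau> - {v})))" .
      qed
      also have "\<dots> = (\<Sum>v\<in>\<tau>. sg idx v \<tau> * altsum (W - \<tau>) (\<lambda>a. F (a + \<chi> (gam v)) (\<tau> - {v}) - F a (\<tau> - {v})))"
        unfolding altsum_def sum_distrib_left
        by (subst sum.swap) (simp add: mult.left_commute)
      also have "\<dots> = (\<Sum>v\<in>\<tau>. if v \<in> W then sg idx v \<tau> * Q (\<tau> - {v}) else 0)"
      proof (rule sum.cong)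
        fix v assume v: "v \<in> \<tau>"
        show "sg idx v \<tau> * altsum (W - \<tau>) (\<lambda>a. F (a + \<chi> (gam v)) (\<tau> - {v}) - F a (\<tau> - {v})) =
            (if v \<in> W then sg idx v \<tau> * Q (\<tau> - {v}) else 0)"
        proof (cases "v \<in> W")
          case True
          then have "W - (\<tau> - {v}) = insert v (W - \<tau>)" using v by auto
          then show ?thesis using True v by (simp add: Q_def altsum_insert)
        next
          case False
          then show ?thesis using \<chi>_dead[of v] flag_mem_V[OF \<tau> v] by (simp add: altsum_def)
        qed
      qed simp
      also have "\<dots> = pair Q (lbd W \<tau>)"
        using flag_finite[OF \<tau>] by (simp add: lbd_def pair_sum sum.If_cases Int_def)
      finally show ?thesis .
    qed
    then have "pair (\<lambda>c. pair (\<lambda>(g, \<tau>). F (\<chi> g) \<tau>) (BD (X c))) z = pair (\<lambda>\<tau>. pair Q (lbd W \<tau>)) z"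
      by (intro pair_cong_on[OF z(1)]) (simp add: simp_def)
    also have "\<dots> = pair Q (lin (lbd W) z)" by (simp add: pair_lin)
    also have "\<dots> = 0" using z by simp
    also have "pair (\<lambda>c. pair (\<lambda>(g, \<tau>). F (\<chi> g) \<tau>) (BD (X c))) z = pair (\<lambda>(g, \<tau>). F (\<chi> g) \<tau>) (BD ?x)"
    proof -
      have "BD ?x = lin (\<lambda>c. BD (X c)) z" by (simp add: ext_def lin_lin)
      then show ?thesis by (simp add: pair_lin)
    qed
    finally show ?thesis .
  qed
  ultimately show ?thesis using xc by (intro bexI[of _ ?x]) (auto simp: flatkernel_def)
qed

text \<open>For a lift x of a live cycle z, the homotopy gives x = \<Phi>x + \<partial>Hx +
  H\<partial>x. Here \<open>tht\<close> kills \<Phi>x, which lies at positive levels, and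
  H\<partial>x, since \<partial>x is in \<open>flatkernel\<close>. So z is the live boundary of
  \<open>tht\<close> applied to Hx.\<close>

lemma raising_lexact:
  fixes \<Phi> H :: "nat \<Rightarrow> 'v set \<Rightarrow> (_ \<Rightarrow>\<^sub>0 'r::comm_ring_1)"
  assumes \<Phi>: "\<And>n \<tau>. n \<le> q \<Longrightarrow> \<tau> \<in> simp n \<Longrightarrow> \<Phi> n \<tau> \<in> supported {(g, \<rho>). g \<in> carrier Ga \<and> 0 < \<chi> g}"
    and H: "\<And>n \<tau>. \<tau> \<in> simp n \<Longrightarrow> H n \<tau> \<in> chains Ga (simp (Suc n))"
    and H0: "\<And>\<tau>. \<tau> \<in> simp 0 \<Longrightarrow> BD (H 0 \<tau>) = Poly_Mapping.single (\<one>\<^bsub>Ga\<^esub>, \<tau>) 1 - \<Phi> 0 \<tau>"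
    and HS: "\<And>n \<tau>. \<tau> \<in> simp (Suc n) \<Longrightarrow> BD (H (Suc n) \<tau>) = Poly_Mapping.single (\<one>\<^bsub>Ga\<^esub>, \<tau>) 1 - \<Phi> (Suc n) \<tau> - ext Ga (H n) (bd \<tau>)"
  shows "lexact W q TYPE('r)"
  unfolding lexact_def
proof (intro allI impI)
  fix n and z :: "'v set \<Rightarrow>\<^sub>0 'r" assume n: "n \<le> q" and z: "z \<in> supported (simp n)" "lin (lbd W) z = 0"
  obtain x where x: "x \<in> supported ({g\<in>carrier Ga. 0 \<le> \<chi> g} \<times> simp n)" "lin tht x = z" "BD x \<in> flatkernel"
    using cycle_lift[OF z] by blast
  have xG: "x \<in> chains Ga (simp n)" using x(1) by (rule supported_mono) auto
  have \<Phi>x: "lin tht (ext Ga (\<Phi> n) x) = 0"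
  proof -
    have "act Ga g (\<Phi> n \<tau>) \<in> supported {(g, \<rho>). 0 < \<chi> g}" if g: "g \<in> carrier Ga" "0 \<le> \<chi> g" "\<tau> \<in> simp n" for g \<tau>
      unfolding act_def
      by (rule supported_lin[OF \<Phi>[OF n g(3)]]) (use g in \<open>auto intro!: supported_single simp: \<chi>_mult\<close>)
    then have "ext Ga (\<Phi> n) x \<in> supported {(g, \<rho>). 0 < \<chi> g}"
      unfolding ext_def by (intro supported_lin[OF x(1)]) auto
    then have "lin tht (ext Ga (\<Phi> n) x) = lin (\<lambda>_. 0) (ext Ga (\<Phi> n) x)"
      by (rule lin_cong_on) (auto simp: tht_def npart_pos)
    then show ?thesis by simp
  qed
  have "lin tht (BD (ext Ga (H n) x)) = z"
  proof (cases n)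
    case 0
    have "BD (ext Ga (H 0) x) = ext Ga (\<lambda>\<tau>. BD (H 0 \<tau>)) x"
      using xG H by (intro raag.ext_ext[of x "simp 0" _ "simp (Suc 0)" _ "simp 0"]) (auto simp: 0 intro: bd_closed)
    also have "\<dots> = ext Ga (\<lambda>\<tau>. Poly_Mapping.single (\<one>\<^bsub>Ga\<^esub>, \<tau>) 1 - \<Phi> 0 \<tau>) x"
      using xG by (intro raag.ext_cong[of x "simp 0"]) (auto simp: 0 H0)
    also have "\<dots> = x - ext Ga (\<Phi> 0) x" using xG by (simp add: raag.ext_fun_diff raag.ext_id 0)
    finally show ?thesis using \<Phi>x x(2) by (simp add: 0 lin_diff)
  next
    case (Suc m)
    have "BD (ext Ga (H n) x) = ext Ga (\<lambda>\<tau>. BD (H n \<tau>)) x"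
      using xG H by (intro raag.ext_ext[of x "simp n" _ "simp (Suc n)" _ "simp n"]) (auto intro: bd_closed)
    also have "\<dots> = ext Ga (\<lambda>\<tau>. Poly_Mapping.single (\<one>\<^bsub>Ga\<^esub>, \<tau>) 1 - \<Phi> n \<tau> - ext Ga (H m) (bd \<tau>)) x"
      using xG by (intro raag.ext_cong[of x "simp n"]) (auto simp: Suc HS)
    also have "\<dots> = x - ext Ga (\<Phi> n) x - ext Ga (\<lambda>\<tau>. ext Ga (H m) (bd \<tau>)) x"
      using xG by (simp add: raag.ext_fun_diff raag.ext_id)
    also have "ext Ga (\<lambda>\<tau>. ext Ga (H m) (bd \<tau>)) x = ext Ga (H m) (BD x)"
      using xG H by (intro raag.ext_ext[symmetric, of x "simp (Suc m)" _ "simp m" _ "simp (Suc m)"])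
        (auto simp: Suc intro: bd_closed)
    finally have "lin tht (BD (ext Ga (H n) x)) = z - lin tht (ext Ga (H m) (BD x))"
      using \<Phi>x x(2) by (simp add: lin_diff)
    also have "lin tht (ext Ga (H m) (BD x)) = 0"
    proof (rule tht_flatkernel[OF x(3)])
      show "BD x \<in> chains Ga (simp m)" using xG BD_closed unfolding Suc by blast
      show "H m \<tau> \<in> chains Ga UNIV" if "\<tau> \<in> simp m" for \<tau> using H[OF that] by (rule supported_mono) auto
    qed
    finally show ?thesis by simp
  qed
  moreover have Hx: "ext Ga (H n) x \<in> chains Ga (simp (Suc n))"
    by (rule raag.ext_closed[OF xG H])
  moreover have "lin tht (ext Ga (H n) x) \<in> supported (simp (Suc n))"
    by (rule supported_lin[OF Hx]) (auto simp: tht_def intro: supported_single)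
  ultimately show "\<exists>y\<in>supported (simp (Suc n)). lin (lbd W) y = z"
    using tht_BD[OF Hx] by (intro bexI[of _ "lin tht (ext Ga (H n) x)"]) auto
qed

text \<open>Cubes are mapped to the resolution over the submonoid and back to cubes over G, both
  times by the comparison theorem. Finite generation bounds how far the way back lowers \<chi>; a
  translation beyond this bound makes the composite raise \<chi> above 0. A live vertex provides
  elements of arbitrarily large \<chi>.\<close>

theorem lexact_if_type_FP:
  assumes FP: "type_FP q (monoid_ring (nonneg_submonoid Ga \<chi>) :: (_ \<Rightarrow> 'r::comm_ring_1) ring) (trivial_module :: (_ \<Rightarrow> 'r, 'r) module)"
    and W: "W \<noteq> {}"
  shows "lexact W q TYPE('r)"
proof -
  let ?M = "nonneg_submonoid Ga \<chi>"
  interpret M: Group.monoid ?M by (rule monoid_nonneg)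
  have carM: "carrier ?M = {g\<in>carrier Ga. 0 \<le> \<chi> g}" by (simp add: nonneg_submonoid_def)
  obtain I :: "nat \<Rightarrow> (nat \<Rightarrow> ('v \<times> bool) list set \<Rightarrow> 'r) set" and Y d
      and e :: "(nat \<Rightarrow> ('v \<times> bool) list set \<Rightarrow> 'r) \<Rightarrow> 'r" where
    R: "exact_complex ?M Y d e" "\<forall>n. Y n \<subseteq> chains ?M (I n)" "\<forall>n. eqlin ?M (chains ?M (I (Suc n))) (d n)"
      "\<forall>n. \<forall>x\<in>chains ?M (I (Suc n)). d n x \<in> Y n" "\<forall>n. \<forall>x\<in>chains ?M (I (Suc (Suc n))). d n (d (Suc n) x) = 0"
      "\<forall>x\<in>chains ?M (I (Suc 0)). aug e (d 0 x) = 0"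
      "\<forall>n\<le>q. \<exists>X. finite X \<and> X \<subseteq> Y n \<and> (\<forall>Z. submod ?M Z \<longrightarrow> X \<subseteq> Z \<longrightarrow> Y n \<subseteq> Z)"
    using M.type_FP_unpack[OF FP] by (elim exE conjE) (rule that)
  note ex = R(1) and YI = R(2)[rule_format] and dlin = R(3)[rule_format] and dY = R(4)[rule_format]
    and dd = R(5)[rule_format] and ed = R(6)[rule_format] and fg = R(7)[rule_format]
  interpret Y: exact_complex ?M Y d e by (rule ex)
  define D where "D n i = d n (Poly_Mapping.single (\<one>\<^bsub>?M\<^esub>, i) 1)" for n i
  have sM: "Poly_Mapping.single (\<one>\<^bsub>?M\<^esub>, i) (1::'r) \<in> chains ?M (I n)" if "i \<in> I n" for i n
    using that by (intro supported_single) simp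
  have DY: "D n i \<in> Y n" if "i \<in> I (Suc n)" for n i unfolding D_def by (rule dY[OF sM[OF that]])
  have extD: "ext Ga (D n) x = d n x" if "x \<in> chains ?M (I (Suc n))" for n x
    using M.eqlin_ext[OF M.submod_chains dlin[of n] that, of "\<lambda>i. Poly_Mapping.single (\<one>\<^bsub>?M\<^esub>, i) 1"] sM M.ext_id[OF that]
    by (simp add: D_def[abs_def])
  have toG: "x \<in> chains ?M A \<Longrightarrow> x \<in> chains Ga A" for x and A :: "'c set"
    by (erule supported_mono) (auto simp: carM)
  \<comment> \<open>Extension of scalars from the submonoid to G: the basis and the boundaries stay,
    only the coefficients grow.\<close>
  have fF: "free_complex Ga I D e"
  proof
    fix n i
    show "i \<in> I (Suc n) \<Longrightarrow> D n i \<in> chains Ga (I n)" using DY YI toG by blast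
    show "i \<in> I (Suc (Suc n)) \<Longrightarrow> ext Ga (D n) (D (Suc n) i) = 0"
      using extD[of "D (Suc n) i" n] DY[of i "Suc n"] YI dd[OF sM] by (auto simp: D_def)
    show "i \<in> I (Suc 0) \<Longrightarrow> aug e (D 0 i) = 0" using ed[OF sM] by (simp add: D_def)
  qed
  interpret f: complex_pair Ga I D e "\<lambda>n. chains Ga (simp n)" "\<lambda>_. BD" "\<lambda>_. 1 :: 'r"
    by (intro complex_pair.intro fF exact_bd)
  obtain \<phi> where \<phi>: "f.chain_map \<phi>" using f.lift by blast
  define ff where "ff n = ext Ga (\<phi> n)" for n
  have ffc: "ff n y \<in> chains Ga (simp n)" if "y \<in> Y n" for n y
    unfolding ff_def by (rule f.chain_map_closed[OF \<phi> toG]) (use that YI in blast)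
  have ff_d: "BD (ff (Suc n) y) = ff n (d n y)" if "y \<in> Y (Suc n)" for n y
  proof -
    have y: "y \<in> chains ?M (I (Suc n))" using that YI by blast
    show ?thesis unfolding ff_def f.chain_map_d[OF \<phi> toG[OF y]] extD[OF y] ..
  qed
  have ff_aug: "aug (\<lambda>_. 1) (ff 0 y) = aug e y" if "y \<in> Y 0" for y
  proof -
    have y: "y \<in> chains ?M (I 0)" using that YI by blast
    have "aug (\<lambda>_. 1) (ff 0 y) = aug (\<lambda>i. aug (\<lambda>_. 1) (\<phi> 0 i)) y" by (simp add: ff_def aug_ext)
    also have "\<dots> = aug e y" by (rule aug_cong[OF y]) (use \<phi> in \<open>simp add: f.chain_map_def\<close>)
    finally show ?thesis .
  qed
  have ff_lin: "ff n (x + y) = ff n x + ff n y" "ff n (x - y) = ff n x - ff n y" "ff n (scale r x) = scale r (ff n x)" for n x y r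
    by (simp_all add: ff_def ext_add ext_diff ext_scale)
  have ff_sum: "ff n (\<Sum>i\<in>J. x i) = (\<Sum>i\<in>J. ff n (x i))" for n x and J :: "'v set" by (simp add: ff_def ext_sum)
  have ff_act: "ff n (act Ga h y) = act Ga h (ff n y)" if "y \<in> Y n" "h \<in> carrier ?M" for n h y
    unfolding ff_def
  proof (rule raag.ext_act)
    show "h \<in> carrier Ga" using that by (simp add: carM)
    show "y \<in> chains Ga (I n)" using that YI toG by blast
  qed (use \<phi> in \<open>auto simp: f.chain_map_def\<close>)
  \<comment> \<open>Elements of the submonoid do not lower levels, so the part of \<open>Y n\<close>
    that \<open>ff n\<close> sends into \<open>low a\<close> is a submodule. A bound on finitely
    many generators therefore bounds all of \<open>Y n\<close>.\<close>
  define low where "low a = {(g, \<rho> :: 'v set). g \<in> carrier Ga \<and> - a \<le> \<chi> g}" for a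
  have "\<exists>a. \<forall>y\<in>Y n. ff n y \<in> supported (low a)" if n: "n \<le> q" for n
  proof -
    obtain X where X: "finite X" "X \<subseteq> Y n" "\<And>Z. submod ?M Z \<Longrightarrow> X \<subseteq> Z \<Longrightarrow> Y n \<subseteq> Z" using fg[OF n] by blast
    define a where "a = Max (insert 0 (\<Union>x\<in>X. (\<lambda>c. - \<chi> (fst c)) ` keys (ff n x)))"
    have Xa: "ff n x \<in> supported (low a)" if x: "x \<in> X" for x
    proof -
      have "- a \<le> \<chi> (fst c)" if c: "c \<in> keys (ff n x)" for c
      proof -
        have "- \<chi> (fst c) \<le> a" unfolding a_def using X(1) x c by (intro Max_ge) auto
        then show ?thesis by simp
      qed
      then show ?thesis using ffc[of x n] x X(2) by (fastforce simp: supported_def low_def)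
    qed
    let ?Z = "{y \<in> Y n. ff n y \<in> supported (low a)}"
    have "submod ?M ?Z"
      unfolding submod_def
    proof (intro conjI ballI allI subsetI)
      fix h y assume h: "h \<in> carrier ?M" and y: "y \<in> ?Z"
      have "act Ga h (ff n y) \<in> supported (low a)"
        unfolding act_def
        by (rule supported_lin[of _ "low a"]) (use h y in \<open>auto simp: low_def carM \<chi>_mult intro!: supported_single\<close>)
      then show "act ?M h y \<in> ?Z" using y h submod_act[OF Y.Y_submod h] ff_act by auto
    next
      show "0 \<in> ?Z" using submod_zero[OF Y.Y_submod] by (simp add: ff_def)
    qed (auto simp: ff_lin supported_add supported_scale submod_add[OF Y.Y_submod] submod_scale[OF Y.Y_submod] submod_sub[OF Y.Y_submod])
    then have "Y n \<subseteq> ?Z" using X Xa by blast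
    then show ?thesis by blast
  qed
  then obtain an where an: "\<And>n y. n \<le> q \<Longrightarrow> y \<in> Y n \<Longrightarrow> ff n y \<in> supported (low (an n))" by metis
  define a where "a = Max (an ` {..q})"
  have low: "ff n y \<in> supported (low a)" if "n \<le> q" "y \<in> Y n" for n y
  proof -
    have "an n \<le> a" unfolding a_def using that by (intro Max_ge) auto
    then show ?thesis using an[OF that] by (elim supported_mono) (auto simp: low_def)
  qed
  obtain w where w: "w \<in> W" using W by blast
  have "\<exists>g\<in>carrier Ga. \<chi> g = real m * \<chi> (gam w)" for m
  proof (induction m)
    case (Suc m)
    then obtain g where "g \<in> carrier Ga" "\<chi> g = real m * \<chi> (gam w)" by auto
    then show ?case using W_V[OF w] by (intro bexI[of _ "g \<otimes>\<^bsub>Ga\<^esub> gam w"]) (auto simp: \<chi>_mult algebra_simps)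
  qed (use raag.one_closed in force)
  moreover obtain m where "a < real m * \<chi> (gam w)" using reals_Archimedean3[OF W_pos[OF w]] by blast
  ultimately obtain g where g: "g \<in> carrier Ga" "a < \<chi> g" by metis
  \<comment> \<open>The final map multiplies the images of basis elements by \<open>g\<close>, and g
    c v = gam v g. So the cube complex is set up over the submonoid with the conjugates
    \<open>c v\<close>, which have the same \<chi> as \<open>gam v\<close>; after multiplication by
    \<open>g\<close> the map commutes with the original boundary.\<close>
  define c where "c v = inv\<^bsub>Ga\<^esub> g \<otimes>\<^bsub>Ga\<^esub> (gam v \<otimes>\<^bsub>Ga\<^esub> g)" for v
  have \<chi>_inv: "\<chi> (inv\<^bsub>Ga\<^esub> g) = - \<chi> g" using \<chi>_mult[of "inv\<^bsub>Ga\<^esub> g" g] g by simp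
  have cM: "c v \<in> carrier ?M" if "v \<in> V" for v
    using that g \<chi>_gam by (simp add: carM c_def \<chi>_mult \<chi>_inv)
  have gc: "g \<otimes>\<^bsub>Ga\<^esub> c v = gam v \<otimes>\<^bsub>Ga\<^esub> g" if "v \<in> V" for v
    using that g by (simp add: c_def raag.m_assoc[symmetric])
  have free_c: "free_complex ?M simp (\<lambda>_. cbd ?M c) (\<lambda>_. 1 :: 'r)"
  proof (rule free_cbd[OF monoid_nonneg cM])
    fix \<tau> v u assume t: "\<tau> \<in> \<Delta>" "v \<in> \<tau>" "u \<in> \<tau>"
    then have V: "v \<in> V" "u \<in> V" using flag_mem_V by auto
    have cc: "c v \<otimes>\<^bsub>Ga\<^esub> c u = inv\<^bsub>Ga\<^esub> g \<otimes>\<^bsub>Ga\<^esub> (gam v \<otimes>\<^bsub>Ga\<^esub> (gam u \<otimes>\<^bsub>Ga\<^esub> g))" if "v \<in> V" "u \<in> V" for v u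
    proof -
      have "c v \<otimes>\<^bsub>Ga\<^esub> c u = inv\<^bsub>Ga\<^esub> g \<otimes>\<^bsub>Ga\<^esub> (gam v \<otimes>\<^bsub>Ga\<^esub> (g \<otimes>\<^bsub>Ga\<^esub> c u))"
        using that g cM[OF that(2)] by (simp add: c_def[of v] raag.m_assoc carM)
      then show ?thesis by (simp add: gc that)
    qed
    have "gam v \<otimes>\<^bsub>Ga\<^esub> (gam u \<otimes>\<^bsub>Ga\<^esub> g) = gam u \<otimes>\<^bsub>Ga\<^esub> (gam v \<otimes>\<^bsub>Ga\<^esub> g)"
      using V g gam_commute[OF t] by (simp add: raag.m_assoc[symmetric])
    then have "c v \<otimes>\<^bsub>Ga\<^esub> c u = c u \<otimes>\<^bsub>Ga\<^esub> c v" using cc V by simp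
    then show "c v \<otimes>\<^bsub>?M\<^esub> c u = c u \<otimes>\<^bsub>?M\<^esub> c v" by (simp add: nonneg_submonoid_def)
  qed
  interpret k: complex_pair ?M simp "\<lambda>_. cbd ?M c" "\<lambda>_. 1 :: 'r" Y d e
    by (intro complex_pair.intro free_c ex)
  obtain \<kappa> where \<kappa>: "k.chain_map \<kappa>" using k.lift by blast
  have \<kappa>Y: "\<kappa> n \<tau> \<in> Y n" if "\<tau> \<in> simp n" for n \<tau> using \<kappa> that by (simp add: k.chain_map_def)
  define \<Phi> where "\<Phi> n \<tau> = act Ga g (ff n (\<kappa> n \<tau>))" for n \<tau>
  interpret C: complex_pair Ga simp "\<lambda>_. bd" "\<lambda>_. 1 :: 'r" "\<lambda>n. chains Ga (simp n)" "\<lambda>_. BD" "\<lambda>_. 1 :: 'r"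
    by (intro complex_pair.intro free_bd exact_bd)
  have \<Phi>c: "\<Phi> n \<tau> \<in> chains Ga (simp n)" if "\<tau> \<in> simp n" for n \<tau>
    unfolding \<Phi>_def by (rule raag.act_closed[OF g(1) ffc[OF \<kappa>Y[OF that]]])
  have "BD (\<Phi> (Suc n) \<tau>) = ext Ga (\<Phi> n) (bd \<tau>)" if \<tau>: "\<tau> \<in> simp (Suc n)" for n \<tau>
  proof -
    have "BD (\<Phi> (Suc n) \<tau>) = act Ga g (BD (ff (Suc n) (\<kappa> (Suc n) \<tau>)))"
      unfolding \<Phi>_def by (rule raag.ext_act[OF g(1) ffc[OF \<kappa>Y[OF \<tau>]] bd_closed])
    also have "BD (ff (Suc n) (\<kappa> (Suc n) \<tau>)) = ff n (ext Ga (\<kappa> n) (cbd ?M c \<tau>))"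
      using \<kappa> \<tau> by (simp add: ff_d \<kappa>Y k.chain_map_def)
    also have "ext Ga (\<kappa> n) (cbd ?M c \<tau>) = (\<Sum>v\<in>\<tau>. scale (sg idx v \<tau>) (act Ga (c v) (\<kappa> n (\<tau> - {v})) - \<kappa> n (\<tau> - {v})))"
      unfolding cbd_def ext_sum
    proof (rule sum.cong)
      fix v assume v: "v \<in> \<tau>"
      have "\<tau> - {v} \<in> simp n" using \<tau> v flag_subset card_remove by (auto simp: simp_def)
      then have "act Ga \<one>\<^bsub>?M\<^esub> (\<kappa> n (\<tau> - {v})) = \<kappa> n (\<tau> - {v})"
        using M.act_one[of "\<kappa> n (\<tau> - {v})" "I n"] \<kappa>Y YI by (auto)
      then show "ext Ga (\<kappa> n) (scale (sg idx v \<tau>) (Poly_Mapping.single (c v, \<tau> - {v}) 1 - Poly_Mapping.single (\<one>\<^bsub>?M\<^esub>, \<tau> - {v}) 1)) =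
          scale (sg idx v \<tau>) (act Ga (c v) (\<kappa> n (\<tau> - {v})) - \<kappa> n (\<tau> - {v}))"
        by (simp add: ext_scale ext_diff ext_single)
    qed simp
    also have "act Ga g (ff n \<dots>) = (\<Sum>v\<in>\<tau>. scale (sg idx v \<tau>) (act Ga (gam v) (\<Phi> n (\<tau> - {v})) - \<Phi> n (\<tau> - {v})))"
      unfolding ff_sum act_sum
    proof (rule sum.cong)
      fix v assume v: "v \<in> \<tau>"
      have s: "\<tau> - {v} \<in> simp n" using \<tau> v flag_subset card_remove by (auto simp: simp_def)
      have V: "v \<in> V" using \<tau> v flag_mem_V by (auto simp: simp_def)
      have y: "\<kappa> n (\<tau> - {v}) \<in> Y n" by (rule \<kappa>Y[OF s])
      have cG: "c v \<in> carrier Ga" using cM[OF V] by (simp add: carM)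
      have "act Ga g (act Ga (c v) (ff n (\<kappa> n (\<tau> - {v})))) = act Ga (gam v) (\<Phi> n (\<tau> - {v}))"
        using raag.act_act[OF g(1) cG ffc[OF y]] raag.act_act[OF gam_closed[OF V] g(1) ffc[OF y]]
        by (simp add: \<Phi>_def gc[OF V])
      then show "act Ga g (ff n (scale (sg idx v \<tau>) (act Ga (c v) (\<kappa> n (\<tau> - {v})) - \<kappa> n (\<tau> - {v})))) =
          scale (sg idx v \<tau>) (act Ga (gam v) (\<Phi> n (\<tau> - {v})) - \<Phi> n (\<tau> - {v}))"
        by (simp add: ff_lin ff_act[OF y cM[OF V]] act_scale act_diff \<Phi>_def)
    qed simp
    also have "\<dots> = ext Ga (\<Phi> n) (bd \<tau>)"
      unfolding cbd_def ext_sum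
    proof (rule sum.cong)
      fix v assume v: "v \<in> \<tau>"
      have s: "\<tau> - {v} \<in> simp n" using \<tau> v flag_subset card_remove by (auto simp: simp_def)
      show "scale (sg idx v \<tau>) (act Ga (gam v) (\<Phi> n (\<tau> - {v})) - \<Phi> n (\<tau> - {v})) =
          ext Ga (\<Phi> n) (scale (sg idx v \<tau>) (Poly_Mapping.single (gam v, \<tau> - {v}) 1 - Poly_Mapping.single (\<one>\<^bsub>Ga\<^esub>, \<tau> - {v}) 1))"
        using raag.act_one[OF \<Phi>c[OF s]] by (simp add: ext_scale ext_diff ext_single)
    qed simp
    finally show ?thesis .
  qed
  moreover have "aug (\<lambda>_. 1) (\<Phi> 0 \<tau>) = (1::'r)" if "\<tau> \<in> simp 0" for \<tau>
    using \<kappa> that ff_aug[OF \<kappa>Y[OF that]] by (simp add: \<Phi>_def k.chain_map_def)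
  ultimately have \<Phi>_map: "C.chain_map \<Phi>" using \<Phi>c by (auto simp: C.chain_map_def)
  define \<Psi> :: "nat \<Rightarrow> 'v set \<Rightarrow> (_ \<Rightarrow>\<^sub>0 'r)" where "\<Psi> n \<tau> = Poly_Mapping.single (\<one>\<^bsub>Ga\<^esub>, \<tau>) 1" for n \<tau>
  have "C.chain_map \<Psi>"
    unfolding C.chain_map_def
  proof (intro conjI allI ballI)
    fix n \<tau> assume "\<tau> \<in> simp (Suc n)"
    then have b: "(bd \<tau> :: _ \<Rightarrow>\<^sub>0 'r) \<in> chains Ga (simp n)" by (rule bd_closed)
    have "ext Ga (\<Psi> n) (bd \<tau>) = bd \<tau>" unfolding \<Psi>_def[abs_def] by (rule raag.ext_id[OF b])
    then show "BD (\<Psi> (Suc n) \<tau>) = ext Ga (\<Psi> n) (bd \<tau>)"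
      by (simp add: \<Psi>_def[of "Suc n"] ext_single raag.act_one[OF b])
  qed (auto simp: \<Psi>_def intro!: supported_single)
  then obtain H where H: "C.homotopy \<Psi> \<Phi> H" using C.homotopic \<Phi>_map by blast
  show ?thesis
  proof (rule raising_lexact[of q \<Phi> H])
    fix n \<tau> assume n: "n \<le> q" "\<tau> \<in> simp n"
    show "\<Phi> n \<tau> \<in> supported {(g, \<rho>). g \<in> carrier Ga \<and> 0 < \<chi> g}"
      unfolding \<Phi>_def act_def
      by (rule supported_lin[OF low[OF n(1) \<kappa>Y[OF n(2)]]]) (use g in \<open>auto simp: low_def \<chi>_mult intro!: supported_single\<close>)
  qed (use H in \<open>auto simp: C.homotopy_def \<Psi>_def\<close>)
qed

end

section \<open>Change of coefficients\<close>

definition cof :: "('c \<Rightarrow>\<^sub>0 int) \<Rightarrow> ('c \<Rightarrow>\<^sub>0 'r::comm_ring_1)" where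
  "cof x = Poly_Mapping.map of_int x"

lemma lookup_cof [simp]: "lookup (cof x) c = of_int (lookup x c)"
  by (simp add: cof_def Poly_Mapping.map.rep_eq when_def)
lemma cof_zero [simp]: "cof 0 = 0" by (rule pm_eqI) simp
lemma cof_add: "cof (x + y) = cof x + cof y" by (rule pm_eqI) (simp add: lookup_add)
lemma cof_scale: "cof (scale r x) = scale (of_int r) (cof x)" by (rule pm_eqI) simp
lemma cof_sum: "cof (\<Sum>i\<in>I. x i) = (\<Sum>i\<in>I. cof (x i))" by (rule pm_eqI) (simp add: lookup_sum)
lemma cof_single [simp]: "cof (Poly_Mapping.single c r) = Poly_Mapping.single c (of_int r)"
  by (rule pm_eqI) (simp add: lookup_single when_def)
lemma keys_cof: "keys (cof x) \<subseteq> keys x" by (auto simp: in_keys_iff)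
lemma cof_supported: "x \<in> supported A \<Longrightarrow> cof x \<in> supported A" using keys_cof[of x] by (auto simp: supported_def)

lemma pair_cof: "pair (\<lambda>c. of_int (f c)) (cof x) = (of_int (pair f x) :: 'r::comm_ring_1)"
  using pair_superset[of "keys x" "cof x :: _ \<Rightarrow>\<^sub>0 'r" "\<lambda>c. of_int (f c)"] keys_cof[of x, where 'b = 'r]
  by (simp add: pair_def)

lemma cof_lin: "cof (lin \<phi> x) = lin (\<lambda>c. cof (\<phi> c)) (cof x :: _ \<Rightarrow>\<^sub>0 'r::comm_ring_1)"
  by (rule pm_eqI) (simp add: lookup_lin pair_cof)

lemma sg_of_int: "of_int (sg idx v \<tau>) = sg idx v \<tau>" by (simp add: sg_def)

section \<open>Passing between the integers and a field\<close>

lemma separating_functional: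
  fixes z :: "'c \<Rightarrow>\<^sub>0 'k::field"
  assumes S0: "0 \<in> S" and S_add: "\<And>x y. x \<in> S \<Longrightarrow> y \<in> S \<Longrightarrow> x + y \<in> S" and S_scale: "\<And>r x. x \<in> S \<Longrightarrow> scale r x \<in> S"
    and z: "z \<notin> S"
  shows "\<exists>f. (\<forall>x\<in>S. pair f x = 0) \<and> pair f z = 1"
proof -
  interpret vector_space_pair "scale :: 'k \<Rightarrow> ('c \<Rightarrow>\<^sub>0 'k) \<Rightarrow> _" "(*) :: 'k \<Rightarrow> 'k \<Rightarrow> 'k"
    by unfold_locales (auto simp: scale_add scale_add_left algebra_simps)
  have sub: "vs1.subspace S" using assms by (simp add: vs1.subspace_def)
  obtain B where B: "B \<subseteq> S" "vs1.independent B" "S \<subseteq> vs1.span B"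
    using vs1.maximal_independent_subset[of S] by blast
  have "vs1.span B \<subseteq> S" by (rule vs1.span_minimal[OF B(1) sub])
  then have zB: "z \<notin> vs1.span B" using z by blast
  then have ind: "vs1.independent (insert z B)" using B(2) vs1.independent_insertI by blast
  obtain g where g: "Vector_Spaces.linear scale (*) g" "\<forall>x\<in>insert z B. g x = (if x = z then 1 else 0)"
    using linear_independent_extend[OF ind, of "\<lambda>x. if x = z then 1 else 0"] by blast
  have gz: "g z = 1" using g by simp
  have "x \<in> B \<Longrightarrow> g x = 0" for x using g zB vs1.span_base[of x B] by auto
  then have gB: "g x = 0" if "x \<in> S" for x
    using linear_eq_0_on_span[OF g(1), of B x] B(3) that by blast
  have gl: "g (x + y) = g x + g y" "g (scale r x) = r * g x" for x y r
    using linear_add[OF g(1)] linear_scale[OF g(1)] by auto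
  have gsum: "g (\<Sum>i\<in>I. h i) = (\<Sum>i\<in>I. g (h i))" for h and I :: "'c set"
    using gl(2)[of 0 0] by (induction I rule: infinite_finite_induct) (auto simp: gl)
  have "pair (\<lambda>c. g (Poly_Mapping.single c 1)) x = g x" for x
  proof -
    have "g x = g (\<Sum>c\<in>keys x. scale (lookup x c) (Poly_Mapping.single c 1))" by (simp only: chain_expand[symmetric])
    then show ?thesis by (simp only: gsum gl pair_def)
  qed
  then show ?thesis using gB gz by (intro exI[of _ "\<lambda>c. g (Poly_Mapping.single c 1)"]) simp
qed

lemma common_denominator:
  fixes f :: "'c \<Rightarrow> rat"
  assumes "finite A"
  shows "\<exists>D > 0. \<exists>h. \<forall>c\<in>A. of_int D * f c = of_int (h c :: int)"
  using assms
proof (induction A rule: finite_induct)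
  case empty
  show ?case by (intro exI[of _ 1]) auto
next
  case (insert a A)
  then obtain D h where D: "D > 0" "\<And>c. c \<in> A \<Longrightarrow> of_int D * f c = of_int (h c)" by blast
  obtain p q where pq: "f a = of_int p / of_int q" "q > 0"
    by (metis quotient_of_denom_pos' quotient_of_div prod.collapse)
  have "\<forall>c\<in>insert a A. of_int (D * q) * f c = of_int (if c = a then D * p else q * h c)"
  proof
    fix c assume c: "c \<in> insert a A"
    show "of_int (D * q) * f c = of_int (if c = a then D * p else q * h c)"
    proof (cases "c = a")
      case False
      then have "of_int D * f c = of_int (h c)" using c D by auto
      then show ?thesis using False by (simp add: mult.assoc mult.left_commute)
    qed (use pq in simp)
  qed
  then show ?case using D(1) pq(2)
    by (intro exI[of _ "D * q"] conjI exI[of _ "\<lambda>c. if c = a then D * p else q * h c"]) auto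
qed

context raag_complex
begin

lemma cof_lbd: "cof (lbd W \<tau>) = (lbd W \<tau> :: _ \<Rightarrow>\<^sub>0 'r::comm_ring_1)"
  by (simp add: lbd_def cof_sum sg_of_int)

lemma cof_lbd_lin: "cof (lin (lbd W) x) = lin (lbd W) (cof x :: _ \<Rightarrow>\<^sub>0 'r::comm_ring_1)"
  by (simp add: cof_lin cof_lbd)

text \<open>Exactness is turned into an integral contraction first: its defining identity is an
  equation between integral coefficients and survives in every ring.\<close>

theorem lexact_from_int:
  assumes "lexact W q TYPE(int)" shows "lexact W q TYPE('r::comm_ring_1)"
proof -
  obtain s :: "_ \<Rightarrow> (_ \<Rightarrow>\<^sub>0 int)" where s: "contraction W q s" using lexact_contraction[OF assms] by blast
  have "contraction W q (\<lambda>\<tau>. cof (s \<tau>) :: _ \<Rightarrow>\<^sub>0 'r)"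
    unfolding contraction_def
  proof (intro ballI impI conjI)
    fix \<tau> assume t: "\<tau> \<in> \<Delta>" "card \<tau> \<le> q"
    then have st: "s \<tau> \<in> supported (simp (Suc (card \<tau>)) \<inter> part W (\<tau> - W))"
      "lin (lbd W) (s \<tau>) + lin s (lbd W \<tau>) = Poly_Mapping.single \<tau> 1" using s by (auto simp: contraction_def)
    show "(cof (s \<tau>) :: _ \<Rightarrow>\<^sub>0 'r) \<in> supported (simp (Suc (card \<tau>)) \<inter> part W (\<tau> - W))" by (rule cof_supported[OF st(1)])
    have "lin (lbd W) (cof (s \<tau>)) + lin (\<lambda>\<tau>. cof (s \<tau>)) (lbd W \<tau>) =
        cof (lin (lbd W) (s \<tau>) + lin s (lbd W \<tau>))"
      by (simp add: cof_add cof_lbd_lin) (simp add: cof_lin cof_lbd)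
    then show "lin (lbd W) (cof (s \<tau>)) + lin (\<lambda>\<tau>. cof (s \<tau>)) (lbd W \<tau>) = Poly_Mapping.single \<tau> (1::'r)"
      by (simp add: st(2))
  qed
  then show ?thesis by (rule contraction_lexact)
qed

definition ltorsion_free :: "'v set \<Rightarrow> bool" where
  "ltorsion_free W \<longleftrightarrow> (\<forall>n k. \<forall>x :: 'v set \<Rightarrow>\<^sub>0 int. \<forall>y. x \<in> supported (simp n) \<longrightarrow> lin (lbd W) x = 0 \<longrightarrow> k > 0 \<longrightarrow>
     y \<in> supported (simp (Suc n)) \<longrightarrow> scale k x = lin (lbd W) y \<longrightarrow>
     (\<exists>y\<in>supported (simp (Suc n)). lin (lbd W) y = x))"

lemma finite_simp: "finite (simp n)" by (rule finite_subset[OF _ finite_flag]) (auto simp: simp_def)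

lemma boundary_separation:
  fixes z :: "'v set \<Rightarrow>\<^sub>0 'k::field"
  assumes "\<not> (\<exists>y\<in>supported (simp (Suc n)). lin (lbd W) y = z)"
  shows "\<exists>f. (\<forall>\<tau>\<in>simp (Suc n). pair f (lbd W \<tau>) = 0) \<and> pair f z = 1"
proof -
  let ?S = "lin (lbd W) ` (supported (simp (Suc n)) :: (_ \<Rightarrow>\<^sub>0 'k) set)"
  have "\<exists>f. (\<forall>x\<in>?S. pair f x = 0) \<and> pair f z = 1"
  proof (rule separating_functional)
    show "0 \<in> ?S" by (rule image_eqI[of _ _ 0]) auto
    show "x + y \<in> ?S" if xy: "x \<in> ?S" "y \<in> ?S" for x y
    proof -
      obtain u v where "x = lin (lbd W) u" "u \<in> supported (simp (Suc n))" "y = lin (lbd W) v" "v \<in> supported (simp (Suc n))"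
        using xy by blast
      then show ?thesis by (intro image_eqI[of _ _ "u + v"]) (auto simp: lin_add supported_add)
    qed
    show "scale r x \<in> ?S" if xs: "x \<in> ?S" for r x
    proof -
      obtain u where "x = lin (lbd W) u" "u \<in> supported (simp (Suc n))" using xs by blast
      then show ?thesis by (intro image_eqI[of _ _ "scale r u"]) (auto simp: lin_scale supported_scale)
    qed
    show "z \<notin> ?S" using assms by blast
  qed
  then obtain f where f: "\<forall>x\<in>?S. pair f x = 0" "pair f z = 1" by blast
  have "pair f (lbd W \<tau>) = 0" if "\<tau> \<in> simp (Suc n)" for \<tau>
  proof -
    have "lbd W \<tau> = lin (lbd W) (Poly_Mapping.single \<tau> (1::'k))" by simp
    moreover have "Poly_Mapping.single \<tau> (1::'k) \<in> supported (simp (Suc n))" by (rule supported_single[OF that])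
    ultimately have "lbd W \<tau> \<in> ?S" by blast
    then show ?thesis using f by blast
  qed
  then show ?thesis using f by blast
qed

text \<open>If an integral cycle does not bound, then by torsion-freeness no multiple of it does, so
  a rational cocycle is nonzero on it. This is scaled to an integral cocycle with the value 1 on
  some integral cycle. Over the field that cycle bounds, although the reduced cocycle still takes
  the value 1 on it.\<close>

theorem lexact_to_int:
  assumes k: "lexact W q TYPE('k::field)" and tf: "ltorsion_free W"
  shows "lexact W q TYPE(int)"
proof -
  have "n \<le> q \<Longrightarrow> x \<in> supported (simp n) \<Longrightarrow> lin (lbd W) x = 0 \<Longrightarrow>
      \<exists>y\<in>supported (simp (Suc n)). lin (lbd W) y = (x :: _ \<Rightarrow>\<^sub>0 int)" for n x
  proof (induction n arbitrary: x rule: less_induct)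
    case (less n x)
    show ?case
    proof (rule ccontr)
      assume nb: "\<not> ?case"
      \<comment> \<open>Exactness in lower degrees, known by induction, gives a contraction there.
        It makes \<open>\<pi>\<close> below a projection of the chains of degree n onto the
        cycles.\<close>
      have "\<exists>s :: _ \<Rightarrow> (_ \<Rightarrow>\<^sub>0 int). \<forall>\<tau>\<in>simp n. lin (lbd W) (lin s (lbd W \<tau>)) = lbd W \<tau> \<and>
          lin s (lbd W \<tau>) \<in> supported (simp n)"
      proof (cases n)
        case 0
        then show ?thesis by (simp add: lbd_zero)
      next
        case (Suc m)
        have "lexact W m TYPE(int)" unfolding lexact_def using less Suc by auto
        then obtain s :: "_ \<Rightarrow> (_ \<Rightarrow>\<^sub>0 int)" where s: "contraction W m s" using lexact_contraction by blast
        have "lin (lbd W) (lin s (lbd W \<tau>)) = lbd W \<tau> \<and> lin s (lbd W \<tau>) \<in> supported (simp n)"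
          if t: "\<tau> \<in> simp n" for \<tau>
        proof -
          have b: "(lbd W \<tau> :: _ \<Rightarrow>\<^sub>0 int) \<in> supported (simp m)" using t Suc lbd_closed by simp
          have "lin (lbd W) (lbd W \<tau>) = (0 :: _ \<Rightarrow>\<^sub>0 int)" by (rule lbd_lbd) (use t in \<open>simp add: simp_def\<close>)
          then show ?thesis using contraction_lin[OF s b] contraction_closed[OF s b] Suc by simp
        qed
        then show ?thesis by blast
      qed
      then obtain s :: "_ \<Rightarrow> (_ \<Rightarrow>\<^sub>0 int)" where s: "\<And>\<tau>. \<tau> \<in> simp n \<Longrightarrow> lin (lbd W) (lin s (lbd W \<tau>)) = lbd W \<tau>"
        "\<And>\<tau>. \<tau> \<in> simp n \<Longrightarrow> lin s (lbd W \<tau>) \<in> supported (simp n)" by blast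
      define \<pi> where "\<pi> \<tau> = Poly_Mapping.single \<tau> 1 - lin s (lbd W \<tau>)" for \<tau>
      have \<pi>0: "lin (lbd W) (\<pi> \<tau>) = 0" if "\<tau> \<in> simp n" for \<tau>
        by (simp add: \<pi>_def lin_diff s(1)[OF that])
      have \<pi>c: "\<pi> \<tau> \<in> supported (simp n)" if "\<tau> \<in> simp n" for \<tau>
        unfolding \<pi>_def by (intro supported_diff supported_single that s(2)[OF that])
      have \<pi>_cyc: "lin \<pi> u = u" if "lin (lbd W) u = 0" for u
      proof -
        have "lin \<pi> u = lin (\<lambda>\<tau>. Poly_Mapping.single \<tau> 1) u - lin s (lin (lbd W) u)"
          unfolding \<pi>_def[abs_def] lin_fun_diff lin_lin ..
        then show ?thesis using that by simp
      qed
      \<comment> \<open>A rational filling with its denominators cleared would fill a multiple of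
        \<open>x\<close> integrally.\<close>
      have "\<not> (\<exists>y\<in>supported (simp (Suc n)). lin (lbd W) y = (cof x :: _ \<Rightarrow>\<^sub>0 rat))"
      proof
        assume "\<exists>y\<in>supported (simp (Suc n)). lin (lbd W) y = (cof x :: _ \<Rightarrow>\<^sub>0 rat)"
        then obtain y :: "_ \<Rightarrow>\<^sub>0 rat" where y: "y \<in> supported (simp (Suc n))" "lin (lbd W) y = cof x" by blast
        obtain D h where D: "D > 0" "\<And>c. c \<in> keys y \<Longrightarrow> of_int D * lookup y c = of_int (h c)"
          using common_denominator[of "keys y" "lookup y"] by auto
        define y' where "y' = (\<Sum>c\<in>keys y. Poly_Mapping.single c (h c))"
        have y': "y' \<in> supported (simp (Suc n))" unfolding y'_def
          by (intro supported_sum supported_single supported_keys[OF y(1)])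
        have "cof y' = (\<Sum>c\<in>keys y. scale (of_int D) (scale (lookup y c) (Poly_Mapping.single c 1)))"
          unfolding y'_def cof_sum by (rule sum.cong) (auto simp: D(2))
        also have "\<dots> = scale (of_int D) y" unfolding scale_sum[symmetric] chain_expand[symmetric] ..
        finally have "cof (lin (lbd W) y') = (cof (scale D x) :: _ \<Rightarrow>\<^sub>0 rat)"
          by (simp add: cof_lbd_lin lin_scale y(2) cof_scale)
        then have "scale D x = lin (lbd W) y'"
          by (intro pm_eqI) (metis lookup_cof of_int_eq_iff)
        then show False using tf less.prems D(1) y' nb unfolding ltorsion_free_def by blast
      qed
      from boundary_separation[OF this] obtain f :: "_ \<Rightarrow> rat" where
        f: "\<And>\<tau>. \<tau> \<in> simp (Suc n) \<Longrightarrow> pair f (lbd W \<tau>) = 0" "pair f (cof x) = 1" by blast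
      obtain D h where D: "D > 0" "\<And>\<tau>. \<tau> \<in> simp n \<Longrightarrow> of_int D * f \<tau> = of_int (h \<tau>)"
        using common_denominator[OF finite_simp, of n f] by auto
      have h_pair: "of_int (pair h u) = of_int D * pair f (cof u)" if "u \<in> supported (simp n)" for u
      proof -
        have "of_int (pair h u) = pair (\<lambda>\<tau>. of_int (h \<tau>)) (cof u :: _ \<Rightarrow>\<^sub>0 rat)" by (simp add: pair_cof)
        also have "\<dots> = pair (\<lambda>\<tau>. of_int D * f \<tau>) (cof u)"
          by (rule pair_cong_on[OF cof_supported[OF that]]) (simp add: D(2))
        finally show ?thesis by (simp add: pair_fun_mult)
      qed
      have h_bd: "pair h (lbd W \<tau>) = 0" if "\<tau> \<in> simp (Suc n)" for \<tau>
        using h_pair[OF lbd_closed[OF that, of W]] f(1)[OF that] by (simp add: cof_lbd)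
      have h_x: "pair h x = D" using h_pair[OF less.prems(2)] f(2) by simp
      \<comment> \<open>The values of \<open>h\<close> on integral cycles. It is an ideal and
        nonzero, containing \<open>D\<close>, so its generator d is nonzero and attained at some
        cycle.\<close>
      define J where "J = pair h ` {u \<in> supported (simp n). lin (lbd W) u = 0}"
      have J: "0 \<in> J" "\<And>a b. a \<in> J \<Longrightarrow> b \<in> J \<Longrightarrow> a + b \<in> J" "\<And>r a. a \<in> J \<Longrightarrow> r * a \<in> J" "D \<in> J"
      proof -
        show "0 \<in> J" unfolding J_def by (rule image_eqI[of _ _ 0]) auto
        show "a + b \<in> J" if ab: "a \<in> J" "b \<in> J" for a b
        proof -
          obtain u v where uv: "u \<in> supported (simp n)" "lin (lbd W) u = 0" "a = pair h u"
            "v \<in> supported (simp n)" "lin (lbd W) v = 0" "b = pair h v" using ab unfolding J_def by blast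
          then show ?thesis unfolding J_def
            by (intro image_eqI[of _ _ "u + v"]) (auto simp: pair_add lin_add supported_add)
        qed
        show "r * a \<in> J" if a: "a \<in> J" for r a
        proof -
          obtain u where "u \<in> supported (simp n)" "lin (lbd W) u = 0" "a = pair h u" using a unfolding J_def by blast
          then show ?thesis unfolding J_def
            by (intro image_eqI[of _ _ "scale r u"]) (auto simp: pair_scale lin_scale supported_scale)
        qed
        show "D \<in> J" unfolding J_def by (rule image_eqI[of _ _ x]) (use less.prems h_x in auto)
      qed
      have "\<forall>a\<in>J. \<forall>b\<in>J. a + b \<in> J" "\<forall>r. \<forall>a\<in>J. r * a \<in> J" using J by blast+
      then obtain d where d: "d \<in> J" "\<forall>a\<in>J. \<exists>r. a = r * d"
        using principal_ideals_int J(1) unfolding principal_ideals_def by blast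
      then have dvd: "d dvd a" if "a \<in> J" for a using that by (metis dvd_triv_right)
      have d0: "d \<noteq> 0" using dvd[OF J(4)] D(1) by auto
      obtain z where z: "z \<in> supported (simp n)" "lin (lbd W) z = 0" "pair h z = d" using d(1) unfolding J_def by auto
      \<comment> \<open>On arbitrary chains \<open>h\<close> need not be divisible by
        \<open>d\<close>, only on cycles. Composing with the projection to cycles makes the division
        exact and changes nothing on cycles.\<close>
      define h' where "h' \<tau> = pair h (\<pi> \<tau>) div d" for \<tau>
      have h': "d * pair h' u = pair h (lin \<pi> u)" if u: "u \<in> supported (simp n)" for u
      proof -
        have "d * pair h' u = pair (\<lambda>\<tau>. d * h' \<tau>) u" by (simp add: pair_fun_mult)
        also have "\<dots> = pair (\<lambda>\<tau>. pair h (\<pi> \<tau>)) u"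
        proof (rule pair_cong_on[OF u])
          fix \<tau> assume t: "\<tau> \<in> simp n"
          have "pair h (\<pi> \<tau>) \<in> J" unfolding J_def using \<pi>0[OF t] \<pi>c[OF t] by blast
          then show "d * h' \<tau> = pair h (\<pi> \<tau>)" using dvd by (simp add: h'_def)
        qed
        finally show ?thesis by (simp add: pair_lin)
      qed
      have h'z: "pair h' z = 1" using h'[OF z(1)] \<pi>_cyc[OF z(2)] z(3) d0 by simp
      have h'b: "pair h' (lbd W \<tau>) = 0" if t: "\<tau> \<in> simp (Suc n)" for \<tau>
      proof -
        have "lin (lbd W) (lbd W \<tau>) = (0 :: _ \<Rightarrow>\<^sub>0 int)" by (rule lbd_lbd) (use t in \<open>simp add: simp_def\<close>)
        then show ?thesis using h'[OF lbd_closed[OF t, of W]] \<pi>_cyc[of "lbd W \<tau>"] h_bd[OF t] d0 by simp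
      qed
      have zk: "(cof z :: _ \<Rightarrow>\<^sub>0 'k) \<in> supported (simp n)" by (rule cof_supported[OF z(1)])
      have "lin (lbd W) (cof z) = (0 :: _ \<Rightarrow>\<^sub>0 'k)" using z(2) by (simp flip: cof_lbd_lin)
      then obtain y :: "_ \<Rightarrow>\<^sub>0 'k" where y: "y \<in> supported (simp (Suc n))" "lin (lbd W) y = cof z"
        using k less.prems(1) zk unfolding lexact_def by blast
      have "(1::'k) = pair (\<lambda>\<tau>. of_int (h' \<tau>)) (cof z)" by (simp add: pair_cof h'z)
      also have "\<dots> = pair (\<lambda>\<tau>. pair (\<lambda>\<tau>. of_int (h' \<tau>)) (lbd W \<tau>)) y" by (simp add: y(2)[symmetric] pair_lin)
      also have "\<dots> = pair (\<lambda>_. 0) y"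
      proof (rule pair_cong_on[OF y(1)])
        fix \<tau> assume t: "\<tau> \<in> simp (Suc n)"
        have "pair (\<lambda>\<tau>. of_int (h' \<tau>)) (lbd W \<tau>) = (of_int (pair h' (lbd W \<tau>)) :: 'k)"
          using pair_cof[of h' "lbd W \<tau>"] by (simp add: cof_lbd)
        then show "pair (\<lambda>\<tau>. of_int (h' \<tau>)) (lbd W \<tau>) = (0::'k)" by (simp add: h'b[OF t])
      qed
      finally show False by simp
    qed
  qed
  then show ?thesis by (auto simp: lexact_def)
qed

end

section \<open>Oriented chains and the live complex\<close>

lemma simplicial_boundary_sum:
  assumes "finite V" "\<And>v. c (v # ys) \<noteq> 0 \<Longrightarrow> v \<in> V"
  shows "simplicial_boundary c ys = (\<Sum>v\<in>V. c (v # ys))"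
  unfolding simplicial_boundary_def using assms by (intro sum.mono_neutral_left) auto

locale finite_complex =
  fixes K :: "'v set set" and V :: "'v set"
  assumes finite_V: "finite V" and K_V: "\<rho> \<in> K \<Longrightarrow> \<rho> \<subseteq> V" and K_sub: "\<rho> \<in> K \<Longrightarrow> \<rho>' \<subseteq> \<rho> \<Longrightarrow> \<rho>' \<in> K"
begin

lemma chains_mem: "c \<in> simplicial_chains K p \<Longrightarrow> c xs \<noteq> 0 \<Longrightarrow> distinct xs \<and> length xs = Suc p \<and> set xs \<in> K"
  by (simp add: simplicial_chains_def)
lemma chains_swap: "c \<in> simplicial_chains K p \<Longrightarrow> c (xs @ a # b # ys) = - c (xs @ b # a # ys)"
  unfolding simplicial_chains_def by blast

lemma boundary_eq: "c \<in> simplicial_chains K p \<Longrightarrow> simplicial_boundary c ys = (\<Sum>v\<in>V. c (v # ys))"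
  using chains_mem[of c p] K_V by (intro simplicial_boundary_sum finite_V) (force)

lemma chains_zero: "(\<lambda>_. 0) \<in> simplicial_chains K p" by (simp add: simplicial_chains_def)

lemma chainsI:
  assumes "\<And>xs. c xs \<noteq> 0 \<Longrightarrow> distinct xs \<and> length xs = Suc p \<and> set xs \<in> K"
    and "\<And>xs a b ys. c (xs @ a # b # ys) = - c (xs @ b # a # ys)"
  shows "c \<in> simplicial_chains K p"
proof -
  have "{xs. c xs \<noteq> 0} \<subseteq> {xs. set xs \<subseteq> V \<and> length xs = Suc p}" using assms(1) K_V by blast
  then have "finite {xs. c xs \<noteq> 0}" by (rule finite_subset) (rule finite_lists_length_eq[OF finite_V])
  then show ?thesis unfolding simplicial_chains_def using assms by blast
qed

lemma chains_lincomb: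
  assumes "c \<in> simplicial_chains K p" "d \<in> simplicial_chains K p"
  shows "(\<lambda>xs. m * c xs + k * d xs) \<in> simplicial_chains K p"
proof (rule chainsI)
  fix xs assume "m * c xs + k * d xs \<noteq> 0"
  then have "c xs \<noteq> 0 \<or> d xs \<noteq> 0" by auto
  then show "distinct xs \<and> length xs = Suc p \<and> set xs \<in> K" using chains_mem assms by blast
next
  fix xs a b ys
  show "m * c (xs @ a # b # ys) + k * d (xs @ a # b # ys) = - (m * c (xs @ b # a # ys) + k * d (xs @ b # a # ys))"
    by (simp add: chains_swap[OF assms(1), of xs a b ys] chains_swap[OF assms(2), of xs a b ys])
qed

lemma boundary_closed: assumes c: "c \<in> simplicial_chains K (Suc p)"
  shows "simplicial_boundary c \<in> simplicial_chains K p"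
proof (rule chainsI)
  fix xs assume "simplicial_boundary c xs \<noteq> 0"
  then obtain v where "c (v # xs) \<noteq> 0" unfolding boundary_eq[OF c] by (meson sum.neutral)
  from chains_mem[OF c this] show "distinct xs \<and> length xs = Suc p \<and> set xs \<in> K"
    using K_sub by (auto)
next
  fix xs a b ys
  show "simplicial_boundary c (xs @ a # b # ys) = - simplicial_boundary c (xs @ b # a # ys)"
    unfolding boundary_eq[OF c] sum_negf[symmetric]
  proof (rule sum.cong)
    fix v show "c (v # xs @ a # b # ys) = - c (v # xs @ b # a # ys)"
      using chains_swap[OF c, of "v # xs" a b ys] by simp
  qed simp
qed

text \<open>Exchanging the two removed vertices shows that the sum equals its negative, which
  suffices for integers.\<close>

lemma boundary_boundary: assumes c: "c \<in> simplicial_chains K (Suc p)"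
  shows "simplicial_boundary (simplicial_boundary c) = (\<lambda>_. 0)"
proof
  fix ys
  let ?S = "\<Sum>v\<in>V. \<Sum>w\<in>V. c (w # v # ys)"
  have "simplicial_boundary (simplicial_boundary c) ys = ?S"
    unfolding boundary_eq[OF boundary_closed[OF c]] boundary_eq[OF c] ..
  moreover have "?S = - ?S"
  proof -
    have "?S = (\<Sum>v\<in>V. \<Sum>w\<in>V. - c (v # w # ys))"
    proof (intro sum.cong HOL.refl)
      fix v w show "c (w # v # ys) = - c (v # w # ys)" using chains_swap[OF c, of "[]" w v ys] by simp
    qed
    also have "\<dots> = - (\<Sum>v\<in>V. \<Sum>w\<in>V. c (v # w # ys))" by (simp add: sum_negf)
    also have "(\<Sum>v\<in>V. \<Sum>w\<in>V. c (v # w # ys)) = ?S" by (rule sum.swap)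
    finally show ?thesis .
  qed
  ultimately show "simplicial_boundary (simplicial_boundary c) ys = 0" by simp
qed

abbreviation "Zg p \<equiv> simplicial_cycle_group K p"

lemma boundary_lincomb:
  assumes "c \<in> simplicial_chains K p" "d \<in> simplicial_chains K p"
  shows "simplicial_boundary (\<lambda>xs. m * c xs + k * d xs) ys = m * simplicial_boundary c ys + k * simplicial_boundary d ys"
  unfolding boundary_eq[OF assms(1)] boundary_eq[OF assms(2)] boundary_eq[OF chains_lincomb[OF assms]]
  by (simp add: sum.distrib sum_distrib_left)

lemma cycles_lincomb:
  assumes "c \<in> simplicial_cycles K p" "d \<in> simplicial_cycles K p"
  shows "(\<lambda>xs. m * c xs + k * d xs) \<in> simplicial_cycles K p"
  using assms chains_lincomb[of c p d m k] boundary_lincomb[of c p d m k]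
  by (auto simp: simplicial_cycles_def fun_eq_iff)

lemma comm_group_cycles: "comm_group (Zg p)"
proof (rule comm_groupI)
  fix x y assume "x \<in> carrier (Zg p)" "y \<in> carrier (Zg p)"
  then show "x \<otimes>\<^bsub>Zg p\<^esub> y \<in> carrier (Zg p)" "x \<otimes>\<^bsub>Zg p\<^esub> y = y \<otimes>\<^bsub>Zg p\<^esub> x"
    using cycles_lincomb[of x p y 1 1] by (auto simp: simplicial_cycle_group_def)
next
  show "\<one>\<^bsub>Zg p\<^esub> \<in> carrier (Zg p)"
    using chains_zero[of p] by (auto simp: simplicial_cycle_group_def simplicial_cycles_def simplicial_boundary_def)
next
  fix x assume x: "x \<in> carrier (Zg p)"
  have "(\<lambda>xs. - 1 * x xs + 0 * x xs) \<in> simplicial_cycles K p"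
    using x by (intro cycles_lincomb) (auto simp: simplicial_cycle_group_def)
  then show "\<exists>y\<in>carrier (Zg p). y \<otimes>\<^bsub>Zg p\<^esub> x = \<one>\<^bsub>Zg p\<^esub>"
    by (intro bexI[of _ "\<lambda>xs. - x xs"]) (auto simp: simplicial_cycle_group_def)
qed (auto simp: simplicial_cycle_group_def add.assoc)

lemma subgroup_boundaries: "subgroup (simplicial_boundaries K p) (Zg p)"
proof -
  interpret Z: comm_group "Zg p" by (rule comm_group_cycles)
  have sub: "simplicial_boundaries K p \<subseteq> simplicial_cycles K p"
    using boundary_closed boundary_boundary by (auto simp: simplicial_boundaries_def simplicial_cycles_def)
  have lc: "(\<lambda>xs. m * x xs + k * y xs) \<in> simplicial_boundaries K p"
    if xy: "x \<in> simplicial_boundaries K p" "y \<in> simplicial_boundaries K p" for x y m k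
  proof -
    obtain c d where cd: "c \<in> simplicial_chains K (Suc p)" "x = simplicial_boundary c"
      "d \<in> simplicial_chains K (Suc p)" "y = simplicial_boundary d" using xy by (auto simp: simplicial_boundaries_def)
    have "(\<lambda>xs. m * x xs + k * y xs) = simplicial_boundary (\<lambda>xs. m * c xs + k * d xs)"
      using boundary_lincomb[OF cd(1,3)] by (auto simp: cd(2,4))
    then show ?thesis using chains_lincomb[OF cd(1,3)] by (auto simp: simplicial_boundaries_def)
  qed
  show ?thesis
  proof (rule Z.subgroupI)
    show "simplicial_boundaries K p \<subseteq> carrier (Zg p)" using sub by (simp add: simplicial_cycle_group_def)
    show "simplicial_boundaries K p \<noteq> {}" using chains_zero by (auto simp: simplicial_boundaries_def)
    fix x y assume x: "x \<in> simplicial_boundaries K p" and y: "y \<in> simplicial_boundaries K p"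
    show "x \<otimes>\<^bsub>Zg p\<^esub> y \<in> simplicial_boundaries K p" using lc[OF x y, of 1 1] by (simp add: simplicial_cycle_group_def)
  next
    fix x assume x: "x \<in> simplicial_boundaries K p"
    have m: "(\<lambda>xs. - x xs) \<in> simplicial_boundaries K p" using lc[OF x x, of "-1" 0] by simp
    have "inv\<^bsub>Zg p\<^esub> x = (\<lambda>xs. - x xs)"
      by (rule Z.inv_equality) (use sub x m in \<open>auto simp: simplicial_cycle_group_def\<close>)
    then show "inv\<^bsub>Zg p\<^esub> x \<in> simplicial_boundaries K p" using m by simp
  qed
qed

text \<open>Unfolds the quotient group: the power of the class of \<open>c\<close> is the class of
  the multiple k c, which is trivial as this multiple bounds.\<close>

lemma torsion_freeD:
  assumes tf: "torsion_free_homology K" and c: "c \<in> simplicial_cycles K p" and k: "k > 0"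
    and d: "d \<in> simplicial_chains K (Suc p)" "\<And>xs. k * c xs = simplicial_boundary d xs"
  shows "\<exists>d\<in>simplicial_chains K (Suc p). c = simplicial_boundary d"
proof -
  interpret Z: comm_group "Zg p" by (rule comm_group_cycles)
  let ?B = "simplicial_boundaries K p"
  interpret B: normal ?B "Zg p" using Z.normal_iff_subgroup subgroup_boundaries by blast
  have cZ: "c \<in> carrier (Zg p)" using c by (simp add: simplicial_cycle_group_def)
  have pow: "c [^]\<^bsub>Zg p\<^esub> (n::nat) = (\<lambda>xs. int n * c xs)" for n
    by (induction n) (auto simp: nat_pow_def simplicial_cycle_group_def algebra_simps)
  define n where "n = nat k"
  have n: "n > 0" "int n = k" using k by (auto simp: n_def)
  have "(\<lambda>xs. k * c xs) = simplicial_boundary d" using d(2) by auto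
  then have kB: "c [^]\<^bsub>Zg p\<^esub> n \<in> ?B" using d(1) by (auto simp: pow n simplicial_boundaries_def)
  interpret Q: group "simplicial_homology K p" unfolding simplicial_homology_def by (rule B.factorgroup_is_group)
  interpret h: group_hom "Zg p" "simplicial_homology K p" "\<lambda>a. ?B #>\<^bsub>Zg p\<^esub> a"
    unfolding simplicial_homology_def
    by (intro group_hom.intro group_hom_axioms.intro Z.is_group B.factorgroup_is_group B.r_coset_hom_Mod)
  have one: "\<one>\<^bsub>simplicial_homology K p\<^esub> = ?B" by (simp add: simplicial_homology_def FactGroup_def)
  have "(?B #>\<^bsub>Zg p\<^esub> c) [^]\<^bsub>simplicial_homology K p\<^esub> n = ?B #>\<^bsub>Zg p\<^esub> (c [^]\<^bsub>Zg p\<^esub> n)"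
    using h.hom_nat_pow[OF cZ] by simp
  also have "\<dots> = ?B" by (rule Z.coset_join2) (use kB cZ subgroup_boundaries in auto)
  finally have p1: "(?B #>\<^bsub>Zg p\<^esub> c) [^]\<^bsub>simplicial_homology K p\<^esub> n = \<one>\<^bsub>simplicial_homology K p\<^esub>" unfolding one .
  have "torsion_free (simplicial_homology K p)" using tf by (simp add: torsion_free_homology_def)
  from this[unfolded torsion_free_def, rule_format, OF h.hom_closed[OF cZ] conjI[OF n(1) p1]]
  have "?B #>\<^bsub>Zg p\<^esub> c = ?B" unfolding one .
  then have "c \<in> ?B" using Z.coset_join1[of ?B c] subgroup_boundaries cZ subgroup.subset[OF subgroup_boundaries] by auto
  then show ?thesis by (auto simp: simplicial_boundaries_def)
qed

end

section \<open>Oriented chains of links inside the live complex\<close>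

context raag_complex
begin

text \<open>The simplices with \<rho> in their live boundary arise from \<rho> by adding a live
  vertex. This brings the live boundary into the form in which \<open>simplicial_boundary\<close> is
  defined.\<close>

lemma lookup_lbd_lin:
  assumes "x \<in> supported \<Delta>"
  shows "lookup (lin (lbd W) x) \<rho> = (\<Sum>v\<in>(V \<inter> W) - \<rho>. sg idx v (insert v \<rho>) * lookup x (insert v \<rho>) :: 'r::comm_ring_1)"
proof -
  have "lookup (lin (lbd W) x) \<rho> = (\<Sum>\<tau>\<in>\<Delta>. lookup x \<tau> * lookup (lbd W \<tau>) \<rho>)"
    unfolding lookup_lin using assms by (intro pair_superset) (auto simp: supported_def)
  also have "\<dots> = (\<Sum>\<tau>\<in>\<Delta>. \<Sum>v\<in>V \<inter> W. if v \<in> \<tau> \<and> \<tau> - {v} = \<rho> then sg idx v \<tau> * lookup x \<tau> else 0)"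
  proof (rule sum.cong)
    fix \<tau> assume t: "\<tau> \<in> \<Delta>"
    have "lookup (lbd W \<tau>) \<rho> = (\<Sum>v\<in>\<tau> \<inter> W. if \<tau> - {v} = \<rho> then sg idx v \<tau> else (0::'r))"
      by (simp add: lbd_def lookup_sum lookup_single when_def)
    also have "\<dots> = (\<Sum>v\<in>V \<inter> W. if v \<in> \<tau> \<and> \<tau> - {v} = \<rho> then sg idx v \<tau> else 0)"
      using flag_V[OF t] finite_V by (intro sum.mono_neutral_cong_left) auto
    finally have "lookup (lbd W \<tau>) \<rho> = (\<Sum>v\<in>V \<inter> W. if v \<in> \<tau> \<and> \<tau> - {v} = \<rho> then sg idx v \<tau> else (0::'r))" .
    then show "lookup x \<tau> * lookup (lbd W \<tau>) \<rho> = (\<Sum>v\<in>V \<inter> W. if v \<in> \<tau> \<and> \<tau> - {v} = \<rho> then sg idx v \<tau> * lookup x \<tau> else 0)"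
      by (simp only: sum_distrib_left) (rule sum.cong, auto)
  qed simp
  also have "\<dots> = (\<Sum>v\<in>V \<inter> W. \<Sum>\<tau>\<in>\<Delta>. if v \<in> \<tau> \<and> \<tau> - {v} = \<rho> then sg idx v \<tau> * lookup x \<tau> else 0)"
    by (rule sum.swap)
  also have "\<dots> = (\<Sum>v\<in>V \<inter> W. if v \<notin> \<rho> then sg idx v (insert v \<rho>) * lookup x (insert v \<rho>) else 0)"
  proof (rule sum.cong)
    fix v
    have eq: "v \<in> \<tau> \<and> \<tau> - {v} = \<rho> \<longleftrightarrow> v \<notin> \<rho> \<and> \<tau> = insert v \<rho>" for \<tau> by auto
    have "insert v \<rho> \<notin> \<Delta> \<Longrightarrow> lookup x (insert v \<rho>) = 0" using assms by (auto simp: supported_def in_keys_iff)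
    then show "(\<Sum>\<tau>\<in>\<Delta>. if v \<in> \<tau> \<and> \<tau> - {v} = \<rho> then sg idx v \<tau> * lookup x \<tau> else 0) =
        (if v \<notin> \<rho> then sg idx v (insert v \<rho>) * lookup x (insert v \<rho>) else 0)"
      unfolding eq by (cases "v \<in> \<rho>") (auto simp: sum.delta)
  qed simp
  also have "\<dots> = (\<Sum>v\<in>(V \<inter> W) - \<rho>. sg idx v (insert v \<rho>) * lookup x (insert v \<rho>))"
    by (rule sum.mono_neutral_cong_right) auto
  finally show ?thesis .
qed

text \<open>The sign of the permutation sorting a list of vertices.\<close>

fun lsg :: "'v list \<Rightarrow> int" where
  "lsg [] = 1"
| "lsg (v # ys) = sg idx v (set ys) * lsg ys"

lemma lsg_swap:
  assumes "distinct (xs @ a # b # ys)" "set (xs @ a # b # ys) \<subseteq> V"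
  shows "lsg (xs @ a # b # ys) = - lsg (xs @ b # a # ys)"
  using assms
proof (induction xs)
  case Nil
  then have ne: "idx a \<noteq> idx b" and d: "a \<notin> set ys" "b \<notin> set ys" using idx_neq[of a b] by auto
  have ins: "sg idx u (insert w (set ys)) = (if idx w < idx u then - sg idx u (set ys) else sg idx u (set ys) :: int)"
    if "w \<notin> set ys" for u w
  proof (cases "idx w < idx u")
    case True
    then show ?thesis using sg_remove_less[of "insert w (set ys)" w idx u, where 'r = int] that by simp
  next
    case False
    then show ?thesis using sg_insert_ge[of idx w u "set ys", where 'r = int] by simp
  qed
  show ?case using ne by (auto simp: ins d)
next
  case (Cons x xs)
  have "set (xs @ a # b # ys) = set (xs @ b # a # ys)" by auto
  then show ?case using Cons by simp
qed

definition "srt \<rho> = map (inv_into V idx) (sorted_list_of_set (idx ` \<rho>))"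

lemma srt: assumes "\<rho> \<subseteq> V" shows "set (srt \<rho>) = \<rho>" "distinct (srt \<rho>)" "length (srt \<rho>) = card \<rho>"
proof -
  have fin: "finite \<rho>" using assms finite_V finite_subset by metis
  have i: "inj_on idx \<rho>" using inj_idx assms inj_on_subset by blast
  have "inv_into V idx ` idx ` \<rho> = \<rho>" using inj_idx assms by (rule inv_into_image_cancel)
  then show s: "set (srt \<rho>) = \<rho>" using fin by (simp add: srt_def)
  show l: "length (srt \<rho>) = card \<rho>" using fin i by (simp add: srt_def card_image)
  show "distinct (srt \<rho>)" by (rule card_distinct) (simp add: s l)
qed

text \<open>\<open>v\<close> passes the smaller entries one exchange at a time, each at the cost of
  a sign. The prefix \<open>us\<close> collects the entries already passed.\<close>

lemma insert_sorted:
  fixes c :: "'v list \<Rightarrow> int"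
  assumes c: "\<And>xs a b ys. c (xs @ a # b # ys) = - c (xs @ b # a # ys)"
    and "v \<in> V" "sorted ns" "distinct ns" "set ns \<subseteq> idx ` V" "idx v \<notin> set ns"
  shows "c (us @ v # map (inv_into V idx) ns) = (- 1) ^ card {n\<in>set ns. n < idx v} * c (us @ map (inv_into V idx) (insort (idx v) ns))"
  using assms(2-)
proof (induction ns arbitrary: us)
  case Nil
  then show ?case using inj_idx by simp
next
  case (Cons n ns)
  show ?case
  proof (cases "idx v \<le> n")
    case True
    then have "{m \<in> set (n # ns). m < idx v} = {}" using Cons.prems by auto
    then have z: "card {m \<in> set (n # ns). m < idx v} = 0" by simp
    show ?thesis unfolding z using True Cons.prems inj_idx by simp
  next
    case False
    let ?i = "inv_into V idx"
    have "{m \<in> set (n # ns). m < idx v} = insert n {m \<in> set ns. m < idx v}" using False by auto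
    moreover have "n \<notin> {m \<in> set ns. m < idx v}" using Cons.prems by auto
    ultimately have crd: "card {m \<in> set (n # ns). m < idx v} = Suc (card {m \<in> set ns. m < idx v})" by simp
    have IH: "c ((us @ [?i n]) @ v # map ?i ns) =
        (- 1) ^ card {m\<in>set ns. m < idx v} * c ((us @ [?i n]) @ map ?i (insort (idx v) ns))"
      using Cons.prems by (intro Cons.IH) auto
    have "c (us @ v # map ?i (n # ns)) = - c ((us @ [?i n]) @ v # map ?i ns)"
      using c[of us v "?i n" "map ?i ns"] by simp
    then show ?thesis unfolding IH crd using False by simp
  qed
qed

lemma insert_srt:
  fixes c :: "'v list \<Rightarrow> int"
  assumes c: "\<And>xs a b ys. c (xs @ a # b # ys) = - c (xs @ b # a # ys)"
    and v: "v \<in> V" "v \<notin> \<rho>" and \<rho>: "\<rho> \<subseteq> V"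
  shows "c (v # srt \<rho>) = sg idx v (insert v \<rho>) * c (srt (insert v \<rho>))"
proof -
  let ?ns = "sorted_list_of_set (idx ` \<rho>)"
  have fin: "finite \<rho>" using \<rho> finite_V finite_subset by metis
  have nv: "idx v \<notin> idx ` \<rho>" using v \<rho> idx_neq by blast
  have "c ([] @ v # map (inv_into V idx) ?ns) =
      (- 1) ^ card {n\<in>set ?ns. n < idx v} * c ([] @ map (inv_into V idx) (insort (idx v) ?ns))"
    using v \<rho> nv fin by (intro insert_sorted[of c]) (rule c, auto)
  moreover have "insort (idx v) ?ns = sorted_list_of_set (idx ` insert v \<rho>)"
    using fin nv by (simp add: sorted_list_of_set_insert)
  moreover have "card {n\<in>set ?ns. n < idx v} = card {w\<in>insert v \<rho>. idx w < idx v}"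
  proof -
    have "{n\<in>set ?ns. n < idx v} = idx ` {w\<in>insert v \<rho>. idx w < idx v}" using fin by auto
    moreover have "inj_on idx {w\<in>insert v \<rho>. idx w < idx v}"
      using inj_idx by (rule inj_on_subset) (use v \<rho> in auto)
    ultimately show ?thesis by (simp add: card_image)
  qed
  ultimately show ?thesis by (simp add: srt_def sg_def)
qed

lemma lsg_srt: assumes "\<rho> \<subseteq> V" shows "lsg (srt \<rho>) = 1"
proof -
  have "lsg (map (inv_into V idx) ns) = 1" if "sorted ns" "distinct ns" "set ns \<subseteq> idx ` V" for ns
    using that
  proof (induction ns)
    case (Cons n ns)
    have f: "idx (inv_into V idx m) = m" if "m \<in> set (n # ns)" for m
      using that Cons.prems by (intro f_inv_into_f) auto
    then have "{w \<in> inv_into V idx ` set ns. idx w < idx (inv_into V idx n)} = {}"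
      using Cons.prems by auto
    then have "sg idx (inv_into V idx n) (inv_into V idx ` set ns) = (1::int)"
      unfolding sg_def by (simp only: card.empty power_0)
    then show ?case using Cons by simp
  qed simp
  moreover have "finite \<rho>" using assms finite_V finite_subset by metis
  moreover have "idx ` \<rho> \<subseteq> idx ` V" using assms by blast
  ultimately show ?thesis unfolding srt_def by simp
qed

lemma sg_self: "sg idx v (insert v \<rho>) = (sg idx v \<rho> :: 'r::comm_ring_1)"
  unfolding sg_def by (rule arg_cong[where f = "\<lambda>A. (- 1) ^ card A"]) auto

text \<open>The chains of a link, as combinations of simplices: \<^term>\<open>kap \<sigma> \<rho>\<close> accounts for the difference
  between the signs of the vertices of \<open>\<rho>\<close> in \<open>\<rho>\<close> and in \<open>\<rho> \<union> \<sigma>\<close>.\<close>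

definition "kap \<sigma> \<rho> = (\<Prod>v\<in>\<rho>. sg idx v \<sigma> :: int)"

lemma sg_union: "finite \<rho> \<Longrightarrow> finite \<sigma> \<Longrightarrow> \<rho> \<inter> \<sigma> = {} \<Longrightarrow> sg idx v (\<rho> \<union> \<sigma>) = (sg idx v \<rho> * sg idx v \<sigma> :: int)"
proof -
  assume a: "finite \<rho>" "finite \<sigma>" "\<rho> \<inter> \<sigma> = {}"
  have "{w\<in>\<rho> \<union> \<sigma>. idx w < idx v} = {w\<in>\<rho>. idx w < idx v} \<union> {w\<in>\<sigma>. idx w < idx v}" by auto
  moreover have "card \<dots> = card {w\<in>\<rho>. idx w < idx v} + card {w\<in>\<sigma>. idx w < idx v}"
    using a by (intro card_Un_disjoint) auto
  ultimately show ?thesis by (simp add: sg_def power_add)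
qed

lemma kap_sq: "finite \<rho> \<Longrightarrow> kap \<sigma> \<rho> * kap \<sigma> \<rho> = 1"
  unfolding kap_def by (simp flip: prod.distrib)

context
  fixes \<sigma> W :: "'v set"
  assumes \<sigma>: "\<sigma> \<in> \<Delta>" "\<sigma> \<inter> W = {}" and W: "W \<subseteq> V"
begin

abbreviation "Lk \<equiv> link \<Delta> W \<sigma>"

lemma Lk_iff: "\<rho> \<in> Lk \<longleftrightarrow> \<rho> \<subseteq> W \<and> \<rho> \<union> \<sigma> \<in> \<Delta>"
  using flag_subset by (auto simp: link_def induced_subcomplex_def)

lemma finite_complex_Lk: "finite_complex Lk W"
proof
  show "finite W" using W finite_V finite_subset by metis
  show "\<rho> \<in> Lk \<Longrightarrow> \<rho> \<subseteq> W" for \<rho> by (simp add: Lk_iff)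
  show "\<rho>' \<in> Lk" if "\<rho> \<in> Lk" "\<rho>' \<subseteq> \<rho>" for \<rho> \<rho>'
    using that flag_subset[of "\<rho> \<union> \<sigma>" "\<rho>' \<union> \<sigma>"] by (auto simp: Lk_iff)
qed

text \<open>A simplex \<rho> of the link stands for \<rho> \<union> \<sigma>, so n vertices here are
  n + card \<sigma> vertices in the live complex. The factor \<open>lsg\<close> makes the function
  alternating.\<close>

definition lchain :: "nat \<Rightarrow> ('v set \<Rightarrow>\<^sub>0 int) \<Rightarrow> 'v list \<Rightarrow> int" where
  "lchain n x xs = (if distinct xs \<and> length xs = n \<and> set xs \<subseteq> W
     then lsg xs * kap \<sigma> (set xs) * lookup x (set xs \<union> \<sigma>) else 0)"

lemma lookup_simp: "x \<in> supported (simp (n + card \<sigma>)) \<Longrightarrow> lookup x (\<rho> \<union> \<sigma>) \<noteq> 0 \<Longrightarrow> \<rho> \<subseteq> W \<Longrightarrow> \<rho> \<in> Lk \<and> card \<rho> = n"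
proof -
  assume a: "x \<in> supported (simp (n + card \<sigma>))" "lookup x (\<rho> \<union> \<sigma>) \<noteq> 0" "\<rho> \<subseteq> W"
  then have d: "\<rho> \<union> \<sigma> \<in> \<Delta>" "card (\<rho> \<union> \<sigma>) = n + card \<sigma>"
    using supported_keys[OF a(1), of "\<rho> \<union> \<sigma>"] by (auto simp: in_keys_iff simp_def)
  then have "finite \<rho>" "finite \<sigma>" "\<rho> \<inter> \<sigma> = {}" using flag_finite[OF d(1)] a(3) \<sigma> by auto
  then show ?thesis using d a(3) by (simp add: Lk_iff card_Un_disjoint)
qed

lemma lchain_closed: assumes x: "x \<in> supported (simp (Suc p + card \<sigma>))"
  shows "lchain (Suc p) x \<in> simplicial_chains Lk p"
proof -
  interpret L: finite_complex Lk W by (rule finite_complex_Lk)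
  show ?thesis
  proof (rule L.chainsI)
    fix xs assume nz: "lchain (Suc p) x xs \<noteq> 0"
    then have "distinct xs" "length xs = Suc p" "set xs \<subseteq> W" "lookup x (set xs \<union> \<sigma>) \<noteq> 0"
      by (auto simp: lchain_def split: if_splits)
    then show "distinct xs \<and> length xs = Suc p \<and> set xs \<in> Lk" using lookup_simp[OF x] by blast
  next
    fix xs ys :: "'v list" and a b
    have s: "set (xs @ b # a # ys) = set (xs @ a # b # ys)" "distinct (xs @ b # a # ys) = distinct (xs @ a # b # ys)"
      "length (xs @ b # a # ys) = length (xs @ a # b # ys)" by auto
    show "lchain (Suc p) x (xs @ a # b # ys) = - lchain (Suc p) x (xs @ b # a # ys)"
    proof (cases "distinct (xs @ a # b # ys) \<and> length (xs @ a # b # ys) = Suc p \<and> set (xs @ a # b # ys) \<subseteq> W")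
      case True
      then have "lsg (xs @ a # b # ys) = - lsg (xs @ b # a # ys)" using W by (intro lsg_swap) blast+
      then show ?thesis using True unfolding lchain_def s by simp
    next
      case False
      have "lchain (Suc p) x (xs @ a # b # ys) = 0" by (simp only: lchain_def False if_False)
      moreover have "lchain (Suc p) x (xs @ b # a # ys) = 0" by (simp only: lchain_def s False if_False)
      ultimately show ?thesis by simp
    qed
  qed
qed

text \<open>Putting \<open>v\<close> in front multiplies \<open>lsg\<close> by the sign of
  \<open>v\<close> in \<rho> and \<open>kap\<close> by its sign in \<sigma>. The product is the sign
  of \<open>v\<close> in \<rho> \<union> \<sigma>, which is the one in \<open>lbd\<close>.\<close>

lemma lchain_boundary: assumes x: "x \<in> supported (simp (Suc (Suc p) + card \<sigma>))"
  shows "simplicial_boundary (lchain (Suc (Suc p)) x) = lchain (Suc p) (lin (lbd W) x)"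
proof
  interpret L: finite_complex Lk W by (rule finite_complex_Lk)
  have x\<Delta>: "x \<in> supported \<Delta>" using x by (rule supported_mono) (auto simp: simp_def)
  fix ys
  have "simplicial_boundary (lchain (Suc (Suc p)) x) ys = (\<Sum>v\<in>W. lchain (Suc (Suc p)) x (v # ys))"
    by (rule L.boundary_eq[OF lchain_closed[OF x]])
  also have "\<dots> = lchain (Suc p) (lin (lbd W) x) ys"
  proof (cases "distinct ys \<and> length ys = Suc p \<and> set ys \<subseteq> W")
    case False
    then show ?thesis by (auto simp: lchain_def intro!: sum.neutral)
  next
    case True
    have fin: "finite \<sigma>" using flag_finite \<sigma> by blast
    have VW: "V \<inter> W = W" using W by auto
    have "(\<Sum>v\<in>W. lchain (Suc (Suc p)) x (v # ys)) =
        (\<Sum>v\<in>W - (set ys \<union> \<sigma>). lsg ys * kap \<sigma> (set ys) * (sg idx v (insert v (set ys \<union> \<sigma>)) * lookup x (insert v (set ys \<union> \<sigma>))))"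
    proof (rule sum.mono_neutral_cong_right)
      show "finite W" by (rule L.finite_V)
      show "\<forall>v\<in>W - (W - (set ys \<union> \<sigma>)). lchain (Suc (Suc p)) x (v # ys) = 0"
        using \<sigma> True by (auto simp: lchain_def)
      fix v assume v: "v \<in> W - (set ys \<union> \<sigma>)"
      then have "kap \<sigma> (insert v (set ys)) = sg idx v \<sigma> * kap \<sigma> (set ys)" by (simp add: kap_def)
      moreover have "sg idx v (insert v (set ys \<union> \<sigma>)) = (sg idx v (set ys) * sg idx v \<sigma> :: int)"
        unfolding sg_self using True \<sigma> fin by (intro sg_union) auto
      ultimately show "lchain (Suc (Suc p)) x (v # ys) =
          lsg ys * kap \<sigma> (set ys) * (sg idx v (insert v (set ys \<union> \<sigma>)) * lookup x (insert v (set ys \<union> \<sigma>)))"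
        using v True by (simp add: lchain_def)
    qed auto
    also have "\<dots> = lchain (Suc p) (lin (lbd W) x) ys"
      using True by (simp add: lchain_def lookup_lbd_lin[OF x\<Delta>] VW sum_distrib_left)
    finally show ?thesis .
  qed
  finally show "simplicial_boundary (lchain (Suc (Suc p)) x) ys = lchain (Suc p) (lin (lbd W) x) ys" .
qed

text \<open>In the other direction, a simplex is given the coefficient of its sorted list of vertices.\<close>

definition schain :: "nat \<Rightarrow> ('v list \<Rightarrow> int) \<Rightarrow> ('v set \<Rightarrow>\<^sub>0 int)" where
  "schain n c = (\<Sum>\<tau>\<in>{\<tau>\<in>simp (n + card \<sigma>). \<tau> - W = \<sigma>}.
     Poly_Mapping.single \<tau> (kap \<sigma> (\<tau> \<inter> W) * c (srt (\<tau> \<inter> W))))"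

lemma lookup_schain: "lookup (schain n c) \<tau> = (if \<tau> \<in> simp (n + card \<sigma>) \<and> \<tau> - W = \<sigma> then kap \<sigma> (\<tau> \<inter> W) * c (srt (\<tau> \<inter> W)) else 0)"
proof -
  have fin: "finite {\<tau>\<in>simp (n + card \<sigma>). \<tau> - W = \<sigma>}"
    by (rule finite_subset[OF _ finite_flag]) (auto simp: simp_def)
  have "lookup (schain n c) \<tau> = (\<Sum>\<rho>\<in>{\<tau>\<in>simp (n + card \<sigma>). \<tau> - W = \<sigma>}. if \<rho> = \<tau> then kap \<sigma> (\<tau> \<inter> W) * c (srt (\<tau> \<inter> W)) else 0)"
    unfolding schain_def lookup_sum by (rule sum.cong) (auto simp: lookup_single when_def)
  also have "\<dots> = (if \<tau> \<in> {\<tau>\<in>simp (n + card \<sigma>). \<tau> - W = \<sigma>} then kap \<sigma> (\<tau> \<inter> W) * c (srt (\<tau> \<inter> W)) else 0)"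
    using fin by (simp add: sum.delta')
  finally show ?thesis by simp
qed

lemma schain_closed: "schain n c \<in> supported (simp (n + card \<sigma>) \<inter> part W \<sigma>)"
  by (auto simp: supported_def in_keys_iff lookup_schain part_def simp_def split: if_splits)

text \<open>An alternating function is determined by its values on sorted lists, and
  \<open>insert_srt\<close> supplies the sign for sorting in one more vertex. Two factors
  \<open>kap\<close> meet and cancel.\<close>

lemma schain_boundary:
  assumes c: "c \<in> simplicial_chains Lk (Suc p)" and x: "x \<in> supported (simp (Suc p + card \<sigma>) \<inter> part W \<sigma>)"
    and e: "lchain (Suc p) x = simplicial_boundary c"
  shows "lin (lbd W) (schain (Suc (Suc p)) c) = x"
proof (rule pm_eqI)
  interpret L: finite_complex Lk W by (rule finite_complex_Lk)
  fix \<tau>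
  have s\<Delta>: "schain (Suc (Suc p)) c \<in> supported \<Delta>" using schain_closed by (rule supported_mono) (auto simp: simp_def)
  have VW: "V \<inter> W = W" using W by auto
  have fin: "finite \<sigma>" using flag_finite \<sigma> by blast
  have L: "lookup (lin (lbd W) (schain (Suc (Suc p)) c)) \<tau> =
      (\<Sum>v\<in>W - \<tau>. sg idx v (insert v \<tau>) * lookup (schain (Suc (Suc p)) c) (insert v \<tau>))"
    unfolding lookup_lbd_lin[OF s\<Delta>] VW ..
  show "lookup (lin (lbd W) (schain (Suc (Suc p)) c)) \<tau> = lookup x \<tau>"
  proof (cases "\<tau> \<in> simp (Suc p + card \<sigma>) \<and> \<tau> - W = \<sigma>")
    case False
    have "lookup x \<tau> = 0" using False supported_keys[OF x, of \<tau>] by (auto simp: in_keys_iff part_def)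
    moreover have "lookup (schain (Suc (Suc p)) c) (insert v \<tau>) = 0" if v: "v \<in> W - \<tau>" for v
    proof (rule ccontr)
      assume "lookup (schain (Suc (Suc p)) c) (insert v \<tau>) \<noteq> 0"
      then have i: "insert v \<tau> \<in> simp (Suc (Suc p) + card \<sigma>)" "insert v \<tau> - W = \<sigma>"
        by (auto simp: lookup_schain split: if_splits)
      then have "\<tau> \<in> \<Delta>" using flag_subset[of "insert v \<tau>" \<tau>] by (auto simp: simp_def)
      moreover have "card \<tau> = Suc p + card \<sigma>" using i v flag_finite[OF \<open>\<tau> \<in> \<Delta>\<close>] by (simp add: simp_def)
      moreover have "\<tau> - W = \<sigma>" using i v by auto
      ultimately show False using False by (simp add: simp_def)
    qed
    ultimately show ?thesis unfolding L by simp
  next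
    case True
    define \<rho> where "\<rho> = \<tau> \<inter> W"
    have \<tau>: "\<tau> = \<rho> \<union> \<sigma>" "\<rho> \<subseteq> W" "\<tau> \<in> \<Delta>" "card \<tau> = Suc p + card \<sigma>" using True by (auto simp: \<rho>_def simp_def)
    have \<rho>: "\<rho> \<inter> \<sigma> = {}" "finite \<rho>" "\<rho> \<subseteq> V" "card \<rho> = Suc p"
    proof -
      show "\<rho> \<inter> \<sigma> = {}" "finite \<rho>" "\<rho> \<subseteq> V" using \<tau> \<sigma> W flag_finite[OF \<tau>(3)] by auto
      then show "card \<rho> = Suc p" using \<tau> fin by (simp add: card_Un_disjoint)
    qed
    have t: "sg idx v (insert v \<tau>) * lookup (schain (Suc (Suc p)) c) (insert v \<tau>) = kap \<sigma> \<rho> * c (v # srt \<rho>)"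
      if v: "v \<in> W - \<tau>" for v
    proof -
      have vV: "v \<in> V" "v \<notin> \<rho>" "v \<notin> \<sigma>" using v W \<tau> by auto
      have iW: "insert v \<tau> \<inter> W = insert v \<rho>" using v by (auto simp: \<rho>_def)
      have iw: "insert v \<tau> - W = \<sigma>" using v True by auto
      have ci: "c (v # srt \<rho>) = sg idx v (insert v \<rho>) * c (srt (insert v \<rho>))"
        by (rule insert_srt[of c, OF L.chains_swap[OF c] vV(1,2) \<rho>(3)])
      have sgt: "sg idx v (insert v \<tau>) = (sg idx v \<rho> * sg idx v \<sigma> :: int)"
        unfolding sg_self \<tau>(1) using \<rho> fin by (intro sg_union) auto
      have kp: "kap \<sigma> (insert v \<rho>) = sg idx v \<sigma> * kap \<sigma> \<rho>" using vV \<rho> by (simp add: kap_def)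
      show ?thesis
      proof (cases "insert v \<tau> \<in> \<Delta>")
        case True
        then have "insert v \<tau> \<in> simp (Suc (Suc p) + card \<sigma>)" using \<tau> v flag_finite[OF \<tau>(3)] by (simp add: simp_def)
        then have "lookup (schain (Suc (Suc p)) c) (insert v \<tau>) = kap \<sigma> (insert v \<rho>) * c (srt (insert v \<rho>))"
          unfolding lookup_schain iw iW by simp
        then have "sg idx v (insert v \<tau>) * lookup (schain (Suc (Suc p)) c) (insert v \<tau>) =
            sg idx v \<rho> * (sg idx v \<sigma> * sg idx v \<sigma>) * kap \<sigma> \<rho> * c (srt (insert v \<rho>))"
          by (simp only: sgt kp ac_simps)
        then show ?thesis unfolding ci sg_self by simp
      next
        case False
        have "c (v # srt \<rho>) = 0"
        proof (rule ccontr)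
          assume "c (v # srt \<rho>) \<noteq> 0"
          then have "set (v # srt \<rho>) \<in> Lk" using L.chains_mem[OF c] by blast
          then have "insert v \<rho> \<in> Lk" by (simp add: srt[OF \<rho>(3)])
          then show False using False \<tau> by (simp add: Lk_iff)
        qed
        then show ?thesis using False by (simp add: lookup_schain simp_def)
      qed
    qed
    have z: "c (v # srt \<rho>) = 0" if "v \<in> W \<inter> \<tau>" for v
    proof (rule ccontr)
      assume "c (v # srt \<rho>) \<noteq> 0"
      then have "distinct (v # srt \<rho>)" using L.chains_mem[OF c] by blast
      then show False using that srt[OF \<rho>(3)] by (simp add: \<rho>_def)
    qed
    have "lookup (lin (lbd W) (schain (Suc (Suc p)) c)) \<tau> = kap \<sigma> \<rho> * (\<Sum>v\<in>W - \<tau>. c (v # srt \<rho>))"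
      unfolding L sum_distrib_left by (rule sum.cong) (use t in auto)
    also have "(\<Sum>v\<in>W - \<tau>. c (v # srt \<rho>)) = (\<Sum>v\<in>W. c (v # srt \<rho>))"
      by (rule sum.mono_neutral_left) (use z L.finite_V in auto)
    also have "\<dots> = simplicial_boundary c (srt \<rho>)" by (rule L.boundary_eq[OF c, symmetric])
    also have "\<dots> = lchain (Suc p) x (srt \<rho>)" by (simp add: e)
    also have "\<dots> = lsg (srt \<rho>) * kap \<sigma> \<rho> * lookup x \<tau>"
      using srt[OF \<rho>(3)] \<rho> \<tau> by (simp add: lchain_def)
    finally have r: "lookup (lin (lbd W) (schain (Suc (Suc p)) c)) \<tau> = (kap \<sigma> \<rho> * kap \<sigma> \<rho>) * lsg (srt \<rho>) * lookup x \<tau>"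
      by simp
    have "lsg (srt \<rho>) = 1" by (rule lsg_srt[OF \<rho>(3)])
    then show ?thesis unfolding r by (simp add: kap_sq \<rho>)
  qed
qed

text \<open>The summand of \<sigma> is the augmented complex of the link, while the hypothesis
  speaks of unreduced homology. They differ at the empty simplex of the link, that is at \<sigma>
  itself: if the link has a vertex v, then \<sigma> is up to sign the live boundary of \<sigma> with
  v; if not, y = 0 and so k x = 0.\<close>

lemma link_torsion:
  fixes x y :: "'v set \<Rightarrow>\<^sub>0 int"
  assumes tf: "torsion_free_homology Lk" and k: "k > 0"
    and x: "x \<in> supported (simp n \<inter> part W \<sigma>)" "lin (lbd W) x = 0"
    and y: "y \<in> supported (simp (Suc n) \<inter> part W \<sigma>)" "scale k x = lin (lbd W) y"
  shows "\<exists>z\<in>supported (simp (Suc n)). lin (lbd W) z = x"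
proof -
  interpret L: finite_complex Lk W by (rule finite_complex_Lk)
  have fin: "finite \<sigma>" using flag_finite \<sigma> by blast
  have sub: "\<sigma> \<subseteq> \<tau>" "\<tau> = \<sigma> \<union> (\<tau> \<inter> W)" if "\<tau> \<in> part W \<sigma>" for \<tau> using that by (auto simp: part_def)
  consider "n < card \<sigma>" | "n = card \<sigma>" | p where "n = Suc p + card \<sigma>"
    by (metis add.commute add_Suc_right less_imp_Suc_add linorder_neqE_nat)
  then show ?thesis
  proof cases
    case 1
    have "simp n \<inter> part W \<sigma> = {}"
    proof (rule ccontr)
      assume "simp n \<inter> part W \<sigma> \<noteq> {}"
      then obtain \<tau> where t: "\<tau> \<in> \<Delta>" "card \<tau> = n" "\<tau> \<in> part W \<sigma>" by (auto simp: simp_def)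
      then show False using 1 card_mono[OF flag_finite[OF t(1)] sub(1)[OF t(3)]] by simp
    qed
    then have "x = 0" using x(1) by (simp add: supported_def)
    then show ?thesis by (intro bexI[of _ 0]) auto
  next
    case 2
    have "\<tau> = \<sigma>" if "\<tau> \<in> simp n \<inter> part W \<sigma>" for \<tau>
      using that 2 sub(1)[of \<tau>] card_subset_eq[of \<tau> \<sigma>] flag_finite by (auto simp: simp_def)
    then have "keys x \<subseteq> {\<sigma>}" using x(1) by (auto simp: supported_def)
    then have xs: "x = Poly_Mapping.single \<sigma> (lookup x \<sigma>)"
      by (intro pm_eqI) (auto simp: lookup_single when_def in_keys_iff)
    show ?thesis
    proof (cases "\<exists>v\<in>W. insert v \<sigma> \<in> \<Delta>")
      case True
      then obtain v where v: "v \<in> W" "insert v \<sigma> \<in> \<Delta>" "v \<notin> \<sigma>" using \<sigma> by blast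
      have "insert v \<sigma> \<inter> W = {v}" "insert v \<sigma> - {v} = \<sigma>" using v \<sigma> by auto
      then have "lin (lbd W) (Poly_Mapping.single (insert v \<sigma>) (sg idx v (insert v \<sigma>) * lookup x \<sigma>)) =
          Poly_Mapping.single \<sigma> ((sg idx v (insert v \<sigma>) * sg idx v (insert v \<sigma>)) * lookup x \<sigma>)"
        by (simp add: lbd_def mult.commute mult.left_commute)
      also have "\<dots> = x" using xs by simp
      finally show ?thesis using v 2 fin
        by (intro bexI[of _ "Poly_Mapping.single (insert v \<sigma>) (sg idx v (insert v \<sigma>) * lookup x \<sigma>)"])
          (auto intro!: supported_single simp: simp_def)
    next
      case False
      have "simp (Suc n) \<inter> part W \<sigma> = {}"
      proof (rule ccontr)
        assume "simp (Suc n) \<inter> part W \<sigma> \<noteq> {}"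
        then obtain \<tau> where t: "\<tau> \<in> \<Delta>" "card \<tau> = Suc n" "\<tau> \<in> part W \<sigma>" by (auto simp: simp_def)
        then have "\<tau> \<noteq> \<sigma>" using 2 by auto
        then obtain v where "v \<in> \<tau> \<inter> W" using sub[OF t(3)] by blast
        then have "insert v \<sigma> \<in> \<Delta>" "v \<in> W" using flag_subset[OF t(1), of "insert v \<sigma>"] sub(1)[OF t(3)] by auto
        then show False using False by blast
      qed
      then have "y = 0" using y(1) by (simp add: supported_def)
      then have "k * lookup x \<sigma> = 0" using y(2) by (metis lookup_scale lin_zero lookup_zero)
      then have "lookup x \<sigma> = 0" using k by (metis mult_eq_0_iff less_irrefl)
      then have "x = 0" using xs by (metis single_zero)
      then show ?thesis by (intro bexI[of _ 0]) auto
    qed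
  next
    case (3 p)
    have xs: "x \<in> supported (simp (Suc p + card \<sigma>))" using x(1) 3 by (auto simp: supported_def)
    have ys: "y \<in> supported (simp (Suc (Suc p) + card \<sigma>))" using y(1) 3 by (auto simp: supported_def)
    \<comment> \<open>For p = 0 there is nothing to check: unreduced 0-chains are all
      cycles.\<close>
    have "p = 0 \<or> simplicial_boundary (lchain (Suc p) x) = (\<lambda>_. 0)"
    proof (cases p)
      case (Suc m)
      have "simplicial_boundary (lchain (Suc (Suc m)) x) = lchain (Suc m) (lin (lbd W) x)"
        by (rule lchain_boundary) (use xs Suc in simp)
      then show ?thesis using x(2) Suc by (simp add: lchain_def fun_eq_iff)
    qed simp
    then have cyc: "lchain (Suc p) x \<in> simplicial_cycles Lk p"
      using lchain_closed[OF xs] by (simp add: simplicial_cycles_def)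
    have "k * lchain (Suc p) x zs = simplicial_boundary (lchain (Suc (Suc p)) y) zs" for zs
      unfolding lchain_boundary[OF ys] y(2)[symmetric] by (simp add: lchain_def)
    from L.torsion_freeD[OF tf cyc k lchain_closed[OF ys] this]
    obtain d where d: "d \<in> simplicial_chains Lk (Suc p)" "lchain (Suc p) x = simplicial_boundary d" by blast
    have "lin (lbd W) (schain (Suc (Suc p)) d) = x"
      by (rule schain_boundary[OF d(1) _ d(2)]) (use x(1) 3 in simp)
    moreover have "schain (Suc (Suc p)) d \<in> supported (simp (Suc n))"
      using schain_closed[of "Suc (Suc p)" d] 3 by (auto simp: supported_def)
    ultimately show ?thesis by blast
  qed
qed

end

lemma proj_closed: "x \<in> supported (simp n) \<Longrightarrow> lin (proj W \<sigma>) x \<in> supported (simp n \<inter> part W \<sigma>)"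
  by (rule supported_lin) (auto simp: proj_def part_def simp_def intro!: supported_single)

lemma proj_lin_lbd: "lin (lbd W) (lin (proj W \<sigma>) x) = lin (proj W \<sigma>) (lin (lbd W) x)"
  unfolding lin_lin by (rule lin_cong) (auto simp: proj_lbd proj_def)

theorem ltorsion_free_links:
  assumes tf: "\<And>\<sigma>. \<sigma> \<in> \<Delta> \<Longrightarrow> \<sigma> \<inter> W = {} \<Longrightarrow> torsion_free_homology (link \<Delta> W \<sigma>)" and W: "W \<subseteq> V"
  shows "ltorsion_free W"
  unfolding ltorsion_free_def
proof (intro allI impI)
  fix n k and x y :: "'v set \<Rightarrow>\<^sub>0 int"
  assume x: "x \<in> supported (simp n)" "lin (lbd W) x = 0" and k: "k > 0"
    and y: "y \<in> supported (simp (Suc n))" "scale k x = lin (lbd W) y"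
  let ?S = "{\<sigma>\<in>\<Delta>. \<sigma> \<inter> W = {}}"
  have "\<exists>z\<in>supported (simp (Suc n)). lin (lbd W) z = lin (proj W \<sigma>) x" if s: "\<sigma> \<in> ?S" for \<sigma>
  proof (rule link_torsion[of \<sigma> W k _ n "lin (proj W \<sigma>) y"])
    show "scale k (lin (proj W \<sigma>) x) = lin (lbd W) (lin (proj W \<sigma>) y)"
      unfolding proj_lin_lbd y(2)[symmetric] lin_scale ..
    show "lin (lbd W) (lin (proj W \<sigma>) x) = 0" by (simp add: proj_lin_lbd x(2))
  qed (use s tf W k proj_closed[OF x(1)] proj_closed[OF y(1)] in auto)
  then obtain z where z: "\<And>\<sigma>. \<sigma> \<in> ?S \<Longrightarrow> z \<sigma> \<in> supported (simp (Suc n)) \<and> lin (lbd W) (z \<sigma>) = lin (proj W \<sigma>) x"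
    by metis
  have "lin (lbd W) (\<Sum>\<sigma>\<in>?S. z \<sigma>) = (\<Sum>\<sigma>\<in>?S. lin (proj W \<sigma>) x)"
    unfolding lin_sum by (rule sum.cong) (use z in auto)
  also have "\<dots> = lin (\<lambda>\<tau>. \<Sum>\<sigma>\<in>?S. proj W \<sigma> \<tau>) x" by (simp add: lin_fun_sum)
  also have "\<dots> = x"
  proof (rule HOL.trans[OF lin_cong_on[OF x(1)] lin_id])
    fix \<tau> assume "\<tau> \<in> simp n"
    then have "\<tau> - W \<in> ?S" using flag_subset[of \<tau> "\<tau> - W"] by (auto simp: simp_def)
    then show "(\<Sum>\<sigma>\<in>?S. proj W \<sigma> \<tau>) = Poly_Mapping.single \<tau> (1::int)"
      by (simp add: proj_def sum.delta)
  qed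
  finally show "\<exists>y\<in>supported (simp (Suc n)). lin (lbd W) y = x"
    using z by (intro bexI[of _ "\<Sum>\<sigma>\<in>?S. z \<sigma>"]) (auto intro!: supported_sum)
qed

end

section \<open>The bar complex\<close>

text \<open>The contraction of the bar resolution that moves the group coefficient into the first
  place of the bar. It is linear but not equivariant.\<close>

definition bcone :: "('g, 'z) monoid_scheme \<Rightarrow> 'g \<times> 'g list \<Rightarrow> ('g \<times> 'g list \<Rightarrow>\<^sub>0 'r::comm_ring_1)" where
  "bcone G c = Poly_Mapping.single (\<one>\<^bsub>G\<^esub>, fst c # snd c) 1"

text \<open>The recursion is chosen so that \<open>bcone\<close> is a contraction by construction.
  The usual alternating sum is recovered in \<open>bdr_formula\<close>.\<close>

fun bdr :: "('g, 'z) monoid_scheme \<Rightarrow> 'g list \<Rightarrow> ('g \<times> 'g list \<Rightarrow>\<^sub>0 'r::comm_ring_1)" where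
  "bdr G [] = 0"
| "bdr G [g] = Poly_Mapping.single (g, []) 1 - Poly_Mapping.single (\<one>\<^bsub>G\<^esub>, []) 1"
| "bdr G (g # x # xs) = Poly_Mapping.single (g, x # xs) 1 - lin (bcone G) (act G g (bdr G (x # xs)))"

definition "blists G n = {xs. set xs \<subseteq> carrier G \<and> length xs = n}"

context monoid
begin

lemma bcone_closed: "x \<in> chains G (blists G n) \<Longrightarrow> lin (bcone G) x \<in> chains G (blists G (Suc n))"
  by (rule supported_lin) (auto simp: bcone_def blists_def intro!: supported_single)

lemma bdr_closed: "xs \<in> blists G (Suc n) \<Longrightarrow> (bdr G xs :: _ \<Rightarrow>\<^sub>0 'r::comm_ring_1) \<in> chains G (blists G n)"
proof (induction xs arbitrary: n rule: induct_list012)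
  case (3 g x xs)
  then obtain m where m: "n = Suc m" by (cases n) (auto simp: blists_def)
  have "(bdr G (x # xs) :: _ \<Rightarrow>\<^sub>0 'r) \<in> chains G (blists G m)" by (rule "3.IH"(2)) (use 3(3) m in \<open>auto simp: blists_def\<close>)
  then have "lin (bcone G) (act G g (bdr G (x # xs) :: _ \<Rightarrow>\<^sub>0 'r)) \<in> chains G (blists G n)"
    unfolding m using 3(3) by (intro bcone_closed act_closed) (auto simp: blists_def)
  then show ?case using 3(3) by (auto intro!: supported_diff supported_single simp: blists_def)
qed (auto simp: blists_def intro!: supported_diff supported_single)

abbreviation "BDR \<equiv> ext G (bdr G)"

lemma ext_bcone: "x \<in> chains G (blists G n) \<Longrightarrow> BDR (lin (bcone G) x) = lin (\<lambda>c. bdr G (fst c # snd c)) x"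
  unfolding ext_def lin_lin
proof (rule lin_cong_on)
  fix c assume c: "c \<in> carrier G \<times> blists G n"
  have "act G \<one> (bdr G (fst c # snd c)) = bdr G (fst c # snd c)"
    by (rule act_one[OF bdr_closed[of _ n]]) (use c in \<open>auto simp: blists_def\<close>)
  then show "lin (\<lambda>(g, a). act G g (bdr G a)) (bcone G c) = bdr G (fst c # snd c)" by (simp add: bcone_def)
qed

lemma cone_BDR_0:
  assumes x: "x \<in> chains G (blists G 0)"
  shows "BDR (lin (bcone G) x) = x - scale (aug (\<lambda>_. 1) x) (Poly_Mapping.single (\<one>, []) 1)"
proof -
  have "BDR (lin (bcone G) x) = lin (\<lambda>c. Poly_Mapping.single c 1 - Poly_Mapping.single (\<one>, []) 1) x"
    unfolding ext_bcone[OF x] by (rule lin_cong_on[OF x]) (auto simp: blists_def)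
  also have "\<dots> = x - lin (\<lambda>c. Poly_Mapping.single (\<one>, []) 1) x" by (simp add: lin_fun_diff)
  also have "lin (\<lambda>c. Poly_Mapping.single (\<one>, []) 1) x = scale (aug (\<lambda>_. 1) x) (Poly_Mapping.single (\<one>, []) 1)"
    by (rule pm_eqI) (simp add: lookup_lin aug_def lookup_single when_def)
  finally show ?thesis .
qed

lemma cone_BDR_Suc:
  assumes x: "x \<in> chains G (blists G (Suc n))"
  shows "BDR (lin (bcone G) x) = x - lin (bcone G) (BDR x)"
proof -
  have "BDR (lin (bcone G) x) = lin (\<lambda>c. Poly_Mapping.single c 1 - lin (bcone G) (act G (fst c) (bdr G (snd c)))) x"
    unfolding ext_bcone[OF x]
  proof (rule lin_cong_on[OF x])
    fix c assume "c \<in> carrier G \<times> blists G (Suc n)"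
    then obtain g y ys where "c = (g, y # ys)" by (cases c; cases "snd c") (auto simp: blists_def)
    then show "bdr G (fst c # snd c) = Poly_Mapping.single c 1 - lin (bcone G) (act G (fst c) (bdr G (snd c)))" by simp
  qed
  also have "\<dots> = x - lin (bcone G) (BDR x)" by (simp add: lin_fun_diff ext_def lin_lin split_def)
  finally show ?thesis .
qed

lemma BDR_closed: "x \<in> chains G (blists G (Suc n)) \<Longrightarrow> BDR x \<in> chains G (blists G n)"
  by (rule ext_closed) (auto intro: bdr_closed)

lemma aug_bdr: "xs \<in> blists G (Suc 0) \<Longrightarrow> aug (\<lambda>_. 1) (bdr G xs) = 0"
  by (cases xs) (auto simp: blists_def aug_diff)

text \<open>By the recursion, a boundary is a translate minus the cone of that translate. The
  contraction identity turns its boundary into the cone of a double boundary of lower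
  degree.\<close>

lemma BDR_bdr: "xs \<in> blists G (Suc (Suc n)) \<Longrightarrow> BDR (bdr G xs :: _ \<Rightarrow>\<^sub>0 'r::comm_ring_1) = 0"
proof (induction n arbitrary: xs)
  case 0
  then obtain g x where xs: "xs = [g, x]" "g \<in> carrier G" "x \<in> carrier G"
    by (auto simp: blists_def length_Suc_conv)
  have b: "(bdr G [x] :: _ \<Rightarrow>\<^sub>0 'r) \<in> chains G (blists G 0)" by (rule bdr_closed) (use xs in \<open>auto simp: blists_def\<close>)
  have "BDR (bdr G xs :: _ \<Rightarrow>\<^sub>0 'r) = act G g (bdr G [x]) - BDR (lin (bcone G) (act G g (bdr G [x])))"
    by (simp add: xs(1) ext_diff ext_single)
  then show ?case using xs
    by (simp only: cone_BDR_0[OF act_closed[OF xs(2) b]]) (simp add: aug_diff)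
next
  case (Suc n)
  then obtain g x ys where xs: "xs = g # x # ys" "g \<in> carrier G" "x # ys \<in> blists G (Suc (Suc n))"
    by (auto simp: blists_def length_Suc_conv)
  have b: "(bdr G (x # ys) :: _ \<Rightarrow>\<^sub>0 'r) \<in> chains G (blists G (Suc n))" by (rule bdr_closed[OF xs(3)])
  have "BDR (bdr G xs :: _ \<Rightarrow>\<^sub>0 'r) = act G g (bdr G (x # ys)) - BDR (lin (bcone G) (act G g (bdr G (x # ys))))"
    by (simp add: xs(1) ext_diff ext_single)
  also have "\<dots> = lin (bcone G) (BDR (act G g (bdr G (x # ys))))"
    by (simp only: cone_BDR_Suc[OF act_closed[OF xs(2) b]]) simp
  also have "BDR (act G g (bdr G (x # ys)) :: _ \<Rightarrow>\<^sub>0 'r) = act G g (BDR (bdr G (x # ys)))"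
    by (rule ext_act[OF xs(2) b bdr_closed])
  finally show ?case by (simp add: Suc.IH[OF xs(3)])
qed

lemma free_bar: "free_complex G (blists G) (\<lambda>_. bdr G) (\<lambda>_. 1 :: 'r::comm_ring_1)"
  by unfold_locales (auto intro: bdr_closed BDR_bdr aug_bdr)

lemma exact_bar: "exact_complex G (\<lambda>n. chains G (blists G n)) (\<lambda>_. BDR) (\<lambda>_. 1 :: 'r::comm_ring_1)"
proof
  show "submod G (chains G (blists G n) :: (_ \<Rightarrow>\<^sub>0 'r) set)" for n by (rule submod_chains)
  show "eqlin G (chains G (blists G (Suc n)) :: (_ \<Rightarrow>\<^sub>0 'r) set) BDR" for n by (rule eqlin_ext_fun) (rule bdr_closed)
  show "\<exists>y\<in>chains G (blists G 0). aug (\<lambda>_. 1) y = (1::'r)"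
    by (rule bexI[of _ "Poly_Mapping.single (\<one>, []) 1"]) (auto intro!: supported_single simp: blists_def)
  fix y :: "_ \<Rightarrow>\<^sub>0 'r"
  show "BDR y \<in> chains G (blists G n)" if "y \<in> chains G (blists G (Suc n))" for n by (rule BDR_closed[OF that])
  show "BDR (BDR y) = 0" if "y \<in> chains G (blists G (Suc (Suc n)))" for n
    by (rule free_complex.ext_D_D[OF free_bar that])
  show "aug (\<lambda>_. 1) (BDR y) = 0" if "y \<in> chains G (blists G (Suc 0))"
  proof -
    have "aug (\<lambda>_. 1) (BDR y) = aug (\<lambda>b. aug (\<lambda>_. 1) (bdr G b)) y" by (simp add: aug_ext)
    also have "\<dots> = aug (\<lambda>_. 0) y" by (rule aug_cong[OF that]) (rule aug_bdr)
    finally show ?thesis by (simp add: aug_def)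
  qed
  show "\<exists>z\<in>chains G (blists G (Suc 0)). BDR z = y" if "y \<in> chains G (blists G 0)" "aug (\<lambda>_. 1) y = 0"
    using cone_BDR_0[OF that(1)] bcone_closed[OF that(1)] that(2) by (intro bexI[of _ "lin (bcone G) y"]) auto
  show "\<exists>z\<in>chains G (blists G (Suc (Suc n))). BDR z = y" if "y \<in> chains G (blists G (Suc n))" "BDR y = 0" for n
    using cone_BDR_Suc[OF that(1)] bcone_closed[OF that(1)] that(2) by (intro bexI[of _ "lin (bcone G) y"]) auto
qed

definition "merge i xs = take i xs @ [xs ! i \<otimes> xs ! Suc i] @ drop (i + 2) xs"

lemma bdr_formula:
  "xs \<in> blists G (Suc n) \<Longrightarrow> bdr G xs = Poly_Mapping.single (hd xs, tl xs) (1::'r::comm_ring_1) +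
     (\<Sum>i<n. Poly_Mapping.single (\<one>, merge i xs) ((- 1) ^ Suc i)) + Poly_Mapping.single (\<one>, butlast xs) ((- 1) ^ Suc n)"
proof (induction n arbitrary: xs)
  case 0
  then obtain g where "xs = [g]" by (auto simp: blists_def length_Suc_conv)
  then show ?case by (simp add: single_uminus)
next
  case (Suc n)
  then obtain g x ys where xs: "xs = g # x # ys" "g \<in> carrier G" "x \<in> carrier G" "x # ys \<in> blists G (Suc n)"
    by (auto simp: blists_def length_Suc_conv)
  have IH: "bdr G (x # ys) = Poly_Mapping.single (x, ys) (1::'r) +
     (\<Sum>i<n. Poly_Mapping.single (\<one>, merge i (x # ys)) ((- 1) ^ Suc i)) + Poly_Mapping.single (\<one>, butlast (x # ys)) ((- 1) ^ Suc n)"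
    using Suc.IH[OF xs(4)] by simp
  have m0: "merge 0 xs = (g \<otimes> x) # ys" by (simp add: merge_def xs(1))
  have mS: "merge (Suc i) xs = g # merge i (x # ys)" for i by (simp add: merge_def xs(1))
  have "lin (bcone G) (act G g (bdr G (x # ys))) = Poly_Mapping.single (\<one>, (g \<otimes> x) # ys) (1::'r) +
     (\<Sum>i<n. Poly_Mapping.single (\<one>, g # merge i (x # ys)) ((- 1) ^ Suc i)) +
     Poly_Mapping.single (\<one>, g # butlast (x # ys)) ((- 1) ^ Suc n)"
    unfolding IH using xs(2) by (simp add: act_add act_sum lin_add lin_sum bcone_def)
  also have "(\<Sum>i<n. Poly_Mapping.single (\<one>, g # merge i (x # ys)) ((- 1) ^ Suc i)) =
      - (\<Sum>i<n. Poly_Mapping.single (\<one>, merge (Suc i) xs) ((- 1) ^ Suc (Suc i) :: 'r))"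
    unfolding sum_negf[symmetric] by (rule sum.cong) (simp_all add: mS single_uminus)
  also have "Poly_Mapping.single (\<one>, (g \<otimes> x) # ys) (1::'r) = - Poly_Mapping.single (\<one>, merge 0 xs) ((- 1) ^ Suc 0)"
    by (simp add: m0 single_uminus)
  finally have l: "lin (bcone G) (act G g (bdr G (x # ys))) = - (\<Sum>i<Suc n. Poly_Mapping.single (\<one>, merge i xs) ((- 1) ^ Suc i))
      + Poly_Mapping.single (\<one>, g # butlast (x # ys)) ((- 1) ^ Suc n :: 'r)"
    by (simp only: sum.lessThan_Suc_shift minus_add_distrib)
  have "bdr G xs = Poly_Mapping.single (g, x # ys) 1 - lin (bcone G) (act G g (bdr G (x # ys)))" by (simp add: xs(1))
  also have "\<dots> = Poly_Mapping.single (g, x # ys) (1::'r) + (\<Sum>i<Suc n. Poly_Mapping.single (\<one>, merge i xs) ((- 1) ^ Suc i))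
      + Poly_Mapping.single (\<one>, butlast xs) ((- 1) ^ Suc (Suc n))"
    unfolding l by (simp add: xs(1) single_uminus)
  finally show ?case by (simp add: xs(1))
qed

end

subsection \<open>Cochains as functionals\<close>

text \<open>With trivial coefficients a cochain is a functional on bar chains that ignores the group
  factor, which is \<open>aug f\<close>. The coboundary becomes composition with the
  boundary.\<close>

lemma coboundary_bdr:
  fixes G :: "'g monoid"
  assumes "Group.monoid G" "xs \<in> blists G (Suc n)"
  shows "group_coboundary G n f xs = aug f (bdr G xs)"
proof -
  interpret monoid G by fact
  have "xs \<in> lists (carrier G) \<and> length xs = Suc n" using assms(2) by (auto simp: blists_def)
  then show ?thesis
    unfolding bdr_formula[OF assms(2)] group_coboundary_def
    by (simp add: aug_add aug_sum merge_def)
qed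

lemma cochain_blists: "f \<in> group_cochains G n \<Longrightarrow> f xs \<noteq> 0 \<Longrightarrow> xs \<in> blists G n"
  by (auto simp: group_cochains_def blists_def)

lemma cocycle_iff:
  fixes G :: "'g monoid"
  assumes "Group.monoid G"
  shows "f \<in> group_cocycles G n \<longleftrightarrow> f \<in> group_cochains G n \<and> (\<forall>xs\<in>blists G (Suc n). aug f (bdr G xs) = 0)"
proof -
  have "group_coboundary G n f xs = 0" if "xs \<notin> blists G (Suc n)" for xs
    using that by (auto simp: group_coboundary_def blists_def)
  then show ?thesis unfolding group_cocycles_def using coboundary_bdr[OF assms, of _ n f] by fastforce
qed

lemma coboundary_cochain: "group_coboundary G n f \<in> group_cochains G (Suc n)"
  by (simp add: group_cochains_def group_coboundary_def)

lemma coboundary_cocycle: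
  fixes G :: "'g monoid"
  assumes M: "Group.monoid G"
  shows "group_coboundary G n f \<in> group_cocycles G (Suc n)"
  unfolding cocycle_iff[OF M]
proof (intro conjI ballI)
  interpret monoid G by fact
  fix xs assume xs: "xs \<in> blists G (Suc (Suc n))"
  have "aug (group_coboundary G n f) (bdr G xs) = aug (\<lambda>ys. aug f (bdr G ys)) (bdr G xs)"
    by (rule aug_cong[OF bdr_closed[OF xs]]) (rule coboundary_bdr[OF M])
  also have "\<dots> = aug f (BDR (bdr G xs))" by (simp add: aug_ext)
  finally show "aug (group_coboundary G n f) (bdr G xs) = 0" by (simp add: BDR_bdr[OF xs])
qed (rule coboundary_cochain)

section \<open>The cohomology ring of a right-angled Artin group\<close>

context raag_complex
begin

abbreviation "bl n \<equiv> blists Ga n"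
abbreviation "bdG \<equiv> bdr Ga"

text \<open>The fundamental cycle of the torus spanned by the commuting generators at the vertices of \<open>\<sigma>\<close>.\<close>

primrec tor :: "nat \<Rightarrow> 'v set \<Rightarrow> (('v \<times> bool) list set \<times> ('v \<times> bool) list set list \<Rightarrow>\<^sub>0 real)" where
  "tor 0 \<sigma> = Poly_Mapping.single (\<one>\<^bsub>Ga\<^esub>, []) 1"
| "tor (Suc n) \<sigma> = lin (bcone Ga) (ext Ga (tor n) (bd \<sigma>))"

lemma tor_closed: "\<sigma> \<in> simp n \<Longrightarrow> tor n \<sigma> \<in> chains Ga (bl n)"
proof (induction n arbitrary: \<sigma>)
  case (Suc n)
  then show ?case by (auto intro!: raag.bcone_closed raag.ext_closed[OF bd_closed])
qed (auto simp: blists_def intro!: supported_single)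

lemma aug_bd: "aug a (bd \<sigma>) = 0"
  by (simp add: cbd_def aug_sum aug_scale aug_diff)

text \<open>The cone fills cycles, and the image of a boundary is a cycle by the previous degree. So
  \<open>tor\<close> is an explicit chain map from the cube complex to the bar complex.\<close>

lemma tor_boundary: "\<sigma> \<in> simp (Suc n) \<Longrightarrow> ext Ga bdG (tor (Suc n) \<sigma>) = ext Ga (tor n) (bd \<sigma>)"
proof (induction n arbitrary: \<sigma>)
  case 0
  have u: "ext Ga (tor 0) (bd \<sigma>) \<in> chains Ga (bl 0)" by (rule raag.ext_closed[OF bd_closed[OF 0] tor_closed])
  have "aug (\<lambda>_. 1) (ext Ga (tor 0) (bd \<sigma>)) = (0::real)"
    unfolding aug_ext by (rule aug_bd)
  then show ?case using raag.cone_BDR_0[OF u] unfolding tor.simps(2) by (simp del: tor.simps)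
next
  case (Suc n)
  let ?u = "ext Ga (tor (Suc n)) (bd \<sigma>)"
  have b: "(bd \<sigma> :: _ \<Rightarrow>\<^sub>0 real) \<in> chains Ga (simp (Suc n))" by (rule bd_closed[OF Suc.prems])
  have u: "?u \<in> chains Ga (bl (Suc n))" by (rule raag.ext_closed[OF b tor_closed])
  have "ext Ga bdG ?u = ext Ga (\<lambda>\<rho>. ext Ga bdG (tor (Suc n) \<rho>)) (bd \<sigma>)"
    by (rule raag.ext_ext[OF b tor_closed raag.bdr_closed])
  also have "\<dots> = ext Ga (\<lambda>\<rho>. ext Ga (tor n) (bd \<rho>)) (bd \<sigma>)"
    by (rule raag.ext_cong[OF b]) (rule Suc.IH)
  also have "\<dots> = ext Ga (tor n) (BD (bd \<sigma>))"
    by (rule raag.ext_ext[OF b bd_closed tor_closed, symmetric])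
  also have "BD (bd \<sigma>) = (0 :: _ \<Rightarrow>\<^sub>0 real)" using Suc.prems by (intro ext_bd_bd) (simp add: simp_def)
  finally show ?case using raag.cone_BDR_Suc[OF u] unfolding tor.simps(2)[of "Suc n"] by (simp del: tor.simps)
qed

section \<open>Cocycles and their values on tori\<close>

definition "ev n f \<sigma> = aug f (tor n \<sigma>)"

text \<open>With trivial coefficients the opposite faces of a cube cancel, so tori are
  cycles.\<close>

lemma ev_coboundary: assumes "\<sigma> \<in> simp (Suc n)" shows "ev (Suc n) (group_coboundary Ga n f) \<sigma> = 0"
proof -
  have "ev (Suc n) (group_coboundary Ga n f) \<sigma> = aug (\<lambda>xs. aug f (bdG xs)) (tor (Suc n) \<sigma>)"
    unfolding ev_def by (rule aug_cong[OF tor_closed[OF assms]]) (rule coboundary_bdr[OF raag.monoid_axioms])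
  also have "\<dots> = aug f (ext Ga (tor n) (bd \<sigma>))" unfolding tor_boundary[OF assms, symmetric] aug_ext by simp
  also have "\<dots> = 0" unfolding aug_ext by (rule aug_bd)
  finally show ?thesis .
qed

lemma ev_add: "ev n (\<lambda>xs. f xs + h xs) \<sigma> = ev n f \<sigma> + ev n h \<sigma>"
  by (simp add: ev_def aug_def pair_fun_add)
lemma ev_mult: "ev n (\<lambda>xs. r * f xs) \<sigma> = r * ev n f \<sigma>"
  by (simp add: ev_def aug_def pair_fun_mult)
lemma ev_sum: "ev n (\<lambda>xs. \<Sum>i\<in>I. f i xs) \<sigma> = (\<Sum>i\<in>I. ev n (f i) \<sigma>)"
  by (simp add: ev_def aug_def pair_fun_sum)

definition "homc \<phi> = (\<lambda>xs :: ('v \<times> bool) list set list. if xs \<in> lists (carrier Ga) \<and> length xs = 1 then \<phi> (hd xs) else (0::real))"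

lemma cup_homc: "cup_cochain 1 (homc \<phi>) f (g # ys) = (if g \<in> carrier Ga then \<phi> g * f ys else 0)"
  by (simp add: cup_cochain_def homc_def)

definition "is_hom \<phi> \<longleftrightarrow> (\<forall>g\<in>carrier Ga. \<forall>h\<in>carrier Ga. \<phi> (g \<otimes>\<^bsub>Ga\<^esub> h) = \<phi> g + (\<phi> h :: real))"

lemma is_hom_one: "is_hom \<phi> \<Longrightarrow> \<phi> \<one>\<^bsub>Ga\<^esub> = 0"
  unfolding is_hom_def using raag.one_closed raag.l_one[OF raag.one_closed] by fastforce

lemma pair_hom_act:
  assumes "is_hom \<phi>" "x \<in> chains Ga A" "g \<in> carrier Ga"
  shows "pair (\<lambda>(h, ys). \<phi> h * f ys) (act Ga g x) = \<phi> g * aug f x + pair (\<lambda>(h, ys). \<phi> h * f ys) x"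
proof -
  have "pair (\<lambda>(h, ys). \<phi> h * f ys) (act Ga g x) = pair (\<lambda>(h, ys). \<phi> (g \<otimes>\<^bsub>Ga\<^esub> h) * f ys) x"
    by (simp add: act_def pair_lin split_def)
  also have "\<dots> = pair (\<lambda>c. \<phi> g * f (snd c) + (case c of (h, ys) \<Rightarrow> \<phi> h * f ys)) x"
    by (rule pair_cong_on[OF assms(2)]) (use assms in \<open>auto simp: is_hom_def algebra_simps\<close>)
  finally show ?thesis by (simp add: pair_fun_add pair_fun_mult aug_def)
qed

text \<open>The outermost cone in \<open>tor\<close> puts one group element in front, which is where
  the factor of degree 1 is evaluated. By additivity of \<phi>, two opposite faces leave only the
  term with \<phi> (gam v).\<close>

lemma ev_cup:
  assumes \<phi>: "is_hom \<phi>" and \<sigma>: "\<sigma> \<in> simp (Suc n)"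
  shows "ev (Suc n) (cup_cochain 1 (homc \<phi>) f) \<sigma> = (\<Sum>v\<in>\<sigma>. sg idx v \<sigma> * \<phi> (gam v) * ev n f (\<sigma> - {v}))"
proof -
  let ?u = "ext Ga (tor n) (bd \<sigma>)"
  have u: "?u \<in> chains Ga (bl n)" by (rule raag.ext_closed[OF bd_closed[OF \<sigma>] tor_closed])
  have "ev (Suc n) (cup_cochain 1 (homc \<phi>) f) \<sigma> = pair (\<lambda>c. cup_cochain 1 (homc \<phi>) f (fst c # snd c)) ?u"
    by (simp add: ev_def aug_def pair_lin bcone_def)
  also have "\<dots> = pair (\<lambda>(h, ys). \<phi> h * f ys) ?u"
    by (rule pair_cong_on[OF u]) (auto simp: cup_homc simp del: One_nat_def)
  also have "?u = (\<Sum>v\<in>\<sigma>. scale (sg idx v \<sigma>) (act Ga (gam v) (tor n (\<sigma> - {v})) - act Ga \<one>\<^bsub>Ga\<^esub> (tor n (\<sigma> - {v}))))"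
    by (simp add: cbd_def ext_sum ext_scale ext_diff ext_single)
  also have "pair (\<lambda>(h, ys). \<phi> h * f ys) \<dots> = (\<Sum>v\<in>\<sigma>. sg idx v \<sigma> * \<phi> (gam v) * ev n f (\<sigma> - {v}))"
    unfolding pair_sum pair_scale pair_diff
  proof (rule sum.cong)
    fix v assume v: "v \<in> \<sigma>"
    have s: "\<sigma> - {v} \<in> simp n" using \<sigma> v flag_subset card_remove by (auto simp: simp_def)
    have V: "v \<in> V" using \<sigma> v flag_mem_V by (auto simp: simp_def)
    show "sg idx v \<sigma> * (pair (\<lambda>(h, ys). \<phi> h * f ys) (act Ga (gam v) (tor n (\<sigma> - {v}))) -
        pair (\<lambda>(h, ys). \<phi> h * f ys) (act Ga \<one>\<^bsub>Ga\<^esub> (tor n (\<sigma> - {v})))) = sg idx v \<sigma> * \<phi> (gam v) * ev n f (\<sigma> - {v})"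
      using pair_hom_act[OF \<phi> tor_closed[OF s], of "gam v" f] raag.act_one[OF tor_closed[OF s]] V
      by (simp add: ev_def)
  qed simp
  finally show ?thesis .
qed

lemma cup_cocycle:
  assumes \<phi>: "is_hom \<phi>" and f: "f \<in> group_cocycles Ga n"
  shows "cup_cochain 1 (homc \<phi>) f \<in> group_cocycles Ga (Suc n)"
  unfolding cocycle_iff[OF raag.monoid_axioms]
proof (intro conjI ballI)
  have fc: "f \<in> group_cochains Ga n" and f0: "\<And>xs. xs \<in> bl (Suc n) \<Longrightarrow> aug f (bdG xs) = 0"
    using f by (auto simp: cocycle_iff[OF raag.monoid_axioms])
  have "xs \<in> lists (carrier Ga) \<and> length xs = Suc n" if nz: "cup_cochain 1 (homc \<phi>) f xs \<noteq> 0" for xs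
  proof (cases xs)
    case Nil
    then show ?thesis using nz by (simp add: cup_cochain_def homc_def)
  next
    case (Cons g ys)
    then have "g \<in> carrier Ga" "f ys \<noteq> 0" using nz cup_homc[of \<phi> f g ys] by (auto split: if_splits)
    then show ?thesis using cochain_blists[OF fc] Cons by (auto simp: blists_def)
  qed
  then show "cup_cochain 1 (homc \<phi>) f \<in> group_cochains Ga (Suc n)" by (simp add: group_cochains_def)
  fix xs assume "xs \<in> bl (Suc (Suc n))"
  then obtain g x ys where xs: "xs = g # x # ys" "g \<in> carrier Ga" "x \<in> carrier Ga" "x # ys \<in> bl (Suc n)"
    by (auto simp: blists_def length_Suc_conv)
  have b: "bdG (x # ys) \<in> chains Ga (bl n)" by (rule raag.bdr_closed[OF xs(4)])
  let ?F = "\<lambda>(h, ys). \<phi> h * f ys"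
  have "aug (cup_cochain 1 (homc \<phi>) f) (bdG xs) = \<phi> x * f ys - pair (\<lambda>c. cup_cochain 1 (homc \<phi>) f (fst c # snd c)) (act Ga g (bdG (x # ys)))"
    using xs(2,3) unfolding xs(1) by (simp add: aug_def pair_diff pair_lin bcone_def cup_homc del: One_nat_def)
  also have "pair (\<lambda>c. cup_cochain 1 (homc \<phi>) f (fst c # snd c)) (act Ga g (bdG (x # ys))) = pair ?F (act Ga g (bdG (x # ys)))"
    by (rule pair_cong_on[OF raag.act_closed[OF xs(2) b]]) (auto simp: cup_homc simp del: One_nat_def)
  also have "\<dots> = pair ?F (bdG (x # ys))"
    using pair_hom_act[OF \<phi> b xs(2), of f] f0[OF xs(4)] by simp
  also have "\<dots> = \<phi> x * f ys"
    unfolding raag.bdr_formula[OF xs(4)] using is_hom_one[OF \<phi>] by (simp add: pair_add pair_sum)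
  finally show "aug (cup_cochain 1 (homc \<phi>) f) (bdG xs) = 0" by simp
qed

text \<open>\<open>gam v\<close> may be the inverse of the generator, so the value prescribed on the
  generator has its sign chosen by \<beta>.\<close>

lemma dual_hom: assumes "v \<in> V" shows "\<exists>\<phi>. is_hom \<phi> \<and> (\<forall>u\<in>V. \<phi> (gam u) = (if u = v then 1 else 0))"
proof -
  obtain \<phi> where \<phi>: "\<forall>g\<in>carrier Ga. \<forall>h\<in>carrier Ga. \<phi> (g \<otimes>\<^bsub>Ga\<^esub> h) = \<phi> g + \<phi> h"
    "\<forall>u\<in>V. \<phi> (gl (u, True)) = (if u = v then (if \<beta> v then 1 else - 1) else (0::real))"
    using hom_exists[of "\<lambda>u. if u = v then (if \<beta> v then 1 else - 1) else 0"] by auto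
  have h: "is_hom \<phi>" using \<phi> by (simp add: is_hom_def)
  have "\<phi> (gam u) = (if u = v then 1 else 0)" if u: "u \<in> V" for u
  proof (cases "\<beta> u")
    case False
    have g: "gl (u, True) \<in> carrier Ga" "gl (u, False) \<in> carrier Ga" using u by auto
    have "gl (u, True) \<otimes>\<^bsub>Ga\<^esub> gl (u, False) = \<one>\<^bsub>Ga\<^esub>" using gl_linv_r[of "(u, True)"] u by (simp add: linv_def)
    then have "\<phi> (gl (u, True)) + \<phi> (gl (u, False)) = 0" using \<phi>(1) g is_hom_one[OF h] by metis
    then show ?thesis using \<phi>(2) u False by (auto simp: gam_def let1_def split: if_splits)
  qed (use \<phi> u in \<open>auto simp: gam_def let1_def split: if_splits\<close>)
  then show ?thesis using h by blast
qed

lemma cocycle_sum: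
  assumes "\<And>i. i \<in> I \<Longrightarrow> f i \<in> group_cocycles Ga n"
  shows "(\<lambda>xs. \<Sum>i\<in>I. r i * f i xs) \<in> group_cocycles Ga n"
proof -
  have c: "\<And>i. i \<in> I \<Longrightarrow> f i \<in> group_cochains Ga n" "\<And>i xs. i \<in> I \<Longrightarrow> xs \<in> bl (Suc n) \<Longrightarrow> aug (f i) (bdG xs) = 0"
    using assms by (auto simp: cocycle_iff[OF raag.monoid_axioms])
  have "xs \<in> lists (carrier Ga) \<and> length xs = n" if nz: "(\<Sum>i\<in>I. r i * f i xs) \<noteq> 0" for xs
  proof -
    obtain i where i: "i \<in> I" "r i * f i xs \<noteq> 0" using sum.not_neutral_contains_not_neutral[OF nz] by blast
    then have "f i xs \<noteq> 0" by simp
    then show ?thesis using cochain_blists[OF c(1)[OF i(1)]] by (simp add: blists_def in_lists_conv_set subset_iff)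
  qed
  then have "(\<lambda>xs. \<Sum>i\<in>I. r i * f i xs) \<in> group_cochains Ga n" by (simp add: group_cochains_def)
  then show ?thesis unfolding cocycle_iff[OF raag.monoid_axioms] using c(2)
    by (simp add: aug_def pair_fun_sum pair_fun_mult)
qed

text \<open>Up to sign this is the cup product of the homomorphisms dual to the vertices of \<tau>.
  By \<open>ev_cup\<close>, such a product vanishes on every torus whose simplex misses one of
  them.\<close>

lemma dual_cocycle: "\<tau> \<in> simp n \<Longrightarrow> \<exists>f\<in>group_cocycles Ga n. \<forall>\<sigma>\<in>simp n. ev n f \<sigma> = (if \<sigma> = \<tau> then 1 else 0)"
proof (induction n arbitrary: \<tau>)
  case 0
  have e: "simp 0 = {{}}" using flag_finite by (auto simp: simp_def)
  have "(\<lambda>xs. if xs = [] then 1 else 0) \<in> group_cocycles Ga 0"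
    unfolding cocycle_iff[OF raag.monoid_axioms]
    by (auto simp: group_cochains_def blists_def length_Suc_conv aug_diff)
  then show ?case using 0 e by (intro bexI) (auto simp: ev_def)
next
  case (Suc n)
  then obtain v where v: "v \<in> \<tau>" using flag_finite by (cases "\<tau> = {}") (auto simp: simp_def)
  have V: "v \<in> V" using Suc.prems v flag_mem_V by (auto simp: simp_def)
  have s: "\<tau> - {v} \<in> simp n" using Suc.prems v flag_subset card_remove by (auto simp: simp_def)
  obtain \<phi> where \<phi>: "is_hom \<phi>" "\<And>u. u \<in> V \<Longrightarrow> \<phi> (gam u) = (if u = v then 1 else 0)" using dual_hom[OF V] by blast
  obtain f where f: "f \<in> group_cocycles Ga n" "\<And>\<sigma>. \<sigma> \<in> simp n \<Longrightarrow> ev n f \<sigma> = (if \<sigma> = \<tau> - {v} then 1 else 0)"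
    using Suc.IH[OF s] by blast
  let ?c = "cup_cochain 1 (homc \<phi>) f"
  have e: "ev (Suc n) ?c \<sigma> = (if \<sigma> = \<tau> then sg idx v \<tau> else 0)" if \<sigma>: "\<sigma> \<in> simp (Suc n)" for \<sigma>
  proof -
    have "ev (Suc n) ?c \<sigma> = (\<Sum>u\<in>\<sigma>. if u = v then sg idx v \<sigma> * ev n f (\<sigma> - {v}) else 0)"
      unfolding ev_cup[OF \<phi>(1) \<sigma>] using \<phi>(2) flag_mem_V \<sigma> by (intro sum.cong) (auto simp: simp_def)
    also have "\<dots> = (if v \<in> \<sigma> then sg idx v \<sigma> * ev n f (\<sigma> - {v}) else 0)"
      using \<sigma> flag_finite by (simp add: simp_def sum.delta)
    also have "\<dots> = (if \<sigma> = \<tau> then sg idx v \<tau> else 0)"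
    proof (cases "v \<in> \<sigma>")
      case True
      then have "\<sigma> - {v} \<in> simp n" using \<sigma> flag_subset card_remove by (auto simp: simp_def)
      moreover have "\<sigma> - {v} = \<tau> - {v} \<longleftrightarrow> \<sigma> = \<tau>" using True v by auto
      ultimately show ?thesis using True f(2) by simp
    qed (use v in auto)
    finally show ?thesis .
  qed
  have "(\<lambda>xs. \<Sum>i\<in>{()}. sg idx v \<tau> * ?c xs) \<in> group_cocycles Ga (Suc n)"
    by (rule cocycle_sum) (rule cup_cocycle[OF \<phi>(1) f(1)])
  then have "(\<lambda>xs. sg idx v \<tau> * ?c xs) \<in> group_cocycles Ga (Suc n)" by simp
  moreover have "ev (Suc n) (\<lambda>xs. sg idx v \<tau> * ?c xs) \<sigma> = (if \<sigma> = \<tau> then 1 else 0)" if "\<sigma> \<in> simp (Suc n)" for \<sigma>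
    unfolding ev_mult e[OF that] by simp
  ultimately show ?case by blast
qed

theorem ev_surj: "\<exists>f\<in>group_cocycles Ga n. \<forall>\<sigma>\<in>simp n. ev n f \<sigma> = \<phi> \<sigma>"
proof -
  have "\<forall>\<tau>\<in>simp n. \<exists>f. f \<in> group_cocycles Ga n \<and> (\<forall>\<sigma>\<in>simp n. ev n f \<sigma> = (if \<sigma> = \<tau> then 1 else 0))"
    using dual_cocycle by blast
  from bchoice[OF this] obtain f where f: "\<forall>\<tau>\<in>simp n. f \<tau> \<in> group_cocycles Ga n \<and> (\<forall>\<sigma>\<in>simp n. ev n (f \<tau>) \<sigma> = (if \<sigma> = \<tau> then 1 else 0))"
    by (rule exE)
  have fin: "finite (simp n)" by (rule finite_subset[OF _ finite_flag]) (auto simp: simp_def)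
  have "ev n (\<lambda>xs. \<Sum>\<tau>\<in>simp n. \<phi> \<tau> * f \<tau> xs) \<sigma> = \<phi> \<sigma>" if "\<sigma> \<in> simp n" for \<sigma>
  proof -
    have "ev n (\<lambda>xs. \<Sum>\<tau>\<in>simp n. \<phi> \<tau> * f \<tau> xs) \<sigma> = (\<Sum>\<tau>\<in>simp n. if \<tau> = \<sigma> then \<phi> \<sigma> else 0)"
      unfolding ev_sum ev_mult by (rule sum.cong) (use f that in auto)
    then show ?thesis using fin that by simp
  qed
  then show ?thesis using f by (intro bexI[OF _ cocycle_sum[of "simp n" f n \<phi>]]) auto
qed

text \<open>Mapping bars to cubes and back by \<open>tor\<close> is homotopic to the identity. The
  cocycle vanishes on the image, which is spanned by translates of tori, so it is the coboundary of
  its composite with the homotopy.\<close>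

theorem ev_inj:
  assumes f: "f \<in> group_cocycles Ga n" and e: "\<And>\<sigma>. \<sigma> \<in> simp n \<Longrightarrow> ev n f \<sigma> = 0"
  shows "f \<in> group_coboundaries Ga n"
proof -
  interpret U: complex_pair Ga "blists Ga" "\<lambda>_. bdG" "\<lambda>_. 1 :: real" "\<lambda>n. chains Ga (simp n)" "\<lambda>_. BD" "\<lambda>_. 1 :: real"
    by (intro complex_pair.intro raag.free_bar exact_bd)
  interpret B: complex_pair Ga "blists Ga" "\<lambda>_. bdG" "\<lambda>_. 1 :: real" "\<lambda>n. chains Ga (bl n)" "\<lambda>_. ext Ga bdG" "\<lambda>_. 1 :: real"
    by (intro complex_pair.intro raag.free_bar raag.exact_bar)
  obtain U where U: "U.chain_map U" using U.lift by blast
  have Uc: "U n xs \<in> chains Ga (simp n)" if "xs \<in> bl n" for n xs using U that by (simp add: U.chain_map_def)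
  define TU where "TU n xs = ext Ga (tor n) (U n xs)" for n xs
  have TUc: "TU n xs \<in> chains Ga (bl n)" if "xs \<in> bl n" for n xs
    unfolding TU_def by (rule raag.ext_closed[OF Uc[OF that] tor_closed])
  have TU: "B.chain_map TU"
    unfolding B.chain_map_def
  proof (intro conjI allI ballI)
    show "TU n xs \<in> chains Ga (bl n)" if "xs \<in> bl n" for n xs by (rule TUc[OF that])
    fix xs assume "xs \<in> bl 0"
    then show "aug (\<lambda>_. 1) (TU 0 xs) = (1::real)" using U by (simp add: TU_def aug_ext U.chain_map_def)
  next
    fix n xs assume xs: "xs \<in> bl (Suc n)"
    have b: "(bdG xs :: _ \<Rightarrow>\<^sub>0 real) \<in> chains Ga (bl n)" by (rule raag.bdr_closed[OF xs])
    have "ext Ga bdG (TU (Suc n) xs) = ext Ga (\<lambda>\<sigma>. ext Ga bdG (tor (Suc n) \<sigma>)) (U (Suc n) xs)"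
      unfolding TU_def by (rule raag.ext_ext[OF Uc[OF xs] tor_closed raag.bdr_closed])
    also have "\<dots> = ext Ga (\<lambda>\<sigma>. ext Ga (tor n) (bd \<sigma>)) (U (Suc n) xs)"
      by (rule raag.ext_cong[OF Uc[OF xs] tor_boundary])
    also have "\<dots> = ext Ga (tor n) (BD (U (Suc n) xs))"
      by (rule raag.ext_ext[OF Uc[OF xs] bd_closed tor_closed, symmetric])
    also have "BD (U (Suc n) xs) = ext Ga (U n) (bdG xs)" using U xs by (simp add: U.chain_map_def)
    also have "ext Ga (tor n) \<dots> = ext Ga (TU n) (bdG xs)"
      unfolding TU_def[abs_def] by (rule raag.ext_ext[OF b Uc tor_closed])
    finally show "ext Ga bdG (TU (Suc n) xs) = ext Ga (TU n) (bdG xs)" .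
  qed
  define \<Psi> :: "nat \<Rightarrow> _ \<Rightarrow> (_ \<Rightarrow>\<^sub>0 real)" where "\<Psi> n xs = Poly_Mapping.single (\<one>\<^bsub>Ga\<^esub>, xs) 1" for n :: nat and xs :: "('v \<times> bool) list set list"
  have \<Psi>: "B.chain_map \<Psi>"
    unfolding B.chain_map_def
  proof (intro conjI allI ballI)
    fix n xs assume xs: "xs \<in> bl (Suc n)"
    have b: "(bdG xs :: _ \<Rightarrow>\<^sub>0 real) \<in> chains Ga (bl n)" by (rule raag.bdr_closed[OF xs])
    show "ext Ga bdG (\<Psi> (Suc n) xs) = ext Ga (\<Psi> n) (bdG xs)"
      unfolding \<Psi>_def[abs_def] raag.ext_id[OF b] by (simp add: ext_single raag.act_one[OF b])
  qed (auto simp: \<Psi>_def intro!: supported_single)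
  obtain h where h: "B.homotopy \<Psi> TU h" using B.homotopic[OF \<Psi> TU] by blast
  have hc: "h n xs \<in> chains Ga (bl (Suc n))" if "xs \<in> bl n" for n xs using h that by (simp add: B.homotopy_def)
  have fc: "f \<in> group_cochains Ga n" and f0: "\<And>xs. xs \<in> bl (Suc n) \<Longrightarrow> aug f (bdG xs) = 0"
    using f by (auto simp: cocycle_iff[OF raag.monoid_axioms])
  have fTU: "aug f (TU n xs) = 0" if "xs \<in> bl n" for xs
  proof -
    have "aug f (TU n xs) = aug (\<lambda>\<sigma>. aug f (tor n \<sigma>)) (U n xs)" by (simp add: TU_def aug_ext)
    also have "\<dots> = aug (\<lambda>_. 0) (U n xs)" by (rule aug_cong[OF Uc[OF that]]) (use e in \<open>simp add: ev_def\<close>)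
    finally show ?thesis by (simp add: aug_def)
  qed
  have fdh: "aug f (ext Ga bdG (h n xs)) = 0" if "xs \<in> bl n" for xs
  proof -
    have "aug f (ext Ga bdG (h n xs)) = aug (\<lambda>ys. aug f (bdG ys)) (h n xs)" by (simp add: aug_ext)
    also have "\<dots> = aug (\<lambda>_. 0) (h n xs)" by (rule aug_cong[OF hc[OF that] f0])
    finally show ?thesis by (simp add: aug_def)
  qed
  have f\<Psi>: "f xs = aug f (\<Psi> n xs)" for xs by (simp add: \<Psi>_def)
  show ?thesis
  proof (cases n)
    case 0
    have "f xs = 0" for xs
    proof (cases "xs \<in> bl n")
      case True
      then have "ext Ga bdG (h n xs) = \<Psi> n xs - TU n xs" using h 0 by (simp add: B.homotopy_def)
      then show ?thesis using f\<Psi>[of xs] fTU[OF True] fdh[OF True] by (simp add: aug_diff)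
    qed (use cochain_blists[OF fc] in blast)
    then show ?thesis using 0 by (simp add: group_coboundaries_def fun_eq_iff)
  next
    case (Suc m)
    define g where "g ys = (if ys \<in> bl m then aug f (h m ys) else 0)" for ys
    have "g \<in> group_cochains Ga m" by (auto simp: group_cochains_def g_def blists_def split: if_splits)
    moreover have "f = group_coboundary Ga m g"
    proof
      fix xs
      show "f xs = group_coboundary Ga m g xs"
      proof (cases "xs \<in> bl n")
        case True
        have b: "(bdG xs :: _ \<Rightarrow>\<^sub>0 real) \<in> chains Ga (bl m)" using True Suc by (intro raag.bdr_closed) simp
        have "ext Ga bdG (h n xs) = \<Psi> n xs - TU n xs - ext Ga (h m) (bdG xs)"
          using h True unfolding B.homotopy_def Suc by blast
        then have "f xs = aug f (ext Ga (h m) (bdG xs))"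
          using f\<Psi>[of xs] fTU[OF True] fdh[OF True] by (simp add: aug_diff)
        also have "\<dots> = aug (\<lambda>ys. aug f (h m ys)) (bdG xs)" by (simp add: aug_ext)
        also have "\<dots> = aug g (bdG xs)" by (rule aug_cong[OF b]) (simp add: g_def)
        finally show ?thesis using coboundary_bdr[OF raag.monoid_axioms, of xs m g] True Suc by simp
      next
        case False
        have "group_coboundary Ga m g xs = 0" using False Suc by (auto simp: group_coboundary_def blists_def)
        then show ?thesis using cochain_blists[OF fc] False by auto
      qed
    qed
    ultimately show ?thesis using Suc by (simp add: group_coboundaries_def)
  qed
qed

end

section \<open>Resonance\<close>

context raag_complex
begin

abbreviation "Zc n \<equiv> cocycle_group Ga n"
abbreviation "Bc n \<equiv> group_coboundaries Ga n"
abbreviation "cl n f \<equiv> cohomology_class Ga n f"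

lemma cocycle_lincomb:
  assumes "f \<in> group_cocycles Ga n" "h \<in> group_cocycles Ga n"
  shows "(\<lambda>xs. m * f xs + k * h xs) \<in> group_cocycles Ga n"
proof -
  have "(\<lambda>xs. \<Sum>b\<in>{True, False}. (if b then m else k) * (if b then f else h) xs) \<in> group_cocycles Ga n"
    by (rule cocycle_sum) (use assms in auto)
  then show ?thesis by simp
qed

lemma zero_cocycle: "(\<lambda>_. 0) \<in> group_cocycles Ga n"
  using cocycle_sum[of "{}" "\<lambda>_ _. 0" n "\<lambda>_. 0"] by simp

lemma comm_group_cocycles: "comm_group (Zc n)"
proof (rule comm_groupI)
  fix x y assume "x \<in> carrier (Zc n)" "y \<in> carrier (Zc n)"
  then show "x \<otimes>\<^bsub>Zc n\<^esub> y \<in> carrier (Zc n)" "x \<otimes>\<^bsub>Zc n\<^esub> y = y \<otimes>\<^bsub>Zc n\<^esub> x"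
    using cocycle_lincomb[of x n y 1 1] by (auto simp: cocycle_group_def)
next
  show "\<one>\<^bsub>Zc n\<^esub> \<in> carrier (Zc n)" using zero_cocycle by (simp add: cocycle_group_def)
next
  fix x assume x: "x \<in> carrier (Zc n)"
  have "(\<lambda>xs. - 1 * x xs + 0 * x xs) \<in> group_cocycles Ga n"
    using x by (intro cocycle_lincomb) (auto simp: cocycle_group_def)
  then show "\<exists>y\<in>carrier (Zc n). y \<otimes>\<^bsub>Zc n\<^esub> x = \<one>\<^bsub>Zc n\<^esub>"
    by (intro bexI[of _ "\<lambda>xs. - x xs"]) (auto simp: cocycle_group_def)
qed (auto simp: cocycle_group_def add.assoc)

text \<open>Serves both for the coboundaries and for the cocycles representing Aomoto coboundaries:
  each is cut out by a linear condition on the torus values.\<close>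

lemma subgroup_ev:
  assumes zero: "S (\<lambda>_. 0)" and lc: "\<And>\<phi> \<psi> m k. S \<phi> \<Longrightarrow> S \<psi> \<Longrightarrow> S (\<lambda>\<sigma>. m * \<phi> \<sigma> + k * \<psi> \<sigma>)"
  shows "subgroup {f \<in> group_cocycles Ga n. S (ev n f)} (Zc n)" (is "subgroup ?H _")
proof -
  interpret Z: comm_group "Zc n" by (rule comm_group_cocycles)
  have e: "ev n (\<lambda>xs. m * f xs + k * h xs) = (\<lambda>\<sigma>. m * ev n f \<sigma> + k * ev n h \<sigma>)" for m k f h
    by (rule HOL.ext) (simp add: ev_add ev_mult)
  have L: "(\<lambda>xs. m * f xs + k * h xs) \<in> ?H" if "f \<in> ?H" "h \<in> ?H" for f h m k
    using that cocycle_lincomb lc by (simp add: e)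
  show ?thesis
  proof (rule Z.subgroupI)
    show "?H \<subseteq> carrier (Zc n)" by (auto simp: cocycle_group_def)
    have "ev n (\<lambda>_. 0) = (\<lambda>_. 0)" using e[of 0 "\<lambda>_. 0" 0 "\<lambda>_. 0"] by simp
    then have "(\<lambda>_. 0) \<in> ?H" using zero_cocycle zero by simp
    then show "?H \<noteq> {}" by blast
    fix f h assume f: "f \<in> ?H" and h: "h \<in> ?H"
    show "f \<otimes>\<^bsub>Zc n\<^esub> h \<in> ?H" using L[OF f h, of 1 1] by (simp add: cocycle_group_def)
  next
    fix f assume f: "f \<in> ?H"
    have m: "(\<lambda>xs. - f xs) \<in> ?H" using L[OF f f, of "-1" 0] by simp
    have "inv\<^bsub>Zc n\<^esub> f = (\<lambda>xs. - f xs)"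
      by (rule Z.inv_equality) (use f m in \<open>auto simp: cocycle_group_def\<close>)
    then show "inv\<^bsub>Zc n\<^esub> f \<in> ?H" using m by simp
  qed
qed

text \<open>Together with \<open>ev_surj\<close> this identifies the cohomology in degree n with the
  real functions on \<open>simp n\<close>, the form in which classes are compared from here
  on.\<close>

lemma coboundaries_ev: "Bc n = {f \<in> group_cocycles Ga n. \<forall>\<sigma>\<in>simp n. ev n f \<sigma> = 0}"
proof -
  have "f \<in> group_cocycles Ga n \<and> (\<forall>\<sigma>\<in>simp n. ev n f \<sigma> = 0)" if f: "f \<in> Bc n" for f
  proof (cases n)
    case 0
    then have "f = (\<lambda>_. 0)" using f by (simp add: group_coboundaries_def)
    then show ?thesis using zero_cocycle by (simp add: ev_def aug_def pair_def)
  next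
    case (Suc m)
    then obtain g where "f = group_coboundary Ga m g" using f by (auto simp: group_coboundaries_def)
    then show ?thesis using Suc ev_coboundary coboundary_cocycle[OF raag.monoid_axioms] by simp
  qed
  then show ?thesis using ev_inj by blast
qed

lemma subgroup_coboundaries: "subgroup (Bc n) (Zc n)"
  unfolding coboundaries_ev by (rule subgroup_ev) auto

lemma class_hom: "group_hom (Zc n) (group_cohomology Ga n) (cl n)"
proof -
  interpret Z: comm_group "Zc n" by (rule comm_group_cocycles)
  interpret B: normal "Bc n" "Zc n" using Z.normal_iff_subgroup subgroup_coboundaries by blast
  show ?thesis unfolding group_cohomology_def cohomology_class_def[abs_def]
    by (intro group_hom.intro group_hom_axioms.intro Z.is_group B.factorgroup_is_group B.r_coset_hom_Mod)
qed

lemma carrier_cohomology: "carrier (group_cohomology Ga n) = cl n ` group_cocycles Ga n"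
  by (auto simp: group_cohomology_def FactGroup_def RCOSETS_def cohomology_class_def cocycle_group_def)

lemma one_cohomology: "\<one>\<^bsub>group_cohomology Ga n\<^esub> = Bc n"
  by (simp add: group_cohomology_def FactGroup_def)

lemma mem_class:
  assumes f: "f \<in> group_cocycles Ga n"
  shows "h \<in> cl n f \<longleftrightarrow> h \<in> group_cocycles Ga n \<and> (\<forall>\<sigma>\<in>simp n. ev n h \<sigma> = ev n f \<sigma>)"
proof
  assume "h \<in> cl n f"
  then obtain b where b: "b \<in> Bc n" "h = (\<lambda>xs. b xs + f xs)"
    by (auto simp: cohomology_class_def r_coset_def cocycle_group_def)
  then show "h \<in> group_cocycles Ga n \<and> (\<forall>\<sigma>\<in>simp n. ev n h \<sigma> = ev n f \<sigma>)"
    using cocycle_lincomb[of b n f 1 1] f by (auto simp: coboundaries_ev ev_add)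
next
  assume h: "h \<in> group_cocycles Ga n \<and> (\<forall>\<sigma>\<in>simp n. ev n h \<sigma> = ev n f \<sigma>)"
  have "(\<lambda>xs. 1 * h xs + (- 1) * f xs) \<in> group_cocycles Ga n" using h f by (intro cocycle_lincomb) auto
  moreover have "ev n (\<lambda>xs. 1 * h xs + (- 1) * f xs) \<sigma> = 0" if "\<sigma> \<in> simp n" for \<sigma>
    unfolding ev_add ev_mult using h that by simp
  ultimately have "(\<lambda>xs. 1 * h xs + (- 1) * f xs) \<in> Bc n" unfolding coboundaries_ev by blast
  then have "\<exists>b\<in>Bc n. h = (\<lambda>xs. b xs + f xs)" by (rule bexI[rotated]) simp
  then show "h \<in> cl n f" by (auto simp: cohomology_class_def r_coset_def cocycle_group_def)
qed

lemma class_eq: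
  assumes f: "f \<in> group_cocycles Ga n" and h: "h \<in> group_cocycles Ga n"
  shows "cl n f = cl n h \<longleftrightarrow> (\<forall>\<sigma>\<in>simp n. ev n f \<sigma> = ev n h \<sigma>)"
proof
  assume "cl n f = cl n h"
  then have "f \<in> cl n h" using mem_class[OF f, of f] f by simp
  then show "\<forall>\<sigma>\<in>simp n. ev n f \<sigma> = ev n h \<sigma>" by (simp add: mem_class[OF h])
next
  assume "\<forall>\<sigma>\<in>simp n. ev n f \<sigma> = ev n h \<sigma>"
  then have "g \<in> cl n f \<longleftrightarrow> g \<in> cl n h" for g unfolding mem_class[OF h] mem_class[OF f] by simp
  then show "cl n f = cl n h" by blast
qed

lemma class_one:
  assumes f: "f \<in> group_cocycles Ga n"
  shows "cl n f = Bc n \<longleftrightarrow> (\<forall>\<sigma>\<in>simp n. ev n f \<sigma> = 0)"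
proof -
  interpret h: group_hom "Zc n" "group_cohomology Ga n" "cl n" by (rule class_hom)
  have "cl n (\<lambda>_. 0) = Bc n" using h.hom_one one_cohomology[of n] by (simp add: cocycle_group_def)
  moreover have "ev n (\<lambda>_. 0) \<sigma> = 0" for \<sigma> by (simp add: ev_def aug_def pair_def)
  ultimately show ?thesis using class_eq[OF f zero_cocycle] by simp
qed

lemma homc_cocycle: assumes "is_hom \<phi>" shows "homc \<phi> \<in> group_cocycles Ga 1"
proof -
  have "(\<lambda>xs. if xs = [] then 1 else 0) \<in> group_cocycles Ga 0"
    unfolding cocycle_iff[OF raag.monoid_axioms]
    by (auto simp: group_cochains_def blists_def length_Suc_conv aug_diff)
  from cup_cocycle[OF assms this] have "cup_cochain 1 (homc \<phi>) (\<lambda>xs. if xs = [] then 1 else 0) \<in> group_cocycles Ga 1" by simp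
  moreover have "cup_cochain 1 (homc \<phi>) (\<lambda>xs. if xs = [] then 1 else 0) = homc \<phi>"
    by (rule HOL.ext) (auto simp: cup_cochain_def homc_def take_Suc split: list.splits)
  ultimately show ?thesis by simp
qed

text \<open>For trivial coefficients, 0-cochains have coboundary zero. So the class is a single
  cocycle, and one of the two unions in \<open>cup_product\<close> has only one term.\<close>

lemma class_homc: "cl 1 (homc \<phi>) = {homc \<phi>}"
proof -
  have "group_coboundary Ga 0 f = (\<lambda>_. 0)" for f
    by (rule HOL.ext) (auto simp: group_coboundary_def length_Suc_conv)
  moreover have "group_cochains Ga 0 \<noteq> {}" by (auto simp: group_cochains_def intro!: exI[of _ "\<lambda>_. 0"])
  ultimately have "Bc 1 = {\<lambda>_. 0}" by (auto simp: group_coboundaries_def)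
  then show ?thesis by (simp add: cohomology_class_def r_coset_def cocycle_group_def)
qed

lemma cup_class:
  assumes \<phi>: "is_hom \<phi>" and f: "f \<in> group_cocycles Ga n"
  shows "cup_product Ga 1 n (cl 1 (homc \<phi>)) (cl n f) = cl (Suc n) (cup_cochain 1 (homc \<phi>) f)"
proof -
  have e: "cl (Suc n) (cup_cochain 1 (homc \<phi>) h) = cl (Suc n) (cup_cochain 1 (homc \<phi>) f)" if h: "h \<in> cl n f" for h
  proof -
    have h': "h \<in> group_cocycles Ga n" "\<And>\<sigma>. \<sigma> \<in> simp n \<Longrightarrow> ev n h \<sigma> = ev n f \<sigma>" using h by (auto simp: mem_class[OF f])
    have "ev (Suc n) (cup_cochain 1 (homc \<phi>) h) \<sigma> = ev (Suc n) (cup_cochain 1 (homc \<phi>) f) \<sigma>" if s: "\<sigma> \<in> simp (Suc n)" for \<sigma>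
      unfolding ev_cup[OF \<phi> s]
    proof (rule sum.cong)
      fix v assume "v \<in> \<sigma>"
      then have "\<sigma> - {v} \<in> simp n" using s flag_subset card_remove by (auto simp: simp_def)
      then show "sg idx v \<sigma> * \<phi> (gam v) * ev n h (\<sigma> - {v}) = sg idx v \<sigma> * \<phi> (gam v) * ev n f (\<sigma> - {v})" by (simp add: h'(2))
    qed simp
    then show ?thesis using class_eq[OF cup_cocycle[OF \<phi> h'(1)] cup_cocycle[OF \<phi> f]] by blast
  qed
  have "cl n f \<noteq> {}" using mem_class[OF f, of f] f by blast
  then have "(\<Union>h\<in>cl n f. cl (Suc n) (cup_cochain 1 (homc \<phi>) h)) = cl (Suc n) (cup_cochain 1 (homc \<phi>) f)"
    by (subst SUP_cong[OF HOL.refl e]) (simp_all only: UN_constant if_False)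
  then show ?thesis
    by (simp only: cup_product_def class_homc plus_1_eq_Suc UN_insert UN_empty Un_empty_right)
qed

text \<open>Multiplication by the class of \<phi> in terms of torus values, as computed in
  \<open>ev_cup\<close>.\<close>

definition dc :: "(('v \<times> bool) list set \<Rightarrow> real) \<Rightarrow> ('v set \<Rightarrow> real) \<Rightarrow> 'v set \<Rightarrow> real" where
  "dc \<phi> \<psi> \<sigma> = (\<Sum>v\<in>\<sigma>. sg idx v \<sigma> * \<phi> (gam v) * \<psi> (\<sigma> - {v}))"

lemma dc_lincomb: "dc \<phi> (\<lambda>\<rho>. m * \<psi> \<rho> + k * \<theta> \<rho>) \<sigma> = m * dc \<phi> \<psi> \<sigma> + k * dc \<phi> \<theta> \<sigma>"
  by (simp add: dc_def sum_distrib_left sum.distrib[symmetric] algebra_simps)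

lemma dc_cong: "\<sigma> \<in> simp (Suc n) \<Longrightarrow> (\<And>\<rho>. \<rho> \<in> simp n \<Longrightarrow> \<psi> \<rho> = \<theta> \<rho>) \<Longrightarrow> dc \<phi> \<psi> \<sigma> = dc \<phi> \<theta> \<sigma>"
  unfolding dc_def using flag_subset card_remove by (intro sum.cong) (auto simp: simp_def)

text \<open>On torus values the Aomoto complex is the complex of functions on simplices with the
  differential \<open>dc\<close>. The remaining work is to read the triviality of a quotient group
  as an inclusion of cocycles in coboundaries.\<close>

theorem resonance_iff:
  assumes \<phi>: "is_hom \<phi>"
  shows "hom_class Ga \<phi> \<in> resonance_variety Ga i \<longleftrightarrow>
    \<not> (\<forall>\<theta>. (\<forall>\<sigma>\<in>simp (Suc i). dc \<phi> \<theta> \<sigma> = 0) \<longrightarrow> (\<exists>\<psi>. \<forall>\<sigma>\<in>simp i. \<theta> \<sigma> = dc \<phi> \<psi> \<sigma>))"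
proof -
  let ?a = "cl 1 (homc \<phi>)" and ?Q = "group_cohomology Ga i"
  let ?H = "aomoto_coboundaries Ga ?a i" and ?Z = "aomoto_cocycles Ga ?a i"
  let ?K = "{f \<in> group_cocycles Ga i. \<exists>\<psi>. \<forall>\<sigma>\<in>simp i. ev i f \<sigma> = dc \<phi> \<psi> \<sigma>}"
  have a: "hom_class Ga \<phi> = ?a" by (simp add: hom_class_def homc_def)
  interpret h: group_hom "Zc i" ?Q "cl i" by (rule class_hom)
  have c: "cup_product Ga 1 j ?a (cl j f) = cl (Suc j) (cup_cochain 1 (homc \<phi>) f)"
    "\<And>\<sigma>. \<sigma> \<in> simp (Suc j) \<Longrightarrow> ev (Suc j) (cup_cochain 1 (homc \<phi>) f) \<sigma> = dc \<phi> (ev j f) \<sigma>"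
    "cup_cochain 1 (homc \<phi>) f \<in> group_cocycles Ga (Suc j)"
    if "f \<in> group_cocycles Ga j" for j f
    using cup_class[OF \<phi> that] ev_cup[OF \<phi>] cup_cocycle[OF \<phi> that] by (simp_all add: dc_def)
  have Z: "?Z = cl i ` {f \<in> group_cocycles Ga i. \<forall>\<sigma>\<in>simp (Suc i). dc \<phi> (ev i f) \<sigma> = 0}"
  proof -
    have "cup_product Ga 1 i ?a (cl i f) = \<one>\<^bsub>group_cohomology Ga (Suc i)\<^esub> \<longleftrightarrow> (\<forall>\<sigma>\<in>simp (Suc i). dc \<phi> (ev i f) \<sigma> = 0)"
      if f: "f \<in> group_cocycles Ga i" for f
      unfolding one_cohomology c(1)[OF f] class_one[OF c(3)[OF f]] using c(2)[OF f] by simp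
    then show ?thesis unfolding aomoto_cocycles_def carrier_cohomology by blast
  qed
  \<comment> \<open>In degree 0 there is nothing to multiply, and correspondingly \<open>dc\<close>
    vanishes on the empty simplex. In higher degrees \<open>ev_surj\<close> realises an arbitrary
    function \<psi> by a cocycle.\<close>
  have H: "?H = cl i ` ?K"
  proof (cases i)
    case 0
    have "dc \<phi> \<psi> \<sigma> = 0" if "\<sigma> \<in> simp 0" for \<sigma> \<psi> using that flag_finite by (auto simp: dc_def simp_def)
    then have K: "?K = {f \<in> group_cocycles Ga i. \<forall>\<sigma>\<in>simp i. ev i f \<sigma> = 0}" using 0 by auto
    have "(\<lambda>_. 0) \<in> ?K" unfolding K using zero_cocycle by (simp add: ev_def aug_def pair_def)
    moreover have "cl i f = Bc i" if "f \<in> ?K" for f using that class_one[of f i] unfolding K by blast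
    ultimately have "cl i ` ?K = {Bc i}" by blast
    then show ?thesis using 0 by (simp add: aomoto_coboundaries_def one_cohomology)
  next
    case (Suc j)
    have "?H = (\<lambda>f. cl i (cup_cochain 1 (homc \<phi>) f)) ` group_cocycles Ga j"
      unfolding aomoto_coboundaries_def Suc nat.case carrier_cohomology image_image by (rule image_cong) (simp_all only: c(1))
    also have "\<dots> = cl i ` ?K"
    proof (intro equalityI subsetI)
      fix u assume "u \<in> (\<lambda>f. cl i (cup_cochain 1 (homc \<phi>) f)) ` group_cocycles Ga j"
      then obtain f where f: "f \<in> group_cocycles Ga j" "u = cl i (cup_cochain 1 (homc \<phi>) f)" by blast
      have "cup_cochain 1 (homc \<phi>) f \<in> ?K" using c(2,3)[OF f(1)] Suc by (intro CollectI conjI exI[of _ "ev j f"]) auto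
      then show "u \<in> cl i ` ?K" using f(2) by blast
    next
      fix u assume "u \<in> cl i ` ?K"
      then obtain f \<psi> where f: "u = cl i f" "f \<in> group_cocycles Ga i" "\<forall>\<sigma>\<in>simp i. ev i f \<sigma> = dc \<phi> \<psi> \<sigma>" by blast
      obtain g where g: "g \<in> group_cocycles Ga j" "\<forall>\<sigma>\<in>simp j. ev j g \<sigma> = \<psi> \<sigma>" using ev_surj[of j \<psi>] by blast
      have "ev i f \<sigma> = ev i (cup_cochain 1 (homc \<phi>) g) \<sigma>" if "\<sigma> \<in> simp i" for \<sigma>
        using f(3) that c(2)[OF g(1), of \<sigma>] dc_cong[of \<sigma> j "ev j g" \<psi> \<phi>] g(2) Suc by simp
      then have "u = cl i (cup_cochain 1 (homc \<phi>) g)"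
        unfolding f(1) using class_eq[OF f(2), of "cup_cochain 1 (homc \<phi>) g"] c(3)[OF g(1)] Suc by blast
      then show "u \<in> (\<lambda>f. cl i (cup_cochain 1 (homc \<phi>) f)) ` group_cocycles Ga j" using g(1) by blast
    qed
    finally show ?thesis .
  qed
  have "subgroup ?K (Zc i)"
  proof (rule subgroup_ev)
    show "\<exists>\<psi>. \<forall>\<sigma>\<in>simp i. 0 = dc \<phi> \<psi> \<sigma>" by (rule exI[of _ "\<lambda>_. 0"]) (simp add: dc_def)
    fix \<alpha> \<beta> m k assume "\<exists>\<psi>. \<forall>\<sigma>\<in>simp i. \<alpha> \<sigma> = dc \<phi> \<psi> \<sigma>" "\<exists>\<psi>. \<forall>\<sigma>\<in>simp i. \<beta> \<sigma> = dc \<phi> \<psi> \<sigma>"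
    then obtain \<psi> \<theta> where "\<forall>\<sigma>\<in>simp i. \<alpha> \<sigma> = dc \<phi> \<psi> \<sigma>" "\<forall>\<sigma>\<in>simp i. \<beta> \<sigma> = dc \<phi> \<theta> \<sigma>" by blast
    then show "\<exists>\<psi>. \<forall>\<sigma>\<in>simp i. m * \<alpha> \<sigma> + k * \<beta> \<sigma> = dc \<phi> \<psi> \<sigma>"
      by (intro exI[of _ "\<lambda>\<rho>. m * \<psi> \<rho> + k * \<theta> \<rho>"]) (simp add: dc_lincomb)
  qed
  then have sub: "subgroup ?H ?Q" unfolding H by (rule h.subgroup_img_is_subgroup)
  have Zsub: "?Z \<subseteq> carrier ?Q" by (auto simp: aomoto_cocycles_def)
  have "(\<lambda>_. 0) \<in> {f \<in> group_cocycles Ga i. \<forall>\<sigma>\<in>simp (Suc i). dc \<phi> (ev i f) \<sigma> = 0}"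
    using zero_cocycle by (simp add: dc_def ev_def aug_def pair_def)
  then have Z0: "?Z \<noteq> {}" unfolding Z by blast
  have one: "\<one>\<^bsub>aomoto_cohomology Ga ?a i\<^esub> = ?H" by (simp add: aomoto_cohomology_def FactGroup_def)
  have car: "carrier (aomoto_cohomology Ga ?a i) = (\<lambda>z. ?H #>\<^bsub>?Q\<^esub> z) ` ?Z"
    by (auto simp: aomoto_cohomology_def FactGroup_def RCOSETS_def r_coset_def)
  have join: "?H #>\<^bsub>?Q\<^esub> z = ?H \<longleftrightarrow> z \<in> ?H" if "z \<in> ?Z" for z
    using h.H.coset_join1[OF _ _ sub] h.H.coset_join2[OF _ sub] that Zsub by blast
  have "carrier (aomoto_cohomology Ga ?a i) = {\<one>\<^bsub>aomoto_cohomology Ga ?a i\<^esub>} \<longleftrightarrow> (\<forall>z\<in>?Z. ?H #>\<^bsub>?Q\<^esub> z = ?H)"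
    unfolding car one using Z0 by blast
  also have "\<dots> \<longleftrightarrow> ?Z \<subseteq> ?H" using join by blast
  also have "\<dots> \<longleftrightarrow> (\<forall>\<theta>. (\<forall>\<sigma>\<in>simp (Suc i). dc \<phi> \<theta> \<sigma> = 0) \<longrightarrow> (\<exists>\<psi>. \<forall>\<sigma>\<in>simp i. \<theta> \<sigma> = dc \<phi> \<psi> \<sigma>))"
  proof (intro iffI allI impI subsetI)
    fix \<theta> assume ZH: "?Z \<subseteq> ?H" and \<theta>: "\<forall>\<sigma>\<in>simp (Suc i). dc \<phi> \<theta> \<sigma> = 0"
    obtain f where f: "f \<in> group_cocycles Ga i" "\<forall>\<sigma>\<in>simp i. ev i f \<sigma> = \<theta> \<sigma>" using ev_surj[of i \<theta>] by blast
    have "dc \<phi> (ev i f) \<sigma> = 0" if "\<sigma> \<in> simp (Suc i)" for \<sigma> using dc_cong[OF that, of "ev i f" \<theta> \<phi>] f(2) \<theta> that by simp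
    then have "cl i f \<in> cl i ` ?K" using ZH f(1) unfolding Z H by blast
    then obtain g \<psi> where g: "cl i f = cl i g" "g \<in> group_cocycles Ga i" "\<forall>\<sigma>\<in>simp i. ev i g \<sigma> = dc \<phi> \<psi> \<sigma>" by blast
    then show "\<exists>\<psi>. \<forall>\<sigma>\<in>simp i. \<theta> \<sigma> = dc \<phi> \<psi> \<sigma>" using class_eq[OF f(1) g(2)] f(2) by (intro exI[of _ \<psi>]) auto
  next
    fix z assume R: "\<forall>\<theta>. (\<forall>\<sigma>\<in>simp (Suc i). dc \<phi> \<theta> \<sigma> = 0) \<longrightarrow> (\<exists>\<psi>. \<forall>\<sigma>\<in>simp i. \<theta> \<sigma> = dc \<phi> \<psi> \<sigma>)" and "z \<in> ?Z"
    then obtain f where f: "z = cl i f" "f \<in> group_cocycles Ga i" "\<forall>\<sigma>\<in>simp (Suc i). dc \<phi> (ev i f) \<sigma> = 0" unfolding Z by blast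
    then have "f \<in> ?K" using R by blast
    then show "z \<in> ?H" unfolding H f(1) by blast
  qed
  finally have "carrier (aomoto_cohomology Ga ?a i) = {\<one>\<^bsub>aomoto_cohomology Ga ?a i\<^esub>} \<longleftrightarrow>
    (\<forall>\<theta>. (\<forall>\<sigma>\<in>simp (Suc i). dc \<phi> \<theta> \<sigma> = 0) \<longrightarrow> (\<exists>\<psi>. \<forall>\<sigma>\<in>simp i. \<theta> \<sigma> = dc \<phi> \<psi> \<sigma>))" .
  moreover have "?a \<in> carrier (group_cohomology Ga 1)" unfolding carrier_cohomology using homc_cocycle[OF \<phi>] by blast
  ultimately show ?thesis unfolding resonance_variety_def a by blast
qed

end

section \<open>Duality between resonance and the live complex\<close>

context raag_character
begin

lemma is_hom_\<chi>: "is_hom \<chi>" using \<chi>_mult by (simp add: is_hom_def)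

text \<open>The rescaling of functions on simplices that absorbs the coefficients \<chi> (gam v) of
  \<open>dc\<close> on live vertices; on dead vertices these coefficients vanish.\<close>

definition "weight \<sigma> = (\<Prod>v\<in>\<sigma> \<inter> W. \<chi> (gam v))"

lemma weight_pos: "weight \<sigma> > 0" unfolding weight_def by (rule prod_pos) (simp add: W_def)

lemma weight_nonzero [simp]: "weight \<sigma> \<noteq> 0" using weight_pos[of \<sigma>] by simp

lemma pair_lbd: "pair f (lbd W \<sigma>) = (\<Sum>v\<in>\<sigma> \<inter> W. sg idx v \<sigma> * f (\<sigma> - {v}))"
  by (simp add: lbd_def pair_sum mult.commute)

lemma dc_weight: assumes \<sigma>: "\<sigma> \<in> \<Delta>" shows "dc \<chi> \<psi> \<sigma> = weight \<sigma> * pair (\<lambda>\<rho>. \<psi> \<rho> / weight \<rho>) (lbd W \<sigma>)"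
proof -
  have "dc \<chi> \<psi> \<sigma> = (\<Sum>v\<in>\<sigma> \<inter> W. sg idx v \<sigma> * \<chi> (gam v) * \<psi> (\<sigma> - {v}))"
    unfolding dc_def using flag_finite[OF \<sigma>] flag_V[OF \<sigma>] \<chi>_dead by (intro sum.mono_neutral_right) auto
  also have "\<dots> = (\<Sum>v\<in>\<sigma> \<inter> W. weight \<sigma> * (sg idx v \<sigma> * (\<psi> (\<sigma> - {v}) / weight (\<sigma> - {v}))))"
  proof (rule sum.cong)
    fix v assume v: "v \<in> \<sigma> \<inter> W"
    have "\<sigma> \<inter> W = insert v ((\<sigma> - {v}) \<inter> W)" using v by auto
    then have "weight \<sigma> = \<chi> (gam v) * weight (\<sigma> - {v})" by (simp add: weight_def)
    then show "sg idx v \<sigma> * \<chi> (gam v) * \<psi> (\<sigma> - {v}) = weight \<sigma> * (sg idx v \<sigma> * (\<psi> (\<sigma> - {v}) / weight (\<sigma> - {v})))"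
      using weight_pos[of "\<sigma> - {v}"] by simp
  qed simp
  finally show ?thesis by (simp add: pair_lbd sum_distrib_left)
qed

lemma dc_exact_iff:
  "(\<forall>\<theta>. (\<forall>\<sigma>\<in>simp (Suc i). dc \<chi> \<theta> \<sigma> = 0) \<longrightarrow> (\<exists>\<psi>. \<forall>\<sigma>\<in>simp i. \<theta> \<sigma> = dc \<chi> \<psi> \<sigma>)) \<longleftrightarrow>
   (\<forall>\<theta> :: _ \<Rightarrow> real. (\<forall>\<sigma>\<in>simp (Suc i). pair \<theta> (lbd W \<sigma>) = 0) \<longrightarrow> (\<exists>\<psi>. \<forall>\<sigma>\<in>simp i. \<theta> \<sigma> = pair \<psi> (lbd W \<sigma>)))"
   (is "?L \<longleftrightarrow> ?R")
proof
  assume L: ?L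
  show ?R
  proof (intro allI impI)
    fix \<theta> :: "_ \<Rightarrow> real" assume \<theta>: "\<forall>\<sigma>\<in>simp (Suc i). pair \<theta> (lbd W \<sigma>) = 0"
    have "dc \<chi> (\<lambda>\<rho>. weight \<rho> * \<theta> \<rho>) \<sigma> = 0" if "\<sigma> \<in> simp (Suc i)" for \<sigma>
      using that \<theta> by (simp add: dc_weight simp_def)
    then obtain \<psi> where \<psi>: "\<forall>\<sigma>\<in>simp i. weight \<sigma> * \<theta> \<sigma> = dc \<chi> \<psi> \<sigma>" using L by blast
    have "\<theta> \<sigma> = pair (\<lambda>\<rho>. \<psi> \<rho> / weight \<rho>) (lbd W \<sigma>)" if s: "\<sigma> \<in> simp i" for \<sigma>
    proof -
      have "weight \<sigma> * \<theta> \<sigma> = weight \<sigma> * pair (\<lambda>\<rho>. \<psi> \<rho> / weight \<rho>) (lbd W \<sigma>)"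
        using \<psi> s dc_weight[of \<sigma> \<psi>] by (simp add: simp_def)
      then show ?thesis using weight_pos[of \<sigma>] by simp
    qed
    then show "\<exists>\<psi>. \<forall>\<sigma>\<in>simp i. \<theta> \<sigma> = pair \<psi> (lbd W \<sigma>)" by blast
  qed
next
  assume R: ?R
  show ?L
  proof (intro allI impI)
    fix \<theta> assume \<theta>: "\<forall>\<sigma>\<in>simp (Suc i). dc \<chi> \<theta> \<sigma> = 0"
    have "pair (\<lambda>\<rho>. \<theta> \<rho> / weight \<rho>) (lbd W \<sigma>) = 0" if s: "\<sigma> \<in> simp (Suc i)" for \<sigma>
      using \<theta> s dc_weight[of \<sigma> \<theta>] weight_pos[of \<sigma>] by (simp add: simp_def)
    then obtain \<psi> where \<psi>: "\<forall>\<sigma>\<in>simp i. \<theta> \<sigma> / weight \<sigma> = pair \<psi> (lbd W \<sigma>)" using R[rule_format, of "\<lambda>\<rho>. \<theta> \<rho> / weight \<rho>"] by blast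
    have "\<theta> \<sigma> = dc \<chi> (\<lambda>\<rho>. weight \<rho> * \<psi> \<rho>) \<sigma>" if s: "\<sigma> \<in> simp i" for \<sigma>
    proof -
      have e: "(\<lambda>\<rho>. weight \<rho> * \<psi> \<rho> / weight \<rho>) = \<psi>" by simp
      have "\<theta> \<sigma> / weight \<sigma> = pair \<psi> (lbd W \<sigma>)" using \<psi> s by blast
      then have "\<theta> \<sigma> = weight \<sigma> * pair \<psi> (lbd W \<sigma>)" using weight_pos[of \<sigma>] by (simp add: field_simps)
      then show ?thesis using dc_weight[of \<sigma> "\<lambda>\<rho>. weight \<rho> * \<psi> \<rho>"] s by (simp only: simp_def e mem_Collect_eq)
    qed
    then show "\<exists>\<psi>. \<forall>\<sigma>\<in>simp i. \<theta> \<sigma> = dc \<chi> \<psi> \<sigma>" by blast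
  qed
qed

text \<open>Over a field, exactness for chains and for functionals are equivalent: a cycle that does
  not bound is detected by a cocycle, and conversely a contraction dualizes.\<close>

theorem resonance_lexact:
  "(\<forall>i\<le>q. hom_class Ga \<chi> \<notin> resonance_variety Ga i) \<longleftrightarrow> lexact W q TYPE(real)"
  unfolding resonance_iff[OF is_hom_\<chi>] not_not dc_exact_iff
proof
  assume R: "\<forall>i\<le>q. \<forall>\<theta> :: _ \<Rightarrow> real. (\<forall>\<sigma>\<in>simp (Suc i). pair \<theta> (lbd W \<sigma>) = 0) \<longrightarrow> (\<exists>\<psi>. \<forall>\<sigma>\<in>simp i. \<theta> \<sigma> = pair \<psi> (lbd W \<sigma>))"
  show "lexact W q TYPE(real)"
    unfolding lexact_def
  proof (intro allI impI)
    fix n and x :: "'v set \<Rightarrow>\<^sub>0 real" assume n: "n \<le> q" and x: "x \<in> supported (simp n)" "lin (lbd W) x = 0"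
    show "\<exists>y\<in>supported (simp (Suc n)). lin (lbd W) y = x"
    proof (rule ccontr)
      assume "\<not> ?thesis"
      from boundary_separation[OF this] obtain f where
        f: "\<forall>\<tau>\<in>simp (Suc n). pair f (lbd W \<tau>) = 0" "pair f x = 1" by blast
      obtain \<psi> where \<psi>: "\<forall>\<sigma>\<in>simp n. f \<sigma> = pair \<psi> (lbd W \<sigma>)" using R n f(1) by blast
      have "pair f x = pair (\<lambda>\<sigma>. pair \<psi> (lbd W \<sigma>)) x" by (rule pair_cong_on[OF x(1)]) (use \<psi> in blast)
      also have "\<dots> = 0" by (simp add: pair_lin[symmetric] x(2))
      finally show False using f(2) by simp
    qed
  qed
next
  assume "lexact W q TYPE(real)"
  then obtain s :: "_ \<Rightarrow> (_ \<Rightarrow>\<^sub>0 real)" where s: "contraction W q s" using lexact_contraction by blast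
  show "\<forall>i\<le>q. \<forall>\<theta> :: _ \<Rightarrow> real. (\<forall>\<sigma>\<in>simp (Suc i). pair \<theta> (lbd W \<sigma>) = 0) \<longrightarrow> (\<exists>\<psi>. \<forall>\<sigma>\<in>simp i. \<theta> \<sigma> = pair \<psi> (lbd W \<sigma>))"
  proof (intro allI impI)
    fix i and \<theta> :: "_ \<Rightarrow> real" assume i: "i \<le> q" and \<theta>: "\<forall>\<sigma>\<in>simp (Suc i). pair \<theta> (lbd W \<sigma>) = 0"
    have "\<theta> \<sigma> = pair (\<lambda>\<rho>. pair \<theta> (s \<rho>)) (lbd W \<sigma>)" if \<sigma>: "\<sigma> \<in> simp i" for \<sigma>
    proof -
      have st: "s \<sigma> \<in> supported (simp (Suc i))" "lin (lbd W) (s \<sigma>) + lin s (lbd W \<sigma>) = Poly_Mapping.single \<sigma> 1"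
        using s \<sigma> i by (auto simp: contraction_def simp_def supported_def)
      have "\<theta> \<sigma> = pair \<theta> (lin (lbd W) (s \<sigma>) + lin s (lbd W \<sigma>))" by (simp add: st(2))
      also have "\<dots> = pair (\<lambda>\<tau>. pair \<theta> (lbd W \<tau>)) (s \<sigma>) + pair (\<lambda>\<rho>. pair \<theta> (s \<rho>)) (lbd W \<sigma>)" by (simp add: pair_add pair_lin)
      also have "pair (\<lambda>\<tau>. pair \<theta> (lbd W \<tau>)) (s \<sigma>) = pair (\<lambda>_. 0) (s \<sigma>)" by (rule pair_cong_on[OF st(1)]) (use \<theta> in blast)
      finally show ?thesis by simp
    qed
    then show "\<exists>\<psi>. \<forall>\<sigma>\<in>simp i. \<theta> \<sigma> = pair \<psi> (lbd W \<sigma>)" by (intro exI) blast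
  qed
qed

lemma \<chi>_zero_if_W_empty: assumes "W = {}" and g: "g \<in> carrier Ga" shows "\<chi> g = 0"
  using g
proof (induction rule: raag_induct)
  case (mult g a)
  have v: "fst a \<in> V" using mult by auto
  have g0: "\<chi> (gam (fst a)) = 0" using \<chi>_dead[OF v] assms by simp
  have "\<chi> (gl a) = 0"
  proof (cases "a = let1 (fst a)")
    case True
    then show ?thesis using g0 by (simp add: gam_def)
  next
    case False
    then have "a = linv (let1 (fst a))" by (cases a) (auto simp: let1_def linv_def)
    then have "gam (fst a) \<otimes>\<^bsub>Ga\<^esub> gl a = \<one>\<^bsub>Ga\<^esub>" using gl_linv_r[OF let1_letters[OF v]] by (simp add: gam_def)
    then have "\<chi> (gam (fst a)) + \<chi> (gl a) = 0" using \<chi>_mult[of "gam (fst a)" "gl a"] v mult by simp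
    then show ?thesis using g0 by simp
  qed
  then show ?case using mult \<chi>_mult by simp
qed simp

theorem Sigma_lexact:
  assumes "principal_ideals TYPE('r::comm_ring_1)"
  shows "(\<exists>g\<in>carrier Ga. \<chi> g \<noteq> 0) \<and>
    type_FP q (monoid_ring (nonneg_submonoid Ga \<chi>) :: (_ \<Rightarrow> 'r) ring) (trivial_module :: (_ \<Rightarrow> 'r, 'r) module) \<longleftrightarrow>
    lexact W q TYPE('r)"
proof
  assume "(\<exists>g\<in>carrier Ga. \<chi> g \<noteq> 0) \<and>
    type_FP q (monoid_ring (nonneg_submonoid Ga \<chi>) :: (_ \<Rightarrow> 'r) ring) (trivial_module :: (_ \<Rightarrow> 'r, 'r) module)"
  then show "lexact W q TYPE('r)" using lexact_if_type_FP \<chi>_zero_if_W_empty by blast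
next
  assume L: "lexact W q TYPE('r)"
  \<comment> \<open>Exactness in degree 0 makes the empty simplex a boundary, and this takes a live
    vertex. So exactness already contains that \<chi> is not zero.\<close>
  have "W \<noteq> {}"
  proof
    assume "W = {}"
    then have l: "lin (lbd W) x = (0 :: _ \<Rightarrow>\<^sub>0 'r)" for x by (simp add: lbd_def[abs_def])
    have "Poly_Mapping.single {} (1::'r) \<in> supported (simp 0)" by (auto intro!: supported_single simp: simp_def flag_complex_def)
    then have "\<exists>y\<in>supported (simp (Suc 0)). lin (lbd W) y = Poly_Mapping.single {} (1::'r)"
      using L l unfolding lexact_def by blast
    then have "Poly_Mapping.single {} (1::'r) = (0 :: 'v set \<Rightarrow>\<^sub>0 'r)" by (simp add: l)
    then show False by (metis lookup_single_eq lookup_zero one_neq_zero)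
  qed
  then obtain v where "v \<in> V" "0 < \<chi> (gam v)" by (auto simp: W_def)
  then have "\<exists>g\<in>carrier Ga. \<chi> g \<noteq> 0" by (intro bexI[of _ "gam v"]) auto
  then show "(\<exists>g\<in>carrier Ga. \<chi> g \<noteq> 0) \<and>
    type_FP q (monoid_ring (nonneg_submonoid Ga \<chi>) :: (_ \<Rightarrow> 'r) ring) (trivial_module :: (_ \<Rightarrow> 'r, 'r) module)"
    using type_FP_if_lexact[OF L assms] by blast
qed

end

section \<open>Comparison of the invariants and the resonance varieties\<close>

theorem corollary14p7:
  fixes V :: "'v set" and E :: "'v set set"
  assumes "finite_simple_graph V E"
    and "\<And>\<sigma> W. \<sigma> \<in> flag_complex V E \<Longrightarrow> W \<subseteq> V \<Longrightarrow> \<sigma> \<inter> W = {} \<Longrightarrow>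
           torsion_free_homology (link (flag_complex V E) W \<sigma>)"
  shows "\<forall>q::nat.
    Sigma_inv q (raag V E) TYPE(int) = Sigma_inv q (raag V E) TYPE('k::field) \<and>
    Sigma_inv q (raag V E) TYPE('k::field) =
      real_homs (raag V E) -
      {\<chi> \<in> real_homs (raag V E).
         hom_class (raag V E) \<chi> \<in> (\<Union>i\<le>q. resonance_variety (raag V E) i)}"
proof
  fix q
  have finV: "finite V" using assms(1) by (simp add: finite_simple_graph_def)
  obtain idx :: "'v \<Rightarrow> nat" where idx: "inj_on idx V" using finite_imp_inj_to_nat_seg[OF finV] by blast
  interpret G: simple_graph V E by unfold_locales (rule assms(1))
  have main: "(\<chi> \<in> Sigma_inv q (raag V E) TYPE(int) \<longleftrightarrow> \<chi> \<in> Sigma_inv q (raag V E) TYPE('k)) \<and>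
    (\<chi> \<in> Sigma_inv q (raag V E) TYPE('k) \<longleftrightarrow> (\<forall>i\<le>q. hom_class (raag V E) \<chi> \<notin> resonance_variety (raag V E) i))"
    if \<chi>: "\<chi> \<in> real_homs (raag V E)" for \<chi>
  proof -
    define \<beta> where "\<beta> v \<longleftrightarrow> 0 \<le> \<chi> (G.gl (v, True))" for v
    have mult: "\<chi> (g \<otimes>\<^bsub>raag V E\<^esub> h) = \<chi> g + \<chi> h" if "g \<in> carrier (raag V E)" "h \<in> carrier (raag V E)" for g h
      using \<chi> that by (auto simp: real_homs_def hom_def)
    interpret C: raag_complex V E idx \<beta> by unfold_locales (rule idx)
    have nonneg: "0 \<le> \<chi> (C.gam v)" if v: "v \<in> V" for v
    proof (cases "\<beta> v")
      case False
      have c: "G.gl (v, True) \<in> carrier (raag V E)" "G.gl (v, False) \<in> carrier (raag V E)" using v by auto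
      have "G.gl (v, True) \<otimes>\<^bsub>raag V E\<^esub> G.gl (v, False) = \<one>\<^bsub>raag V E\<^esub>"
        using G.gl_linv_r[of "(v, True)"] v by (simp add: linv_def)
      then have "\<chi> (G.gl (v, True)) + \<chi> (G.gl (v, False)) = \<chi> \<one>\<^bsub>raag V E\<^esub>" using mult[OF c] by simp
      moreover have "\<chi> \<one>\<^bsub>raag V E\<^esub> = 0" using mult[of "\<one>\<^bsub>raag V E\<^esub>" "\<one>\<^bsub>raag V E\<^esub>"] by simp
      ultimately show ?thesis using False by (simp add: C.gam_def C.let1_def \<beta>_def)
    qed (simp add: C.gam_def C.let1_def \<beta>_def)
    interpret X: raag_character V E idx \<beta> \<chi> by unfold_locales (use mult nonneg in auto)
    have tf: "C.ltorsion_free X.W"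
      by (rule C.ltorsion_free_links) (use assms(2) in \<open>auto simp: X.W_def\<close>)
    have S: "\<chi> \<in> Sigma_inv q (raag V E) TYPE('r::comm_ring_1) \<longleftrightarrow> C.lexact X.W q TYPE('r)"
      if "principal_ideals TYPE('r)"
      unfolding Sigma_inv_def using \<chi> X.Sigma_lexact[OF that, of q] by blast
    \<comment> \<open>Both the given field and the reals are compared with the integers: integral
      exactness passes to every ring, and torsion-freeness leads back from a field.\<close>
    have "C.lexact X.W q TYPE(int) \<longleftrightarrow> C.lexact X.W q TYPE('k)"
      using C.lexact_from_int[of X.W q] C.lexact_to_int[OF _ tf] by blast
    moreover have "C.lexact X.W q TYPE(int) \<longleftrightarrow> C.lexact X.W q TYPE(real)"
      using C.lexact_from_int[of X.W q] C.lexact_to_int[OF _ tf] by blast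
    ultimately show ?thesis
      using S[OF principal_ideals_int] S[OF principal_ideals_field] X.resonance_lexact[of q] by blast
  qed
  have sub: "Sigma_inv q (raag V E) R \<subseteq> real_homs (raag V E)" for R :: "'r::comm_ring_1 itself"
    by (auto simp: Sigma_inv_def)
  have "\<chi> \<in> Sigma_inv q (raag V E) TYPE(int) \<longleftrightarrow> \<chi> \<in> Sigma_inv q (raag V E) TYPE('k)" for \<chi>
    using main[of \<chi>] sub[of "TYPE(int)"] sub[of "TYPE('k)"] by blast
  moreover have "\<chi> \<in> Sigma_inv q (raag V E) TYPE('k) \<longleftrightarrow> \<chi> \<in> real_homs (raag V E) -
      {\<chi> \<in> real_homs (raag V E). hom_class (raag V E) \<chi> \<in> (\<Union>i\<le>q. resonance_variety (raag V E) i)}" for \<chi>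
    using main[of \<chi>] sub[of "TYPE('k)"] by blast
  ultimately show "Sigma_inv q (raag V E) TYPE(int) = Sigma_inv q (raag V E) TYPE('k::field) \<and>
    Sigma_inv q (raag V E) TYPE('k::field) =
      real_homs (raag V E) -
      {\<chi> \<in> real_homs (raag V E).
         hom_class (raag V E) \<chi> \<in> (\<Union>i\<le>q. resonance_variety (raag V E) i)}"
    by blast
qed

end
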